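(* Let $p$ be a prime integer and let $F$ be a field with $\operatorname{char}(F)=p$. If three symbol $p$-algebras of degree $p$ over $F$ are inseparably linked, then they become cyclically linked under a prime-to-$p$ extension of $F$ of degree at most $2p-1$; that is, there is a field extension $L/F$ whose degree is prime to $p$ and at most $2p-1$ such that the scalar extensions of the three algebras to $L$ are cyclically linked over $L$.
   Context: For a field $F$ of characteristic $p$, a symbol $p$-algebra of degree $p$ over $F$ is an algebra of the form $[\alpha,\beta)_{p,F}=F\langle x,y : x^p-x=\alpha,\ y^p=\beta,\ yxy^{-1}=x+1\rangle$ for some $\alpha\in F$ and $\beta\in F^\times$. Symbol $p$-algebras $A_1,\dots,A_m$ of degree $p$ over $F$ are inseparably linked if there exists a purely inseparable degree $p$ field extension $K=F[\sqrt[p]{\gamma}]$ of $F$ that splits them all. They are cyclically linked if there exists a degree $p$ cyclic extension $K=F[\lambda : \lambda^p-\lambda=\delta]$ of $F$ that splits them all.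
   Formalization: If the base field has no cyclic field extension of degree p (e.g. separably closed imperfect F, where the claim read with fields fails), the split algebra F[λ : λ^p−λ=δ] is also allowed as the cyclic extension; otherwise it must be a cyclic field extension of degree p. *)

theory Defs
  imports "HOL-Algebra.Algebra"
begin

hide_const (open) Multiset.mult Wellorder_Constructions.zero  (* these shadow the record fields of rings *)

text \<open>An algebra over a commutative ring \<open>R\<close>, not necessarily commutative, is a pair of a ring
  \<open>A\<close> and a structure homomorphism from \<open>R\<close> to the centre of \<open>A\<close>.\<close>

type_synonym ('a, 'b) alg = "'b ring \<times> ('a \<Rightarrow> 'b)"

definition alg_iso :: "'a ring \<Rightarrow> ('a, 'b) alg \<Rightarrow> ('a, 'c) alg \<Rightarrow> bool" where
  "alg_iso R A B \<longleftrightarrow> (\<exists>\<phi> \<in> ring_iso (fst A) (fst B). \<forall>r \<in> carrier R. \<phi> (snd A r) = snd B r)"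


section \<open>Monoid rings\<close>

text \<open>For the free monoid this is the free algebra over \<open>R\<close>; over the integers it is used below to
  construct tensor products.\<close>

definition monoid_ring :: "('a, 'm) ring_scheme \<Rightarrow> ('g, 'n) monoid_scheme \<Rightarrow> ('g \<Rightarrow> 'a) ring" where
  "monoid_ring R M =
     \<lparr> carrier = {f. f \<in> carrier M \<rightarrow> carrier R \<and> (\<forall>m. m \<notin> carrier M \<longrightarrow> f m = \<zero>\<^bsub>R\<^esub>)
                     \<and> finite {m. f m \<noteq> \<zero>\<^bsub>R\<^esub>}},
       mult = (\<lambda>f g m. \<Oplus>\<^bsub>R\<^esub>z \<in> {(a, b). f a \<noteq> \<zero>\<^bsub>R\<^esub> \<and> g b \<noteq> \<zero>\<^bsub>R\<^esub> \<and> a \<otimes>\<^bsub>M\<^esub> b = m}.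
                 f (fst z) \<otimes>\<^bsub>R\<^esub> g (snd z)),
       one = (\<lambda>m. if m = \<one>\<^bsub>M\<^esub> then \<one>\<^bsub>R\<^esub> else \<zero>\<^bsub>R\<^esub>),
       zero = (\<lambda>m. \<zero>\<^bsub>R\<^esub>),
       add = (\<lambda>f g m. f m \<oplus>\<^bsub>R\<^esub> g m) \<rparr>"

definition single :: "('a, 'm) ring_scheme \<Rightarrow> 'g \<Rightarrow> 'a \<Rightarrow> 'g \<Rightarrow> 'a" where
  "single R g a = (\<lambda>m. if m = g then a else \<zero>\<^bsub>R\<^esub>)"


section \<open>Symbol algebras\<close>

datatype gen = GX | GY

definition words :: "gen list monoid" where
  "words = \<lparr> carrier = UNIV, mult = (@), one = [] \<rparr>"

abbreviation free_alg :: "'a ring \<Rightarrow> (gen list \<Rightarrow> 'a) ring" where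
  "free_alg F \<equiv> monoid_ring F words"

text \<open>The relation \<open>y x y\<^sup>-\<^sup>1 = x + 1\<close> is written as \<open>y x = (x + 1) y\<close>; since \<open>\<beta>\<close> is a unit, so is \<open>y\<close>
  in the quotient, by the relation \<open>y\<^sup>p = \<beta>\<close>.\<close>

definition symbol_relations :: "nat \<Rightarrow> 'a ring \<Rightarrow> 'a \<Rightarrow> 'a \<Rightarrow> (gen list \<Rightarrow> 'a) set" where
  "symbol_relations p F \<alpha> \<beta> =
     (let W = free_alg F;
          x = single F [GX] \<one>\<^bsub>F\<^esub>;
          y = single F [GY] \<one>\<^bsub>F\<^esub>
      in { (x [^]\<^bsub>W\<^esub> p \<ominus>\<^bsub>W\<^esub> x) \<ominus>\<^bsub>W\<^esub> single F [] \<alpha>,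
           y [^]\<^bsub>W\<^esub> p \<ominus>\<^bsub>W\<^esub> single F [] \<beta>,
           (y \<otimes>\<^bsub>W\<^esub> x) \<ominus>\<^bsub>W\<^esub> ((x \<oplus>\<^bsub>W\<^esub> \<one>\<^bsub>W\<^esub>) \<otimes>\<^bsub>W\<^esub> y) })"

definition symbol_algebra ::
    "nat \<Rightarrow> 'a ring \<Rightarrow> 'a \<Rightarrow> 'a \<Rightarrow> ('a, (gen list \<Rightarrow> 'a) set) alg" where
  "symbol_algebra p F \<alpha> \<beta> =
     (let W = free_alg F; I = genideal W (symbol_relations p F \<alpha> \<beta>)
      in (W Quot I, \<lambda>a. I +>\<^bsub>W\<^esub> single F [] a))"


section \<open>Scalar extension and splitting\<close>

text \<open>\<open>scalar_ext R A K\<close> is \<open>A \<otimes>\<^sub>R K\<close> as an algebra over \<open>K\<close>, for \<open>K\<close> a commutative \<open>R\<close>-algebra.  The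
  integral monoid ring of the multiplicative monoid \<open>A \<times> K\<close> is the free abelian group on the
  symbols \<open>(a, k)\<close> with \<open>(a, k) (b, l) = (a b, k l)\<close>.  The relations of the tensor product are
  stable under multiplication by symbols, so the two-sided ideal they generate is just their additive span.\<close>

definition tensor_relations :: "'a ring \<Rightarrow> ('a, 'b) alg \<Rightarrow> ('a, 'k) alg \<Rightarrow> ('b \<times> 'k \<Rightarrow> int) set" where
  "tensor_relations R A K =
     (let S = fst A; T = fst K; Z = monoid_ring int_ring (S \<times>\<times> T);
          e = (\<lambda>a k. single int_ring (a, k) 1)
      in {e (a \<oplus>\<^bsub>S\<^esub> b) k \<ominus>\<^bsub>Z\<^esub> (e a k \<oplus>\<^bsub>Z\<^esub> e b k) | a b k.
            a \<in> carrier S \<and> b \<in> carrier S \<and> k \<in> carrier T}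
       \<union> {e a (k \<oplus>\<^bsub>T\<^esub> l) \<ominus>\<^bsub>Z\<^esub> (e a k \<oplus>\<^bsub>Z\<^esub> e a l) | a k l.
            a \<in> carrier S \<and> k \<in> carrier T \<and> l \<in> carrier T}
       \<union> {e (a \<otimes>\<^bsub>S\<^esub> snd A r) k \<ominus>\<^bsub>Z\<^esub> e a (snd K r \<otimes>\<^bsub>T\<^esub> k) | a r k.
            a \<in> carrier S \<and> r \<in> carrier R \<and> k \<in> carrier T})"

definition scalar_ext ::
    "'a ring \<Rightarrow> ('a, 'b) alg \<Rightarrow> ('a, 'k) alg \<Rightarrow> ('k, ('b \<times> 'k \<Rightarrow> int) set) alg" where
  "scalar_ext R A K =
     (let Z = monoid_ring int_ring (fst A \<times>\<times> fst K); I = genideal Z (tensor_relations R A K)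
      in (Z Quot I, \<lambda>k. I +>\<^bsub>Z\<^esub> single int_ring (\<one>\<^bsub>fst A\<^esub>, k) 1))"

definition matrix_algebra :: "nat \<Rightarrow> 'a ring \<Rightarrow> ('a, nat \<times> nat \<Rightarrow> 'a) alg" where
  "matrix_algebra n R =
     (\<lparr> carrier = {f. (\<forall>i < n. \<forall>j < n. f (i, j) \<in> carrier R)
                      \<and> (\<forall>i j. \<not> (i < n \<and> j < n) \<longrightarrow> f (i, j) = \<zero>\<^bsub>R\<^esub>)},
        mult = (\<lambda>f g (i, j). if i < n \<and> j < n then \<Oplus>\<^bsub>R\<^esub>k \<in> {..<n}. f (i, k) \<otimes>\<^bsub>R\<^esub> g (k, j) else \<zero>\<^bsub>R\<^esub>),
        one = (\<lambda>(i, j). if i < n \<and> i = j then \<one>\<^bsub>R\<^esub> else \<zero>\<^bsub>R\<^esub>),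
        zero = (\<lambda>_. \<zero>\<^bsub>R\<^esub>),
        add = (\<lambda>f g (i, j). if i < n \<and> j < n then f (i, j) \<oplus>\<^bsub>R\<^esub> g (i, j) else \<zero>\<^bsub>R\<^esub>) \<rparr>,
      \<lambda>a (i, j). if i < n \<and> i = j then a else \<zero>\<^bsub>R\<^esub>)"

text \<open>Here \<open>n\<close> is the degree of \<open>A\<close>.\<close>

definition splits :: "nat \<Rightarrow> 'a ring \<Rightarrow> ('a, 'k) alg \<Rightarrow> ('a, 'b) alg \<Rightarrow> bool" where
  "splits n R K A \<longleftrightarrow> alg_iso (fst K) (scalar_ext R A K) (matrix_algebra n (fst K))"


section \<open>Field extensions\<close>

definition field_ext :: "'a ring \<Rightarrow> ('a, 'k) alg \<Rightarrow> bool" where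
  "field_ext F K \<longleftrightarrow> field F \<and> field (fst K) \<and> snd K \<in> ring_hom F (fst K)"

definition has_degree :: "'a ring \<Rightarrow> ('a, 'k) alg \<Rightarrow> nat \<Rightarrow> bool" where
  "has_degree F K n \<longleftrightarrow> ring.dimension (fst K) n (snd K ` carrier F) (carrier (fst K))"

definition purely_inseparable_ext :: "nat \<Rightarrow> 'a ring \<Rightarrow> ('a, 'k) alg \<Rightarrow> bool" where
  "purely_inseparable_ext p F K \<longleftrightarrow> field_ext F K \<and>
     (\<forall>x \<in> carrier (fst K). \<exists>n. x [^]\<^bsub>fst K\<^esub> (p ^ n :: nat) \<in> snd K ` carrier F)"

definition galois_auts :: "'a ring \<Rightarrow> ('a, 'k) alg \<Rightarrow> ('k \<Rightarrow> 'k) set" where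
  "galois_auts F K = {\<sigma> \<in> ring_iso (fst K) (fst K). \<forall>a \<in> carrier F. \<sigma> (snd K a) = snd K a}"

text \<open>A finite extension is Galois with cyclic group iff the fixed field of its automorphism group
  is the base field and this (finite) group consists of the powers of one element.\<close>

definition cyclic_ext :: "nat \<Rightarrow> 'a ring \<Rightarrow> ('a, 'k) alg \<Rightarrow> bool" where
  "cyclic_ext n F K \<longleftrightarrow> field_ext F K \<and> has_degree F K n \<and>
     {x \<in> carrier (fst K). \<forall>\<sigma> \<in> galois_auts F K. \<sigma> x = x} = snd K ` carrier F \<and>
     (\<exists>\<sigma> \<in> galois_auts F K. \<forall>\<tau> \<in> galois_auts F K. \<exists>i::nat. \<forall>x \<in> carrier (fst K). \<tau> x = (\<sigma> ^^ i) x)"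

definition adjoin_root :: "'a ring \<Rightarrow> 'a list \<Rightarrow> ('a, 'a list set) alg" where
  "adjoin_root F f =
     (let P = univ_poly F (carrier F)
      in (rupture F (carrier F) f, \<lambda>a. cgenideal P f +>\<^bsub>P\<^esub> ring.poly_of_const F a))"

text \<open>\<open>F[\<gamma>\<^sup>1\<^sup>/\<^sup>p] = F[X]/(X\<^sup>p - \<gamma>)\<close>\<close>

definition radical_ext :: "nat \<Rightarrow> 'a ring \<Rightarrow> 'a \<Rightarrow> ('a, 'a list set) alg" where
  "radical_ext p F \<gamma> =
     (let P = univ_poly F (carrier F)
      in adjoin_root F (var F [^]\<^bsub>P\<^esub> p \<ominus>\<^bsub>P\<^esub> ring.poly_of_const F \<gamma>))"

text \<open>\<open>F[\<lambda> : \<lambda>\<^sup>p - \<lambda> = \<delta>] = F[X]/(X\<^sup>p - X - \<delta>)\<close>\<close>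

definition artin_schreier_ext :: "nat \<Rightarrow> 'a ring \<Rightarrow> 'a \<Rightarrow> ('a, 'a list set) alg" where
  "artin_schreier_ext p F \<delta> =
     (let P = univ_poly F (carrier F)
      in adjoin_root F ((var F [^]\<^bsub>P\<^esub> p \<ominus>\<^bsub>P\<^esub> var F) \<ominus>\<^bsub>P\<^esub> ring.poly_of_const F \<delta>))"


section \<open>Linkage\<close>

definition inseparably_linked :: "nat \<Rightarrow> 'a ring \<Rightarrow> ('a, 'b) alg set \<Rightarrow> bool" where
  "inseparably_linked p F \<A> \<longleftrightarrow>
     (\<exists>\<gamma> \<in> carrier F. let K = radical_ext p F \<gamma> in
        purely_inseparable_ext p F K \<and> has_degree F K p \<and> (\<forall>A \<in> \<A>. splits p F K A))"

text \<open>\<open>F[\<lambda> : \<lambda>\<^sup>p - \<lambda> = \<delta>]\<close> is a cyclic field extension of degree \<open>p\<close>, or it is the split \<open>\<int>/p\<close>-Galois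
  algebra \<open>F \<times> \<dots> \<times> F\<close>.  It is required to be a field as soon as \<open>F\<close> has any cyclic field extension of degree \<open>p\<close>.
  If \<open>F\<close> has none (for instance if \<open>F\<close> is separably closed), then all
  symbol \<open>p\<close>-algebras of degree \<open>p\<close> over \<open>F\<close> are split, and the split Galois algebra is admitted as
  the cyclic extension.  Without this convention even three split algebras over a separably closed, imperfect
  field would be inseparably but not cyclically linked.\<close>

definition cyclically_linked :: "nat \<Rightarrow> 'a ring \<Rightarrow> ('a, 'b) alg set \<Rightarrow> bool" where
  "cyclically_linked p F \<A> \<longleftrightarrow>
     (\<exists>\<delta> \<in> carrier F. let K = artin_schreier_ext p F \<delta> in
        (cyclic_ext p F K \<or> (\<forall>\<epsilon> \<in> carrier F. \<not> cyclic_ext p F (artin_schreier_ext p F \<epsilon>)))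
        \<and> (\<forall>A \<in> \<A>. splits p F K A))"

end

theory Submission
  imports Defs "HOL-Number_Theory.Residues" "HOL-Computational_Algebra.Polynomial"
begin

text \<open>Let the common splitting field be \<open>F(\<gamma>\<^sup>1\<^sup>/\<^sup>p)\<close>. A symbol algebra \<open>A\<close> split by it is of the form \<open>[a, \<gamma>)\<close>: the
  algebra acts on a column space over the splitting field, and this space is either spanned by one vector
  over \<open>A\<close>, so that multiplication by the root of \<open>\<gamma>\<close> is given by an element of \<open>A\<close>, or it contains
  a representation of degree \<open>p\<close> over \<open>F\<close>, so that \<open>A\<close> is a matrix algebra. So the three algebras
  are \<open>[a\<^sub>i, \<gamma>)\<close>, and one may take \<open>a\<^sub>2 \<noteq> a\<^sub>3\<close>. Next, \<open>[a, \<gamma>) = [a + s, \<gamma>)\<close> for every nonzero value \<open>s\<close> of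
  \<open>\<gamma> (u\<^sup>p a + v\<^sup>p - v u\<^sup>p\<^sup>-\<^sup>1)\<close>. With \<open>u\<^sub>1 = 0\<close>, \<open>u\<^sub>2 = u\<close>, \<open>u\<^sub>3 = u + 1\<close> and the same \<open>v\<close> for all three algebras, the
  values \<open>a\<^sub>i + s\<^sub>i\<close> agree as soon as \<open>u\<close> is a root of one polynomial of degree \<open>2 p - 1\<close>, which has an
  irreducible factor of degree prime to \<open>p\<close>. The common value \<open>\<delta>\<close> gives the Artin--Schreier extension.\<close>

text \<open>The bound \<open>2 p - 1\<close> is the degree of a determinant. Comparing the common
  value for \<open>u2 = u\<close> and \<open>u3 = u + 1\<close> with that for \<open>u1 = 0\<close>
  cancels \<open>v^p\<close> and leaves two linear equations for \<open>v\<close> with coefficients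
  \<open>u^(p-1)\<close> and \<open>(u+1)^(p-1)\<close>. They are compatible when a polynomial in
  \<open>u\<close> with leading term \<gamma> \<open>(a3 - a2) u^(2 p - 1)\<close> vanishes. Its
  degree is -1 modulo \<open>p\<close>, which forces an irreducible factor of degree prime to
  \<open>p\<close>. The form \<open>u^p a + v^p - v u^(p-1)\<close> is the norm of
  \<open>u z + v\<close> where \<open>z^p - z = a\<close>. If \<open>s\<close> is \<gamma> times a
  nonzero norm, the algebra has the presentations \<open>[a, s)\<close> and
  \<open>[a + s, s)\<close>; what is used is that the Artin-Schreier algebra of \<open>a + s\<close>
  splits it. Explicit matrices over that algebra exhibit the splitting. It need not be a field:
  \<delta> may have the form \<open>c^p - c\<close>, and then any other cyclic extension of the new
  base field serves as well. Injectivity and dimension counts rest on one fact: in characteristic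
  \<open>p\<close> the \<open>p^2\<close> monomials in a pair with \<open>v u = (u + 1) v\<close>,
  \<open>v\<close> a unit, are independent over elements commuting with both.\<close>

section \<open>Falling factorials modulo a prime\<close>

text \<open>The bound on the number of roots over the field of \<open>p\<close> elements, argued
  over the integers. Dividing by \<open>X - a\<close> leaves a remainder divisible by
  \<open>p\<close>, and at another root \<open>b\<close> the factor \<open>b - a\<close> is prime to
  \<open>p\<close>, so the quotient keeps all the other roots.\<close>

lemma int_poly_dvd_of_roots:
 fixes Q :: "int poly"
 assumes "Factorial_Ring.prime p"
 shows "[|finite S; Polynomial.degree Q < card S; \<forall>a\<in>S. \<forall>b\<in>S. a ~= b --> ~ p dvd a - b; \<forall>a\<in>S. p dvd poly Q a|]
   ==> \<exists>q. Q = Polynomial.smult p q"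
proof (induction "card S" arbitrary: S Q)
 case 0
 then show ?case by simp
next
 case (Suc n)
 then obtain a where a: "a \<in> S" by fastforce
 let ?Q = "synthetic_div Q a"
 have Q: "Q = [:- a, 1:] * ?Q + [:poly Q a:]" using synthetic_div_correct'[of a Q] by simp
 obtain c where c: "poly Q a = p * c" using Suc.prems(4) a by (auto simp: dvd_def)
 show ?case
 proof (cases "Polynomial.degree Q = 0")
  case True
  then obtain d where "Q = [:d:]" using degree_eq_zeroE by blast
  then show ?thesis using c by (intro exI[of _ "[:c:]"]) simp
 next
  case False
  have "p dvd poly ?Q b" if b: "b \<in> S - {a}" for b
  proof -
   have "poly Q b = (b - a) * poly ?Q b + poly Q a" by (subst Q) (simp add: algebra_simps)
   then have "p dvd (b - a) * poly ?Q b"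
    using Suc.prems(4) a b by (metis DiffD1 add_diff_cancel_right' dvd_diff)
   moreover have "~ p dvd b - a" using Suc.prems(3) a b by blast
   ultimately show ?thesis using assms by (simp add: prime_dvd_mult_iff)
  qed
  moreover have "Polynomial.degree ?Q < card (S - {a})"
   using False Suc.prems(1,2) a by (simp add: degree_synthetic_div)
  moreover have "n = card (S - {a})" using Suc.hyps(2) Suc.prems(1) a by simp
  ultimately have "\<exists>q. ?Q = Polynomial.smult p q"
   using Suc.hyps(1)[of "S - {a}" ?Q] Suc.prems(1,3) by blast
  then obtain q where "?Q = Polynomial.smult p q" ..
  then have "Q = Polynomial.smult p ([:- a, 1:] * q + [:c:])" using Q c by (simp add: smult_add_right)
  then show ?thesis by blast
 qed
qed

text \<open>The product and \<open>X^p - X\<close> are both monic of degree \<open>p\<close>. At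
  \<open>0, ..., p - 1\<close> the product vanishes, and \<open>X^p - X\<close> vanishes modulo
  \<open>p\<close> by Fermat, so the difference has degree below \<open>p\<close> and
  \<open>p\<close> incongruent roots.\<close>

lemma falling_poly_mod_prime:
 assumes "Factorial_Ring.prime p"
 shows "\<exists>q. (\<Prod>i<p. [:- int i, 1:]) = Polynomial.monom 1 p - Polynomial.monom 1 1 + Polynomial.smult (int p) q"
proof -
 let ?F = "\<Prod>i<p. [:- int i, 1:]"
 let ?Q = "?F - (Polynomial.monom 1 p - Polynomial.monom 1 1)"
 have p: "p \<ge> 2" using assms prime_ge_2_nat by blast
 have dF: "Polynomial.degree ?F = p"
  by (subst degree_prod_eq_sum_degree) auto
 have lF: "Polynomial.coeff ?F p = 1"
  using lead_coeff_prod[of "%i. [:- int i, 1:]" "{..<p}"] dF by simp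
 have "Polynomial.coeff ?Q i = 0" if "i \<ge> p" for i
  using that p dF lF by (cases "i = p") (auto simp: coeff_eq_0)
 then have "Polynomial.degree ?Q < p" using p
  by (metis (no_types, lifting) degree_lessI le_trans not_less pos2 zero_less_iff_neq_zero less_le_trans)
 moreover have "int p dvd poly ?Q (int k)" if k: "k < p" for k
 proof -
  have "poly ?F (int k) = 0" using k by (auto simp: poly_prod)
  moreover have "[k ^ p = k] (mod p)"
  proof (cases "p dvd k")
   case True
   then have "p dvd k ^ p" using p by (metis dvd_power dvd_trans not_numeral_le_zero bot_nat_0.not_eq_extremum)
   then show ?thesis using True by (simp add: cong_def mod_eq_0_iff_dvd)
  next
   case False
   then have "[k ^ (p - 1) * k = 1 * k] (mod p)" using fermat_theorem[OF assms] cong_scalar_right by blast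
   moreover have "k ^ (p - 1) * k = k ^ p" using p by (metis Suc_diff_1 power_Suc2 pos2 order_less_le_trans)
   ultimately show ?thesis by simp
  qed
  then have "int p dvd int (k ^ p) - int k" by (metis cong_iff_dvd_diff cong_int_iff)
  ultimately show ?thesis using p by (simp add: poly_monom dvd_diff_commute)
 qed
 moreover have "~ int p dvd int a - int b" if "a < p" "b < p" "a ~= b" for a b
 proof
  assume "int p dvd int a - int b"
  then have "[a = b] (mod p)" by (metis cong_iff_dvd_diff cong_int_iff)
  then show False using that by (simp add: cong_def)
 qed
 moreover have "card (int ` {..<p}) = p" by (simp add: card_image)
 moreover have "Factorial_Ring.prime (int p)" using assms by simp
 ultimately obtain q where "?Q = Polynomial.smult (int p) q"
  using int_poly_dvd_of_roots[of "int p" "int ` {..<p}" ?Q] by auto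
 then show ?thesis by (intro exI[of _ q]) (simp add: algebra_simps)
qed

section \<open>Integer multiples and integer polynomials in a ring\<close>

lemmas (in ring) mult_int = add_pow_ldistr_int add_pow_rdistr_int

context ring begin

lemma int_mult_closed [simp, intro]: "x \<in> carrier R ==> [(k::int)] \<cdot> x \<in> carrier R"
 by (rule add.int_pow_closed)

lemma int_mult_zero [simp]: "[(k::int)] \<cdot> \<zero> = \<zero>"
 by (rule add.int_pow_one)

lemma int_mult_0 [simp]: "[(0::int)] \<cdot> x = \<zero>"
 by (simp add: add_pow_def int_pow_def)

lemma int_mult_1 [simp]: "x \<in> carrier R ==> [(1::int)] \<cdot> x = x"
 using add.int_pow_1 by simp

lemma int_mult_add: "x \<in> carrier R ==> [(k + l::int)] \<cdot> x = [k] \<cdot> x \<oplus> [l] \<cdot> x"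
 using add.int_pow_mult by simp

lemma int_mult_mult: "x \<in> carrier R ==> [(k * l::int)] \<cdot> x = [k] \<cdot> ([l] \<cdot> x)"
 using add.int_pow_pow[of x k l] by (simp add: mult.commute)

lemma int_mult_distrib: "x \<in> carrier R ==> y \<in> carrier R ==> [(k::int)] \<cdot> (x \<oplus> y) = [k] \<cdot> x \<oplus> [k] \<cdot> y"
 using add.int_pow_distrib by simp

lemma int_mult_minus: "x \<in> carrier R ==> [(- k::int)] \<cdot> x = \<ominus> ([k] \<cdot> x)"
 using add.int_pow_neg by simp

lemma int_mult_diff: "x \<in> carrier R ==> [(k - l::int)] \<cdot> x = [k] \<cdot> x \<ominus> [l] \<cdot> x"
 using int_mult_add[of x k "- l"] by (simp add: int_mult_minus minus_eq)

lemma int_mult_of_nat: "[int n] \<cdot> x = [n] \<cdot> x"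
 by (simp add: add_pow_int_ge)

lemma int_mult_one: "x \<in> carrier R ==> [(k::int)] \<cdot> x = ([k] \<cdot> \<one>) \<otimes> x"
 by (simp add: add_pow_ldistr_int)

lemma int_mult_finsum:
 "f \<in> A \<rightarrow> carrier R ==> [(k::int)] \<cdot> (\<Oplus>i\<in>A. f i) = (\<Oplus>i\<in>A. [k] \<cdot> f i)"
proof (cases "finite A")
 case True
 show "f \<in> A \<rightarrow> carrier R ==> ?thesis" using True
 proof (induction A rule: finite_induct)
  case empty then show ?case by simp
 next
  case (insert x F)
  then show ?case by (simp add: int_mult_distrib Pi_def)
 qed
qed simp

text \<open>Evaluation of integer polynomials at an element of a ring that need not be commutative;
  it carries the congruence for falling factorials over to rings of characteristic
  \<open>p\<close>.\<close>

definition int_eval :: "'a => int poly => 'a" where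
 "int_eval t q = fold_coeffs (%a b. ([a] \<cdot> \<one>) \<oplus> (t \<otimes> b)) q \<zero>"

lemma int_eval_0 [simp]: "int_eval t 0 = \<zero>"
 by (simp add: int_eval_def)

lemma int_eval_pCons [simp]:
 assumes "t \<in> carrier R"
 shows "int_eval t (pCons a q) = ([a] \<cdot> \<one>) \<oplus> t \<otimes> int_eval t q"
proof (cases "a = 0 & q = 0")
 case True
 then show ?thesis using assms by (simp add: int_eval_def)
next
 case False
 then show ?thesis using assms
  by (cases "a = 0") (auto simp: int_eval_def fold_coeffs_pCons_coeff_not_0_eq fold_coeffs_pCons_not_0_0_eq)
qed

lemma int_eval_1 [simp]: "t \<in> carrier R ==> int_eval t 1 = \<one>"
 by (simp add: one_pCons)

lemma int_eval_closed [simp]: "t \<in> carrier R ==> int_eval t q \<in> carrier R"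
 by (induction q) auto

lemma int_eval_add: "t \<in> carrier R ==> int_eval t (q + r) = int_eval t q \<oplus> int_eval t r"
proof (induction q r rule: poly_induct2)
 case (pCons a p b q)
 then show ?case by (simp add: int_mult_add r_distr a_ac)
qed simp

lemma int_eval_smult: "t \<in> carrier R ==> int_eval t (Polynomial.smult c q) = [c] \<cdot> int_eval t q"
proof (induction q)
 case (pCons a q)
 then show ?case by (simp add: int_mult_mult int_mult_distrib add_pow_rdistr_int)
qed simp

lemma int_eval_diff: "t \<in> carrier R ==> int_eval t (q - r) = int_eval t q \<ominus> int_eval t r"
 using int_eval_add[of t q "- r"] int_eval_smult[of t "- 1" r] by (simp add: int_mult_minus minus_eq)

lemma int_eval_monom: "t \<in> carrier R ==> int_eval t (Polynomial.monom 1 n) = t [^] n"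
 by (induction n) (auto simp: monom_0 monom_Suc group_commutes_pow)

text \<open>Falling factorials \<open>t (t - 1) ... (t - n + 1)\<close> serve as a basis in place of
  the powers of \<open>t\<close>. In characteristic \<open>p\<close>, replacing \<open>t\<close> by
  \<open>t + 1\<close> changes the \<open>n\<close>-th one by \<open>n\<close> times its
  predecessor, with \<open>n\<close> invertible for \<open>0 < n < p\<close>, and the
  \<open>p\<close>-th one is \<open>t^p - t\<close>.\<close>

definition falling :: "'a => nat => 'a" where
 "falling t n = rec_nat \<one> (%i f. (t \<ominus> [int i] \<cdot> \<one>) \<otimes> f) n"

lemma falling_0 [simp]: "falling t 0 = \<one>"
 and falling_Suc: "falling t (Suc n) = (t \<ominus> [int n] \<cdot> \<one>) \<otimes> falling t n"
 by (auto simp: falling_def)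

lemma falling_closed [simp, intro]: "t \<in> carrier R ==> falling t n \<in> carrier R"
 by (induction n) (auto simp: falling_Suc)

lemma falling_int_eval: "t \<in> carrier R ==> falling t n = int_eval t (\<Prod>i<n. [:- int i, 1:])"
proof (induction n)
 case (Suc n)
 define F where "F = (\<Prod>i<n. [:- int i, 1:])"
 have "(\<Prod>i<Suc n. [:- int i, 1:]) = pCons 0 F - Polynomial.smult (int n) F"
  unfolding F_def by (simp add: algebra_simps)
 then have "int_eval t (\<Prod>i<Suc n. [:- int i, 1:]) = t \<otimes> int_eval t F \<ominus> [int n] \<cdot> int_eval t F"
  using Suc.prems by (simp add: int_eval_diff int_eval_smult)
 also have "\<dots> = (t \<ominus> [int n] \<cdot> \<one>) \<otimes> int_eval t F"
  using Suc.prems by (simp add: minus_eq l_distr l_minus add_pow_ldistr_int)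
 finally show ?case using Suc by (simp add: falling_Suc F_def)
qed simp

lemma falling_comm:
 assumes "t \<in> carrier R" "z \<in> carrier R" "t \<otimes> z = z \<otimes> t"
 shows "falling t n \<otimes> z = z \<otimes> falling t n"
proof (induction n)
 case (Suc n)
 have "[int n] \<cdot> \<one> \<otimes> z = z \<otimes> [int n] \<cdot> \<one>" using assms by (simp add: mult_int)
 then have "(t \<ominus> [int n] \<cdot> \<one>) \<otimes> z = z \<otimes> (t \<ominus> [int n] \<cdot> \<one>)" using assms
  by (simp add: minus_eq l_distr r_distr l_minus r_minus)
 then show ?case using Suc assms
  by (simp add: falling_Suc) (metis (no_types, lifting) falling_closed int_mult_closed m_assoc minus_closed one_closed)
qed (use assms in auto)

lemma falling_mult: "t \<in> carrier R ==> t \<otimes> falling t n = falling t (Suc n) \<oplus> [int n] \<cdot> falling t n"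
 by (simp add: falling_Suc minus_eq l_distr l_minus add_pow_ldistr_int a_assoc l_neg)

text \<open>The binomial theorem for commuting additive operators instead of commuting elements:
  left and right multiplication by one element always commute as operators, whatever the arguments
  commute with.\<close>

lemma operator_binomial:
 assumes "f \<in> carrier R \<rightarrow> carrier R" "g \<in> carrier R \<rightarrow> carrier R"
  and fa: "!!x y. x \<in> carrier R ==> y \<in> carrier R ==> f (x \<oplus> y) = f x \<oplus> f y"
  and ga: "!!x y. x \<in> carrier R ==> y \<in> carrier R ==> g (x \<oplus> y) = g x \<oplus> g y"
  and fg: "!!x. x \<in> carrier R ==> f (g x) = g (f x)"
  and z: "z \<in> carrier R"
 shows "((%x. f x \<oplus> g x) ^^ n) z = (\<Oplus>k\<in>{..n}. [int (n choose k)] \<cdot> (f ^^ k) ((g ^^ (n - k)) z))"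
proof (induction n)
 case 0
 show ?case using z by simp
next
 case (Suc n)
 have fc [simp]: "f x \<in> carrier R" "g x \<in> carrier R" if "x \<in> carrier R" for x using assms(1,2) that by auto
 have pc [simp]: "(f ^^ k) x \<in> carrier R" "(g ^^ k) x \<in> carrier R" if "x \<in> carrier R" for k x
  using that by (induction k) auto
 have gf: "g ((f ^^ k) x) = (f ^^ k) (g x)" if "x \<in> carrier R" for k x
  using that by (induction k) (auto simp: fg[symmetric])
 have hz: "h \<zero> = \<zero>" if "!!x. x \<in> carrier R ==> h x \<in> carrier R"
  "!!x y. x \<in> carrier R ==> y \<in> carrier R ==> h (x \<oplus> y) = h x \<oplus> h y" for h
  using that(2)[of \<zero> \<zero>] that(1)[of \<zero>] by (metis add.l_cancel_one r_zero zero_closed)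
 have hsum: "h (\<Oplus>i\<in>A. c i) = (\<Oplus>i\<in>A. h (c i))"
  if h: "!!x. x \<in> carrier R ==> h x \<in> carrier R"
  "!!x y. x \<in> carrier R ==> y \<in> carrier R ==> h (x \<oplus> y) = h x \<oplus> h y" and "finite A" "c \<in> A \<rightarrow> carrier R" for h c and A :: "nat set"
  using that(3,4) by (induction A rule: finite_induct) (auto simp: hz[OF h] h Pi_def)
 have hnat: "h ([m] \<cdot> x) = [m] \<cdot> h x" if h: "!!x. x \<in> carrier R ==> h x \<in> carrier R"
  "!!x y. x \<in> carrier R ==> y \<in> carrier R ==> h (x \<oplus> y) = h x \<oplus> h y" and "x \<in> carrier R" for h x and m :: nat
  using that(3) by (induction m) (auto simp: hz[OF h] h)
 define T where "T k m = (f ^^ k) ((g ^^ m) z)" for k m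
 have T [simp]: "T k m \<in> carrier R" for k m using z by (simp add: T_def)
 have fT: "f (T k m) = T (Suc k) m" and gT: "g (T k m) = T k (Suc m)" for k m
  using z by (auto simp: T_def gf)
 let ?S = "\<Oplus>k\<in>{..n}. [int (n choose k)] \<cdot> T k (n - k)"
 have "f ?S = (\<Oplus>k\<in>{..n}. [int (n choose k)] \<cdot> T (Suc k) (n - k))"
  by (subst hsum) (auto simp: fa fT int_mult_of_nat hnat)
 moreover have "g ?S = (\<Oplus>k\<in>{..n}. [int (n choose k)] \<cdot> T k (Suc n - k))"
  by (subst hsum) (auto simp: ga gT int_mult_of_nat hnat Suc_diff_le intro!: finsum_cong')
 \<comment> \<open>The added term has binomial coefficient 0. It lets this sum be split at index 0,
   where the other one starts, as Pascal's rule requires.\<close>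
 moreover have "\<dots> = (\<Oplus>k\<in>{..Suc n}. [int (n choose k)] \<cdot> T k (Suc n - k))"
  by (subst finsum_Suc) (auto simp: binomial_eq_0)
 moreover have "\<dots> = (\<Oplus>k\<in>{..n}. [int (n choose Suc k)] \<cdot> T (Suc k) (n - k)) \<oplus> T 0 (Suc n)"
  by (subst finsum_Suc2) auto
 moreover have "(\<Oplus>k\<in>{..Suc n}. [int (Suc n choose k)] \<cdot> T k (Suc n - k))
   = (\<Oplus>k\<in>{..n}. [int (n choose k)] \<cdot> T (Suc k) (n - k) \<oplus> [int (n choose Suc k)] \<cdot> T (Suc k) (n - k)) \<oplus> T 0 (Suc n)"
  by (subst finsum_Suc2) (auto simp: int_mult_add simp del: finsum_Suc add.finprod_Suc)
 ultimately show ?case using Suc unfolding T_def[symmetric]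
  by (simp add: finsum_addf a_assoc del: finsum_Suc add.finprod_Suc)
qed

end

section \<open>Rings of prime characteristic\<close>

text \<open>Neither commutativity nor \<open>1 ~= 0\<close> belongs to the locale, so it applies to
  matrix rings and passes along every ring homomorphism.\<close>

locale char_p_ring = ring +
 fixes p :: nat
 assumes prime_p: "Factorial_Ring.prime p" and char_p: "[p] \<cdot> \<one> = \<zero>"
begin

lemma p_pos: "p > 0" and p_gt1: "p > 1"
 using prime_p prime_gt_1_nat prime_gt_0_nat by auto

lemma p_mult [simp]: "x \<in> carrier R ==> [int p] \<cdot> x = \<zero>"
 using int_mult_one[of x "int p"] char_p by (simp add: int_mult_of_nat)

lemma p_dvd_mult: "int p dvd k ==> x \<in> carrier R ==> [k] \<cdot> x = \<zero>"
 by (auto simp: int_mult_mult dvd_def)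

text \<open>Bezout provides an inverse of \<open>k\<close> modulo \<open>p\<close>, which acts
  through integer multiples.\<close>

lemma int_mult_cancel:
 assumes "~ int p dvd k" "x \<in> carrier R" "[k] \<cdot> x = \<zero>"
 shows "x = \<zero>"
proof -
 have "coprime (int p) k" using prime_p assms(1) by (simp add: prime_imp_coprime)
 then obtain u v where uv: "u * int p + v * k = 1" using bezout_int[of "int p" k] by auto
 have "x = [(u * int p + v * k)] \<cdot> x" using uv assms by simp
 also have "\<dots> = \<zero>" using assms(2,3) by (simp add: int_mult_add int_mult_mult)
 finally show ?thesis .
qed

lemma falling_p: "t \<in> carrier R ==> falling t p = t [^] p \<ominus> t"
proof -
 assume t: "t \<in> carrier R"
 obtain q where q: "(\<Prod>i<p. [:- int i, 1:]) = Polynomial.monom 1 p - Polynomial.monom 1 1 + Polynomial.smult (int p) q"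
  using falling_poly_mod_prime[OF prime_p] by blast
 then have "falling t p = (t [^] p \<ominus> t [^] (1::nat)) \<oplus> [int p] \<cdot> int_eval t q"
  using t by (simp only: falling_int_eval int_eval_add int_eval_diff int_eval_monom int_eval_smult)
 then show ?thesis using t by simp
qed

text \<open>Only the two extreme terms of the binomial sum survive, the other coefficients being
  divisible by \<open>p\<close>. Applied to multiplications by commuting elements this gives
  \<open>freshman\<close>; applied to left and right multiplication by \<open>c\<close> it computes
  the \<open>p\<close>-th iterate of the derivation \<open>z -> c z - z c\<close>.\<close>

lemma operator_frobenius:
 assumes "f \<in> carrier R \<rightarrow> carrier R" "g \<in> carrier R \<rightarrow> carrier R"
  and "!!x y. x \<in> carrier R ==> y \<in> carrier R ==> f (x \<oplus> y) = f x \<oplus> f y"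
  and "!!x y. x \<in> carrier R ==> y \<in> carrier R ==> g (x \<oplus> y) = g x \<oplus> g y"
  and "!!x. x \<in> carrier R ==> f (g x) = g (f x)"
  and z: "z \<in> carrier R"
 shows "((%x. f x \<oplus> g x) ^^ p) z = (f ^^ p) z \<oplus> (g ^^ p) z"
proof -
 have pc [simp]: "(f ^^ k) x \<in> carrier R" "(g ^^ k) x \<in> carrier R" if "x \<in> carrier R" for k x
  using that assms(1,2) by (induction k) auto
 obtain m where m: "p = Suc m" using p_pos gr0_conv_Suc by blast
 define t where "t k = [int (p choose k)] \<cdot> (f ^^ k) ((g ^^ (p - k)) z)" for k
 have t [simp]: "t k \<in> carrier R" for k using z by (simp add: t_def)
 have zero: "t k = \<zero>" if "k ~= 0" "k < p" for k
  unfolding t_def using that dvd_choose_prime[of k p] prime_p z by (intro p_dvd_mult) auto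
 have "((%x. f x \<oplus> g x) ^^ p) z = (\<Oplus>k\<in>{..p}. t k)" unfolding t_def by (rule operator_binomial[OF assms])
 also have "\<dots> = (\<Oplus>k\<in>{..m}. t (Suc k)) \<oplus> t 0" unfolding m by (subst finsum_Suc2) auto
 also have "(\<Oplus>k\<in>{..m}. t (Suc k)) = (\<Oplus>k\<in>{..m}. if m = k then t (Suc k) else \<zero>)"
  using zero m by (intro finsum_cong') auto
 also have "\<dots> = t (Suc m)" by (rule finsum_singleton) auto
 finally show ?thesis using z by (simp add: m[symmetric]) (simp add: t_def)
qed

lemma freshman:
 assumes x: "x \<in> carrier R" and y: "y \<in> carrier R" and xy: "x \<otimes> y = y \<otimes> x"
 shows "(x \<oplus> y) [^] p = x [^] p \<oplus> y [^] p"
proof -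
 have pow: "((%w. a \<otimes> w) ^^ n) \<one> = a [^] n" if "a \<in> carrier R" for a and n :: nat
  using that by (induction n) (auto simp: group_commutes_pow)
 have "((%w. x \<otimes> w \<oplus> y \<otimes> w) ^^ n) \<one> = (x \<oplus> y) [^] n" for n :: nat
 proof (induction n)
  case (Suc n)
  have "(x \<oplus> y) [^] n \<otimes> (x \<oplus> y) = (x \<oplus> y) \<otimes> (x \<oplus> y) [^] n"
   using x y by (intro group_commutes_pow) auto
  then show ?case using Suc x y by (simp add: l_distr)
 qed simp
 moreover have "((%w. x \<otimes> w \<oplus> y \<otimes> w) ^^ p) \<one>
   = ((%w. x \<otimes> w) ^^ p) \<one> \<oplus> ((%w. y \<otimes> w) ^^ p) \<one>"
  using x y xy by (intro operator_frobenius) (auto simp: r_distr m_assoc[symmetric])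
 ultimately show ?thesis using pow x y by simp
qed

end

context ring begin

lemma additive_finsum:
 assumes "!!x. x \<in> carrier R ==> h x \<in> carrier R"
  and "!!x y. x \<in> carrier R ==> y \<in> carrier R ==> h (x \<oplus> y) = h x \<oplus> h y"
  and "finite A" "f \<in> A \<rightarrow> carrier R"
 shows "h (\<Oplus>i\<in>A. f i) = (\<Oplus>i\<in>A. h (f i))"
proof -
 have "h \<zero> = \<zero>"
  using assms(2)[of \<zero> \<zero>] assms(1)[of \<zero>] by (metis add.l_cancel_one r_zero zero_closed)
 with assms(3,4) show ?thesis
  by (induction A rule: finite_induct) (auto simp: assms(1,2) Pi_def)
qed

lemma finsum_lessThan_Suc_shift:
 assumes "f \<in> {..<Suc m} \<rightarrow> carrier R"
 shows "(\<Oplus>i\<in>{..<Suc m}. f i) = f 0 \<oplus> (\<Oplus>i\<in>{..<m}. f (Suc i))"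
proof -
 have "(\<Oplus>i\<in>Suc ` {..<m}. f i) = (\<Oplus>i\<in>{..<m}. f (Suc i))"
  using assms by (intro finsum_reindex) auto
 then show ?thesis
  using assms unfolding lessThan_Suc_eq_insert_0 by (subst finsum_insert) (auto simp: Pi_def)
qed

lemma Units_right_zero: "y \<in> Units R ==> x \<in> carrier R ==> x \<otimes> y = \<zero> ==> x = \<zero>"
 by (metis Units_closed Units_inv_closed Units_r_inv l_null m_assoc r_one)

lemma add_minus_cancel: "a \<in> carrier R ==> b \<in> carrier R ==> a \<oplus> (b \<oplus> \<ominus> a) = b"
 by (metis a_comm a_inv_closed a_lcomm add.r_inv r_zero)

end

section \<open>Pairs with \<open>v u = (u + 1) v\<close>\<close>

text \<open>Scalars and the values of \<open>u^p - u\<close> and \<open>v^p\<close> are kept out of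
  the locale. The same results then apply to the presented algebra, to its scalar extensions, to
  their images among matrices and to new generators found inside the algebra.\<close>

locale symbol_pair = char_p_ring +
 fixes u v
 assumes u [simp, intro]: "u \<in> carrier R" and Y_unit: "v \<in> Units R"
  and YX: "v \<otimes> u = (u \<oplus> \<one>) \<otimes> v"
begin

lemma v [simp, intro]: "v \<in> carrier R"
 using Y_unit by (rule Units_closed)

lemma Y_pow_X: "v [^] (j::nat) \<otimes> u = u \<otimes> v [^] j \<oplus> [int j] \<cdot> (v [^] j)"
proof (induction j)
 case (Suc j)
 have "v [^] Suc j \<otimes> u = v [^] j \<otimes> (u \<oplus> \<one>) \<otimes> v" by (simp add: m_assoc YX)
 also have "\<dots> = (u \<otimes> v [^] j \<oplus> [int j] \<cdot> (v [^] j) \<oplus> v [^] j) \<otimes> v" by (simp add: r_distr Suc)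
 finally show ?case by (simp add: l_distr m_assoc mult_int int_mult_add a_ac)
qed simp

text \<open>Passing \<open>v\<close> from left to right replaces \<open>u\<close> by
  \<open>u + 1\<close>, and the falling factorial of \<open>u + 1\<close> of length
  \<open>i + 1\<close> is \<open>u + 1\<close> times that of \<open>u\<close> of length
  \<open>i\<close>.\<close>

lemma Y_falling_Suc: "v \<otimes> falling u (Suc i) = (u \<oplus> \<one>) \<otimes> falling u i \<otimes> v"
proof (induction i)
 case 0
 then show ?case by (simp add: falling_Suc YX minus_eq)
next
 case (Suc i)
 let ?k = "[int i] \<cdot> \<one>"
 have k: "?k \<in> carrier R" by simp
 have "v \<otimes> (u \<ominus> [int (Suc i)] \<cdot> \<one>) = (u \<ominus> ?k) \<otimes> v"
  using YX by (simp add: minus_eq r_distr l_distr r_minus l_minus mult_int int_mult_add int_mult_distrib minus_add a_ac r_neg2 r_neg1)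
 then have "v \<otimes> falling u (Suc (Suc i)) = (u \<ominus> ?k) \<otimes> (v \<otimes> falling u (Suc i))"
  by (subst falling_Suc) (simp add: m_assoc[symmetric])
 also have "\<dots> = ((u \<ominus> ?k) \<otimes> (u \<oplus> \<one>)) \<otimes> falling u i \<otimes> v" by (simp add: Suc m_assoc)
 also have "(u \<ominus> ?k) \<otimes> (u \<oplus> \<one>) = (u \<oplus> \<one>) \<otimes> (u \<ominus> ?k)"
  by (simp add: minus_eq r_distr l_distr r_minus l_minus mult_int int_mult_distrib minus_add a_ac)
 finally show ?case by (subst falling_Suc) (simp add: m_assoc)
qed

text \<open>The difference rule for falling factorials. At \<open>i = 0\<close> the truncated index
  \<open>i - 1\<close> is harmless because its coefficient is 0.\<close>

lemma Y_falling: "v \<otimes> falling u i = (falling u i \<oplus> [int i] \<cdot> falling u (i - 1)) \<otimes> v"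
proof (cases i)
 case (Suc k)
 have "(u \<oplus> \<one>) \<otimes> falling u k = falling u (Suc k) \<oplus> [int (Suc k)] \<cdot> falling u k"
  by (simp add: l_distr falling_mult int_mult_add a_ac)
 then show ?thesis using Suc Y_falling_Suc[of k] by simp
qed simp

text \<open>The standard monomials, with falling factorials of \<open>u\<close> for its powers. The
  exponent of \<open>v\<close> is the weight for \<open>z -> z u - u z\<close>, by
  \<open>mon_X\<close>.\<close>

definition mon :: "nat \<times> nat => 'a" where
 "mon z = falling u (fst z) \<otimes> v [^] snd z"

lemma mon_closed [simp, intro]: "mon z \<in> carrier R"
 by (simp add: mon_def)

lemma X_mon: "u \<otimes> mon (i, j) = mon (Suc i, j) \<oplus> [int i] \<cdot> mon (i, j)"
 by (simp add: mon_def m_assoc[symmetric] falling_mult l_distr mult_int)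

lemma Y_mon: "v \<otimes> mon (i, j) = mon (i, Suc j) \<oplus> [int i] \<cdot> mon (i - 1, Suc j)"
proof -
 have "v \<otimes> v [^] j = v [^] Suc j" by (simp add: group_commutes_pow)
 then show ?thesis
  by (simp add: mon_def m_assoc[symmetric] Y_falling l_distr mult_int del: nat_pow_Suc)
    (simp add: m_assoc)
qed

lemma mon_X: "mon (i, j) \<otimes> u = u \<otimes> mon (i, j) \<oplus> [int j] \<cdot> mon (i, j)"
proof -
 have "falling u i \<otimes> u = u \<otimes> falling u i" by (rule falling_comm) auto
 then show ?thesis
  by (simp add: mon_def m_assoc Y_pow_X r_distr mult_int) (simp add: m_assoc[symmetric])
qed

text \<open>Commutation with the pair only, which is what the independence arguments ask of
  coefficients; the ring may be larger than what \<open>u\<close> and \<open>v\<close>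
  generate.\<close>

definition central_elt :: "'a => bool" where
 "central_elt c \<longleftrightarrow> c \<in> carrier R & c \<otimes> u = u \<otimes> c & c \<otimes> v = v \<otimes> c"

lemma central_elt_closed [simp]: "central_elt c ==> c \<in> carrier R"
 by (simp add: central_elt_def)

lemma central_elt_int: "central_elt c ==> central_elt ([(k::int)] \<cdot> c)"
 by (simp add: central_elt_def mult_int)

text \<open>The \<open>w z\<close> are eigenvectors of \<open>x -> x u - u x\<close> with eigenvalue
  \<open>h z\<close>. Applying this operator minus \<open>k\<close> to the relation, for each
  \<open>k\<close> in \<open>A\<close>, multiplies the term at \<open>z\<close> by the factors
  \<open>h z - k\<close>.\<close>

lemma weight_components:
 assumes "finite S" "w \<in> S \<rightarrow> carrier R"
  and h: "!!z. z \<in> S ==> w z \<otimes> u = u \<otimes> w z \<oplus> [int (h z)] \<cdot> w z"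
  and "(\<Oplus>z\<in>S. w z) = \<zero>" "finite A"
 shows "(\<Oplus>z\<in>S. [(\<Prod>k\<in>A. int (h z) - int k)] \<cdot> w z) = \<zero>"
 using \<open>finite A\<close>
proof (induction A rule: finite_induct)
 case empty
 have "(\<Oplus>z\<in>S. [(1::int)] \<cdot> w z) = (\<Oplus>z\<in>S. w z)" using assms(2) by (intro finsum_cong') (auto simp: Pi_def)
 then show ?case using assms(4) by simp
next
 case (insert k A)
 define D where "D x = (x \<otimes> u \<ominus> u \<otimes> x) \<ominus> [int k] \<cdot> x" for x
 define q where "q z = [(\<Prod>k\<in>A. int (h z) - int k)] \<cdot> w z" for z
 have q: "q \<in> S \<rightarrow> carrier R" using assms(2) by (auto simp: q_def Pi_def)
 have Dv: "D (q z) = [(\<Prod>k\<in>insert k A. int (h z) - int k)] \<cdot> w z" if "z \<in> S" for z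
 proof -
  have c: "w z \<in> carrier R" "q z \<in> carrier R" using that assms(2) q by auto
  have "q z \<otimes> u = u \<otimes> q z \<oplus> [int (h z)] \<cdot> q z"
   using h[OF that] c
   by (simp add: q_def mult_int int_mult_distrib int_mult_mult[symmetric] mult.commute)
  then have "D (q z) = [int (h z)] \<cdot> q z \<ominus> [int k] \<cdot> q z" unfolding D_def
   using c by (simp add: minus_eq a_ac r_neg2 r_neg1)
  then show ?thesis using c insert.hyps
   by (simp add: int_mult_diff[symmetric]) (simp add: q_def int_mult_mult[symmetric])
 qed
 have "\<zero> = D (\<Oplus>z\<in>S. q z)" using insert.IH by (simp add: q_def D_def minus_eq)
 also have "\<dots> = (\<Oplus>z\<in>S. D (q z))"
  by (rule additive_finsum)
   (use assms(1) q in \<open>auto simp: D_def minus_eq l_distr r_distr minus_add int_mult_distrib a_ac\<close>)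
 also have "\<dots> = (\<Oplus>z\<in>S. [(\<Prod>k\<in>insert k A. int (h z) - int k)] \<cdot> w z)"
  using Dv assms(2) by (intro finsum_cong') auto
 finally show ?case by simp
qed

text \<open>Taking all residues except \<open>j\<close> for the factors kills every other weight, as
  in Lagrange interpolation; on weight \<open>j\<close> there remains the product of the
  \<open>j - k\<close>, which is prime to \<open>p\<close>.\<close>

lemma weight_component_zero:
 assumes "finite S" "w \<in> S \<rightarrow> carrier R"
  and h: "!!z. z \<in> S ==> w z \<otimes> u = u \<otimes> w z \<oplus> [int (h z)] \<cdot> w z"
  and hp: "!!z. z \<in> S ==> h z < p"
  and sum: "(\<Oplus>z\<in>S. w z) = \<zero>" and j: "j < p"
 shows "(\<Oplus>z\<in>{z \<in> S. h z = j}. w z) = \<zero>"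
proof -
 let ?A = "{..<p} - {j}"
 let ?c = "\<Prod>k\<in>?A. int j - int k"
 have 1: "(\<Oplus>z\<in>S. [(\<Prod>k\<in>?A. int (h z) - int k)] \<cdot> w z) = \<zero>"
  using assms(1,2) h sum by (intro weight_components) auto
 have z: "[(\<Prod>k\<in>?A. int (h z) - int k)] \<cdot> w z = \<zero>" if "z \<in> S" "h z ~= j" for z
 proof -
  have "(\<Prod>k\<in>?A. int (h z) - int k) = 0" using that hp[of z] by (intro prod_zero) auto
  then show ?thesis by (simp only: int_mult_0)
 qed
 have "(\<Oplus>z\<in>{z \<in> S. h z = j}. [?c] \<cdot> w z) = (\<Oplus>z\<in>S. [(\<Prod>k\<in>?A. int (h z) - int k)] \<cdot> w z)"
  by (rule add.finprod_mono_neutral_cong_left) (use assms(1,2) in \<open>auto intro: z\<close>)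
 then have "[?c] \<cdot> (\<Oplus>z\<in>{z \<in> S. h z = j}. w z) = \<zero>"
  using 1 assms(2) by (subst int_mult_finsum) auto
 moreover have "~ int p dvd ?c"
 proof -
  have "~ int p dvd int j - int k" if "k < p" "k ~= j" for k
  proof
   assume "int p dvd int j - int k"
   then have "[j = k] (mod p)" by (metis cong_iff_dvd_diff cong_int_iff)
   then show False using that j by (simp add: cong_def)
  qed
  then show ?thesis using prime_p by (auto simp: prime_dvd_prod_iff)
 qed
 moreover have "(\<Oplus>z\<in>{z \<in> S. h z = j}. w z) \<in> carrier R" using assms(2) by (intro finsum_closed) auto
 ultimately show ?thesis using int_mult_cancel by blast
qed

text \<open>The commutator of \<open>v\<close> with the sum is the difference operator applied to
  the sum, times \<open>v\<close> on the right; the unit \<open>v\<close> can be cancelled.\<close>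

lemma shift_sum:
 assumes c: "!!i. i < Suc n ==> central_elt (c i)"
  and comm: "v \<otimes> (\<Oplus>i\<in>{..<Suc n}. c i \<otimes> falling u i) = (\<Oplus>i\<in>{..<Suc n}. c i \<otimes> falling u i) \<otimes> v"
 shows "(\<Oplus>i\<in>{..<n}. ([int (Suc i)] \<cdot> c (Suc i)) \<otimes> falling u i) = \<zero>"
proof -
 define D where "D x = v \<otimes> x \<ominus> x \<otimes> v" for x
 let ?g = "%i. ([int i] \<cdot> c i) \<otimes> falling u (i - 1)"
 have D: "D (c i \<otimes> falling u i) = ?g i \<otimes> v" if "i < Suc n" for i
 proof -
  have ci: "c i \<in> carrier R" "v \<otimes> c i = c i \<otimes> v" using c[OF that] by (auto simp: central_elt_def)
  have "v \<otimes> (c i \<otimes> falling u i) = c i \<otimes> (v \<otimes> falling u i)"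
   using ci by (simp add: m_assoc[symmetric])
  also have "\<dots> = c i \<otimes> falling u i \<otimes> v \<oplus> ?g i \<otimes> v"
   using ci by (simp add: Y_falling m_assoc l_distr r_distr mult_int)
  finally show ?thesis unfolding D_def using ci by (simp add: minus_eq a_ac r_neg2 r_neg1)
 qed
 have cc: "c i \<in> carrier R" if "i < Suc n" for i using c[OF that] by simp
 have "\<zero> = D (\<Oplus>i\<in>{..<Suc n}. c i \<otimes> falling u i)"
  unfolding D_def comm using cc by (simp add: minus_eq r_neg del: lessThan_Suc)
 also have "\<dots> = (\<Oplus>i\<in>{..<Suc n}. D (c i \<otimes> falling u i))"
  by (rule additive_finsum) (use cc in \<open>auto simp: D_def minus_eq l_distr r_distr minus_add a_ac\<close>)
 also have "\<dots> = (\<Oplus>i\<in>{..<Suc n}. ?g i \<otimes> v)"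
  using D cc by (intro finsum_cong') auto
 also have "\<dots> = (\<Oplus>i\<in>{..<Suc n}. ?g i) \<otimes> v"
  using cc by (subst finsum_ldistr) auto
 finally have "(\<Oplus>i\<in>{..<Suc n}. ?g i) \<otimes> v = \<zero>" ..
 moreover have "(\<Oplus>i\<in>{..<Suc n}. ?g i) \<in> carrier R" using cc by (intro finsum_closed) auto
 ultimately have "(\<Oplus>i\<in>{..<Suc n}. ?g i) = \<zero>" using Units_right_zero[OF Y_unit] by blast
 then show ?thesis using cc by (subst (asm) finsum_lessThan_Suc_shift) auto
qed

text \<open>A vanishing sum commutes with \<open>v\<close>, so \<open>shift_sum\<close> yields a
  relation shorter by one with coefficients \<open>(i + 1) c (i + 1)\<close>. The bound
  \<open>n \<le> p\<close> keeps these factors prime to \<open>p\<close>.\<close>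

lemma falling_indep:
 assumes "n \<le> p" "!!i. i < n ==> central_elt (c i)" "(\<Oplus>i\<in>{..<n}. c i \<otimes> falling u i) = \<zero>"
 shows "\<forall>i<n. c i = \<zero>"
 using assms
proof (induction n arbitrary: c)
 case (Suc n)
 have cc: "c i \<in> carrier R" if "i < Suc n" for i using Suc.prems(2)[OF that] by simp
 have "(\<Oplus>i\<in>{..<n}. ([int (Suc i)] \<cdot> c (Suc i)) \<otimes> falling u i) = \<zero>"
  using Suc.prems by (intro shift_sum) simp_all
 then have "\<forall>i<n. [int (Suc i)] \<cdot> c (Suc i) = \<zero>"
  using Suc.prems by (intro Suc.IH) (auto intro: central_elt_int)
 moreover have "~ int p dvd int (Suc i)" if "i < n" for i
  using that Suc.prems(1) by (auto dest: zdvd_imp_le)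
 ultimately have *: "c (Suc i) = \<zero>" if "i < n" for i
  using int_mult_cancel cc that by (metis Suc_mono)
 have "(\<Oplus>i\<in>{..<n}. c (Suc i) \<otimes> falling u (Suc i)) = (\<Oplus>i\<in>{..<n}. \<zero>)"
  using * by (intro finsum_cong') auto
 then have "c 0 = \<zero>"
  using Suc.prems(3) cc by (subst (asm) finsum_lessThan_Suc_shift) auto
 then show ?case using * by (auto simp: less_Suc_eq_0_disj)
qed simp

abbreviation I where "I \<equiv> {..<p} \<times> {..<p}"

lemma column_sum:
 assumes "j < p" "f \<in> I \<rightarrow> carrier R"
 shows "(\<Oplus>z\<in>{z \<in> I. snd z = j}. f z) = (\<Oplus>i\<in>{..<p}. f (i, j))"
proof -
 have "{z \<in> I. snd z = j} = (%i. (i, j)) ` {..<p}" using assms by auto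
 moreover have "(\<Oplus>z\<in>(%i. (i, j)) ` {..<p}. f z) = (\<Oplus>i\<in>{..<p}. f (i, j))"
  using assms by (intro finsum_reindex) (auto simp: inj_on_def)
 ultimately show ?thesis by simp
qed

text \<open>Weights separate the powers of \<open>v\<close>; within one weight the power of
  \<open>v\<close> cancels, and the falling factorials of \<open>u\<close> are independent. In the
  injectivity arguments this plays the part of the simplicity of symbol algebras.\<close>

lemma mon_indep:
 assumes c: "!!z. z \<in> I ==> central_elt (c z)" and sum: "(\<Oplus>z\<in>I. c z \<otimes> mon z) = \<zero>"
 shows "\<forall>z\<in>I. c z = \<zero>"
proof -
 have "\<forall>i<p. c (i, j) = \<zero>" if j: "j < p" for j
 proof (rule falling_indep)
  have "(\<Oplus>z\<in>{z \<in> I. snd z = j}. c z \<otimes> mon z) = \<zero>"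
  proof (rule weight_component_zero[OF _ _ _ _ sum j])
   fix z assume "z \<in> I"
   then obtain i j where z: "z = (i, j)" "central_elt (c z)" using c by (cases z) auto
   then have "c z \<otimes> mon z \<otimes> u = c z \<otimes> (u \<otimes> mon z \<oplus> [int j] \<cdot> mon z)" by (simp add: m_assoc mon_X)
   also have "\<dots> = u \<otimes> (c z \<otimes> mon z) \<oplus> [int (snd z)] \<cdot> (c z \<otimes> mon z)"
    using z by (simp add: r_distr mult_int m_assoc[symmetric] central_elt_def)
   finally show "c z \<otimes> mon z \<otimes> u = u \<otimes> (c z \<otimes> mon z) \<oplus> [int (snd z)] \<cdot> (c z \<otimes> mon z)" .
  qed (use c in auto)
  then have "(\<Oplus>i\<in>{..<p}. c (i, j) \<otimes> mon (i, j)) = \<zero>"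
   using c by (subst (asm) column_sum[OF j]) auto
  moreover have "(\<Oplus>i\<in>{..<p}. c (i, j) \<otimes> mon (i, j)) = (\<Oplus>i\<in>{..<p}. c (i, j) \<otimes> falling u i) \<otimes> v [^] j"
   using c j by (subst finsum_ldistr) (auto simp: mon_def m_assoc intro!: finsum_cong')
  moreover have "v [^] j \<in> Units R" using Y_unit by (rule Units_pow_closed)
  moreover have "(\<Oplus>i\<in>{..<p}. c (i, j) \<otimes> falling u i) \<in> carrier R"
   using c j by (intro finsum_closed) auto
  ultimately show "(\<Oplus>i\<in>{..<p}. c (i, j) \<otimes> falling u i) = \<zero>"
   using Units_right_zero by metis
 qed (use c j in auto)
 then show ?thesis by auto
qed

text \<open>Commuting with \<open>u\<close> removes all weights except 0. Commuting with
  \<open>v\<close> then makes the difference operator vanish on what is left, so that only the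
  constant term survives.\<close>

lemma mon_centralizer:
 assumes c: "!!z. z \<in> I ==> central_elt (c z)" and comm: "central_elt (\<Oplus>z\<in>I. c z \<otimes> mon z)"
 shows "(\<Oplus>z\<in>I. c z \<otimes> mon z) = c (0, 0)"
proof -
 let ?s = "\<Oplus>z\<in>I. c z \<otimes> mon z"
 define D where "D x = x \<otimes> u \<ominus> u \<otimes> x" for x
 have cc: "c z \<in> carrier R" if "z \<in> I" for z using c[OF that] by simp
 have "D (c z \<otimes> mon z) = [int (snd z)] \<cdot> c z \<otimes> mon z" if zI: "z \<in> I" for z
 proof -
  obtain i j where z: "z = (i, j)" "central_elt (c z)" using c zI by (cases z) auto
  then have "c z \<otimes> mon z \<otimes> u = c z \<otimes> (u \<otimes> mon z \<oplus> [int j] \<cdot> mon z)" by (simp add: m_assoc mon_X)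
  also have "\<dots> = u \<otimes> (c z \<otimes> mon z) \<oplus> [int (snd z)] \<cdot> (c z \<otimes> mon z)"
   using z by (simp add: r_distr mult_int m_assoc[symmetric] central_elt_def)
  finally show ?thesis using z unfolding D_def by (simp add: minus_eq a_ac add_minus_cancel r_neg2 r_neg1 mult_int)
 qed
 then have "(\<Oplus>z\<in>I. [int (snd z)] \<cdot> c z \<otimes> mon z) = (\<Oplus>z\<in>I. D (c z \<otimes> mon z))"
  using cc by (intro finsum_cong') (auto simp: D_def)
 also have "\<dots> = D ?s"
  by (rule additive_finsum[symmetric]) (use cc in \<open>auto simp: D_def minus_eq l_distr r_distr minus_add a_ac\<close>)
 also have "\<dots> = \<zero>" using comm by (simp add: D_def central_elt_def minus_eq r_neg)
 finally have "(\<Oplus>z\<in>I. [int (snd z)] \<cdot> c z \<otimes> mon z) = \<zero>" .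
 then have 1: "\<forall>z\<in>I. [int (snd z)] \<cdot> c z = \<zero>"
  using c by (intro mon_indep) (auto intro: central_elt_int)
 have 2: "c z = \<zero>" if "z \<in> I" "snd z ~= 0" for z
 proof -
  have "~ int p dvd int (snd z)" using that by (auto dest: zdvd_imp_le)
  then show ?thesis using 1 that cc int_mult_cancel by metis
 qed
 have s: "?s = (\<Oplus>i\<in>{..<p}. c (i, 0) \<otimes> falling u i)"
 proof -
  have "(\<Oplus>z\<in>{z \<in> I. snd z = 0}. c z \<otimes> mon z) = ?s"
   using 2 cc by (intro add.finprod_mono_neutral_cong_left) auto
  moreover have "(\<Oplus>i\<in>{..<p}. c (i, 0) \<otimes> mon (i, 0)) = (\<Oplus>i\<in>{..<p}. c (i, 0) \<otimes> falling u i)"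
   using cc p_pos by (intro finsum_cong') (auto simp: mon_def)
  ultimately show ?thesis using cc p_pos by (subst (asm) column_sum) auto
 qed
 obtain m where m: "p = Suc m" using p_pos gr0_conv_Suc by blast
 have "v \<otimes> ?s = ?s \<otimes> v" using comm by (simp add: central_elt_def)
 from this[unfolded s] have "(\<Oplus>i\<in>{..<m}. ([int (Suc i)] \<cdot> c (Suc i, 0)) \<otimes> falling u i) = \<zero>"
  unfolding m using c m by (intro shift_sum) auto
 then have 3: "\<forall>i<m. [int (Suc i)] \<cdot> c (Suc i, 0) = \<zero>"
  using c m by (intro falling_indep) (auto intro: central_elt_int)
 have "c (Suc i, 0) = \<zero>" if "i < m" for i
 proof -
  have "~ int p dvd int (Suc i)" using that m by (auto dest!: zdvd_imp_le)
  moreover have "(Suc i, 0) \<in> I" using that m by auto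
  ultimately show ?thesis using 3 that cc int_mult_cancel by metis
 qed
 then have "(\<Oplus>i\<in>{..<m}. c (Suc i, 0) \<otimes> falling u (Suc i)) = (\<Oplus>i\<in>{..<m}. \<zero>)"
  by (intro finsum_cong') auto
 then have "(\<Oplus>i\<in>{..<Suc m}. c (i, 0) \<otimes> falling u i) = c (0, 0)"
  using cc m by (subst finsum_lessThan_Suc_shift) auto
 then show ?thesis unfolding s by (simp only: m)
qed

end

section \<open>Spans of indexed families over a subring\<close>

context ring begin

text \<open>Coefficients given as a function on the index set suit the monomials, which are indexed
  by pairs. \<open>Span_map_eq_lspan\<close> links this to spans of lists.\<close>

definition lspan :: "'a set => ('i => 'a) => 'i set => 'a set" where
 "lspan K f A = {\<Oplus>z\<in>A. c z \<otimes> f z | c. c \<in> A \<rightarrow> K}"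

lemma lspanI: "c \<in> A \<rightarrow> K ==> (\<Oplus>z\<in>A. c z \<otimes> f z) \<in> lspan K f A"
 by (auto simp: lspan_def)

context
 fixes K and A :: "'i set" and f :: "'i => 'a"
 assumes K: "subring K R" and A: "finite A" and f: "f \<in> A \<rightarrow> carrier R"
begin

lemma lspan_closed: "lspan K f A \<subseteq> carrier R"
 using f subringE(1)[OF K] by (auto simp: lspan_def intro!: finsum_closed)

lemma lspan_add:
 assumes "x \<in> lspan K f A" "y \<in> lspan K f A" shows "x \<oplus> y \<in> lspan K f A"
proof -
 obtain c d where c: "c \<in> A \<rightarrow> K" "x = (\<Oplus>z\<in>A. c z \<otimes> f z)" and d: "d \<in> A \<rightarrow> K" "y = (\<Oplus>z\<in>A. d z \<otimes> f z)"
  using assms by (auto simp: lspan_def)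
 have K': "c z \<in> carrier R" "d z \<in> carrier R" "f z \<in> carrier R" if "z \<in> A" for z
  using that c d f subringE(1)[OF K] by auto
 have "x \<oplus> y = (\<Oplus>z\<in>A. c z \<otimes> f z \<oplus> d z \<otimes> f z)"
  unfolding c d using K' by (intro finsum_addf[symmetric]) auto
 also have "\<dots> = (\<Oplus>z\<in>A. (c z \<oplus> d z) \<otimes> f z)"
  using K' by (intro finsum_cong') (auto simp: l_distr)
 also have "\<dots> \<in> lspan K f A"
  using c d subringE(7)[OF K] by (intro lspanI) auto
 finally show ?thesis .
qed

lemma lspan_smult:
 assumes "k \<in> K" "x \<in> lspan K f A" shows "k \<otimes> x \<in> lspan K f A"
proof -
 obtain c where c: "c \<in> A \<rightarrow> K" "x = (\<Oplus>z\<in>A. c z \<otimes> f z)"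
  using assms by (auto simp: lspan_def)
 have K': "c z \<in> carrier R" "f z \<in> carrier R" if "z \<in> A" for z
  using that c f subringE(1)[OF K] by auto
 have k: "k \<in> carrier R" using assms(1) subringE(1)[OF K] by auto
 have "k \<otimes> x = (\<Oplus>z\<in>A. k \<otimes> (c z \<otimes> f z))"
  unfolding c using K' A k by (intro finsum_rdistr) auto
 also have "\<dots> = (\<Oplus>z\<in>A. (k \<otimes> c z) \<otimes> f z)"
  using K' k by (intro finsum_cong') (auto simp: m_assoc)
 also have "\<dots> \<in> lspan K f A"
  using c assms(1) subringE(6)[OF K] by (intro lspanI) auto
 finally show ?thesis .
qed

lemma lspan_zero: "\<zero> \<in> lspan K f A"
proof -
 have "(\<Oplus>z\<in>A. \<zero> \<otimes> f z) = (\<Oplus>z\<in>A. \<zero>)" using f by (intro finsum_cong') (auto simp: Pi_def)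
 then have "(\<Oplus>z\<in>A. \<zero> \<otimes> f z) = \<zero>" by simp
 moreover have "(\<Oplus>z\<in>A. \<zero> \<otimes> f z) \<in> lspan K f A" using subringE(2)[OF K] by (intro lspanI) auto
 ultimately show ?thesis by simp
qed

lemma lspan_base: assumes "a \<in> A" shows "f a \<in> lspan K f A"
proof -
 have "(\<Oplus>z\<in>A. (if a = z then \<one> else \<zero>) \<otimes> f z) = (\<Oplus>z\<in>A. if a = z then f z else \<zero>)"
  using f by (intro finsum_cong') (auto simp: Pi_def)
 also have "\<dots> = f a" using f A assms by (intro finsum_singleton) auto
 finally show ?thesis
  using subringE(2,3)[OF K] by (auto simp: lspan_def intro!: exI[of _ "%z. if a = z then \<one> else \<zero>"])
qed

lemma lspan_minus: "x \<in> lspan K f A ==> \<ominus> x \<in> lspan K f A"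
 using lspan_smult[of "\<ominus> \<one>" x] subringE(3,5)[OF K] lspan_closed by (auto simp: l_minus subset_iff)

lemma lspan_int_mult: "x \<in> lspan K f A ==> [(k::int)] \<cdot> x \<in> lspan K f A"
proof -
 assume x: "x \<in> lspan K f A"
 have xc: "x \<in> carrier R" using x lspan_closed by auto
 have "[n] \<cdot> x \<in> lspan K f A" for n :: nat
  by (induction n) (use x lspan_zero in \<open>auto intro: lspan_add\<close>)
 then show ?thesis
  by (cases k) (use lspan_minus in \<open>auto simp: int_mult_of_nat int_mult_minus[OF xc] simp del: of_nat_Suc add.nat_pow_Suc\<close>)
qed

lemma lspan_finsum: "finite B ==> g \<in> B \<rightarrow> lspan K f A ==> (\<Oplus>z\<in>B. g z) \<in> lspan K f A"
proof (induction B rule: finite_induct)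
 case empty
 then show ?case using lspan_zero by simp
next
 case (insert x F)
 then show ?case using lspan_closed by (subst finsum_insert) (auto intro: lspan_add)
qed

lemma lspan_least:
 assumes "\<zero> \<in> M" "!!x y. x \<in> M ==> y \<in> M ==> x \<oplus> y \<in> M" "!!k x. k \<in> K ==> x \<in> A ==> k \<otimes> f x \<in> M"
  and "M \<subseteq> carrier R"
 shows "lspan K f A \<subseteq> M"
proof
 fix x assume "x \<in> lspan K f A"
 then obtain c where c: "c \<in> A \<rightarrow> K" "x = (\<Oplus>z\<in>A. c z \<otimes> f z)" by (auto simp: lspan_def)
 have "(\<Oplus>z\<in>B. c z \<otimes> f z) \<in> M" if "finite B" "B \<subseteq> A" for B
  using that
 proof (induction B rule: finite_induct)
  case (insert x F)
  moreover have "!!z. z \<in> insert x F ==> c z \<otimes> f z \<in> M" using insert.prems c assms(3) by auto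
  ultimately show ?case using assms(2,4) by (subst finsum_insert) (auto simp: subset_iff)
 qed (use assms(1) in simp)
 then show "x \<in> M" using c(2) A by simp
qed

end

end

lemma (in ring_hom_ring) hom_int_mult: "x \<in> carrier R ==> h ([(k::int)] \<cdot>\<^bsub>R\<^esub> x) = [k] \<cdot>\<^bsub>S\<^esub> h x"
proof -
 assume x: "x \<in> carrier R"
 have n: "h ([n] \<cdot>\<^bsub>R\<^esub> x) = [n] \<cdot>\<^bsub>S\<^esub> h x" for n :: nat
  using x by (induction n) auto
 show ?thesis
  by (cases k) (use n x in \<open>auto simp: R.int_mult_of_nat S.int_mult_of_nat R.int_mult_minus S.int_mult_minus simp del: of_nat_Suc R.add.nat_pow_Suc S.add.nat_pow_Suc\<close>)
qed

lemma (in ring_hom_ring) hom_falling: "t \<in> carrier R ==> h (R.falling t n) = S.falling (h t) n"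
 by (induction n) (auto simp: R.falling_Suc S.falling_Suc R.minus_eq S.minus_eq hom_int_mult)

lemma (in ring_hom_ring) hom_finsum':
 "finite A ==> f \<in> A \<rightarrow> carrier R ==> h (finsum R f A) = (\<Oplus>\<^bsub>S\<^esub>i\<in>A. h (f i))"
 by (induction A rule: finite_induct) (auto simp: Pi_def)

context symbol_pair begin

text \<open>Multiplying a monomial by \<open>u\<close> or \<open>v\<close> raises an exponent by at
  most one. An exponent that reaches \<open>p\<close> is brought back to 0 by \<open>u^p - u\<close>
  or \<open>v^p\<close>, which lie in \<open>K\<close>.\<close>

lemma symbol_pair_mon_span:
 assumes K: "subring K R" "!!k. k \<in> K ==> central_elt k"
  and a: "u [^] p \<ominus> u \<in> K" and b: "v [^] p \<in> K"
 shows u_lspan: "x \<in> lspan K mon I ==> u \<otimes> x \<in> lspan K mon I"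
  and v_lspan: "x \<in> lspan K mon I ==> v \<otimes> x \<in> lspan K mon I"
  and lspan_one: "\<one> \<in> lspan K mon I"
proof -
 note mc = finite_cartesian_product[OF finite_lessThan finite_lessThan]
 have f: "mon \<in> I \<rightarrow> carrier R" by auto
 note L = K(1) mc[of p p] f
 have base: "mon z \<in> lspan K mon I" if "z \<in> I" for z using lspan_base[OF L that] .
 have mon_p: "mon (i, j) \<in> lspan K mon I" if "i \<le> p" "j < p" for i j
 proof (cases "i = p")
  case True
  have "mon (i, j) = (u [^] p \<ominus> u) \<otimes> mon (0, j)"
   unfolding True by (simp add: mon_def falling_p)
  then show ?thesis using lspan_smult[OF L a base[of "(0, j)"]] that p_pos by simp
 next
  case False
  then show ?thesis using that by (intro base) auto
 qed
 have mon_q: "mon (i, j) \<in> lspan K mon I" if "i < p" "j \<le> p" for i j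
 proof (cases "j = p")
  case True
  have "central_elt (v [^] p)" using K b by blast
  then have "falling u i \<otimes> v [^] p = v [^] p \<otimes> falling u i"
   by (intro falling_comm) (auto simp: central_elt_def)
  then have "mon (i, j) = v [^] p \<otimes> mon (i, 0)"
   unfolding True by (simp add: mon_def)
  then show ?thesis using lspan_smult[OF L b base[of "(i, 0)"]] that p_pos by simp
 next
  case False
  then show ?thesis using that by (intro base) auto
 qed
 show "\<one> \<in> lspan K mon I" using base[of "(0, 0)"] p_pos by (simp add: mon_def)
 have gen: "w \<otimes> x \<in> lspan K mon I" if w: "w = u \<or> w = v" and x: "x \<in> lspan K mon I" for w x
 proof -
  have wc: "w \<in> carrier R" using w by auto
  obtain c where c: "c \<in> I \<rightarrow> K" "x = (\<Oplus>z\<in>I. c z \<otimes> mon z)" using x by (auto simp: lspan_def)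
  have cc: "central_elt (c z)" if "z \<in> I" for z using c that K(2) by auto
  have "w \<otimes> x = (\<Oplus>z\<in>I. w \<otimes> (c z \<otimes> mon z))"
   unfolding c(2) by (rule finsum_rdistr) (use cc wc in auto)
  also have "\<dots> = (\<Oplus>z\<in>I. c z \<otimes> (w \<otimes> mon z))"
  proof (rule finsum_cong')
   fix z assume z: "z \<in> I"
   have "w \<otimes> c z = c z \<otimes> w" using cc[OF z] w by (auto simp: central_elt_def)
   then show "w \<otimes> (c z \<otimes> mon z) = c z \<otimes> (w \<otimes> mon z)" using cc[OF z] wc by (simp add: m_assoc[symmetric])
  qed (use cc wc in auto)
  also have "\<dots> \<in> lspan K mon I"
  proof (rule lspan_finsum[OF L])
   show "(%z. c z \<otimes> (w \<otimes> mon z)) \<in> I \<rightarrow> lspan K mon I"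
   proof
    fix z assume z: "z \<in> I"
    obtain i j where ij: "z = (i, j)" "i < p" "j < p" using z by auto
    have "u \<otimes> mon z \<in> lspan K mon I"
     unfolding ij X_mon using ij base[OF z] mon_p[of "Suc i" j]
     by (intro lspan_add[OF L] lspan_int_mult[OF L]) auto
    moreover have "v \<otimes> mon z \<in> lspan K mon I"
     unfolding ij Y_mon using ij mon_q[of i "Suc j"] mon_q[of "i - 1" "Suc j"]
     by (intro lspan_add[OF L] lspan_int_mult[OF L]) auto
    ultimately show "c z \<otimes> (w \<otimes> mon z) \<in> lspan K mon I"
     using w c(1) z lspan_smult[OF L] by auto
   qed
  qed auto
  finally show ?thesis .
 qed
 show "u \<otimes> x \<in> lspan K mon I" "v \<otimes> x \<in> lspan K mon I" if "x \<in> lspan K mon I" for x using gen that by auto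
qed

text \<open>The elements whose left multiplication preserves the span form a set \<open>M\<close>
  closed under sums and products that contains \<open>K\<close>, \<open>u\<close> and
  \<open>v\<close>, hence the span itself.\<close>

lemma lspan_mult:
 assumes K: "subring K R" "!!k. k \<in> K ==> central_elt k"
  and a: "u [^] p \<ominus> u \<in> K" and b: "v [^] p \<in> K"
  and x: "x \<in> lspan K mon I" and y: "y \<in> lspan K mon I"
 shows "x \<otimes> y \<in> lspan K mon I"
proof -
 have f: "mon \<in> I \<rightarrow> carrier R" and fin: "finite I" by auto
 note L = K(1) fin f
 note uv = symbol_pair_mon_span[OF K a b]
 define M where "M = {x \<in> carrier R. \<forall>y \<in> lspan K mon I. x \<otimes> y \<in> lspan K mon I}"
 have Lc: "y \<in> carrier R" if "y \<in> lspan K mon I" for y using lspan_closed[OF L] that by auto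
 have Kc: "k \<in> carrier R" if "k \<in> K" for k using K that by simp
 have M_mult: "x \<otimes> y \<in> M" if "x \<in> M" "y \<in> M" for x y
  using that Lc by (auto simp: M_def m_assoc)
 have M_add: "x \<oplus> y \<in> M" if "x \<in> M" "y \<in> M" for x y
  using that Lc lspan_add[OF L] by (auto simp: M_def l_distr)
 have M_K: "k \<in> M" if "k \<in> K" for k using that Kc lspan_smult[OF L] by (auto simp: M_def)
 have M_1: "\<one> \<in> M" and M_0: "\<zero> \<in> M" using Lc lspan_zero[OF L] by (auto simp: M_def)
 have M_u: "u \<in> M" and M_v: "v \<in> M" using uv by (auto simp: M_def)
 have "[int n] \<cdot> \<one> \<in> M" for n
  by (auto simp: M_def mult_int Lc intro!: lspan_int_mult[OF L])
 then have "u \<ominus> [int n] \<cdot> \<one> \<in> M" for n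
 proof -
  have "\<ominus> ([int n] \<cdot> \<one>) \<in> M"
   by (auto simp: M_def mult_int Lc l_minus intro!: lspan_minus[OF L] lspan_int_mult[OF L])
  then show ?thesis unfolding minus_eq using M_add M_u by blast
 qed
 then have "falling u i \<in> M" for i
  by (induction i) (use M_1 M_mult in \<open>auto simp: falling_Suc\<close>)
 moreover have "v [^] j \<in> M" for j :: nat
  by (induction j) (use M_1 M_mult M_v in auto)
 ultimately have "mon z \<in> M" for z using M_mult by (simp add: mon_def)
 then have "lspan K mon I \<subseteq> M"
  using M_0 M_add M_mult M_K by (intro lspan_least[OF L]) (auto simp: M_def)
 then show ?thesis using x y by (auto simp: M_def)
qed

end

lemma (in abelian_monoid) finsum_swap:
 assumes "finite A" "finite B" "!!i j. i \<in> A ==> j \<in> B ==> f i j \<in> carrier G"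
 shows "(\<Oplus>i\<in>A. \<Oplus>j\<in>B. f i j) = (\<Oplus>j\<in>B. \<Oplus>i\<in>A. f i j)"
 using assms(1,3)
proof (induction A rule: finite_induct)
 case (insert x F)
 have "(\<Oplus>j\<in>B. \<Oplus>i\<in>insert x F. f i j) = (\<Oplus>j\<in>B. f x j \<oplus> (\<Oplus>i\<in>F. f i j))"
  using insert by (intro finsum_cong') (auto intro!: finsum_closed)
 also have "\<dots> = (\<Oplus>j\<in>B. f x j) \<oplus> (\<Oplus>j\<in>B. \<Oplus>i\<in>F. f i j)"
  using insert.prems by (intro finsum_addf) (auto intro!: finsum_closed)
 finally show ?case using insert by (subst finsum_insert) (auto intro!: finsum_closed)
qed simp

section \<open>Matrix rings over a commutative ring\<close>

definition mat_unit :: "'a ring => nat => nat => 'a => nat \<times> nat => 'a" where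
 "mat_unit R i j a = (%(k, l). if k = i & l = j then a else \<zero>\<^bsub>R\<^esub>)"

locale matrix_ring = cring R for R :: "'a ring" (structure) +
 fixes n :: nat
 assumes n_pos: "n > 0"
begin

abbreviation "Mat \<equiv> fst (matrix_algebra n R)"
abbreviation "sc \<equiv> snd (matrix_algebra n R)"

lemma mat_mult: "i < n ==> j < n ==> (f \<otimes>\<^bsub>Mat\<^esub> g) (i, j) = (\<Oplus>k\<in>{..<n}. f (i, k) \<otimes> g (k, j))"
 by (simp add: matrix_algebra_def)

lemma mat_add: "i < n ==> j < n ==> (f \<oplus>\<^bsub>Mat\<^esub> g) (i, j) = f (i, j) \<oplus> g (i, j)"
 by (simp add: matrix_algebra_def)

lemma mat_one: "i < n ==> j < n ==> \<one>\<^bsub>Mat\<^esub> (i, j) = (if i = j then \<one> else \<zero>)"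
 by (simp add: matrix_algebra_def)

lemma mat_zero: "\<zero>\<^bsub>Mat\<^esub> (i, j) = \<zero>"
 by (simp add: matrix_algebra_def)

lemma mat_sc: "i < n ==> j < n ==> sc a (i, j) = (if i = j then a else \<zero>)"
 by (simp add: matrix_algebra_def)

lemma mat_outs:
 assumes "~ (i < n & j < n)"
 shows "(f \<otimes>\<^bsub>Mat\<^esub> g) (i, j) = \<zero>" "(f \<oplus>\<^bsub>Mat\<^esub> g) (i, j) = \<zero>" "\<one>\<^bsub>Mat\<^esub> (i, j) = \<zero>" "sc a (i, j) = \<zero>"
 using assms by (simp_all add: matrix_algebra_def, auto)

lemma mat_iff: "f \<in> carrier Mat \<longleftrightarrow> (\<forall>i<n. \<forall>j<n. f (i, j) \<in> carrier R)
  & (\<forall>i j. ~ (i < n & j < n) --> f (i, j) = \<zero>)"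
 by (simp add: matrix_algebra_def)

lemma mat_closed: "f \<in> carrier Mat ==> i < n ==> j < n ==> f (i, j) \<in> carrier R"
 unfolding mat_iff by blast

lemma mat_outside: "f \<in> carrier Mat ==> ~ (i < n & j < n) ==> f (i, j) = \<zero>"
 unfolding mat_iff by blast

lemma mat_closed' [simp]: "f \<in> carrier Mat ==> f (i, j) \<in> carrier R"
 using mat_closed[of f i j] mat_outside[of f i j] by fastforce

lemma matI: "(!!i j. i < n ==> j < n ==> f (i, j) \<in> carrier R) ==> (!!i j. ~ (i < n & j < n) ==> f (i, j) = \<zero>) ==> f \<in> carrier Mat"
 unfolding mat_iff by blast

lemma mat_eqI:
 assumes "f \<in> carrier Mat" "g \<in> carrier Mat" "!!i j. i < n ==> j < n ==> f (i, j) = g (i, j)"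
 shows "f = g"
proof
 fix z show "f z = g z"
  using assms mat_outside[of f "fst z" "snd z"] mat_outside[of g "fst z" "snd z"]
  by (cases z) (metis fst_conv snd_conv)
qed

lemma mat_mult_closed [simp]: "f \<in> carrier Mat ==> g \<in> carrier Mat ==> f \<otimes>\<^bsub>Mat\<^esub> g \<in> carrier Mat"
 by (rule matI) (auto simp: mat_mult mat_outs intro!: finsum_closed)

lemma mat_add_closed [simp]: "f \<in> carrier Mat ==> g \<in> carrier Mat ==> f \<oplus>\<^bsub>Mat\<^esub> g \<in> carrier Mat"
 by (rule matI) (auto simp: mat_add mat_outs)

lemma mat_one_closed [simp]: "\<one>\<^bsub>Mat\<^esub> \<in> carrier Mat"
 and mat_zero_closed [simp]: "\<zero>\<^bsub>Mat\<^esub> \<in> carrier Mat"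
 and mat_sc_closed [simp]: "a \<in> carrier R ==> sc a \<in> carrier Mat"
 by (rule matI; auto simp: mat_outs mat_one mat_zero mat_sc)+

lemma mat_unit_closed [simp]: "i < n ==> j < n ==> a \<in> carrier R ==> mat_unit R i j a \<in> carrier Mat"
 by (rule matI) (auto simp: mat_unit_def)

lemma mat_ring: "ring Mat"
proof (rule ringI)
 show "abelian_group Mat"
 proof (rule abelian_groupI)
  fix x assume x: "x \<in> carrier Mat"
  define y where "y = (%z. \<ominus> x z)"
  have "y \<in> carrier Mat" using x by (intro matI) (auto simp: y_def mat_outside)
  moreover have "y \<oplus>\<^bsub>Mat\<^esub> x = \<zero>\<^bsub>Mat\<^esub>"
   by (rule mat_eqI) (use x calculation in \<open>auto simp: mat_add mat_zero y_def l_neg\<close>)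
  ultimately show "\<exists>y\<in>carrier Mat. y \<oplus>\<^bsub>Mat\<^esub> x = \<zero>\<^bsub>Mat\<^esub>" by blast
 qed (auto simp: mat_add mat_zero a_ac intro!: mat_eqI)
 have one: "\<one>\<^bsub>Mat\<^esub> \<otimes>\<^bsub>Mat\<^esub> x = x" "x \<otimes>\<^bsub>Mat\<^esub> \<one>\<^bsub>Mat\<^esub> = x" if x: "x \<in> carrier Mat" for x
 proof -
  show "\<one>\<^bsub>Mat\<^esub> \<otimes>\<^bsub>Mat\<^esub> x = x"
  proof (rule mat_eqI)
   fix i j assume ij: "i < n" "j < n"
   have "(\<Oplus>k\<in>{..<n}. \<one>\<^bsub>Mat\<^esub> (i, k) \<otimes> x (k, j)) = (\<Oplus>k\<in>{..<n}. if i = k then x (k, j) else \<zero>)"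
    using x ij by (intro finsum_cong') (auto simp: mat_one)
   also have "\<dots> = x (i, j)" using x ij by (intro finsum_singleton) auto
   finally show "(\<one>\<^bsub>Mat\<^esub> \<otimes>\<^bsub>Mat\<^esub> x) (i, j) = x (i, j)" using ij by (simp add: mat_mult)
  qed (use x in auto)
  show "x \<otimes>\<^bsub>Mat\<^esub> \<one>\<^bsub>Mat\<^esub> = x"
  proof (rule mat_eqI)
   fix i j assume ij: "i < n" "j < n"
   have "(\<Oplus>k\<in>{..<n}. x (i, k) \<otimes> \<one>\<^bsub>Mat\<^esub> (k, j)) = (\<Oplus>k\<in>{..<n}. if j = k then x (i, k) else \<zero>)"
    using x ij by (intro finsum_cong') (auto simp: mat_one)
   also have "\<dots> = x (i, j)" using x ij by (intro finsum_singleton) auto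
   finally show "(x \<otimes>\<^bsub>Mat\<^esub> \<one>\<^bsub>Mat\<^esub>) (i, j) = x (i, j)" using ij by (simp add: mat_mult)
  qed (use x in auto)
 qed
 show "Group.monoid Mat"
 proof (rule Group.monoid.intro)
  fix x y z assume xyz: "x \<in> carrier Mat" "y \<in> carrier Mat" "z \<in> carrier Mat"
  show "x \<otimes>\<^bsub>Mat\<^esub> y \<otimes>\<^bsub>Mat\<^esub> z = x \<otimes>\<^bsub>Mat\<^esub> (y \<otimes>\<^bsub>Mat\<^esub> z)"
  proof (rule mat_eqI)
   fix i j assume ij: "i < n" "j < n"
   have "(x \<otimes>\<^bsub>Mat\<^esub> y \<otimes>\<^bsub>Mat\<^esub> z) (i, j) = (\<Oplus>k\<in>{..<n}. (\<Oplus>l\<in>{..<n}. x (i, l) \<otimes> y (l, k)) \<otimes> z (k, j))"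
    unfolding mat_mult[OF ij] using ij xyz by (intro finsum_cong') (auto simp: mat_mult)
   also have "\<dots> = (\<Oplus>k\<in>{..<n}. \<Oplus>l\<in>{..<n}. x (i, l) \<otimes> (y (l, k) \<otimes> z (k, j)))"
    using ij xyz by (intro finsum_cong') (auto simp: finsum_ldistr m_assoc Pi_def intro!: finsum_closed)
   also have "\<dots> = (\<Oplus>l\<in>{..<n}. \<Oplus>k\<in>{..<n}. x (i, l) \<otimes> (y (l, k) \<otimes> z (k, j)))"
    using ij xyz by (intro finsum_swap) auto
   also have "\<dots> = (\<Oplus>l\<in>{..<n}. x (i, l) \<otimes> (\<Oplus>k\<in>{..<n}. y (l, k) \<otimes> z (k, j)))"
    using ij xyz by (intro finsum_cong') (auto simp: finsum_rdistr Pi_def intro!: finsum_closed)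
   also have "\<dots> = (x \<otimes>\<^bsub>Mat\<^esub> (y \<otimes>\<^bsub>Mat\<^esub> z)) (i, j)"
    unfolding mat_mult[OF ij] using ij xyz by (intro finsum_cong') (auto simp: mat_mult intro!: finsum_closed)
   finally show "(x \<otimes>\<^bsub>Mat\<^esub> y \<otimes>\<^bsub>Mat\<^esub> z) (i, j) = (x \<otimes>\<^bsub>Mat\<^esub> (y \<otimes>\<^bsub>Mat\<^esub> z)) (i, j)" .
  qed (use xyz in auto)
 qed (auto simp: one)
 fix x y z assume xyz: "x \<in> carrier Mat" "y \<in> carrier Mat" "z \<in> carrier Mat"
 show "(x \<oplus>\<^bsub>Mat\<^esub> y) \<otimes>\<^bsub>Mat\<^esub> z = x \<otimes>\<^bsub>Mat\<^esub> z \<oplus>\<^bsub>Mat\<^esub> y \<otimes>\<^bsub>Mat\<^esub> z"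
 proof (rule mat_eqI)
  fix i j assume ij: "i < n" "j < n"
  have "((x \<oplus>\<^bsub>Mat\<^esub> y) \<otimes>\<^bsub>Mat\<^esub> z) (i, j) = (\<Oplus>k\<in>{..<n}. x (i, k) \<otimes> z (k, j) \<oplus> y (i, k) \<otimes> z (k, j))"
   unfolding mat_mult[OF ij] using ij xyz by (intro finsum_cong') (auto simp: mat_add l_distr)
  then show "((x \<oplus>\<^bsub>Mat\<^esub> y) \<otimes>\<^bsub>Mat\<^esub> z) (i, j) = (x \<otimes>\<^bsub>Mat\<^esub> z \<oplus>\<^bsub>Mat\<^esub> y \<otimes>\<^bsub>Mat\<^esub> z) (i, j)"
   using ij xyz by (simp add: mat_add mat_mult finsum_addf Pi_def)
 qed (use xyz in auto)
 show "z \<otimes>\<^bsub>Mat\<^esub> (x \<oplus>\<^bsub>Mat\<^esub> y) = z \<otimes>\<^bsub>Mat\<^esub> x \<oplus>\<^bsub>Mat\<^esub> z \<otimes>\<^bsub>Mat\<^esub> y"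
 proof (rule mat_eqI)
  fix i j assume ij: "i < n" "j < n"
  have "(z \<otimes>\<^bsub>Mat\<^esub> (x \<oplus>\<^bsub>Mat\<^esub> y)) (i, j) = (\<Oplus>k\<in>{..<n}. z (i, k) \<otimes> x (k, j) \<oplus> z (i, k) \<otimes> y (k, j))"
   unfolding mat_mult[OF ij] using ij xyz by (intro finsum_cong') (auto simp: mat_add r_distr)
  then show "(z \<otimes>\<^bsub>Mat\<^esub> (x \<oplus>\<^bsub>Mat\<^esub> y)) (i, j) = (z \<otimes>\<^bsub>Mat\<^esub> x \<oplus>\<^bsub>Mat\<^esub> z \<otimes>\<^bsub>Mat\<^esub> y) (i, j)"
   using ij xyz by (simp add: mat_add mat_mult finsum_addf Pi_def)
 qed (use xyz in auto)
qed

lemma mat_mult_unit: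
 assumes "f \<in> carrier Mat" "k < n" "l < n" "a \<in> carrier R" "i < n" "j < n"
 shows "(f \<otimes>\<^bsub>Mat\<^esub> mat_unit R k l a) (i, j) = (if j = l then f (i, k) \<otimes> a else \<zero>)"
proof -
 have "(\<Oplus>m\<in>{..<n}. f (i, m) \<otimes> mat_unit R k l a (m, j)) = (\<Oplus>m\<in>{..<n}. if k = m then (if j = l then f (i, m) \<otimes> a else \<zero>) else \<zero>)"
  using assms by (intro finsum_cong') (auto simp: mat_unit_def)
 also have "\<dots> = (if j = l then f (i, k) \<otimes> a else \<zero>)" using assms by (intro finsum_singleton) auto
 finally show ?thesis using assms by (simp add: mat_mult)
qed

lemma sc_mult: "a \<in> carrier R ==> f \<in> carrier Mat ==> i < n ==> j < n ==> (sc a \<otimes>\<^bsub>Mat\<^esub> f) (i, j) = a \<otimes> f (i, j)"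
proof -
 assume *: "a \<in> carrier R" "f \<in> carrier Mat" "i < n" "j < n"
 have "(\<Oplus>k\<in>{..<n}. sc a (i, k) \<otimes> f (k, j)) = (\<Oplus>k\<in>{..<n}. if i = k then a \<otimes> f (k, j) else \<zero>)"
  using * by (intro finsum_cong') (auto simp: mat_sc)
 also have "\<dots> = a \<otimes> f (i, j)" using * by (intro finsum_singleton) auto
 finally show ?thesis using * by (simp add: mat_mult)
qed

lemma mult_sc: "a \<in> carrier R ==> f \<in> carrier Mat ==> i < n ==> j < n ==> (f \<otimes>\<^bsub>Mat\<^esub> sc a) (i, j) = a \<otimes> f (i, j)"
proof -
 assume *: "a \<in> carrier R" "f \<in> carrier Mat" "i < n" "j < n"
 have "(\<Oplus>k\<in>{..<n}. f (i, k) \<otimes> sc a (k, j)) = (\<Oplus>k\<in>{..<n}. if j = k then a \<otimes> f (i, k) else \<zero>)"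
  using * by (intro finsum_cong') (auto simp: mat_sc m_comm)
 also have "\<dots> = a \<otimes> f (i, j)" using * by (intro finsum_singleton) auto
 finally show ?thesis using * by (simp add: mat_mult)
qed

lemma sc_central: "a \<in> carrier R ==> f \<in> carrier Mat ==> sc a \<otimes>\<^bsub>Mat\<^esub> f = f \<otimes>\<^bsub>Mat\<^esub> sc a"
 by (rule mat_eqI) (auto simp: sc_mult mult_sc)

lemma sc_hom: "sc \<in> ring_hom R Mat"
proof (rule ring_hom_memI)
 fix a b assume ab: "a \<in> carrier R" "b \<in> carrier R"
 show "sc (a \<otimes> b) = sc a \<otimes>\<^bsub>Mat\<^esub> sc b" by (rule mat_eqI) (use ab in \<open>auto simp: sc_mult mat_sc\<close>)
 show "sc (a \<oplus> b) = sc a \<oplus>\<^bsub>Mat\<^esub> sc b" by (rule mat_eqI) (use ab in \<open>auto simp: mat_add mat_sc\<close>)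
qed (auto intro!: mat_eqI simp: mat_sc mat_one)

lemma sc_inj: "a \<in> carrier R ==> sc a = \<zero>\<^bsub>Mat\<^esub> ==> a = \<zero>"
 using mat_sc[OF n_pos n_pos, of a] mat_zero by (metis)

text \<open>Multiplication by the matrix unit at \<open>(k, 0)\<close> moves column \<open>k\<close>
  to column 0. Column vectors are thus represented as matrices supported in column 0, and a matrix
  is determined by its action on them.\<close>

lemma mat_eq_columnI:
 assumes "f \<in> carrier Mat" "g \<in> carrier Mat"
  and "!!k. k < n ==> f \<otimes>\<^bsub>Mat\<^esub> mat_unit R k 0 \<one> = g \<otimes>\<^bsub>Mat\<^esub> mat_unit R k 0 \<one>"
 shows "f = g"
proof (rule mat_eqI)
 fix i j assume ij: "i < n" "j < n"
 have "(f \<otimes>\<^bsub>Mat\<^esub> mat_unit R j 0 \<one>) (i, 0) = (g \<otimes>\<^bsub>Mat\<^esub> mat_unit R j 0 \<one>) (i, 0)"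
  using assms(3) ij by simp
 then show "f (i, j) = g (i, j)" using ij assms(1,2) n_pos by (simp add: mat_mult_unit)
qed (use assms in auto)

lemma mat_decomp:
 assumes "f \<in> carrier Mat"
 shows "f = (\<Oplus>\<^bsub>Mat\<^esub>z\<in>{..<n} \<times> {..<n}. sc (f z) \<otimes>\<^bsub>Mat\<^esub> mat_unit R (fst z) (snd z) \<one>)"
proof -
 interpret M: ring Mat by (rule mat_ring)
 have sum: "(finsum Mat g A) (i, j) = (\<Oplus>z\<in>A. g z (i, j))"
  if "finite A" "g \<in> A \<rightarrow> carrier Mat" "i < n" "j < n" for g i j and A :: "(nat \<times> nat) set"
  using that by (induction A rule: finite_induct) (auto simp: mat_zero mat_add Pi_def)
 let ?g = "%z. sc (f z) \<otimes>\<^bsub>Mat\<^esub> mat_unit R (fst z) (snd z) \<one>"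
 have g: "?g \<in> {..<n} \<times> {..<n} \<rightarrow> carrier Mat" using assms by auto
 show ?thesis
 proof (rule mat_eqI)
  fix i j assume ij: "i < n" "j < n"
  have "(\<Oplus>z\<in>{..<n} \<times> {..<n}. ?g z (i, j)) = (\<Oplus>z\<in>{..<n} \<times> {..<n}. if (i, j) = z then f z else \<zero>)"
   using ij assms by (intro finsum_cong') (auto simp: sc_mult, auto simp: mat_unit_def split: if_splits)
  also have "\<dots> = f (i, j)" using ij assms by (intro finsum_singleton) auto
  finally show "f (i, j) = (finsum Mat ?g ({..<n} \<times> {..<n})) (i, j)"
   using sum[OF _ g ij] by simp
 qed (use assms g in \<open>auto intro!: M.finsum_closed\<close>)
qed

end

section \<open>Units, differences and powers in characteristic \<open>p\<close>\<close>

no_notation ideal_prod (infixl \<open>\<cdot>\<index>\<close> 80)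

lemma (in monoid) Units_of_pow:
 assumes "y \<in> carrier G" "y [^] (n::nat) \<in> Units G" "n > 0"
 shows "y \<in> Units G"
proof -
 obtain m where m: "n = Suc m" using assms(3) gr0_conv_Suc by blast
 obtain i where i: "i \<in> carrier G" "i \<otimes> y [^] n = \<one>" "y [^] n \<otimes> i = \<one>"
  using assms(2) by (auto simp: Units_def)
 have "y \<otimes> (y [^] m \<otimes> i) = (y \<otimes> y [^] m) \<otimes> i" using i assms(1) by (simp add: m_assoc)
 also have "\<dots> = \<one>" using i assms(1) m by (simp add: group_commutes_pow[OF refl, symmetric])
 finally have "y \<otimes> (y [^] m \<otimes> i) = \<one>" .
 moreover have "(i \<otimes> y [^] m) \<otimes> y = \<one>" using i assms(1) m by (simp add: m_assoc)
 moreover from calculation have "i \<otimes> y [^] m = y [^] m \<otimes> i"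
  using i assms(1) by (metis inv_unique m_closed nat_pow_closed)
 ultimately show ?thesis using i assms(1) by (auto simp: Units_def intro!: bexI[of _ "y [^] m \<otimes> i"])
qed

context ring begin

lemma int_mult_uminus: "x \<in> carrier R ==> [(k::int)] \<cdot> (\<ominus> x) = \<ominus> ([k] \<cdot> x)"
 using add.int_pow_inv by (simp add: a_inv_def)

lemma diff_mult: "x \<in> carrier R ==> y \<in> carrier R ==> z \<in> carrier R ==> (x \<ominus> y) \<otimes> z = x \<otimes> z \<ominus> y \<otimes> z"
 by (simp add: minus_eq l_distr l_minus)

lemma mult_diff: "x \<in> carrier R ==> y \<in> carrier R ==> z \<in> carrier R ==> z \<otimes> (x \<ominus> y) = z \<otimes> x \<ominus> z \<otimes> y"
 by (simp add: minus_eq r_distr r_minus)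

lemma diff_diff_cancel:
 "x \<in> carrier R ==> y \<in> carrier R ==> z \<in> carrier R ==> (x \<ominus> z) \<ominus> (y \<ominus> z) = x \<ominus> y"
 by (simp add: minus_eq minus_add a_ac add_minus_cancel)

lemma telescope_diff:
 "x \<in> carrier R ==> y \<in> carrier R ==> z \<in> carrier R ==> (x \<ominus> ((x \<ominus> y) \<ominus> z)) \<ominus> y = z"
 by algebra

lemma diff_exchange:
 "x \<in> carrier R ==> y \<in> carrier R ==> z \<in> carrier R ==> w \<in> carrier R ==> (x \<ominus> y) \<ominus> (z \<ominus> w) = (x \<ominus> z) \<ominus> (y \<ominus> w)"
 by algebra

lemma diff_diff_self: "x \<in> carrier R ==> y \<in> carrier R ==> x \<ominus> (x \<ominus> y) = y"
 by algebra

lemma subring_finsum_closed: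
 assumes "subring U R" "finite A" "f \<in> A \<rightarrow> U"
 shows "(\<Oplus>i\<in>A. f i) \<in> U"
 using assms(2,3)
proof (induction A rule: finite_induct)
 case empty
 then show ?case using subringE(2)[OF assms(1)] by simp
next
 case (insert x F)
 then show ?case using subringE(1,7)[OF assms(1)] by (subst finsum_insert) (auto simp: Pi_def)
qed

lemma subring_pow_closed: "subring U R ==> x \<in> U ==> x [^] (n::nat) \<in> U"
 by (induction n) (auto simp: subringE(3,6))

lemma subring_diff_closed: "subring U R ==> x \<in> U ==> y \<in> U ==> x \<ominus> y \<in> U"
 by (simp add: minus_eq subringE(5,7))

end

lemma (in ring_hom_ring) hom_diff: "x \<in> carrier R ==> y \<in> carrier R ==> h (x \<ominus>\<^bsub>R\<^esub> y) = h x \<ominus>\<^bsub>S\<^esub> h y"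
 by (simp add: R.minus_eq S.minus_eq)

context char_p_ring begin

lemma uminus_pow_p: "x \<in> carrier R ==> (\<ominus> x) [^] p = \<ominus> (x [^] p)"
proof -
 assume x: "x \<in> carrier R"
 have "(x \<oplus> \<ominus> x) [^] p = x [^] p \<oplus> (\<ominus> x) [^] p" by (rule freshman) (auto simp: x l_minus r_minus)
 then have "x [^] p \<oplus> (\<ominus> x) [^] p = \<zero>" using p_pos x by (simp add: r_neg nat_pow_zero)
 then show ?thesis using x by (metis a_inv_closed minus_equality add.m_comm nat_pow_closed)
qed

lemma diff_pow_p:
 "x \<in> carrier R ==> y \<in> carrier R ==> x \<otimes> y = y \<otimes> x ==> (x \<ominus> y) [^] p = x [^] p \<ominus> y [^] p"
 using freshman[of x "\<ominus> y"] by (simp add: minus_eq uminus_pow_p l_minus r_minus)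

lemma int_pow_p: "([(k::int)] \<cdot> \<one>) [^] p = [k] \<cdot> \<one>"
proof -
 have n: "([int n] \<cdot> \<one>) [^] p = [int n] \<cdot> \<one>" for n
 proof (induction n)
  case 0
  then show ?case using p_pos by (simp add: nat_pow_zero)
 next
  case (Suc n)
  have "([int n] \<cdot> \<one> \<oplus> \<one>) [^] p = ([int n] \<cdot> \<one>) [^] p \<oplus> \<one> [^] p" by (rule freshman) (auto simp: mult_int)
  then show ?case using Suc by (simp add: int_mult_add a_comm)
 qed
 show ?thesis
 proof (cases k)
  case (neg m)
  then show ?thesis using n[of "Suc m"] uminus_pow_p[of "[int (Suc m)] \<cdot> \<one>"]
   by (simp add: int_mult_minus del: of_nat_Suc)
 qed (use n in auto)
qed

lemma int_fermat: "~ int p dvd k ==> ([k] \<cdot> \<one>) [^] (p - 1) = \<one>"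
proof -
 assume k: "~ int p dvd k"
 let ?k = "[k] \<cdot> \<one>"
 have "?k [^] p = ?k [^] (p - 1) \<otimes> ?k" using p_pos by (metis Suc_pred' nat_pow_Suc)
 then have "[k] \<cdot> (?k [^] (p - 1)) = ?k"
  using int_pow_p[of k] by (simp add: add_pow_rdistr_int)
 then have "[k] \<cdot> (?k [^] (p - 1) \<ominus> \<one>) = \<zero>"
  by (simp add: minus_eq int_mult_distrib int_mult_uminus r_neg)
 from int_mult_cancel[OF k _ this] show ?thesis by simp
qed

end

lemma (in ring_hom_ring) hom_char_p: "char_p_ring R p ==> char_p_ring S p"
proof -
 assume "char_p_ring R p"
 then interpret char_p_ring R p .
 have "[int p] \<cdot>\<^bsub>S\<^esub> \<one>\<^bsub>S\<^esub> = \<zero>\<^bsub>S\<^esub>" using hom_int_mult[of "\<one>\<^bsub>R\<^esub>" "int p"] by simp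
 then show ?thesis using prime_p by unfold_locales (simp_all add: S.int_mult_of_nat)
qed

section \<open>Explicit matrices for split symbol algebras\<close>

locale split_matrices = matrix_ring R p + char_p_ring R p for R :: "'a ring" (structure) and p
begin

sublocale M: ring Mat by (rule mat_ring)
sublocale sc: ring_hom_ring R Mat sc
 by (intro ring_hom_ringI2) (use ring_axioms M.ring_axioms sc_hom in auto)
sublocale M: char_p_ring Mat p using sc.hom_char_p char_p_ring_axioms by blast

definition col :: "nat => nat \<times> nat => 'a" where "col k = mat_unit R k 0 \<one>"

lemma sc_left_commute:
 "a \<in> carrier R ==> f \<in> carrier Mat ==> g \<in> carrier Mat ==> f \<otimes>\<^bsub>Mat\<^esub> (sc a \<otimes>\<^bsub>Mat\<^esub> g) = sc a \<otimes>\<^bsub>Mat\<^esub> (f \<otimes>\<^bsub>Mat\<^esub> g)"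
 using sc_central[of a f] by (simp add: M.m_assoc[symmetric])

lemma col_closed [simp]: "k < p ==> col k \<in> carrier Mat"
 using n_pos by (simp add: col_def)

text \<open>The roots \<open>l, l - 1, ..., l - (p - 1)\<close> of one Artin-Schreier polynomial.
  They decrease along the diagonal so that \<open>shift\<close>, which moves each column unit to the
  next, satisfies \<open>v u = (u + 1) v\<close> with \<open>u = diag l\<close>.\<close>

definition diag :: "'a => nat \<times> nat => 'a" where
 "diag l = (%(i, j). if i < p & i = j then l \<ominus> [int i] \<cdot> \<one> else \<zero>)"

text \<open>The companion matrix of \<open>X^p - s\<close>.\<close>

definition shift :: "'a => nat \<times> nat => 'a" where
 "shift s = (%(i, j). if i < p & j < p then if i = Suc j then \<one> else if i = 0 & j = p - 1 then s else \<zero> else \<zero>)"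

lemma diag_closed [simp]: "l \<in> carrier R ==> diag l \<in> carrier Mat"
 by (rule matI) (auto simp: diag_def)

lemma shift_closed [simp]: "s \<in> carrier R ==> shift s \<in> carrier Mat"
 by (rule matI) (auto simp: shift_def)

lemma diag_col: "l \<in> carrier R ==> k < p ==> diag l \<otimes>\<^bsub>Mat\<^esub> col k = sc (l \<ominus> [int k] \<cdot> \<one>) \<otimes>\<^bsub>Mat\<^esub> col k"
 unfolding col_def by (rule mat_eqI) (auto simp: mat_mult_unit n_pos mat_sc, auto simp: diag_def)

lemma shift_col: "s \<in> carrier R ==> Suc k < p ==> shift s \<otimes>\<^bsub>Mat\<^esub> col k = col (Suc k)"
 unfolding col_def by (rule mat_eqI) (auto simp: mat_mult_unit n_pos, auto simp: shift_def mat_unit_def)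

lemma shift_col_last: "s \<in> carrier R ==> shift s \<otimes>\<^bsub>Mat\<^esub> col (p - 1) = sc s \<otimes>\<^bsub>Mat\<^esub> col 0"
 unfolding col_def using p_gt1
 by (intro mat_eqI) (auto simp: mat_mult_unit n_pos mat_sc, auto simp: shift_def)

lemma shift_pow_col: "s \<in> carrier R ==> k + m < p ==> shift s [^]\<^bsub>Mat\<^esub> m \<otimes>\<^bsub>Mat\<^esub> col k = col (k + m)"
proof (induction m)
 case (Suc m)
 have "shift s [^]\<^bsub>Mat\<^esub> Suc m = shift s \<otimes>\<^bsub>Mat\<^esub> shift s [^]\<^bsub>Mat\<^esub> m"
  using Suc.prems by (simp add: M.group_commutes_pow)
 then show ?case using Suc by (simp add: M.m_assoc shift_col del: M.nat_pow_Suc)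
qed simp

text \<open>Of the \<open>m\<close> steps, \<open>p - 1 - k\<close> lead to the last column unit,
  one crosses the corner entry \<open>s\<close>, and \<open>k + m - p\<close> remain. The bound
  \<open>m \<le> p\<close> leaves no room for a second crossing.\<close>

lemma shift_pow_wrap:
 assumes s: "s \<in> carrier R" and k: "k < p" and that: "m \<le> p" "p \<le> k + m"
 shows "shift s [^]\<^bsub>Mat\<^esub> m \<otimes>\<^bsub>Mat\<^esub> col k = sc s \<otimes>\<^bsub>Mat\<^esub> col (k + m - p)"
proof -
  define r q where "r = k + m - p" and "q = p - 1 - k"
  have m: "m = r + Suc q" using that k by (auto simp: r_def q_def)
  let ?S = "shift s"
  have S: "?S \<in> carrier Mat" using s by simp
  have "?S [^]\<^bsub>Mat\<^esub> m = ?S [^]\<^bsub>Mat\<^esub> r \<otimes>\<^bsub>Mat\<^esub> ?S [^]\<^bsub>Mat\<^esub> Suc q"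
   unfolding m using S by (rule M.nat_pow_mult[symmetric])
  then have "?S [^]\<^bsub>Mat\<^esub> m \<otimes>\<^bsub>Mat\<^esub> col k = ?S [^]\<^bsub>Mat\<^esub> (k + m - p) \<otimes>\<^bsub>Mat\<^esub> (?S [^]\<^bsub>Mat\<^esub> Suc (p - 1 - k) \<otimes>\<^bsub>Mat\<^esub> col k)"
   using S k by (simp add: M.m_assoc r_def q_def del: M.nat_pow_Suc)
  also have "?S [^]\<^bsub>Mat\<^esub> Suc (p - 1 - k) \<otimes>\<^bsub>Mat\<^esub> col k = ?S \<otimes>\<^bsub>Mat\<^esub> (?S [^]\<^bsub>Mat\<^esub> (p - 1 - k) \<otimes>\<^bsub>Mat\<^esub> col k)"
   using S k by (simp add: M.group_commutes_pow M.m_assoc[symmetric])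
  also have "?S [^]\<^bsub>Mat\<^esub> (p - 1 - k) \<otimes>\<^bsub>Mat\<^esub> col k = col (p - 1)"
   using s k by (subst shift_pow_col) auto
  also have "?S \<otimes>\<^bsub>Mat\<^esub> col (p - 1) = sc s \<otimes>\<^bsub>Mat\<^esub> col 0" using s by (rule shift_col_last)
  also have "?S [^]\<^bsub>Mat\<^esub> (k + m - p) \<otimes>\<^bsub>Mat\<^esub> (sc s \<otimes>\<^bsub>Mat\<^esub> col 0) = sc s \<otimes>\<^bsub>Mat\<^esub> (?S [^]\<^bsub>Mat\<^esub> (k + m - p) \<otimes>\<^bsub>Mat\<^esub> col 0)"
   using S s p_pos by (intro sc_left_commute; simp)
  also have "?S [^]\<^bsub>Mat\<^esub> (k + m - p) \<otimes>\<^bsub>Mat\<^esub> col 0 = col (k + m - p)"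
   using s k that by (subst shift_pow_col) auto
  finally show ?thesis .
qed

lemma shift_pow_p: "s \<in> carrier R ==> shift s [^]\<^bsub>Mat\<^esub> p = sc s"
proof (rule mat_eq_columnI)
 fix k assume s: "s \<in> carrier R" and k: "k < p"
 show "shift s [^]\<^bsub>Mat\<^esub> p \<otimes>\<^bsub>Mat\<^esub> mat_unit R k 0 \<one> = sc s \<otimes>\<^bsub>Mat\<^esub> mat_unit R k 0 \<one>"
  using shift_pow_wrap[OF s k, of p] unfolding col_def by simp
qed auto

lemma shift_diag:
 assumes "l \<in> carrier R" "s \<in> carrier R"
 shows "shift s \<otimes>\<^bsub>Mat\<^esub> diag l = (diag l \<oplus>\<^bsub>Mat\<^esub> \<one>\<^bsub>Mat\<^esub>) \<otimes>\<^bsub>Mat\<^esub> shift s"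
proof (rule mat_eq_columnI)
 fix k assume k: "k < p"
 let ?a = "l \<ominus> [int k] \<cdot> \<one>"
 have a: "?a \<in> carrier R" using assms by simp
 have "shift s \<otimes>\<^bsub>Mat\<^esub> diag l \<otimes>\<^bsub>Mat\<^esub> col k = sc ?a \<otimes>\<^bsub>Mat\<^esub> (shift s \<otimes>\<^bsub>Mat\<^esub> col k)"
  using assms k a by (simp add: M.m_assoc diag_col) (intro sc_left_commute; simp)
 moreover have "(diag l \<oplus>\<^bsub>Mat\<^esub> \<one>\<^bsub>Mat\<^esub>) \<otimes>\<^bsub>Mat\<^esub> shift s \<otimes>\<^bsub>Mat\<^esub> col k = sc ?a \<otimes>\<^bsub>Mat\<^esub> (shift s \<otimes>\<^bsub>Mat\<^esub> col k)"
 proof -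
  \<comment> \<open>The column unit reached from \<open>k\<close> has index \<open>k + 1\<close> or,
    after wrapping, 0. Both are congruent to \<open>k + 1\<close> modulo \<open>p\<close>, so one
    computation covers them, with \<open>t\<close> equal to 1 or \<open>s\<close>.\<close>
  have *: "diag l \<otimes>\<^bsub>Mat\<^esub> (sc t \<otimes>\<^bsub>Mat\<^esub> col m) \<oplus>\<^bsub>Mat\<^esub> sc t \<otimes>\<^bsub>Mat\<^esub> col m = sc ?a \<otimes>\<^bsub>Mat\<^esub> (sc t \<otimes>\<^bsub>Mat\<^esub> col m)"
   if t: "t \<in> carrier R" and m: "m < p" "int p dvd int m - int (Suc k)" for t m
  proof -
   have "[int m] \<cdot> \<one> = [int (Suc k)] \<cdot> \<one>"
    using p_dvd_mult[OF m(2), of \<one>] int_mult_diff[of \<one> "int m" "int (Suc k)"]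
    by (metis int_mult_closed one_closed r_right_minus_eq)
   then have "(l \<ominus> [int m] \<cdot> \<one>) \<oplus> \<one> = ?a"
    using assms by (simp add: int_mult_add minus_add minus_eq a_ac r_neg1 r_neg2 add_minus_cancel)
   then have e: "sc ?a = sc (l \<ominus> [int m] \<cdot> \<one>) \<oplus>\<^bsub>Mat\<^esub> \<one>\<^bsub>Mat\<^esub>"
    using assms by (metis int_mult_closed minus_closed one_closed sc.hom_add sc.hom_one)
   have "diag l \<otimes>\<^bsub>Mat\<^esub> (sc t \<otimes>\<^bsub>Mat\<^esub> col m) = sc t \<otimes>\<^bsub>Mat\<^esub> (diag l \<otimes>\<^bsub>Mat\<^esub> col m)"
    using assms t m by (intro sc_left_commute; simp)
   also have "\<dots> = sc (l \<ominus> [int m] \<cdot> \<one>) \<otimes>\<^bsub>Mat\<^esub> (sc t \<otimes>\<^bsub>Mat\<^esub> col m)"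
    using assms t m by (simp add: diag_col) (intro sc_left_commute; simp)
   finally show ?thesis unfolding e using assms t m by (simp add: M.l_distr)
  qed
  have "(diag l \<oplus>\<^bsub>Mat\<^esub> \<one>\<^bsub>Mat\<^esub>) \<otimes>\<^bsub>Mat\<^esub> shift s \<otimes>\<^bsub>Mat\<^esub> col k
    = diag l \<otimes>\<^bsub>Mat\<^esub> (shift s \<otimes>\<^bsub>Mat\<^esub> col k) \<oplus>\<^bsub>Mat\<^esub> shift s \<otimes>\<^bsub>Mat\<^esub> col k"
   using assms k by (simp add: M.m_assoc M.l_distr)
  also have "\<dots> = sc ?a \<otimes>\<^bsub>Mat\<^esub> (shift s \<otimes>\<^bsub>Mat\<^esub> col k)"
  proof (cases "Suc k < p")
   case True
   then show ?thesis using *[of \<one> "Suc k"] assms k by (simp add: shift_col)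
  next
   case False
   then have kp: "k = p - 1" using k by simp
   have "shift s \<otimes>\<^bsub>Mat\<^esub> col k = sc s \<otimes>\<^bsub>Mat\<^esub> col 0"
    unfolding kp using assms(2) by (rule shift_col_last)
   moreover have "int p dvd int 0 - int (Suc k)" using kp p_pos by simp
   ultimately show ?thesis using *[of s 0] assms p_pos by simp
  qed
  finally show ?thesis .
 qed
 ultimately show "shift s \<otimes>\<^bsub>Mat\<^esub> diag l \<otimes>\<^bsub>Mat\<^esub> mat_unit R k 0 \<one> =
   (diag l \<oplus>\<^bsub>Mat\<^esub> \<one>\<^bsub>Mat\<^esub>) \<otimes>\<^bsub>Mat\<^esub> shift s \<otimes>\<^bsub>Mat\<^esub> mat_unit R k 0 \<one>"
  unfolding col_def by simp
qed (use assms in auto)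

lemma diag_pow_col:
 "l \<in> carrier R ==> k < p ==> diag l [^]\<^bsub>Mat\<^esub> (m::nat) \<otimes>\<^bsub>Mat\<^esub> col k = sc ((l \<ominus> [int k] \<cdot> \<one>) [^] m) \<otimes>\<^bsub>Mat\<^esub> col k"
proof (induction m)
 case (Suc m)
 let ?a = "l \<ominus> [int k] \<cdot> \<one>"
 have a: "?a \<in> carrier R" using Suc.prems by simp
 have "diag l [^]\<^bsub>Mat\<^esub> Suc m \<otimes>\<^bsub>Mat\<^esub> col k = diag l [^]\<^bsub>Mat\<^esub> m \<otimes>\<^bsub>Mat\<^esub> (sc ?a \<otimes>\<^bsub>Mat\<^esub> col k)"
  using Suc.prems by (simp add: M.m_assoc diag_col)
 also have "\<dots> = sc ?a \<otimes>\<^bsub>Mat\<^esub> (diag l [^]\<^bsub>Mat\<^esub> m \<otimes>\<^bsub>Mat\<^esub> col k)"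
  using Suc.prems a by (intro sc_left_commute; simp)
 also have "\<dots> = sc (?a [^] Suc m) \<otimes>\<^bsub>Mat\<^esub> col k"
  using Suc a by (simp add: M.m_assoc[symmetric] sc.hom_mult[symmetric] m_comm del: sc.hom_mult)
 finally show ?case .
qed simp

lemma diag_artin_schreier:
 assumes l: "l \<in> carrier R"
 shows "diag l [^]\<^bsub>Mat\<^esub> p \<ominus>\<^bsub>Mat\<^esub> diag l = sc (l [^] p \<ominus> l)"
proof (rule mat_eq_columnI)
 fix k assume k: "k < p"
 let ?a = "l \<ominus> [int k] \<cdot> \<one>"
 have "?a [^] p \<ominus> ?a = l [^] p \<ominus> l"
  using l by (simp add: diff_pow_p m_comm int_pow_p diff_diff_cancel)
 moreover have "(diag l [^]\<^bsub>Mat\<^esub> p \<ominus>\<^bsub>Mat\<^esub> diag l) \<otimes>\<^bsub>Mat\<^esub> col k = sc (?a [^] p \<ominus> ?a) \<otimes>\<^bsub>Mat\<^esub> col k"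
  using l k diag_pow_col[OF l k, of p] by (simp add: M.diff_mult diag_col sc.hom_diff)
 ultimately show "(diag l [^]\<^bsub>Mat\<^esub> p \<ominus>\<^bsub>Mat\<^esub> diag l) \<otimes>\<^bsub>Mat\<^esub> mat_unit R k 0 \<one> = sc (l [^] p \<ominus> l) \<otimes>\<^bsub>Mat\<^esub> mat_unit R k 0 \<one>"
  unfolding col_def by simp
qed (use l in auto)

text \<open>Put \<open>t = l - x\<close>. Then \<open>t - k\<close> acts on \<open>col k\<close> as
  \<open>shift s\<close>, so the falling factorials of \<open>t\<close> carry \<open>col 0\<close>
  through all column units and \<open>t^p - t\<close> sends \<open>col 0\<close> to \<open>s\<close>
  times itself. Hence \<open>x^p - x\<close> acts on \<open>col 0\<close> as the scalar claimed;
  commuting with \<open>t\<close>, it acts by the same scalar on every column unit.\<close>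

lemma diag_shift_artin_schreier:
 assumes l: "l \<in> carrier R" and s: "s \<in> carrier R"
 defines "x \<equiv> diag l \<ominus>\<^bsub>Mat\<^esub> shift s"
 shows "x [^]\<^bsub>Mat\<^esub> p \<ominus>\<^bsub>Mat\<^esub> x = sc ((l [^] p \<ominus> l) \<ominus> s)"
proof -
 have x: "x \<in> carrier Mat" using l s by (simp add: x_def)
 define t where "t = sc l \<ominus>\<^bsub>Mat\<^esub> x"
 have t: "t \<in> carrier Mat" using l x by (simp add: t_def)
 have step: "(t \<ominus>\<^bsub>Mat\<^esub> [int k] \<cdot>\<^bsub>Mat\<^esub> \<one>\<^bsub>Mat\<^esub>) \<otimes>\<^bsub>Mat\<^esub> col k = shift s \<otimes>\<^bsub>Mat\<^esub> col k" if k: "k < p" for k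
 proof -
  have i: "[int k] \<cdot>\<^bsub>Mat\<^esub> \<one>\<^bsub>Mat\<^esub> = sc ([int k] \<cdot> \<one>)" by (simp add: sc.hom_int_mult)
  have "(t \<ominus>\<^bsub>Mat\<^esub> [int k] \<cdot>\<^bsub>Mat\<^esub> \<one>\<^bsub>Mat\<^esub>) \<otimes>\<^bsub>Mat\<^esub> col k
   = (sc l \<otimes>\<^bsub>Mat\<^esub> col k \<ominus>\<^bsub>Mat\<^esub> (sc (l \<ominus> [int k] \<cdot> \<one>) \<otimes>\<^bsub>Mat\<^esub> col k \<ominus>\<^bsub>Mat\<^esub> shift s \<otimes>\<^bsub>Mat\<^esub> col k)) \<ominus>\<^bsub>Mat\<^esub> sc ([int k] \<cdot> \<one>) \<otimes>\<^bsub>Mat\<^esub> col k"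
   unfolding t_def x_def i using l s k by (simp add: M.diff_mult diag_col)
  also have "\<dots> = (sc l \<otimes>\<^bsub>Mat\<^esub> col k \<ominus>\<^bsub>Mat\<^esub> ((sc l \<otimes>\<^bsub>Mat\<^esub> col k \<ominus>\<^bsub>Mat\<^esub> sc ([int k] \<cdot> \<one>) \<otimes>\<^bsub>Mat\<^esub> col k) \<ominus>\<^bsub>Mat\<^esub> shift s \<otimes>\<^bsub>Mat\<^esub> col k)) \<ominus>\<^bsub>Mat\<^esub> sc ([int k] \<cdot> \<one>) \<otimes>\<^bsub>Mat\<^esub> col k"
   using l s k by (simp add: M.diff_mult sc.hom_diff)
  also have "\<dots> = shift s \<otimes>\<^bsub>Mat\<^esub> col k"
  proof -
   show ?thesis by (rule M.telescope_diff) (use l s k in auto)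
  qed
  finally show ?thesis .
 qed
 have fall: "M.falling t k \<otimes>\<^bsub>Mat\<^esub> col 0 = col k" if "k < p" for k
  using that
 proof (induction k)
  case (Suc k)
  then show ?case using step[of k] t p_pos s by (simp add: M.falling_Suc M.m_assoc shift_col)
 qed (use p_pos in simp)
 obtain q where q: "p = Suc q" using p_pos gr0_conv_Suc by blast
 have "M.falling t p \<otimes>\<^bsub>Mat\<^esub> col 0 = (t \<ominus>\<^bsub>Mat\<^esub> [int q] \<cdot>\<^bsub>Mat\<^esub> \<one>\<^bsub>Mat\<^esub>) \<otimes>\<^bsub>Mat\<^esub> (M.falling t q \<otimes>\<^bsub>Mat\<^esub> col 0)"
  using t p_pos by (subst q) (simp add: M.falling_Suc M.m_assoc)
 also have "\<dots> = sc s \<otimes>\<^bsub>Mat\<^esub> col 0"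
  using fall[of q] step[of q] shift_col_last[OF s] q by simp
 finally have 1: "(t [^]\<^bsub>Mat\<^esub> p \<ominus>\<^bsub>Mat\<^esub> t) \<otimes>\<^bsub>Mat\<^esub> col 0 = sc s \<otimes>\<^bsub>Mat\<^esub> col 0"
  using t by (simp add: M.falling_p)
 define z where "z = x [^]\<^bsub>Mat\<^esub> p \<ominus>\<^bsub>Mat\<^esub> x"
 have z: "z \<in> carrier Mat" using x by (simp add: z_def)
 have "t [^]\<^bsub>Mat\<^esub> p = sc (l [^] p) \<ominus>\<^bsub>Mat\<^esub> x [^]\<^bsub>Mat\<^esub> p"
  unfolding t_def using l x by (subst M.diff_pow_p) (auto simp: sc_central sc.hom_nat_pow)
 then have "t [^]\<^bsub>Mat\<^esub> p \<ominus>\<^bsub>Mat\<^esub> t = sc (l [^] p \<ominus> l) \<ominus>\<^bsub>Mat\<^esub> z"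
  unfolding t_def z_def using l x by (simp add: sc.hom_diff M.diff_exchange)
 then have "sc s \<otimes>\<^bsub>Mat\<^esub> col 0 = sc (l [^] p \<ominus> l) \<otimes>\<^bsub>Mat\<^esub> col 0 \<ominus>\<^bsub>Mat\<^esub> z \<otimes>\<^bsub>Mat\<^esub> col 0"
  using 1 z l p_pos by (simp add: M.diff_mult)
 then have "z \<otimes>\<^bsub>Mat\<^esub> col 0 = sc (l [^] p \<ominus> l) \<otimes>\<^bsub>Mat\<^esub> col 0 \<ominus>\<^bsub>Mat\<^esub> sc s \<otimes>\<^bsub>Mat\<^esub> col 0"
  using z l p_pos by (simp add: M.diff_diff_self)
 then have z0: "z \<otimes>\<^bsub>Mat\<^esub> col 0 = sc ((l [^] p \<ominus> l) \<ominus> s) \<otimes>\<^bsub>Mat\<^esub> col 0"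
  using l s p_pos by (simp add: sc.hom_diff M.diff_mult)
 have "x [^]\<^bsub>Mat\<^esub> p \<otimes>\<^bsub>Mat\<^esub> x = x \<otimes>\<^bsub>Mat\<^esub> x [^]\<^bsub>Mat\<^esub> p" using x by (intro M.group_commutes_pow) auto
 then have "z \<otimes>\<^bsub>Mat\<^esub> x = x \<otimes>\<^bsub>Mat\<^esub> z" unfolding z_def using x by (simp add: M.diff_mult M.mult_diff)
 then have "t \<otimes>\<^bsub>Mat\<^esub> z = z \<otimes>\<^bsub>Mat\<^esub> t" unfolding t_def using x z l by (simp add: M.diff_mult M.mult_diff sc_central)
 then have zf: "z \<otimes>\<^bsub>Mat\<^esub> M.falling t k = M.falling t k \<otimes>\<^bsub>Mat\<^esub> z" for k
  using M.falling_comm[OF t z] by simp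
 show ?thesis unfolding z_def[symmetric]
 proof (rule mat_eq_columnI)
  fix k assume k: "k < p"
  have "z \<otimes>\<^bsub>Mat\<^esub> col k = M.falling t k \<otimes>\<^bsub>Mat\<^esub> (z \<otimes>\<^bsub>Mat\<^esub> col 0)"
   unfolding fall[OF k, symmetric] using z t p_pos zf by (simp add: M.m_assoc[symmetric])
  also have "\<dots> = sc ((l [^] p \<ominus> l) \<ominus> s) \<otimes>\<^bsub>Mat\<^esub> col k"
   unfolding z0 using l s t p_pos fall[OF k] by (subst sc_left_commute) auto
  finally show "z \<otimes>\<^bsub>Mat\<^esub> mat_unit R k 0 \<one> = sc ((l [^] p \<ominus> l) \<ominus> s) \<otimes>\<^bsub>Mat\<^esub> mat_unit R k 0 \<one>"
   unfolding col_def .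
 qed (use z l s in auto)
qed

text \<open>Fermat's little theorem turns powers of shifted diagonal matrices into matrix units.\<close>

lemma diag_shift_generate:
 assumes l: "l \<in> carrier R" and s: "s \<in> Units R"
  and U: "subring U Mat" "!!a. a \<in> carrier R ==> sc a \<in> U" "diag l \<in> U" "shift s \<in> U"
 shows "U = carrier Mat"
proof -
 have sR: "s \<in> carrier R" "inv s \<in> carrier R" "inv s \<otimes> s = \<one>" using s by auto
 note Um = subringE(6)[OF U(1)]
 have unit_col: "mat_unit R i j \<one> \<otimes>\<^bsub>Mat\<^esub> col m = (if m = j then col i else \<zero>\<^bsub>Mat\<^esub>)" if "i < p" "j < p" "m < p" for i j m
  unfolding col_def using that n_pos by (intro mat_eqI) (auto simp: mat_mult_unit mat_zero, auto simp: mat_unit_def)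
 have kk: "mat_unit R k k \<one> \<in> U" if k: "k < p" for k
 proof -
  \<comment> \<open>\<open>w\<close> has eigenvalue \<open>k - m\<close> on \<open>col m\<close>, so
    its power \<open>p - 1\<close> is 0 on \<open>col k\<close> and the identity on the other column
    units.\<close>
  define w where "w = diag l \<ominus>\<^bsub>Mat\<^esub> sc (l \<ominus> [int k] \<cdot> \<one>)"
  have w: "w \<in> carrier Mat" using l by (simp add: w_def)
  have wc: "w \<otimes>\<^bsub>Mat\<^esub> col m = sc ([(int k - int m)] \<cdot> \<one>) \<otimes>\<^bsub>Mat\<^esub> col m" if m: "m < p" for m
  proof -
   have "w \<otimes>\<^bsub>Mat\<^esub> col m = sc ((l \<ominus> [int m] \<cdot> \<one>) \<ominus> (l \<ominus> [int k] \<cdot> \<one>)) \<otimes>\<^bsub>Mat\<^esub> col m"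
    unfolding w_def using l m by (simp add: M.diff_mult diag_col sc.hom_diff)
   also have "(l \<ominus> [int m] \<cdot> \<one>) \<ominus> (l \<ominus> [int k] \<cdot> \<one>) = [int k] \<cdot> \<one> \<ominus> [int m] \<cdot> \<one>"
    using l by (simp add: minus_eq minus_add a_ac add_minus_cancel r_neg1 r_neg2)
   finally show ?thesis by (simp add: int_mult_diff)
  qed
  have wn: "w [^]\<^bsub>Mat\<^esub> (n::nat) \<otimes>\<^bsub>Mat\<^esub> col m = sc (([(int k - int m)] \<cdot> \<one>) [^] n) \<otimes>\<^bsub>Mat\<^esub> col m" if m: "m < p" for m n
  proof (induction n)
   case (Suc n)
   have "w [^]\<^bsub>Mat\<^esub> Suc n \<otimes>\<^bsub>Mat\<^esub> col m = w [^]\<^bsub>Mat\<^esub> n \<otimes>\<^bsub>Mat\<^esub> (sc ([(int k - int m)] \<cdot> \<one>) \<otimes>\<^bsub>Mat\<^esub> col m)"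
    using w m by (simp add: M.m_assoc wc)
   also have "\<dots> = sc ([(int k - int m)] \<cdot> \<one>) \<otimes>\<^bsub>Mat\<^esub> (w [^]\<^bsub>Mat\<^esub> n \<otimes>\<^bsub>Mat\<^esub> col m)"
    using w m by (intro sc_left_commute) auto
   also have "\<dots> = sc ([(int k - int m)] \<cdot> \<one> \<otimes> ([(int k - int m)] \<cdot> \<one>) [^] n) \<otimes>\<^bsub>Mat\<^esub> col m"
    unfolding Suc using m by (simp add: M.m_assoc)
   finally show ?case by (simp add: m_comm)
  qed (use m in simp)
  have "mat_unit R k k \<one> = \<one>\<^bsub>Mat\<^esub> \<ominus>\<^bsub>Mat\<^esub> w [^]\<^bsub>Mat\<^esub> (p - 1)"
  proof (rule mat_eq_columnI)
   fix m assume m: "m < p"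
   have "(\<one>\<^bsub>Mat\<^esub> \<ominus>\<^bsub>Mat\<^esub> w [^]\<^bsub>Mat\<^esub> (p - 1)) \<otimes>\<^bsub>Mat\<^esub> col m = (if m = k then col k else \<zero>\<^bsub>Mat\<^esub>)"
   proof (cases "m = k")
    case True
    have "\<zero> [^] (p - 1) = \<zero>" using p_gt1 by (simp add: nat_pow_zero)
    then show ?thesis using True m w wn[OF m, of "p - 1"] by (simp add: M.l_distr M.l_minus M.minus_eq)
   next
    case False
    have "~ int p dvd int k - int m"
    proof
     assume "int p dvd int k - int m"
     then have "[k = m] (mod p)" by (metis cong_iff_dvd_diff cong_int_iff)
     then show False using False m k by (simp add: cong_def)
    qed
    then show ?thesis using False m w wn[OF m, of "p - 1"] int_fermat by (simp add: M.l_distr M.l_minus M.minus_eq M.r_neg)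
   qed
   then show "mat_unit R k k \<one> \<otimes>\<^bsub>Mat\<^esub> mat_unit R m 0 \<one> = (\<one>\<^bsub>Mat\<^esub> \<ominus>\<^bsub>Mat\<^esub> w [^]\<^bsub>Mat\<^esub> (p - 1)) \<otimes>\<^bsub>Mat\<^esub> mat_unit R m 0 \<one>"
    using unit_col[OF k k m] unfolding col_def by simp
  qed (use k w in auto)
  moreover have "w \<in> U" unfolding w_def using U l by (intro M.subring_diff_closed[OF U(1)]) auto
  ultimately show ?thesis
   using M.subring_diff_closed[OF U(1)] M.subring_pow_closed[OF U(1)] subringE(3)[OF U(1)] by simp
 qed
 have ij: "mat_unit R i j \<one> \<in> U" if i: "i < p" and j: "j < p" for i j
 proof (cases "j \<le> i")
  case True
  have "mat_unit R i j \<one> = shift s [^]\<^bsub>Mat\<^esub> (i - j) \<otimes>\<^bsub>Mat\<^esub> mat_unit R j j \<one>"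
  proof (rule mat_eq_columnI)
   fix m assume m: "m < p"
   have "shift s [^]\<^bsub>Mat\<^esub> (i - j) \<otimes>\<^bsub>Mat\<^esub> mat_unit R j j \<one> \<otimes>\<^bsub>Mat\<^esub> col m = (if m = j then col i else \<zero>\<^bsub>Mat\<^esub>)"
    using unit_col[OF j j m] shift_pow_col[OF sR(1), of j "i - j"] True i j m sR by (simp add: M.m_assoc)
   then show "mat_unit R i j \<one> \<otimes>\<^bsub>Mat\<^esub> mat_unit R m 0 \<one> = shift s [^]\<^bsub>Mat\<^esub> (i - j) \<otimes>\<^bsub>Mat\<^esub> mat_unit R j j \<one> \<otimes>\<^bsub>Mat\<^esub> mat_unit R m 0 \<one>"
    using unit_col[OF i j m] unfolding col_def by simp
  qed (use i j sR in auto)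
  then show ?thesis using Um M.subring_pow_closed[OF U(1) U(4)] kk[OF j] by simp
 next
  case False
  \<comment> \<open>To get from column unit \<open>j\<close> to a smaller index \<open>i\<close> the
    shift has to wrap around once, which costs a factor \<open>s\<close>.\<close>
  have "mat_unit R i j \<one> = sc (inv s) \<otimes>\<^bsub>Mat\<^esub> (shift s [^]\<^bsub>Mat\<^esub> (p + i - j) \<otimes>\<^bsub>Mat\<^esub> mat_unit R j j \<one>)"
  proof (rule mat_eq_columnI)
   fix m assume m: "m < p"
   have "sc (inv s) \<otimes>\<^bsub>Mat\<^esub> (shift s [^]\<^bsub>Mat\<^esub> (p + i - j) \<otimes>\<^bsub>Mat\<^esub> mat_unit R j j \<one>) \<otimes>\<^bsub>Mat\<^esub> col m
     = sc (inv s) \<otimes>\<^bsub>Mat\<^esub> (shift s [^]\<^bsub>Mat\<^esub> (p + i - j) \<otimes>\<^bsub>Mat\<^esub> (if m = j then col j else \<zero>\<^bsub>Mat\<^esub>))"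
    using unit_col[OF j j m] i j m sR by (simp add: M.m_assoc)
   also have "\<dots> = (if m = j then sc (inv s) \<otimes>\<^bsub>Mat\<^esub> (sc s \<otimes>\<^bsub>Mat\<^esub> col i) else \<zero>\<^bsub>Mat\<^esub>)"
    using shift_pow_wrap[OF sR(1) j, of "p + i - j"] False i j m sR by simp
   also have "\<dots> = (if m = j then col i else \<zero>\<^bsub>Mat\<^esub>)"
    using sR i by (simp add: M.m_assoc[symmetric] sc.hom_mult[symmetric] del: sc.hom_mult)
   finally show "mat_unit R i j \<one> \<otimes>\<^bsub>Mat\<^esub> mat_unit R m 0 \<one> = sc (inv s) \<otimes>\<^bsub>Mat\<^esub> (shift s [^]\<^bsub>Mat\<^esub> (p + i - j) \<otimes>\<^bsub>Mat\<^esub> mat_unit R j j \<one>) \<otimes>\<^bsub>Mat\<^esub> mat_unit R m 0 \<one>"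
    using unit_col[OF i j m] unfolding col_def by simp
  qed (use i j sR in auto)
  then show ?thesis using Um M.subring_pow_closed[OF U(1) U(4)] kk[OF j] U(2) sR by simp
 qed
 show ?thesis
 proof
  show "U \<subseteq> carrier Mat" using subringE(1)[OF U(1)] .
  show "carrier Mat \<subseteq> U"
  proof
   fix f assume f: "f \<in> carrier Mat"
   show "f \<in> U"
    by (subst mat_decomp[OF f], rule M.subring_finsum_closed[OF U(1)])
     (use f ij U(2) Um in auto)
  qed
 qed
qed

end

text \<open>For \<open>m = p\<close> this says that replacing \<open>v\<close> by \<open>v u\<close>
  multiplies \<open>v^p\<close> by \<open>u^p - u\<close>, the norm of \<open>u\<close>.\<close>

lemma (in symbol_pair) v_mult_u_pow: "(v \<otimes> u) [^] (m::nat) = v [^] m \<otimes> falling u m"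
proof (induction m)
 case (Suc m)
 have c: "v \<otimes> u \<in> carrier R" by simp
 have "u \<otimes> v [^] m = v [^] m \<otimes> (u \<ominus> [int m] \<cdot> \<one>)"
  using Y_pow_X[of m] by (simp add: r_distr r_minus mult_int minus_eq a_assoc r_neg)
 then have "v \<otimes> u \<otimes> (v [^] m \<otimes> falling u m) = v \<otimes> (v [^] m \<otimes> (u \<ominus> [int m] \<cdot> \<one>)) \<otimes> falling u m"
  by (simp add: m_assoc[symmetric]) (simp add: m_assoc)
 also have "\<dots> = (v \<otimes> v [^] m) \<otimes> falling u (Suc m)"
  by (simp add: falling_Suc m_assoc)
 also have "v \<otimes> v [^] m = v [^] Suc m" by (simp add: group_commutes_pow)
 finally show ?case using Suc c by (metis nat_pow_Suc2)
qed simp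

lemma (in monoid) Units_of_comm_prod:
 assumes "x \<in> carrier G" "y \<in> carrier G" "x \<otimes> y = y \<otimes> x" "x \<otimes> y \<in> Units G"
 shows "x \<in> Units G"
proof -
 obtain i where i: "i \<in> carrier G" "i \<otimes> (x \<otimes> y) = \<one>" "(x \<otimes> y) \<otimes> i = \<one>"
  using assms(4) by (auto simp: Units_def)
 have 1: "x \<otimes> (y \<otimes> i) = \<one>" using i(1,3) assms(1,2) by (simp add: m_assoc)
 have 2: "(i \<otimes> y) \<otimes> x = \<one>" using i(1,2) assms(1-3) by (simp add: m_assoc)
 have "i \<otimes> y = y \<otimes> i" using 1 2 i assms by (metis inv_unique m_closed)
 then show ?thesis using 1 2 i assms by (auto simp: Units_def intro!: bexI[of _ "y \<otimes> i"])
qed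

context split_matrices begin

text \<open>\<open>x\<close> and \<open>y\<close> present the matrix ring as \<open>[a, g)\<close>.
  Generation is stated through subrings because it is applied to the image of a homomorphism, where
  it yields surjectivity.\<close>

definition splitting_pair :: "'a => 'a => (nat \<times> nat => 'a) => (nat \<times> nat => 'a) => bool" where
 "splitting_pair a g x y \<longleftrightarrow> symbol_pair Mat p x y & x [^]\<^bsub>Mat\<^esub> p \<ominus>\<^bsub>Mat\<^esub> x = sc a & y [^]\<^bsub>Mat\<^esub> p = sc g &
   (\<forall>U. subring U Mat & sc ` carrier R \<subseteq> U & x \<in> U & y \<in> U --> U = carrier Mat)"

lemma sc_Units: "a \<in> Units R ==> sc a \<in> Units Mat"
proof -
 assume a: "a \<in> Units R"
 then have aR: "a \<in> carrier R" by auto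
 have "sc a \<otimes>\<^bsub>Mat\<^esub> sc (inv a) = \<one>\<^bsub>Mat\<^esub>" "sc (inv a) \<otimes>\<^bsub>Mat\<^esub> sc a = \<one>\<^bsub>Mat\<^esub>"
  using a aR sc.hom_mult[of a "inv a"] sc.hom_mult[of "inv a" a] by simp_all
 moreover have "inv a \<in> carrier R" using a by simp
 ultimately show ?thesis using aR unfolding Units_def by (auto intro!: bexI[of _ "sc (inv a)"])
qed

lemma shift_Units: "s \<in> Units R ==> shift s \<in> Units Mat"
 by (rule M.Units_of_pow[of _ p]) (auto simp: shift_pow_p sc_Units p_pos Units_closed)

text \<open>The case in which the first slot already has the form \<open>l^p - l\<close>. With
  \<open>l = 0\<close> it also presents the matrix algebra itself.\<close>

lemma splitting_pair_diag:
 assumes "l \<in> carrier R" "g \<in> Units R"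
 shows "splitting_pair (l [^] p \<ominus> l) g (diag l) (shift g)"
 unfolding splitting_pair_def
proof (intro conjI allI impI)
 show "symbol_pair Mat p (diag l) (shift g)"
  using assms shift_Units shift_diag by unfold_locales auto
 show "U = carrier Mat" if "subring U Mat & sc ` carrier R \<subseteq> U & diag l \<in> U & shift g \<in> U" for U
  using that assms by (intro diag_shift_generate) auto
qed (use assms in \<open>auto simp: diag_artin_schreier shift_pow_p\<close>)

lemma diag_shift_pair:
 assumes l: "l \<in> carrier R" and s: "s \<in> Units R"
 shows "symbol_pair Mat p (diag l \<ominus>\<^bsub>Mat\<^esub> shift s) (shift s)"
proof -
 have "s \<in> carrier R" using s by auto
 then show ?thesis
  using assms shift_Units shift_diag[of l s]
  by unfold_locales (auto simp: M.mult_diff M.diff_mult M.l_distr M.minus_eq M.r_distr M.r_minus M.l_minus M.a_ac)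
qed

text \<open>\<open>diag l\<close> and \<open>shift s\<close> present \<open>[a + s, s)\<close>.
  Subtracting \<open>shift s\<close> from \<open>diag l\<close> lowers the first slot by
  \<open>s\<close>, and dividing \<open>shift s\<close> by \<open>c\<close> turns the second slot
  \<open>s = g c^p\<close> into \<open>g\<close>.\<close>

lemma splitting_pair_scalar:
 assumes l: "l \<in> carrier R" and a: "a \<in> carrier R" and g: "g \<in> carrier R" and c: "c \<in> Units R"
  and gc: "g \<otimes> c [^] p \<in> Units R" and eq: "a = (l [^] p \<ominus> l) \<ominus> g \<otimes> c [^] p"
 shows "\<exists>x y. splitting_pair a g x y"
proof -
 define s where "s = g \<otimes> c [^] p"
 have s: "s \<in> Units R" "s \<in> carrier R" using gc by (auto simp: s_def)
 have cR: "c \<in> carrier R" "inv c \<in> carrier R" "inv c \<in> Units R" "c \<otimes> inv c = \<one>" "inv c \<otimes> c = \<one>" using c by auto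
 define x where "x = diag l \<ominus>\<^bsub>Mat\<^esub> shift s"
 define y where "y = shift s \<otimes>\<^bsub>Mat\<^esub> sc (inv c)"
 interpret symbol_pair Mat p x "shift s" unfolding x_def by (rule diag_shift_pair[OF l s(1)])
 have "splitting_pair a g x y" unfolding splitting_pair_def
 proof (intro conjI allI impI)
  have "y \<otimes>\<^bsub>Mat\<^esub> x = shift s \<otimes>\<^bsub>Mat\<^esub> x \<otimes>\<^bsub>Mat\<^esub> sc (inv c)"
   unfolding y_def using cR s by (simp add: M.m_assoc sc_central)
  then have "y \<otimes>\<^bsub>Mat\<^esub> x = (x \<oplus>\<^bsub>Mat\<^esub> \<one>\<^bsub>Mat\<^esub>) \<otimes>\<^bsub>Mat\<^esub> y"
   unfolding y_def using cR s YX by (simp add: M.m_assoc)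
  then show "symbol_pair Mat p x y" using shift_Units[OF s(1)] sc_Units[OF cR(3)]
   by unfold_locales (auto simp: y_def)
  show "x [^]\<^bsub>Mat\<^esub> p \<ominus>\<^bsub>Mat\<^esub> x = sc a"
   unfolding x_def eq s_def[symmetric] using l s by (intro diag_shift_artin_schreier)
  have "y [^]\<^bsub>Mat\<^esub> p = shift s [^]\<^bsub>Mat\<^esub> p \<otimes>\<^bsub>Mat\<^esub> sc (inv c) [^]\<^bsub>Mat\<^esub> p"
   unfolding y_def using s cR by (intro M.pow_mult_distrib) (auto simp: sc_central)
  also have "\<dots> = sc (s \<otimes> inv c [^] p)" using s cR by (simp add: shift_pow_p sc.hom_nat_pow)
  also have "s \<otimes> inv c [^] p = g \<otimes> (c \<otimes> inv c) [^] p"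
   unfolding s_def using g cR by (subst pow_mult_distrib) (auto simp: m_ac simp del: Units_r_inv Units_l_inv)
  finally show "y [^]\<^bsub>Mat\<^esub> p = sc g" using g cR by simp
  fix U assume U: "subring U Mat & sc ` carrier R \<subseteq> U & x \<in> U & y \<in> U"
  have "y \<otimes>\<^bsub>Mat\<^esub> sc c = shift s" unfolding y_def using s cR
   by (simp add: M.m_assoc sc.hom_mult[symmetric] del: sc.hom_mult)
  then have S: "shift s \<in> U" using U subringE(6)[of U Mat y "sc c"] cR by auto
  have "x \<oplus>\<^bsub>Mat\<^esub> shift s = diag l" unfolding x_def using l s
   by (simp add: M.minus_eq M.a_assoc M.l_neg)
  then have "diag l \<in> U" using U S subringE(7)[of U Mat x "shift s"] by auto
  then show "U = carrier Mat" using U S by (intro diag_shift_generate[OF l s(1)]) auto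
 qed
 then show ?thesis by blast
qed

text \<open>As in the scalar case, but now \<open>s\<close> is \<open>g c^p\<close> times the norm
  of \<open>h = x + w\<close>. Dividing \<open>shift s\<close> by \<open>h\<close> as well divides
  its \<open>p\<close>-th power by that norm, and the commutation rule with \<open>x\<close>
  persists because \<open>x\<close> commutes with \<open>h\<close>.\<close>

lemma splitting_pair_norm:
 assumes l: "l \<in> carrier R" and a: "a \<in> carrier R" and g: "g \<in> carrier R" and c: "c \<in> Units R" and w: "w \<in> carrier R"
  and s: "s \<in> Units R" "s = g \<otimes> c [^] p \<otimes> (a \<oplus> (w [^] p \<ominus> w))" and eq: "a = (l [^] p \<ominus> l) \<ominus> s"
 shows "\<exists>x y. splitting_pair a g x y"
proof -
 have sR: "s \<in> carrier R" using s(1) by auto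
 have cR: "c \<in> carrier R" "inv c \<in> carrier R" "inv c \<in> Units R" "c \<otimes> inv c = \<one>" "inv c \<otimes> c = \<one>" using c by auto
 define n where "n = a \<oplus> (w [^] p \<ominus> w)"
 have nR: "n \<in> carrier R" using a w by (simp add: n_def)
 have n: "n \<in> Units R"
  by (rule Units_of_comm_prod[of n "g \<otimes> c [^] p"]) (use s g cR nR in \<open>auto simp: m_comm n_def\<close>)
 define x where "x = diag l \<ominus>\<^bsub>Mat\<^esub> shift s"
 define h where "h = x \<oplus>\<^bsub>Mat\<^esub> sc w"
 interpret A: symbol_pair Mat p x "shift s" unfolding x_def by (rule diag_shift_pair[OF l s(1)])
 have xa: "x [^]\<^bsub>Mat\<^esub> p \<ominus>\<^bsub>Mat\<^esub> x = sc a"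
  unfolding x_def eq using l sR by (intro diag_shift_artin_schreier)
 have h: "h \<in> carrier Mat" using w by (simp add: h_def)
 have "h [^]\<^bsub>Mat\<^esub> p = x [^]\<^bsub>Mat\<^esub> p \<oplus>\<^bsub>Mat\<^esub> sc (w [^] p)"
  unfolding h_def using w by (subst M.freshman) (auto simp: sc_central sc.hom_nat_pow)
 then have "h [^]\<^bsub>Mat\<^esub> p \<ominus>\<^bsub>Mat\<^esub> h = (x [^]\<^bsub>Mat\<^esub> p \<ominus>\<^bsub>Mat\<^esub> x) \<oplus>\<^bsub>Mat\<^esub> (sc (w [^] p) \<ominus>\<^bsub>Mat\<^esub> sc w)"
  unfolding h_def using w by (simp add: M.minus_eq M.minus_add M.a_ac)
 then have hn: "h [^]\<^bsub>Mat\<^esub> p \<ominus>\<^bsub>Mat\<^esub> h = sc n"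
  unfolding xa n_def using a w by (simp add: sc.hom_diff)
 \<comment> \<open>\<open>h\<close> divides the unit \<open>n\<close>, since
   \<open>h (h^(p-1) - 1) = h^p - h = n\<close>.\<close>
 have hU: "h \<in> Units Mat"
 proof -
  have hp: "h \<otimes>\<^bsub>Mat\<^esub> h [^]\<^bsub>Mat\<^esub> (p - 1) = h [^]\<^bsub>Mat\<^esub> p" "h [^]\<^bsub>Mat\<^esub> (p - 1) \<otimes>\<^bsub>Mat\<^esub> h = h [^]\<^bsub>Mat\<^esub> p"
   using p_pos h by (metis M.nat_pow_Suc2 Suc_pred', metis M.nat_pow_Suc Suc_pred')
  have "h \<otimes>\<^bsub>Mat\<^esub> (h [^]\<^bsub>Mat\<^esub> (p - 1) \<ominus>\<^bsub>Mat\<^esub> \<one>\<^bsub>Mat\<^esub>) = sc n" "(h [^]\<^bsub>Mat\<^esub> (p - 1) \<ominus>\<^bsub>Mat\<^esub> \<one>\<^bsub>Mat\<^esub>) \<otimes>\<^bsub>Mat\<^esub> h = sc n"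
   using h hp by (simp_all add: M.mult_diff M.diff_mult hn)
  then show ?thesis
   using h sc_Units[OF n] M.Units_of_comm_prod[of h "h [^]\<^bsub>Mat\<^esub> (p - 1) \<ominus>\<^bsub>Mat\<^esub> \<one>\<^bsub>Mat\<^esub>"] by simp
 qed
 define i where "i = inv\<^bsub>Mat\<^esub> h"
 have i: "i \<in> Units Mat" "i \<in> carrier Mat" "i \<otimes>\<^bsub>Mat\<^esub> h = \<one>\<^bsub>Mat\<^esub>" "h \<otimes>\<^bsub>Mat\<^esub> i = \<one>\<^bsub>Mat\<^esub>"
  using hU by (auto simp: i_def)
 define y where "y = shift s \<otimes>\<^bsub>Mat\<^esub> i \<otimes>\<^bsub>Mat\<^esub> sc (inv c)"
 have y: "y \<in> carrier Mat" using i sR cR by (simp add: y_def)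
 have yU: "y \<in> Units Mat" using i shift_Units[OF s(1)] sc_Units[OF cR(3)] by (auto simp: y_def)
 have yh: "y \<otimes>\<^bsub>Mat\<^esub> h = shift s \<otimes>\<^bsub>Mat\<^esub> sc (inv c)"
 proof -
  have "y \<otimes>\<^bsub>Mat\<^esub> h = shift s \<otimes>\<^bsub>Mat\<^esub> (i \<otimes>\<^bsub>Mat\<^esub> h) \<otimes>\<^bsub>Mat\<^esub> sc (inv c)"
   unfolding y_def using i(2) sR cR h by (simp add: M.m_assoc sc_central)
  then show ?thesis using i sR by simp
 qed
 have Sh: "shift s \<otimes>\<^bsub>Mat\<^esub> h = (h \<oplus>\<^bsub>Mat\<^esub> \<one>\<^bsub>Mat\<^esub>) \<otimes>\<^bsub>Mat\<^esub> shift s"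
  unfolding h_def using A.YX w sR by (simp add: M.r_distr M.l_distr sc_central M.a_ac)
 have yh': "y \<otimes>\<^bsub>Mat\<^esub> h = (h \<oplus>\<^bsub>Mat\<^esub> \<one>\<^bsub>Mat\<^esub>) \<otimes>\<^bsub>Mat\<^esub> y"
 proof -
  have "(h \<oplus>\<^bsub>Mat\<^esub> \<one>\<^bsub>Mat\<^esub>) \<otimes>\<^bsub>Mat\<^esub> y = (h \<oplus>\<^bsub>Mat\<^esub> \<one>\<^bsub>Mat\<^esub>) \<otimes>\<^bsub>Mat\<^esub> shift s \<otimes>\<^bsub>Mat\<^esub> (i \<otimes>\<^bsub>Mat\<^esub> sc (inv c))"
   unfolding y_def using i(2) sR cR h by (simp add: M.m_assoc)
  also have "\<dots> = shift s \<otimes>\<^bsub>Mat\<^esub> (h \<otimes>\<^bsub>Mat\<^esub> i) \<otimes>\<^bsub>Mat\<^esub> sc (inv c)"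
   unfolding Sh[symmetric] using i(2) sR cR h by (simp add: M.m_assoc)
  finally show ?thesis using i sR yh by simp
 qed
 interpret B: symbol_pair Mat p h y using yU yh' h by unfold_locales
 have "splitting_pair a g x y" unfolding splitting_pair_def
 proof (intro conjI allI impI)
  have "x = h \<ominus>\<^bsub>Mat\<^esub> sc w" unfolding h_def using w by (simp add: M.minus_eq M.a_assoc M.r_neg)
  then have "y \<otimes>\<^bsub>Mat\<^esub> x = (x \<oplus>\<^bsub>Mat\<^esub> \<one>\<^bsub>Mat\<^esub>) \<otimes>\<^bsub>Mat\<^esub> y"
   using yh' w y h by (simp add: M.mult_diff M.diff_mult M.l_distr sc_central)
    (simp add: M.minus_eq M.a_ac)
  then show "symbol_pair Mat p x y" using yU by unfold_locales auto
  show "x [^]\<^bsub>Mat\<^esub> p \<ominus>\<^bsub>Mat\<^esub> x = sc a" by (rule xa)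
  \<comment> \<open>This is \<open>v_mult_u_pow\<close> for the pair \<open>h\<close>,
    \<open>y\<close>, in which \<open>h^p - h\<close> is the scalar \<open>n\<close>.\<close>
  have "y [^]\<^bsub>Mat\<^esub> p \<otimes>\<^bsub>Mat\<^esub> sc n = (y \<otimes>\<^bsub>Mat\<^esub> h) [^]\<^bsub>Mat\<^esub> p"
   unfolding B.v_mult_u_pow using h hn by (simp add: M.falling_p)
  also have "\<dots> = shift s [^]\<^bsub>Mat\<^esub> p \<otimes>\<^bsub>Mat\<^esub> sc (inv c) [^]\<^bsub>Mat\<^esub> p"
   unfolding yh using sR cR by (intro M.pow_mult_distrib) (auto simp: sc_central)
  also have "\<dots> = sc (s \<otimes> inv c [^] p)" using sR cR by (simp add: shift_pow_p sc.hom_nat_pow)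
  also have "s \<otimes> inv c [^] p = g \<otimes> n \<otimes> (c \<otimes> inv c) [^] p"
   unfolding s(2) n_def[symmetric] using g cR nR by (subst pow_mult_distrib) (auto simp: m_ac simp del: Units_r_inv Units_l_inv)
  finally have "y [^]\<^bsub>Mat\<^esub> p \<otimes>\<^bsub>Mat\<^esub> sc n = sc g \<otimes>\<^bsub>Mat\<^esub> sc n" using g nR cR by simp
  then show "y [^]\<^bsub>Mat\<^esub> p = sc g"
   using sc_Units[OF n] y g by (metis M.Units_closed M.Units_inv_closed M.Units_r_inv M.m_assoc M.nat_pow_closed M.r_one sc.hom_closed)
  fix U assume U: "subring U Mat & sc ` carrier R \<subseteq> U & x \<in> U & y \<in> U"
  have "h \<in> U" unfolding h_def using U w by (auto intro!: subringE(7)[of U Mat])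
  then have "y \<otimes>\<^bsub>Mat\<^esub> h \<otimes>\<^bsub>Mat\<^esub> sc c \<in> U" using U cR by (auto intro!: subringE(6)[of U Mat])
  moreover have "y \<otimes>\<^bsub>Mat\<^esub> h \<otimes>\<^bsub>Mat\<^esub> sc c = shift s" unfolding yh using sR cR
   by (simp add: M.m_assoc sc.hom_mult[symmetric] del: sc.hom_mult)
  ultimately have S: "shift s \<in> U" by simp
  have "x \<oplus>\<^bsub>Mat\<^esub> shift s = diag l" unfolding x_def using l sR
   by (simp add: M.minus_eq M.a_assoc M.l_neg)
  then have "diag l \<in> U" using U S subringE(7)[of U Mat x "shift s"] by auto
  then show "U = carrier Mat" using U S by (intro diag_shift_generate[OF l s(1)]) auto
 qed
 then show ?thesis by blast
qed

end

section \<open>Monoid rings\<close>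

context abelian_monoid begin

lemma finsum_image_fibres:
 assumes "finite S" "f \<in> S \<rightarrow> carrier G"
 shows "(\<Oplus>m\<in>h ` S. \<Oplus>z\<in>{z \<in> S. h z = m}. f z) = (\<Oplus>z\<in>S. f z)"
proof -
 have "(\<Oplus>z\<in>(\<Union>m\<in>h ` S. {z \<in> S. h z = m}). f z) = (\<Oplus>m\<in>h ` S. \<Oplus>z\<in>{z \<in> S. h z = m}. f z)"
  using assms by (intro add.finprod_UN_disjoint) (auto simp: pairwise_def disjnt_def)
 moreover have "(\<Union>m\<in>h ` S. {z \<in> S. h z = m}) = S" by auto
 ultimately show ?thesis by simp
qed

lemma finsum_cartesian:
 assumes "finite A" "finite B" "f \<in> A \<times> B \<rightarrow> carrier G"
 shows "(\<Oplus>z\<in>A \<times> B. f z) = (\<Oplus>a\<in>A. \<Oplus>b\<in>B. f (a, b))"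
 using assms(1,3)
proof (induction A rule: finite_induct)
 case (insert x F)
 have "insert x F \<times> B = Pair x ` B \<union> F \<times> B" by auto
 then have "(\<Oplus>z\<in>insert x F \<times> B. f z) = (\<Oplus>z\<in>Pair x ` B. f z) \<oplus> (\<Oplus>z\<in>F \<times> B. f z)"
  using insert assms(2) by (simp only:) (rule finsum_Un_disjoint, auto)
 also have eq: "(\<Oplus>z\<in>Pair x ` B. f z) = (\<Oplus>b\<in>B. f (x, b))"
  using insert by (intro finsum_reindex) (auto simp: inj_on_def)
 finally have "(\<Oplus>z\<in>insert x F \<times> B. f z) = (\<Oplus>b\<in>B. f (x, b)) \<oplus> (\<Oplus>z\<in>F \<times> B. f z)" .
 moreover have "f \<in> F \<times> B \<rightarrow> carrier G" using insert.prems by auto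
 ultimately show ?case using insert by (subst finsum_insert) (auto intro!: finsum_closed)
qed simp

end

text \<open>The linear extension of \<open>\<phi>\<close> along \<open>\<theta>\<close>. A
  multiplicative \<open>\<phi>\<close> gives the universal property of the monoid ring; arbitrary
  \<open>\<phi>\<close> into \<open>R\<close> give the linear functionals by which identities in the
  monoid ring are tested.\<close>

definition mr_eval :: "('a, 'm) ring_scheme => ('b, 'k) ring_scheme => ('a => 'b) => ('g => 'b) => ('g => 'a) => 'b" where
 "mr_eval R B \<theta> \<phi> f = (\<Oplus>\<^bsub>B\<^esub>m\<in>{m. f m ~= \<zero>\<^bsub>R\<^esub>}. \<theta> (f m) \<otimes>\<^bsub>B\<^esub> \<phi> m)"

locale monoid_algebra = cring R + M: Group.monoid M for R :: "('a, 'm) ring_scheme" (structure) and M :: "('g, 'n) monoid_scheme"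
begin

abbreviation "Z \<equiv> monoid_ring R M"
abbreviation supp :: "('g => 'a) => 'g set" where "supp f \<equiv> {m. f m ~= \<zero>}"

lemma mr_iff: "f \<in> carrier Z \<longleftrightarrow> f \<in> carrier M \<rightarrow> carrier R & (\<forall>m. m \<notin> carrier M --> f m = \<zero>) & finite (supp f)"
 by (simp add: monoid_ring_def)

lemma mr_closed: "f \<in> carrier Z ==> f m \<in> carrier R"
 unfolding mr_iff by (cases "m \<in> carrier M") auto

lemma mr_finite: "f \<in> carrier Z ==> finite (supp f)"
 unfolding mr_iff by blast

lemma mr_supp: "f \<in> carrier Z ==> supp f \<subseteq> carrier M"
 unfolding mr_iff by blast

lemma mrI: "(!!m. f m \<in> carrier R) ==> supp f \<subseteq> carrier M ==> finite (supp f) ==> f \<in> carrier Z"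
 unfolding mr_iff by blast

lemma mr_add: "(f \<oplus>\<^bsub>Z\<^esub> g) m = f m \<oplus> g m" and mr_zero: "\<zero>\<^bsub>Z\<^esub> m = \<zero>"
 and mr_one: "\<one>\<^bsub>Z\<^esub> = single R \<one>\<^bsub>M\<^esub> \<one>"
 by (simp_all add: monoid_ring_def single_def)

lemma mr_mult: "(f \<otimes>\<^bsub>Z\<^esub> g) m = (\<Oplus>z \<in> {z \<in> supp f \<times> supp g. fst z \<otimes>\<^bsub>M\<^esub> snd z = m}. f (fst z) \<otimes> g (snd z))"
proof -
 have "{(a, b). f a ~= \<zero> & g b ~= \<zero> & a \<otimes>\<^bsub>M\<^esub> b = m} = {z \<in> supp f \<times> supp g. fst z \<otimes>\<^bsub>M\<^esub> snd z = m}" by auto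
 then show ?thesis by (simp add: monoid_ring_def)
qed

lemma mr_add_closed [simp]: "f \<in> carrier Z ==> g \<in> carrier Z ==> f \<oplus>\<^bsub>Z\<^esub> g \<in> carrier Z"
proof (rule mrI)
 assume fg: "f \<in> carrier Z" "g \<in> carrier Z"
 have s: "supp (f \<oplus>\<^bsub>Z\<^esub> g) \<subseteq> supp f \<union> supp g" by (auto simp: mr_add)
 show "supp (f \<oplus>\<^bsub>Z\<^esub> g) \<subseteq> carrier M" using s mr_supp fg by blast
 show "finite (supp (f \<oplus>\<^bsub>Z\<^esub> g))" using s mr_finite fg finite_subset by blast
qed (auto simp: mr_add mr_closed)

lemma mr_mult_supp: "supp (f \<otimes>\<^bsub>Z\<^esub> g) \<subseteq> (%z. fst z \<otimes>\<^bsub>M\<^esub> snd z) ` (supp f \<times> supp g)"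
proof
 fix m assume m: "m \<in> supp (f \<otimes>\<^bsub>Z\<^esub> g)"
 have "{z \<in> supp f \<times> supp g. fst z \<otimes>\<^bsub>M\<^esub> snd z = m} ~= {}"
 proof
  assume e: "{z \<in> supp f \<times> supp g. fst z \<otimes>\<^bsub>M\<^esub> snd z = m} = {}"
  have "(f \<otimes>\<^bsub>Z\<^esub> g) m = \<zero>" unfolding mr_mult e by simp
  then show False using m by simp
 qed
 then show "m \<in> (%z. fst z \<otimes>\<^bsub>M\<^esub> snd z) ` (supp f \<times> supp g)" by blast
qed

lemma mr_mult_closed [simp]: "f \<in> carrier Z ==> g \<in> carrier Z ==> f \<otimes>\<^bsub>Z\<^esub> g \<in> carrier Z"
proof (rule mrI)
 assume fg: "f \<in> carrier Z" "g \<in> carrier Z"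
 show "(f \<otimes>\<^bsub>Z\<^esub> g) m \<in> carrier R" for m
  unfolding mr_mult using fg by (intro finsum_closed) (auto simp: mr_closed)
 show "supp (f \<otimes>\<^bsub>Z\<^esub> g) \<subseteq> carrier M" using mr_mult_supp[of f g] mr_supp[OF fg(1)] mr_supp[OF fg(2)] by fastforce
 show "finite (supp (f \<otimes>\<^bsub>Z\<^esub> g))" using mr_mult_supp[of f g] fg by (auto intro: finite_subset simp: mr_finite)
qed

lemma single_closed [simp]: "g \<in> carrier M ==> a \<in> carrier R ==> single R g a \<in> carrier Z"
proof (rule mrI)
 assume "g \<in> carrier M" "a \<in> carrier R"
 have s: "supp (single R g a) \<subseteq> {g}" by (auto simp: single_def)
 then show "supp (single R g a) \<subseteq> carrier M" using \<open>g \<in> carrier M\<close> by auto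
 show "finite (supp (single R g a))" using s finite_subset by blast
qed (auto simp: single_def)

end

locale monoid_algebra_eval = monoid_algebra R M + B: ring B + \<theta>: ring_hom_ring R B \<theta>
 for R :: "('a, 'm) ring_scheme" (structure) and M :: "('g, 'n) monoid_scheme" and B :: "('b, 'k) ring_scheme" and \<theta> +
 fixes \<phi> :: "'g => 'b"
 assumes \<phi> [simp]: "g \<in> carrier M ==> \<phi> g \<in> carrier B"
begin

abbreviation "E \<equiv> mr_eval R B \<theta> \<phi>"

lemma eval_superset:
 assumes "f \<in> carrier Z" "finite A" "supp f \<subseteq> A" "A \<subseteq> carrier M"
 shows "E f = (\<Oplus>\<^bsub>B\<^esub>m\<in>A. \<theta> (f m) \<otimes>\<^bsub>B\<^esub> \<phi> m)"
 unfolding mr_eval_def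
 by (rule B.add.finprod_mono_neutral_cong_left) (use assms mr_closed in \<open>auto simp: subset_iff\<close>)

lemma eval_closed [simp]: "f \<in> carrier Z ==> E f \<in> carrier B"
 unfolding mr_eval_def using mr_supp mr_closed by (intro B.finsum_closed) (auto simp: subset_iff)

lemma eval_add: "f \<in> carrier Z ==> g \<in> carrier Z ==> E (f \<oplus>\<^bsub>Z\<^esub> g) = E f \<oplus>\<^bsub>B\<^esub> E g"
proof -
 assume fg: "f \<in> carrier Z" "g \<in> carrier Z"
 let ?A = "supp f \<union> supp g"
 have A: "finite ?A" "?A \<subseteq> carrier M" "supp (f \<oplus>\<^bsub>Z\<^esub> g) \<subseteq> ?A" using fg mr_supp mr_finite by (auto simp: mr_add)
 have Am: "m \<in> carrier M" if "m \<in> ?A" for m using A that by blast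
 have "E (f \<oplus>\<^bsub>Z\<^esub> g) = (\<Oplus>\<^bsub>B\<^esub>m\<in>?A. \<theta> ((f \<oplus>\<^bsub>Z\<^esub> g) m) \<otimes>\<^bsub>B\<^esub> \<phi> m)" using fg A by (intro eval_superset) auto
 also have "\<dots> = (\<Oplus>\<^bsub>B\<^esub>m\<in>?A. \<theta> (f m) \<otimes>\<^bsub>B\<^esub> \<phi> m \<oplus>\<^bsub>B\<^esub> \<theta> (g m) \<otimes>\<^bsub>B\<^esub> \<phi> m)"
  using fg Am mr_closed by (intro B.finsum_cong') (auto simp: mr_add B.l_distr)
 also have "\<dots> = (\<Oplus>\<^bsub>B\<^esub>m\<in>?A. \<theta> (f m) \<otimes>\<^bsub>B\<^esub> \<phi> m) \<oplus>\<^bsub>B\<^esub> (\<Oplus>\<^bsub>B\<^esub>m\<in>?A. \<theta> (g m) \<otimes>\<^bsub>B\<^esub> \<phi> m)"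
  using fg Am mr_closed by (intro B.finsum_addf) auto
 finally show ?thesis using fg A by (simp add: eval_superset[symmetric])
qed

lemma eval_single: "g \<in> carrier M ==> a \<in> carrier R ==> E (single R g a) = \<theta> a \<otimes>\<^bsub>B\<^esub> \<phi> g"
proof -
 assume g: "g \<in> carrier M" "a \<in> carrier R"
 have "E (single R g a) = (\<Oplus>\<^bsub>B\<^esub>m\<in>{g}. \<theta> (single R g a m) \<otimes>\<^bsub>B\<^esub> \<phi> m)"
  using g by (intro eval_superset single_closed) (auto simp: single_def)
 then show ?thesis using g by (simp add: single_def)
qed

text \<open>Grouping the pairs of indices by their product turns the convolution into a double sum.
  The sums run over any finite sets containing the supports, so that different elements can share
  one index set.\<close>

lemma eval_mult:
 assumes "f \<in> carrier Z" "g \<in> carrier Z" "finite A" "finite C" "supp f \<subseteq> A" "supp g \<subseteq> C" "A \<subseteq> carrier M" "C \<subseteq> carrier M"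
 shows "E (f \<otimes>\<^bsub>Z\<^esub> g) = (\<Oplus>\<^bsub>B\<^esub>a\<in>A. \<Oplus>\<^bsub>B\<^esub>b\<in>C. \<theta> (f a) \<otimes>\<^bsub>B\<^esub> \<theta> (g b) \<otimes>\<^bsub>B\<^esub> \<phi> (a \<otimes>\<^bsub>M\<^esub> b))"
proof -
 let ?h = "%z. fst z \<otimes>\<^bsub>M\<^esub> snd z"
 let ?S = "supp f \<times> supp g"
 let ?t = "%z. \<theta> (f (fst z)) \<otimes>\<^bsub>B\<^esub> \<theta> (g (snd z)) \<otimes>\<^bsub>B\<^esub> \<phi> (?h z)"
 have cl: "f m \<in> carrier R" "g m \<in> carrier R" for m using assms mr_closed by auto
 have AC: "a \<in> carrier M" if "a \<in> A \<or> a \<in> C" for a using assms that by blast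
 have S: "a \<in> carrier M" if "a \<in> supp f \<or> a \<in> supp g" for a using mr_supp[OF assms(1)] mr_supp[OF assms(2)] that by blast
 have fin: "finite ?S" using assms mr_finite by auto
 have "E (f \<otimes>\<^bsub>Z\<^esub> g) = (\<Oplus>\<^bsub>B\<^esub>m\<in>?h ` ?S. \<theta> ((f \<otimes>\<^bsub>Z\<^esub> g) m) \<otimes>\<^bsub>B\<^esub> \<phi> m)"
  using assms(1,2) fin S mr_mult_supp by (intro eval_superset) auto
 also have "\<dots> = (\<Oplus>\<^bsub>B\<^esub>m\<in>?h ` ?S. \<Oplus>\<^bsub>B\<^esub>z\<in>{z \<in> ?S. ?h z = m}. ?t z)"
 proof (rule B.finsum_cong')
  fix m assume m: "m \<in> ?h ` ?S"
  then have mM: "m \<in> carrier M" using S by auto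
  let ?F = "{z \<in> ?S. ?h z = m}"
  have finF: "finite ?F" by (rule finite_subset[OF _ fin]) auto
  have "\<theta> ((f \<otimes>\<^bsub>Z\<^esub> g) m) = (\<Oplus>\<^bsub>B\<^esub>z\<in>?F. \<theta> (f (fst z)) \<otimes>\<^bsub>B\<^esub> \<theta> (g (snd z)))"
   unfolding mr_mult using cl finF by (subst \<theta>.hom_finsum') (auto intro!: B.finsum_cong')
  then show "\<theta> ((f \<otimes>\<^bsub>Z\<^esub> g) m) \<otimes>\<^bsub>B\<^esub> \<phi> m = (\<Oplus>\<^bsub>B\<^esub>z\<in>?F. ?t z)"
   using finF cl mM by (simp only:) (subst B.finsum_ldistr, auto intro!: B.finsum_cong')
 qed (use cl S in \<open>auto intro!: B.finsum_closed\<close>)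
 also have "\<dots> = (\<Oplus>\<^bsub>B\<^esub>z\<in>?S. ?t z)"
  using fin cl S by (intro B.finsum_image_fibres) auto
 also have "\<dots> = (\<Oplus>\<^bsub>B\<^esub>z\<in>A \<times> C. ?t z)"
  by (rule B.add.finprod_mono_neutral_cong_left) (use assms(3-6) cl AC in auto)
 also have "\<dots> = (\<Oplus>\<^bsub>B\<^esub>a\<in>A. \<Oplus>\<^bsub>B\<^esub>b\<in>C. ?t (a, b))"
  using assms(3,4) cl AC by (intro B.finsum_cartesian) auto
 finally show ?thesis by simp
qed

end

context monoid_algebra begin

lemma eval_locale: "(!!g. g \<in> carrier M ==> \<phi> g \<in> carrier R) ==> monoid_algebra_eval R M R id \<phi>"
 by unfold_locales (auto intro: ring_hom_memI)

lemma eval_delta: "f \<in> carrier Z ==> m \<in> carrier M ==> mr_eval R R id (single R m \<one>) f = f m"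
proof -
 assume f: "f \<in> carrier Z" "m \<in> carrier M"
 interpret E: monoid_algebra_eval R M R id "single R m \<one>" by (rule eval_locale) (auto simp: single_def)
 have "E.E f = (\<Oplus>k\<in>insert m (supp f). id (f k) \<otimes> single R m \<one> k)"
  using f mr_supp mr_finite by (intro E.eval_superset) auto
 also have "\<dots> = (\<Oplus>k\<in>insert m (supp f). if m = k then f k else \<zero>)"
  using f mr_closed by (intro finsum_cong') (auto simp: single_def)
 also have "\<dots> = f m" using f mr_finite mr_closed by (intro finsum_singleton) auto
 finally show ?thesis .
qed

text \<open>The functional that is 1 at \<open>m\<close> and 0 elsewhere reads off the coefficient
  at \<open>m\<close>. The ring axioms of the monoid ring thus become identities between finite sums
  in \<open>R\<close>, free of convolutions.\<close>

lemma mr_eqI: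
 assumes "f \<in> carrier Z" "g \<in> carrier Z"
  and "!!\<phi>. (!!g. g \<in> carrier M ==> \<phi> g \<in> carrier R) ==> mr_eval R R id \<phi> f = mr_eval R R id \<phi> g"
 shows "f = g"
proof
 fix m show "f m = g m"
 proof (cases "m \<in> carrier M")
  case True
  then show ?thesis using assms(3)[of "single R m \<one>"] eval_delta[of _ m] assms(1,2)
   by (auto simp: single_def)
 next
  case False
  then have "m \<notin> supp f" "m \<notin> supp g" using mr_supp[OF assms(1)] mr_supp[OF assms(2)] by blast+
  then show ?thesis by simp
 qed
qed

lemma mr_assoc:
 assumes f: "f \<in> carrier Z" and g: "g \<in> carrier Z" and h: "h \<in> carrier Z"
 shows "f \<otimes>\<^bsub>Z\<^esub> g \<otimes>\<^bsub>Z\<^esub> h = f \<otimes>\<^bsub>Z\<^esub> (g \<otimes>\<^bsub>Z\<^esub> h)"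
proof (rule mr_eqI)
 fix \<phi> assume \<phi>: "!!g. g \<in> carrier M ==> \<phi> g \<in> carrier R"
 note loc = eval_locale[of \<phi>, OF \<phi>]
 interpret E: monoid_algebra_eval R M R id \<phi> by (rule loc)
 let ?A = "supp f" and ?B = "supp g" and ?C = "supp h" and ?F = "f \<otimes>\<^bsub>Z\<^esub> g" and ?G = "g \<otimes>\<^bsub>Z\<^esub> h"
 have fin: "finite ?A" "finite ?B" "finite ?C" "finite (supp ?F)" "finite (supp ?G)" using f g h by (auto intro: mr_finite)
 have sub: "?A \<subseteq> carrier M" "?B \<subseteq> carrier M" "?C \<subseteq> carrier M" "supp ?F \<subseteq> carrier M" "supp ?G \<subseteq> carrier M"
  using f g h by (auto intro!: mr_supp)
 have M: "a \<in> ?A ==> a \<in> carrier M" "a \<in> ?B ==> a \<in> carrier M" "a \<in> ?C ==> a \<in> carrier M"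
  "a \<in> supp ?F ==> a \<in> carrier M" "a \<in> supp ?G ==> a \<in> carrier M" for a using sub by blast+
 have cl [simp]: "f m \<in> carrier R" "g m \<in> carrier R" "h m \<in> carrier R" "?F m \<in> carrier R" "?G m \<in> carrier R" for m
  using f g h by (auto intro: mr_closed)
 let ?t = "%a b c. f a \<otimes> (g b \<otimes> (h c \<otimes> \<phi> (a \<otimes>\<^bsub>M\<^esub> (b \<otimes>\<^bsub>M\<^esub> c))))"
 have t: "?t a b c \<in> carrier R" if "a \<in> ?A" "b \<in> ?B" "c \<in> ?C" for a b c using that M \<phi> by simp
 have "E.E (?F \<otimes>\<^bsub>Z\<^esub> h) = (\<Oplus>a\<in>supp ?F. \<Oplus>c\<in>?C. ?F a \<otimes> h c \<otimes> \<phi> (a \<otimes>\<^bsub>M\<^esub> c))"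
  using E.eval_mult[of ?F h "supp ?F" ?C] f g h fin sub by simp
 also have "\<dots> = (\<Oplus>c\<in>?C. \<Oplus>a\<in>supp ?F. ?F a \<otimes> h c \<otimes> \<phi> (a \<otimes>\<^bsub>M\<^esub> c))"
  using fin M \<phi> by (intro finsum_swap) auto
 also have "\<dots> = (\<Oplus>c\<in>?C. \<Oplus>a\<in>?A. \<Oplus>b\<in>?B. ?t a b c)"
 proof (rule finsum_cong')
  fix c assume c: "c \<in> ?C"
  \<comment> \<open>The outer factor is absorbed into the functional, so that
    \<open>eval_mult\<close> for this new functional expands the inner product.\<close>
  let ?\<phi> = "%a. h c \<otimes> \<phi> (a \<otimes>\<^bsub>M\<^esub> c)"
  have \<phi>': "?\<phi> a \<in> carrier R" if "a \<in> carrier M" for a using that \<phi> M c by simp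
  interpret E': monoid_algebra_eval R M R id ?\<phi> by (rule eval_locale) (rule \<phi>')
  have "(\<Oplus>a\<in>supp ?F. ?F a \<otimes> h c \<otimes> \<phi> (a \<otimes>\<^bsub>M\<^esub> c)) = (\<Oplus>a\<in>supp ?F. ?F a \<otimes> ?\<phi> a)"
   using \<phi> M c by (intro finsum_cong') (auto simp: m_assoc)
  also have "\<dots> = E'.E ?F" using E'.eval_superset[of ?F "supp ?F"] f g fin sub by simp
  also have "\<dots> = (\<Oplus>a\<in>?A. \<Oplus>b\<in>?B. f a \<otimes> g b \<otimes> ?\<phi> (a \<otimes>\<^bsub>M\<^esub> b))"
   using E'.eval_mult[of f g ?A ?B] f g fin sub by simp
  also have "\<dots> = (\<Oplus>a\<in>?A. \<Oplus>b\<in>?B. ?t a b c)"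
   using \<phi> M c by (intro finsum_cong') (auto simp: m_assoc M.m_assoc intro!: finsum_cong' finsum_closed)
  finally show "(\<Oplus>a\<in>supp ?F. ?F a \<otimes> h c \<otimes> \<phi> (a \<otimes>\<^bsub>M\<^esub> c)) = (\<Oplus>a\<in>?A. \<Oplus>b\<in>?B. ?t a b c)" .
 qed (use t in \<open>auto intro!: finsum_closed\<close>)
 also have "\<dots> = (\<Oplus>a\<in>?A. \<Oplus>c\<in>?C. \<Oplus>b\<in>?B. ?t a b c)"
  using fin t by (intro finsum_swap) (auto intro!: finsum_closed)
 also have "\<dots> = (\<Oplus>a\<in>?A. \<Oplus>b\<in>?B. \<Oplus>c\<in>?C. ?t a b c)"
  using fin t by (intro finsum_cong' finsum_swap) (auto intro!: finsum_closed)
 also have "\<dots> = (\<Oplus>a\<in>?A. \<Oplus>d\<in>supp ?G. f a \<otimes> ?G d \<otimes> \<phi> (a \<otimes>\<^bsub>M\<^esub> d))"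
 proof (rule finsum_cong')
  fix a assume a: "a \<in> ?A"
  let ?\<phi> = "%d. f a \<otimes> \<phi> (a \<otimes>\<^bsub>M\<^esub> d)"
  have \<phi>': "?\<phi> d \<in> carrier R" if "d \<in> carrier M" for d using that \<phi> M a by simp
  interpret E': monoid_algebra_eval R M R id ?\<phi> by (rule eval_locale) (rule \<phi>')
  have "(\<Oplus>d\<in>supp ?G. f a \<otimes> ?G d \<otimes> \<phi> (a \<otimes>\<^bsub>M\<^esub> d)) = (\<Oplus>d\<in>supp ?G. ?G d \<otimes> ?\<phi> d)"
   using \<phi> M a by (intro finsum_cong') (auto simp: m_ac)
  also have "\<dots> = E'.E ?G" using E'.eval_superset[of ?G "supp ?G"] h g fin sub by simp
  also have "\<dots> = (\<Oplus>b\<in>?B. \<Oplus>c\<in>?C. g b \<otimes> h c \<otimes> ?\<phi> (b \<otimes>\<^bsub>M\<^esub> c))"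
   using E'.eval_mult[of g h ?B ?C] h g fin sub by simp
  also have "\<dots> = (\<Oplus>b\<in>?B. \<Oplus>c\<in>?C. ?t a b c)"
   using \<phi> M a by (intro finsum_cong') (auto simp: m_ac intro!: finsum_cong' finsum_closed)
  finally show "(\<Oplus>b\<in>?B. \<Oplus>c\<in>?C. ?t a b c) = (\<Oplus>d\<in>supp ?G. f a \<otimes> ?G d \<otimes> \<phi> (a \<otimes>\<^bsub>M\<^esub> d))" by simp
 qed (use M \<phi> in \<open>auto intro!: finsum_closed\<close>)
 also have "\<dots> = E.E (f \<otimes>\<^bsub>Z\<^esub> ?G)"
  using E.eval_mult[of f ?G ?A "supp ?G"] f g h fin sub by simp
 finally show "E.E (?F \<otimes>\<^bsub>Z\<^esub> h) = E.E (f \<otimes>\<^bsub>Z\<^esub> ?G)" .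
qed (use f g h in auto)

lemma mr_one_mult:
 assumes f: "f \<in> carrier Z"
 shows "\<one>\<^bsub>Z\<^esub> \<otimes>\<^bsub>Z\<^esub> f = f" "f \<otimes>\<^bsub>Z\<^esub> \<one>\<^bsub>Z\<^esub> = f"
proof -
 have one: "\<one>\<^bsub>Z\<^esub> \<in> carrier Z" by (simp add: mr_one)
 have so: "supp \<one>\<^bsub>Z\<^esub> \<subseteq> {\<one>\<^bsub>M\<^esub>}" by (auto simp: mr_one single_def)
 have o: "\<one>\<^bsub>Z\<^esub> \<one>\<^bsub>M\<^esub> = \<one>" by (simp add: mr_one single_def)
 have M: "a \<in> supp f ==> a \<in> carrier M" for a using mr_supp[OF f] by blast
 show "\<one>\<^bsub>Z\<^esub> \<otimes>\<^bsub>Z\<^esub> f = f"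
 proof (rule mr_eqI)
  fix \<phi> assume \<phi>: "!!g. g \<in> carrier M ==> \<phi> g \<in> carrier R"
  interpret E: monoid_algebra_eval R M R id \<phi> by (rule eval_locale[OF \<phi>])
  have "E.E (\<one>\<^bsub>Z\<^esub> \<otimes>\<^bsub>Z\<^esub> f) = (\<Oplus>a\<in>{\<one>\<^bsub>M\<^esub>}. \<Oplus>b\<in>supp f. \<one>\<^bsub>Z\<^esub> a \<otimes> f b \<otimes> \<phi> (a \<otimes>\<^bsub>M\<^esub> b))"
   using E.eval_mult[of "\<one>\<^bsub>Z\<^esub>" f "{\<one>\<^bsub>M\<^esub>}" "supp f"] f one so mr_finite mr_supp by simp
  also have "\<dots> = (\<Oplus>b\<in>supp f. \<one>\<^bsub>Z\<^esub> \<one>\<^bsub>M\<^esub> \<otimes> f b \<otimes> \<phi> (\<one>\<^bsub>M\<^esub> \<otimes>\<^bsub>M\<^esub> b))"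
   using f M \<phi> mr_closed o by (subst finsum_insert) (auto intro!: finsum_closed)
  also have "\<dots> = (\<Oplus>b\<in>supp f. f b \<otimes> \<phi> b)"
   using f M \<phi> mr_closed o by (intro finsum_cong') auto
  finally show "E.E (\<one>\<^bsub>Z\<^esub> \<otimes>\<^bsub>Z\<^esub> f) = E.E f" using E.eval_superset[of f "supp f"] f mr_finite mr_supp by simp
 qed (use f one in auto)
 show "f \<otimes>\<^bsub>Z\<^esub> \<one>\<^bsub>Z\<^esub> = f"
 proof (rule mr_eqI)
  fix \<phi> assume \<phi>: "!!g. g \<in> carrier M ==> \<phi> g \<in> carrier R"
  interpret E: monoid_algebra_eval R M R id \<phi> by (rule eval_locale[OF \<phi>])
  have "E.E (f \<otimes>\<^bsub>Z\<^esub> \<one>\<^bsub>Z\<^esub>) = (\<Oplus>b\<in>supp f. \<Oplus>a\<in>{\<one>\<^bsub>M\<^esub>}. f b \<otimes> \<one>\<^bsub>Z\<^esub> a \<otimes> \<phi> (b \<otimes>\<^bsub>M\<^esub> a))"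
   using E.eval_mult[of f "\<one>\<^bsub>Z\<^esub>" "supp f" "{\<one>\<^bsub>M\<^esub>}"] f one so mr_finite mr_supp by simp
  also have "\<dots> = (\<Oplus>b\<in>supp f. f b \<otimes> \<phi> b)"
   using f M \<phi> mr_closed o by (intro finsum_cong') auto
  finally show "E.E (f \<otimes>\<^bsub>Z\<^esub> \<one>\<^bsub>Z\<^esub>) = E.E f" using E.eval_superset[of f "supp f"] f mr_finite mr_supp by simp
 qed (use f one in auto)
qed

lemma mr_distr:
 assumes f: "f \<in> carrier Z" and g: "g \<in> carrier Z" and h: "h \<in> carrier Z"
 shows "(f \<oplus>\<^bsub>Z\<^esub> g) \<otimes>\<^bsub>Z\<^esub> h = f \<otimes>\<^bsub>Z\<^esub> h \<oplus>\<^bsub>Z\<^esub> g \<otimes>\<^bsub>Z\<^esub> h"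
  and "h \<otimes>\<^bsub>Z\<^esub> (f \<oplus>\<^bsub>Z\<^esub> g) = h \<otimes>\<^bsub>Z\<^esub> f \<oplus>\<^bsub>Z\<^esub> h \<otimes>\<^bsub>Z\<^esub> g"
proof -
 let ?A = "supp f \<union> supp g" and ?C = "supp h"
 have A: "finite ?A" "?A \<subseteq> carrier M" "supp (f \<oplus>\<^bsub>Z\<^esub> g) \<subseteq> ?A" "finite ?C" "?C \<subseteq> carrier M" "supp f \<subseteq> ?A" "supp g \<subseteq> ?A"
  using f g h mr_supp mr_finite by (auto simp: mr_add)
 have M: "a \<in> ?A ==> a \<in> carrier M" "a \<in> ?C ==> a \<in> carrier M" for a using A by blast+
 have cl [simp]: "f m \<in> carrier R" "g m \<in> carrier R" "h m \<in> carrier R" for m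
  using f g h by (auto intro: mr_closed)
 show "(f \<oplus>\<^bsub>Z\<^esub> g) \<otimes>\<^bsub>Z\<^esub> h = f \<otimes>\<^bsub>Z\<^esub> h \<oplus>\<^bsub>Z\<^esub> g \<otimes>\<^bsub>Z\<^esub> h"
 proof (rule mr_eqI)
  fix \<phi> assume \<phi>: "!!g. g \<in> carrier M ==> \<phi> g \<in> carrier R"
  interpret E: monoid_algebra_eval R M R id \<phi> by (rule eval_locale[OF \<phi>])
  have "E.E ((f \<oplus>\<^bsub>Z\<^esub> g) \<otimes>\<^bsub>Z\<^esub> h) = (\<Oplus>a\<in>?A. \<Oplus>c\<in>?C. (f \<oplus>\<^bsub>Z\<^esub> g) a \<otimes> h c \<otimes> \<phi> (a \<otimes>\<^bsub>M\<^esub> c))"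
   using E.eval_mult[of "f \<oplus>\<^bsub>Z\<^esub> g" h ?A ?C] f g h A by simp
  also have "\<dots> = (\<Oplus>a\<in>?A. (\<Oplus>c\<in>?C. f a \<otimes> h c \<otimes> \<phi> (a \<otimes>\<^bsub>M\<^esub> c) \<oplus> g a \<otimes> h c \<otimes> \<phi> (a \<otimes>\<^bsub>M\<^esub> c)))"
   using M \<phi> by (intro finsum_cong') (auto simp: mr_add l_distr intro!: finsum_cong' finsum_closed)
  also have "\<dots> = (\<Oplus>a\<in>?A. (\<Oplus>c\<in>?C. f a \<otimes> h c \<otimes> \<phi> (a \<otimes>\<^bsub>M\<^esub> c)) \<oplus> (\<Oplus>c\<in>?C. g a \<otimes> h c \<otimes> \<phi> (a \<otimes>\<^bsub>M\<^esub> c)))"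
   using M \<phi> by (intro finsum_cong' finsum_addf) (auto intro!: finsum_closed)
  also have "\<dots> = (\<Oplus>a\<in>?A. \<Oplus>c\<in>?C. f a \<otimes> h c \<otimes> \<phi> (a \<otimes>\<^bsub>M\<^esub> c)) \<oplus> (\<Oplus>a\<in>?A. \<Oplus>c\<in>?C. g a \<otimes> h c \<otimes> \<phi> (a \<otimes>\<^bsub>M\<^esub> c))"
   using M \<phi> by (intro finsum_addf) (auto intro!: finsum_closed)
  also have "\<dots> = E.E (f \<otimes>\<^bsub>Z\<^esub> h) \<oplus> E.E (g \<otimes>\<^bsub>Z\<^esub> h)"
   using E.eval_mult[of f h ?A ?C] E.eval_mult[of g h ?A ?C] f g h A by simp
  finally show "E.E ((f \<oplus>\<^bsub>Z\<^esub> g) \<otimes>\<^bsub>Z\<^esub> h) = E.E (f \<otimes>\<^bsub>Z\<^esub> h \<oplus>\<^bsub>Z\<^esub> g \<otimes>\<^bsub>Z\<^esub> h)"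
   using f g h by (simp add: E.eval_add)
 qed (use f g h in auto)
 show "h \<otimes>\<^bsub>Z\<^esub> (f \<oplus>\<^bsub>Z\<^esub> g) = h \<otimes>\<^bsub>Z\<^esub> f \<oplus>\<^bsub>Z\<^esub> h \<otimes>\<^bsub>Z\<^esub> g"
 proof (rule mr_eqI)
  fix \<phi> assume \<phi>: "!!g. g \<in> carrier M ==> \<phi> g \<in> carrier R"
  interpret E: monoid_algebra_eval R M R id \<phi> by (rule eval_locale[OF \<phi>])
  have "E.E (h \<otimes>\<^bsub>Z\<^esub> (f \<oplus>\<^bsub>Z\<^esub> g)) = (\<Oplus>c\<in>?C. \<Oplus>a\<in>?A. h c \<otimes> (f \<oplus>\<^bsub>Z\<^esub> g) a \<otimes> \<phi> (c \<otimes>\<^bsub>M\<^esub> a))"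
   using E.eval_mult[of h "f \<oplus>\<^bsub>Z\<^esub> g" ?C ?A] f g h A by simp
  also have "\<dots> = (\<Oplus>c\<in>?C. (\<Oplus>a\<in>?A. h c \<otimes> f a \<otimes> \<phi> (c \<otimes>\<^bsub>M\<^esub> a) \<oplus> h c \<otimes> g a \<otimes> \<phi> (c \<otimes>\<^bsub>M\<^esub> a)))"
   using M \<phi> by (intro finsum_cong') (auto simp: mr_add l_distr r_distr intro!: finsum_cong' finsum_closed)
  also have "\<dots> = (\<Oplus>c\<in>?C. (\<Oplus>a\<in>?A. h c \<otimes> f a \<otimes> \<phi> (c \<otimes>\<^bsub>M\<^esub> a)) \<oplus> (\<Oplus>a\<in>?A. h c \<otimes> g a \<otimes> \<phi> (c \<otimes>\<^bsub>M\<^esub> a)))"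
   using M \<phi> by (intro finsum_cong' finsum_addf) (auto intro!: finsum_closed)
  also have "\<dots> = (\<Oplus>c\<in>?C. \<Oplus>a\<in>?A. h c \<otimes> f a \<otimes> \<phi> (c \<otimes>\<^bsub>M\<^esub> a)) \<oplus> (\<Oplus>c\<in>?C. \<Oplus>a\<in>?A. h c \<otimes> g a \<otimes> \<phi> (c \<otimes>\<^bsub>M\<^esub> a))"
   using M \<phi> by (intro finsum_addf) (auto intro!: finsum_closed)
  also have "\<dots> = E.E (h \<otimes>\<^bsub>Z\<^esub> f) \<oplus> E.E (h \<otimes>\<^bsub>Z\<^esub> g)"
   using E.eval_mult[of h f ?C ?A] E.eval_mult[of h g ?C ?A] f g h A by simp
  finally show "E.E (h \<otimes>\<^bsub>Z\<^esub> (f \<oplus>\<^bsub>Z\<^esub> g)) = E.E (h \<otimes>\<^bsub>Z\<^esub> f \<oplus>\<^bsub>Z\<^esub> h \<otimes>\<^bsub>Z\<^esub> g)"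
   using f g h by (simp add: E.eval_add)
 qed (use f g h in auto)
qed

lemma mr_ring: "ring Z"
proof (rule ringI)
 show "abelian_group Z"
 proof (rule abelian_groupI)
  fix f assume f: "f \<in> carrier Z"
  define g where "g = (%m. \<ominus> f m)"
  have "supp g \<subseteq> supp f" unfolding g_def by (auto simp: f mr_closed)
  then have "g \<in> carrier Z" using f mr_supp[OF f] mr_finite[OF f] mr_closed[OF f]
   by (intro mrI) (auto simp: g_def intro: finite_subset)
  moreover have "g \<oplus>\<^bsub>Z\<^esub> f = \<zero>\<^bsub>Z\<^esub>" using mr_closed[OF f] by (auto simp: fun_eq_iff mr_add mr_zero g_def l_neg)
  ultimately show "\<exists>g\<in>carrier Z. g \<oplus>\<^bsub>Z\<^esub> f = \<zero>\<^bsub>Z\<^esub>" by blast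
 qed (auto simp: fun_eq_iff mr_add mr_zero mr_closed a_ac intro!: mrI)
 show "Group.monoid Z"
  by (rule Group.monoid.intro) (auto simp: mr_assoc mr_one_mult, simp add: mr_one)
qed (auto simp: mr_distr)

lemma mr_induct:
 assumes "\<zero>\<^bsub>Z\<^esub> \<in> S" "!!f g. f \<in> S ==> g \<in> S ==> f \<oplus>\<^bsub>Z\<^esub> g \<in> S" "!!m a. m \<in> carrier M ==> a \<in> carrier R ==> single R m a \<in> S"
 shows "carrier Z \<subseteq> S"
proof
 fix f assume f: "f \<in> carrier Z"
 have "g \<in> S" if "finite A" "g \<in> carrier Z" "supp g \<subseteq> A" for A g
  using that
 proof (induction A arbitrary: g rule: finite_induct)
  case empty
  then have "g = \<zero>\<^bsub>Z\<^esub>" by (auto simp: fun_eq_iff mr_zero)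
  then show ?case using assms(1) by simp
 next
  case (insert x F)
  show ?case
  proof (cases "g x = \<zero>")
   case True
   then have "supp g \<subseteq> F" using insert.prems(2) by auto
   then show ?thesis using insert by blast
  next
   case False
   then have x: "x \<in> carrier M" using mr_supp[OF insert.prems(1)] by auto
   let ?g = "g(x := \<zero>)"
   have gx: "g m \<in> carrier R" for m using mr_closed[OF insert.prems(1)] .
   have s: "supp ?g \<subseteq> F" "supp ?g \<subseteq> supp g" using insert.prems(2) by auto
   then have "?g \<in> carrier Z" using gx mr_supp[OF insert.prems(1)] finite_subset[OF s(1) insert.hyps(1)] by (intro mrI) auto
   then have "?g \<in> S" using insert.IH s by blast
   moreover have "g = single R x (g x) \<oplus>\<^bsub>Z\<^esub> ?g" using gx by (auto simp: fun_eq_iff mr_add single_def)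
   ultimately show ?thesis using assms(2,3) x gx by metis
  qed
 qed
 then show "f \<in> S" using f mr_finite by blast
qed

lemma single_add: "a \<in> carrier R ==> b \<in> carrier R ==> single R m a \<oplus>\<^bsub>Z\<^esub> single R m b = single R m (a \<oplus> b)"
 by (auto simp: fun_eq_iff mr_add single_def)

lemma single_mult:
 assumes "m \<in> carrier M" "n \<in> carrier M" "a \<in> carrier R" "b \<in> carrier R"
 shows "single R m a \<otimes>\<^bsub>Z\<^esub> single R n b = single R (m \<otimes>\<^bsub>M\<^esub> n) (a \<otimes> b)"
proof (rule mr_eqI)
 fix \<phi> assume \<phi>: "!!g. g \<in> carrier M ==> \<phi> g \<in> carrier R"
 interpret E: monoid_algebra_eval R M R id \<phi> by (rule eval_locale[OF \<phi>])
 have s: "supp (single R m a) \<subseteq> {m}" "supp (single R n b) \<subseteq> {n}" by (auto simp: single_def)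
 have "E.E (single R m a \<otimes>\<^bsub>Z\<^esub> single R n b) = a \<otimes> b \<otimes> \<phi> (m \<otimes>\<^bsub>M\<^esub> n)"
 proof -
  have same: "single R m a m = a" "single R n b n = b" by (simp_all add: single_def)
  show ?thesis
   using E.eval_mult[OF single_closed single_closed _ _ s] assms \<phi> by (simp add: same)
 qed
 then show "E.E (single R m a \<otimes>\<^bsub>Z\<^esub> single R n b) = E.E (single R (m \<otimes>\<^bsub>M\<^esub> n) (a \<otimes> b))"
  using assms by (simp add: E.eval_single)
qed (use assms in auto)

end

locale monoid_algebra_hom = monoid_algebra_eval +
 assumes \<phi>_mult: "g \<in> carrier M ==> h \<in> carrier M ==> \<phi> (g \<otimes>\<^bsub>M\<^esub> h) = \<phi> g \<otimes>\<^bsub>B\<^esub> \<phi> h"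
  and \<phi>_one: "\<phi> \<one>\<^bsub>M\<^esub> = \<one>\<^bsub>B\<^esub>"
  and \<theta>_central: "r \<in> carrier R ==> g \<in> carrier M ==> \<theta> r \<otimes>\<^bsub>B\<^esub> \<phi> g = \<phi> g \<otimes>\<^bsub>B\<^esub> \<theta> r"
begin

lemma eval_hom: "ring_hom_ring Z B E"
proof (intro ring_hom_ringI2 ring_hom_memI)
 show "ring Z" by (rule mr_ring)
 show "ring B" by (rule B.ring_axioms)
 show "E \<one>\<^bsub>Z\<^esub> = \<one>\<^bsub>B\<^esub>" by (simp add: mr_one eval_single \<phi>_one)
 fix f g assume f: "f \<in> carrier Z" and g: "g \<in> carrier Z"
 show "E f \<in> carrier B" using f by simp
 show "E (f \<oplus>\<^bsub>Z\<^esub> g) = E f \<oplus>\<^bsub>B\<^esub> E g" using f g by (rule eval_add)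
 have M: "a \<in> supp f ==> a \<in> carrier M" "a \<in> supp g ==> a \<in> carrier M" for a using mr_supp[OF f] mr_supp[OF g] by auto
 have cl [simp]: "f m \<in> carrier R" "g m \<in> carrier R" for m using f g by (auto intro: mr_closed)
 have fin: "finite (supp f)" "finite (supp g)" using f g mr_finite by auto
 have "E f \<otimes>\<^bsub>B\<^esub> E g = (\<Oplus>\<^bsub>B\<^esub>a\<in>supp f. (\<theta> (f a) \<otimes>\<^bsub>B\<^esub> \<phi> a) \<otimes>\<^bsub>B\<^esub> E g)"
  unfolding mr_eval_def[of R B \<theta> \<phi> f] using fin M g by (intro B.finsum_ldistr) auto
 also have "\<dots> = (\<Oplus>\<^bsub>B\<^esub>a\<in>supp f. \<Oplus>\<^bsub>B\<^esub>b\<in>supp g. (\<theta> (f a) \<otimes>\<^bsub>B\<^esub> \<phi> a) \<otimes>\<^bsub>B\<^esub> (\<theta> (g b) \<otimes>\<^bsub>B\<^esub> \<phi> b))"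
  unfolding mr_eval_def[of R B \<theta> \<phi> g] using fin M
  by (intro B.finsum_cong' B.finsum_rdistr) (auto intro!: B.finsum_closed)
 also have "\<dots> = (\<Oplus>\<^bsub>B\<^esub>a\<in>supp f. \<Oplus>\<^bsub>B\<^esub>b\<in>supp g. \<theta> (f a) \<otimes>\<^bsub>B\<^esub> \<theta> (g b) \<otimes>\<^bsub>B\<^esub> \<phi> (a \<otimes>\<^bsub>M\<^esub> b))"
 proof (intro B.finsum_cong')
  fix a b assume ab: "a \<in> supp f" "b \<in> supp g"
  have "\<phi> a \<otimes>\<^bsub>B\<^esub> (\<theta> (g b) \<otimes>\<^bsub>B\<^esub> \<phi> b) = \<theta> (g b) \<otimes>\<^bsub>B\<^esub> (\<phi> a \<otimes>\<^bsub>B\<^esub> \<phi> b)"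
   using ab M \<theta>_central[of "g b" a] by (simp add: B.m_assoc[symmetric])
  then show "(\<theta> (f a) \<otimes>\<^bsub>B\<^esub> \<phi> a) \<otimes>\<^bsub>B\<^esub> (\<theta> (g b) \<otimes>\<^bsub>B\<^esub> \<phi> b) = \<theta> (f a) \<otimes>\<^bsub>B\<^esub> \<theta> (g b) \<otimes>\<^bsub>B\<^esub> \<phi> (a \<otimes>\<^bsub>M\<^esub> b)"
   using ab M by (simp add: B.m_assoc \<phi>_mult)
 qed (use M in \<open>auto intro!: B.finsum_closed\<close>)
 also have "\<dots> = E (f \<otimes>\<^bsub>Z\<^esub> g)"
  using f g fin mr_supp by (intro eval_mult[symmetric]) auto
 finally show "E (f \<otimes>\<^bsub>Z\<^esub> g) = E f \<otimes>\<^bsub>B\<^esub> E g" by simp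
qed

end

lemma quotient_lift:
 assumes "ideal I Z" "ring_hom_ring Z B h" "!!i. i \<in> I ==> h i = \<zero>\<^bsub>B\<^esub>"
 shows "\<exists>h'. ring_hom_ring (Z Quot I) B h' & (\<forall>z\<in>carrier Z. h' (I +>\<^bsub>Z\<^esub> z) = h z)"
proof -
 interpret I: ideal I Z by fact
 interpret h: ring_hom_ring Z B h by fact
 \<comment> \<open>\<open>h\<close> is constant on each coset of \<open>I\<close>, so the image of a
   coset is a singleton.\<close>
 define h' where "h' C = the_elem (h ` C)" for C
 have coset: "h' (I +>\<^bsub>Z\<^esub> z) = h z" if z: "z \<in> carrier Z" for z
 proof -
  have "h ` (I +>\<^bsub>Z\<^esub> z) = {h z}"
  proof
   show "h ` (I +>\<^bsub>Z\<^esub> z) \<subseteq> {h z}"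
    using z assms(3) I.Icarr by (auto simp: a_r_coset_def' )
   show "{h z} \<subseteq> h ` (I +>\<^bsub>Z\<^esub> z)" using I.a_rcos_self[OF z] by auto
  qed
  then show ?thesis by (simp add: h'_def)
 qed
 have rep: "\<exists>z\<in>carrier Z. C = I +>\<^bsub>Z\<^esub> z" if "C \<in> carrier (Z Quot I)" for C
  using that by (auto simp: FactRing_def A_RCOSETS_def')
 have q: "(+>\<^bsub>Z\<^esub>) I \<in> ring_hom Z (Z Quot I)" by (rule I.rcos_ring_hom)
 have "ring_hom_ring (Z Quot I) B h'"
 proof (intro ring_hom_ringI2 ring_hom_memI)
  show "ring (Z Quot I)" by (rule I.quotient_is_ring)
  show "ring B" by (rule h.S.ring_axioms)
  show "h' \<one>\<^bsub>Z Quot I\<^esub> = \<one>\<^bsub>B\<^esub>" using coset[of "\<one>\<^bsub>Z\<^esub>"] ring_hom_one[OF q] by simp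
  fix C D assume CD: "C \<in> carrier (Z Quot I)" "D \<in> carrier (Z Quot I)"
  then obtain c d where cd: "c \<in> carrier Z" "C = I +>\<^bsub>Z\<^esub> c" "d \<in> carrier Z" "D = I +>\<^bsub>Z\<^esub> d" using rep by meson
  show "h' C \<in> carrier B" using cd coset by simp
  show "h' (C \<otimes>\<^bsub>Z Quot I\<^esub> D) = h' C \<otimes>\<^bsub>B\<^esub> h' D"
   using cd coset ring_hom_mult[OF q, of c d, symmetric] by simp
  show "h' (C \<oplus>\<^bsub>Z Quot I\<^esub> D) = h' C \<oplus>\<^bsub>B\<^esub> h' D"
   using cd coset ring_hom_add[OF q, of c d, symmetric] by simp
 qed
 then show ?thesis using coset by blast
qed

lemma (in ideal) quot_map_zero: "i \<in> I ==> I +> i = \<zero>\<^bsub>R Quot I\<^esub>"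
 using a_rcos_const by (simp add: FactRing_def)

lemma (in ideal) quot_map_surj: "C \<in> carrier (R Quot I) ==> \<exists>z\<in>carrier R. C = I +> z"
 by (auto simp: FactRing_def A_RCOSETS_def')

lemma (in ideal) quot_map_eqI:
 assumes "x \<in> carrier R" "y \<in> carrier R" "x \<ominus> y \<in> I"
 shows "I +> x = I +> y"
proof -
 interpret q: ring_hom_ring R "R Quot I" "(+>) I" by (rule rcos_ring_hom_ring)
 have "(I +> x) \<ominus>\<^bsub>R Quot I\<^esub> (I +> y) = \<zero>\<^bsub>R Quot I\<^esub>"
  using assms quot_map_zero[OF assms(3)] by (simp add: q.hom_diff)
 then show ?thesis using assms by (simp add: q.S.r_right_minus_eq)
qed

section \<open>The presented symbol algebra and its universal property\<close>

locale symbol_presentation = cring F for F :: "'a ring" (structure) +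
 fixes p :: nat and a b :: 'a
 assumes a [simp]: "a \<in> carrier F" and b [simp]: "b \<in> carrier F"
begin

abbreviation "W \<equiv> free_alg F"
abbreviation "J \<equiv> genideal W (symbol_relations p F a b)"
abbreviation "Sym \<equiv> fst (symbol_algebra p F a b)"
abbreviation "ins \<equiv> snd (symbol_algebra p F a b)"

lemma words_monoid: "Group.monoid words"
 by (rule Group.monoid.intro) (auto simp: words_def)

sublocale W: monoid_algebra F words
 using words_monoid by (simp add: monoid_algebra_def cring_axioms)

sublocale W: ring W by (rule W.mr_ring)

lemma words_simps [simp]: "carrier words = UNIV" "u \<otimes>\<^bsub>words\<^esub> v = u @ v" "\<one>\<^bsub>words\<^esub> = []"
 by (auto simp: words_def)

abbreviation "wx \<equiv> single F [GX] \<one>"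
abbreviation "wy \<equiv> single F [GY] \<one>"

lemma sym_relations: "symbol_relations p F a b =
 {(wx [^]\<^bsub>W\<^esub> p \<ominus>\<^bsub>W\<^esub> wx) \<ominus>\<^bsub>W\<^esub> single F [] a, wy [^]\<^bsub>W\<^esub> p \<ominus>\<^bsub>W\<^esub> single F [] b,
  (wy \<otimes>\<^bsub>W\<^esub> wx) \<ominus>\<^bsub>W\<^esub> ((wx \<oplus>\<^bsub>W\<^esub> \<one>\<^bsub>W\<^esub>) \<otimes>\<^bsub>W\<^esub> wy)}"
 by (simp add: symbol_relations_def Let_def)

lemma rel_closed: "symbol_relations p F a b \<subseteq> carrier W"
 unfolding sym_relations by simp

sublocale J: ideal J W using rel_closed by (rule W.genideal_ideal)

lemma Sym_eq: "Sym = W Quot J" and ins_eq: "ins c = J +>\<^bsub>W\<^esub> single F [] c"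
 by (simp_all add: symbol_algebra_def Let_def)

sublocale q: ring_hom_ring W Sym "(+>\<^bsub>W\<^esub>) J" unfolding Sym_eq by (rule J.rcos_ring_hom_ring)

lemma Sym_ring: "ring Sym" by (rule q.S.ring_axioms)

lemma ins_hom: "ring_hom_ring F Sym ins"
proof (intro ring_hom_ringI2 ring_hom_memI)
 fix c d assume cd: "c \<in> carrier F" "d \<in> carrier F"
 show "ins (c \<otimes> d) = ins c \<otimes>\<^bsub>Sym\<^esub> ins d"
  using cd q.hom_mult[of "single F [] c" "single F [] d"] by (simp add: ins_eq W.single_mult)
 show "ins (c \<oplus> d) = ins c \<oplus>\<^bsub>Sym\<^esub> ins d"
  using cd q.hom_add[of "single F [] c" "single F [] d"] by (simp add: ins_eq W.single_add)
 show "ins c \<in> carrier Sym" using cd by (simp add: ins_eq)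
next
 show "ins \<one> = \<one>\<^bsub>Sym\<^esub>" using q.hom_one by (simp add: ins_eq W.mr_one)
qed (auto simp: ring_axioms Sym_ring)

definition "gx = J +>\<^bsub>W\<^esub> wx"
definition "gy = J +>\<^bsub>W\<^esub> wy"

lemma g_closed [simp]: "gx \<in> carrier Sym" "gy \<in> carrier Sym"
 by (auto simp: gx_def gy_def)

lemma rel_mem: "r \<in> symbol_relations p F a b ==> r \<in> J"
 using W.genideal_self[OF rel_closed] by blast

lemma sym_rel:
 "gx [^]\<^bsub>Sym\<^esub> p \<ominus>\<^bsub>Sym\<^esub> gx = ins a" "gy [^]\<^bsub>Sym\<^esub> p = ins b"
 "gy \<otimes>\<^bsub>Sym\<^esub> gx = (gx \<oplus>\<^bsub>Sym\<^esub> \<one>\<^bsub>Sym\<^esub>) \<otimes>\<^bsub>Sym\<^esub> gy"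
proof -
 have "J +>\<^bsub>W\<^esub> (wx [^]\<^bsub>W\<^esub> p \<ominus>\<^bsub>W\<^esub> wx) = J +>\<^bsub>W\<^esub> single F [] a"
  by (rule J.quot_map_eqI, simp, simp, rule rel_mem) (simp add: sym_relations)
 then show "gx [^]\<^bsub>Sym\<^esub> p \<ominus>\<^bsub>Sym\<^esub> gx = ins a"
  by (simp add: ins_eq gx_def q.hom_diff q.hom_nat_pow)
 have "J +>\<^bsub>W\<^esub> (wy [^]\<^bsub>W\<^esub> p) = J +>\<^bsub>W\<^esub> single F [] b"
  by (rule J.quot_map_eqI, simp, simp, rule rel_mem) (simp add: sym_relations)
 then show "gy [^]\<^bsub>Sym\<^esub> p = ins b"
  by (simp add: ins_eq gy_def q.hom_nat_pow)
 have "J +>\<^bsub>W\<^esub> (wy \<otimes>\<^bsub>W\<^esub> wx) = J +>\<^bsub>W\<^esub> ((wx \<oplus>\<^bsub>W\<^esub> \<one>\<^bsub>W\<^esub>) \<otimes>\<^bsub>W\<^esub> wy)"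
  by (rule J.quot_map_eqI, simp, simp, rule rel_mem) (simp add: sym_relations)
 then show "gy \<otimes>\<^bsub>Sym\<^esub> gx = (gx \<oplus>\<^bsub>Sym\<^esub> \<one>\<^bsub>Sym\<^esub>) \<otimes>\<^bsub>Sym\<^esub> gy"
  by (simp add: gx_def gy_def)
qed

lemma ins_central: "c \<in> carrier F ==> ins c \<otimes>\<^bsub>Sym\<^esub> gx = gx \<otimes>\<^bsub>Sym\<^esub> ins c"
 "c \<in> carrier F ==> ins c \<otimes>\<^bsub>Sym\<^esub> gy = gy \<otimes>\<^bsub>Sym\<^esub> ins c"
 unfolding ins_eq gx_def gy_def
 by (simp_all add: q.hom_mult[symmetric] W.single_mult del: q.hom_mult)

text \<open>Words grow by one generator on the left, so the two one-sided multiplications stand in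
  for closure under products.\<close>

lemma sym_induct:
 assumes "\<zero>\<^bsub>Sym\<^esub> \<in> S" "!!s t. s \<in> S ==> t \<in> S ==> s \<oplus>\<^bsub>Sym\<^esub> t \<in> S" "!!c. c \<in> carrier F ==> ins c \<in> S"
  and "!!s. s \<in> S ==> gx \<otimes>\<^bsub>Sym\<^esub> s \<in> S" "!!s. s \<in> S ==> gy \<otimes>\<^bsub>Sym\<^esub> s \<in> S"
 shows "carrier Sym \<subseteq> S"
proof -
 have word: "J +>\<^bsub>W\<^esub> single F w c \<in> S" if c: "c \<in> carrier F" for w c
 proof (induction w)
  case Nil
  show ?case using assms(3)[OF c] by (simp add: ins_eq)
 next
  case (Cons g w)
  have "single F (g # w) c = single F [g] \<one> \<otimes>\<^bsub>W\<^esub> single F w c" using c by (simp add: W.single_mult)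
  then have "J +>\<^bsub>W\<^esub> single F (g # w) c = (J +>\<^bsub>W\<^esub> single F [g] \<one>) \<otimes>\<^bsub>Sym\<^esub> (J +>\<^bsub>W\<^esub> single F w c)" using c by simp
  then show ?case using Cons assms(4,5) by (cases g) (auto simp: gx_def gy_def)
 qed
 have "carrier W \<subseteq> {z \<in> carrier W. J +>\<^bsub>W\<^esub> z \<in> S}"
  by (rule W.mr_induct) (use assms(1,2) word in auto)
 then show ?thesis using J.quot_map_surj unfolding Sym_eq by blast
qed

lemma sym_universal:
 assumes "ring_hom_ring F B \<tau>" and x: "x \<in> carrier B" and y: "y \<in> carrier B"
  and rel: "x [^]\<^bsub>B\<^esub> p \<ominus>\<^bsub>B\<^esub> x = \<tau> a" "y [^]\<^bsub>B\<^esub> p = \<tau> b" "y \<otimes>\<^bsub>B\<^esub> x = (x \<oplus>\<^bsub>B\<^esub> \<one>\<^bsub>B\<^esub>) \<otimes>\<^bsub>B\<^esub> y"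
  and central: "!!c. c \<in> carrier F ==> \<tau> c \<otimes>\<^bsub>B\<^esub> x = x \<otimes>\<^bsub>B\<^esub> \<tau> c" "!!c. c \<in> carrier F ==> \<tau> c \<otimes>\<^bsub>B\<^esub> y = y \<otimes>\<^bsub>B\<^esub> \<tau> c"
 shows "\<exists>h. ring_hom_ring Sym B h & h gx = x & h gy = y & (\<forall>c\<in>carrier F. h (ins c) = \<tau> c)"
proof -
 interpret \<tau>: ring_hom_ring F B \<tau> by fact
 define \<phi> where "\<phi> w = foldr (%g acc. (case g of GX => x | GY => y) \<otimes>\<^bsub>B\<^esub> acc) w \<one>\<^bsub>B\<^esub>" for w
 have \<phi>c [simp]: "\<phi> w \<in> carrier B" for w unfolding \<phi>_def by (induction w) (auto simp: x y split: gen.split)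
 have \<phi>m: "\<phi> (u @ w) = \<phi> u \<otimes>\<^bsub>B\<^esub> \<phi> w" for u w
 proof (induction u)
  case Nil
  show ?case using \<phi>c[of w] by (simp add: \<phi>_def)
 next
  case (Cons g u)
  have g: "(case g of GX => x | GY => y) \<in> carrier B" using x y by (simp split: gen.split)
  have s: "\<phi> (g # r) = (case g of GX => x | GY => y) \<otimes>\<^bsub>B\<^esub> \<phi> r" for r by (simp add: \<phi>_def)
  show ?case using Cons g by (simp add: s \<tau>.S.m_assoc)
 qed
 have \<phi>central: "\<tau> c \<otimes>\<^bsub>B\<^esub> \<phi> w = \<phi> w \<otimes>\<^bsub>B\<^esub> \<tau> c" if c: "c \<in> carrier F" for c w
 proof (induction w)
  case Nil
  show ?case using c by (simp add: \<phi>_def)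
 next
  case (Cons g w)
  let ?g = "case g of GX => x | GY => y"
  have g: "?g \<in> carrier B" "\<tau> c \<otimes>\<^bsub>B\<^esub> ?g = ?g \<otimes>\<^bsub>B\<^esub> \<tau> c" using x y central c by (auto split: gen.split)
  have s: "\<phi> (g # w) = ?g \<otimes>\<^bsub>B\<^esub> \<phi> w" by (simp add: \<phi>_def)
  have "\<tau> c \<otimes>\<^bsub>B\<^esub> (?g \<otimes>\<^bsub>B\<^esub> \<phi> w) = ?g \<otimes>\<^bsub>B\<^esub> (\<tau> c \<otimes>\<^bsub>B\<^esub> \<phi> w)" using g c by (simp add: \<tau>.S.m_assoc[symmetric])
  then show ?case using Cons g c by (simp add: s \<tau>.S.m_assoc)
 qed
 interpret E: monoid_algebra_hom F words B \<tau> \<phi>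
 proof unfold_locales
  show "\<phi> \<one>\<^bsub>words\<^esub> = \<one>\<^bsub>B\<^esub>" by (simp add: \<phi>_def)
 qed (simp_all add: \<phi>m \<phi>central)
 interpret E: ring_hom_ring W B E.E by (rule E.eval_hom)
 have ex: "E.E wx = x" "E.E wy = y" "c \<in> carrier F ==> E.E (single F [] c) = \<tau> c" for c
  using x y by (auto simp: E.eval_single \<phi>_def)
 have "E.E ((wx [^]\<^bsub>W\<^esub> p \<ominus>\<^bsub>W\<^esub> wx) \<ominus>\<^bsub>W\<^esub> single F [] a) = \<zero>\<^bsub>B\<^esub>"
  using rel(1) by (simp add: E.hom_diff E.hom_nat_pow ex \<tau>.S.r_right_minus_eq)
 moreover have "E.E (wy [^]\<^bsub>W\<^esub> p \<ominus>\<^bsub>W\<^esub> single F [] b) = \<zero>\<^bsub>B\<^esub>"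
  using rel(2) by (simp add: E.hom_diff E.hom_nat_pow ex \<tau>.S.r_right_minus_eq)
 moreover have "E.E ((wy \<otimes>\<^bsub>W\<^esub> wx) \<ominus>\<^bsub>W\<^esub> ((wx \<oplus>\<^bsub>W\<^esub> \<one>\<^bsub>W\<^esub>) \<otimes>\<^bsub>W\<^esub> wy)) = \<zero>\<^bsub>B\<^esub>"
  using rel(3) x y by (simp add: E.hom_diff ex \<tau>.S.r_right_minus_eq)
 ultimately have "symbol_relations p F a b \<subseteq> {z \<in> carrier W. E.E z = \<zero>\<^bsub>B\<^esub>}"
  using rel_closed unfolding sym_relations by blast
 then have "symbol_relations p F a b \<subseteq> a_kernel W B E.E" unfolding a_kernel_def' .
 then have "J \<subseteq> a_kernel W B E.E"
  by (rule W.genideal_minimal[OF E.kernel_is_ideal])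
 then have "E.E i = \<zero>\<^bsub>B\<^esub>" if "i \<in> J" for i using that unfolding a_kernel_def' by blast
 then obtain h where h: "ring_hom_ring Sym B h" "!!z. z \<in> carrier W ==> h (J +>\<^bsub>W\<^esub> z) = E.E z"
  using quotient_lift[OF J.ideal_axioms E.ring_hom_ring_axioms] unfolding Sym_eq by blast
 then show ?thesis using ex by (intro exI[of _ h]) (auto simp: gx_def gy_def ins_eq)
qed

end

section \<open>Scalar extension and its universal property\<close>

locale scalar_extension = A: ring "fst A" + T: cring "fst K" + \<sigma>: ring_hom_ring R "fst A" "snd A" + \<kappa>: ring_hom_ring R "fst K" "snd K"
 for R :: "'a ring" and A :: "('a, 'b) alg" and K :: "('a, 'k) alg"
begin

abbreviation "S \<equiv> fst A"
abbreviation "T \<equiv> fst K"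
abbreviation "Z \<equiv> monoid_ring int_ring (S \<times>\<times> T)"
abbreviation "I \<equiv> genideal Z (tensor_relations R A K)"
abbreviation "Q \<equiv> fst (scalar_ext R A K)"
abbreviation "\<iota> \<equiv> snd (scalar_ext R A K)"
abbreviation "e a k \<equiv> single int_ring (a, k) (1::int)"

sublocale Z: monoid_algebra int_ring "S \<times>\<times> T"
 unfolding monoid_algebra_def
 using DirProd_monoid[OF A.monoid_axioms T.monoid_axioms] int_is_cring by simp

sublocale ZR: ring Z by (rule Z.mr_ring)

lemma carrier_prod [simp]: "(s, t) \<in> carrier (S \<times>\<times> T) \<longleftrightarrow> s \<in> carrier S & t \<in> carrier T"
 by (simp add: DirProd_def)

lemma mult_prod [simp]: "(s, t) \<otimes>\<^bsub>S \<times>\<times> T\<^esub> (s', t') = (s \<otimes>\<^bsub>S\<^esub> s', t \<otimes>\<^bsub>T\<^esub> t')" "\<one>\<^bsub>S \<times>\<times> T\<^esub> = (\<one>\<^bsub>S\<^esub>, \<one>\<^bsub>T\<^esub>)"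
 by (simp_all add: DirProd_def)

lemma e_closed [simp]: "s \<in> carrier S ==> t \<in> carrier T ==> e s t \<in> carrier Z"
 by (rule Z.single_closed) auto

lemma e_mult: "s \<in> carrier S ==> t \<in> carrier T ==> s' \<in> carrier S ==> t' \<in> carrier T ==>
 e s t \<otimes>\<^bsub>Z\<^esub> e s' t' = e (s \<otimes>\<^bsub>S\<^esub> s') (t \<otimes>\<^bsub>T\<^esub> t')"
 using Z.single_mult[of "(s, t)" "(s', t')" 1 1] by simp

lemma rel_eq: "tensor_relations R A K =
  {e (a \<oplus>\<^bsub>S\<^esub> b) k \<ominus>\<^bsub>Z\<^esub> (e a k \<oplus>\<^bsub>Z\<^esub> e b k) | a b k. a \<in> carrier S & b \<in> carrier S & k \<in> carrier T}
    \<union> {e a (k \<oplus>\<^bsub>T\<^esub> l) \<ominus>\<^bsub>Z\<^esub> (e a k \<oplus>\<^bsub>Z\<^esub> e a l) | a k l. a \<in> carrier S & k \<in> carrier T & l \<in> carrier T}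
    \<union> {e (a \<otimes>\<^bsub>S\<^esub> snd A r) k \<ominus>\<^bsub>Z\<^esub> e a (snd K r \<otimes>\<^bsub>T\<^esub> k) | a r k. a \<in> carrier S & r \<in> carrier R & k \<in> carrier T}"
 by (simp add: tensor_relations_def Let_def)

lemma rel_closed: "tensor_relations R A K \<subseteq> carrier Z"
 unfolding rel_eq by auto

sublocale I: ideal I Z using rel_closed by (rule ZR.genideal_ideal)

lemma Q_eq: "Q = Z Quot I" and iota_eq: "\<iota> k = I +>\<^bsub>Z\<^esub> e \<one>\<^bsub>S\<^esub> k"
 by (simp_all add: scalar_ext_def Let_def)

sublocale q: ring_hom_ring Z Q "(+>\<^bsub>Z\<^esub>) I" unfolding Q_eq by (rule I.rcos_ring_hom_ring)

abbreviation "i s \<equiv> I +>\<^bsub>Z\<^esub> e s \<one>\<^bsub>T\<^esub>"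

lemma Q_ring: "ring Q" by (rule q.S.ring_axioms)

lemma rel_mem: "r \<in> tensor_relations R A K ==> r \<in> I"
 using ZR.genideal_self[OF rel_closed] by blast

lemma e_rel:
 "a \<in> carrier S ==> b \<in> carrier S ==> k \<in> carrier T ==> I +>\<^bsub>Z\<^esub> e (a \<oplus>\<^bsub>S\<^esub> b) k = (I +>\<^bsub>Z\<^esub> e a k) \<oplus>\<^bsub>Q\<^esub> (I +>\<^bsub>Z\<^esub> e b k)"
 "a \<in> carrier S ==> k \<in> carrier T ==> l \<in> carrier T ==> I +>\<^bsub>Z\<^esub> e a (k \<oplus>\<^bsub>T\<^esub> l) = (I +>\<^bsub>Z\<^esub> e a k) \<oplus>\<^bsub>Q\<^esub> (I +>\<^bsub>Z\<^esub> e a l)"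
 "a \<in> carrier S ==> r \<in> carrier R ==> k \<in> carrier T ==> I +>\<^bsub>Z\<^esub> e (a \<otimes>\<^bsub>S\<^esub> snd A r) k = I +>\<^bsub>Z\<^esub> e a (snd K r \<otimes>\<^bsub>T\<^esub> k)"
proof -
 show "I +>\<^bsub>Z\<^esub> e (a \<oplus>\<^bsub>S\<^esub> b) k = (I +>\<^bsub>Z\<^esub> e a k) \<oplus>\<^bsub>Q\<^esub> (I +>\<^bsub>Z\<^esub> e b k)" if "a \<in> carrier S" "b \<in> carrier S" "k \<in> carrier T"
 proof -
  have "I +>\<^bsub>Z\<^esub> e (a \<oplus>\<^bsub>S\<^esub> b) k = I +>\<^bsub>Z\<^esub> (e a k \<oplus>\<^bsub>Z\<^esub> e b k)"
   using that by (intro I.quot_map_eqI rel_mem) (auto simp: rel_eq)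
  then show ?thesis using that by simp
 qed
 show "I +>\<^bsub>Z\<^esub> e a (k \<oplus>\<^bsub>T\<^esub> l) = (I +>\<^bsub>Z\<^esub> e a k) \<oplus>\<^bsub>Q\<^esub> (I +>\<^bsub>Z\<^esub> e a l)" if "a \<in> carrier S" "k \<in> carrier T" "l \<in> carrier T"
 proof -
  have "I +>\<^bsub>Z\<^esub> e a (k \<oplus>\<^bsub>T\<^esub> l) = I +>\<^bsub>Z\<^esub> (e a k \<oplus>\<^bsub>Z\<^esub> e a l)"
   using that by (intro I.quot_map_eqI rel_mem) (auto simp: rel_eq)
  then show ?thesis using that by simp
 qed
 show "I +>\<^bsub>Z\<^esub> e (a \<otimes>\<^bsub>S\<^esub> snd A r) k = I +>\<^bsub>Z\<^esub> e a (snd K r \<otimes>\<^bsub>T\<^esub> k)" if "a \<in> carrier S" "r \<in> carrier R" "k \<in> carrier T"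
  using that by (intro I.quot_map_eqI rel_mem) (auto simp: rel_eq)
qed

lemma i_hom: "ring_hom_ring S Q i"
proof (intro ring_hom_ringI2 ring_hom_memI)
 fix a b assume ab: "a \<in> carrier S" "b \<in> carrier S"
 show "i (a \<otimes>\<^bsub>S\<^esub> b) = i a \<otimes>\<^bsub>Q\<^esub> i b" using ab q.hom_mult[of "e a \<one>\<^bsub>T\<^esub>" "e b \<one>\<^bsub>T\<^esub>"] by (simp add: e_mult)
 show "i (a \<oplus>\<^bsub>S\<^esub> b) = i a \<oplus>\<^bsub>Q\<^esub> i b" using ab by (simp add: e_rel)
next
 show "i \<one>\<^bsub>S\<^esub> = \<one>\<^bsub>Q\<^esub>" using q.hom_one by (simp add: Z.mr_one)
qed (auto simp: A.ring_axioms Q_ring)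

lemma iota_hom: "ring_hom_ring T Q \<iota>"
proof (intro ring_hom_ringI2 ring_hom_memI)
 fix k l assume kl: "k \<in> carrier T" "l \<in> carrier T"
 show "\<iota> (k \<otimes>\<^bsub>T\<^esub> l) = \<iota> k \<otimes>\<^bsub>Q\<^esub> \<iota> l" using kl q.hom_mult[of "e \<one>\<^bsub>S\<^esub> k" "e \<one>\<^bsub>S\<^esub> l"] by (simp add: e_mult iota_eq)
 show "\<iota> (k \<oplus>\<^bsub>T\<^esub> l) = \<iota> k \<oplus>\<^bsub>Q\<^esub> \<iota> l" using kl by (simp add: e_rel iota_eq)
next
 show "\<iota> \<one>\<^bsub>T\<^esub> = \<one>\<^bsub>Q\<^esub>" using q.hom_one by (simp add: Z.mr_one iota_eq)
qed (auto simp: T.ring_axioms Q_ring iota_eq)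

lemma i_iota: "s \<in> carrier S ==> t \<in> carrier T ==> I +>\<^bsub>Z\<^esub> e s t = \<iota> t \<otimes>\<^bsub>Q\<^esub> i s"
 "s \<in> carrier S ==> t \<in> carrier T ==> I +>\<^bsub>Z\<^esub> e s t = i s \<otimes>\<^bsub>Q\<^esub> \<iota> t"
 unfolding iota_eq by (simp_all add: q.hom_mult[symmetric] e_mult del: q.hom_mult)

lemma i_iota_commute: "s \<in> carrier S ==> t \<in> carrier T ==> \<iota> t \<otimes>\<^bsub>Q\<^esub> i s = i s \<otimes>\<^bsub>Q\<^esub> \<iota> t"
 using i_iota by metis

lemma i_structure: "r \<in> carrier R ==> i (snd A r) = \<iota> (snd K r)"
 using e_rel(3)[of "\<one>\<^bsub>S\<^esub>" r "\<one>\<^bsub>T\<^esub>"] by (simp add: iota_eq)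

text \<open>The tensor product is a quotient of a free abelian group, so sums and additive inverses
  of pure tensors reach everything; the inverses account for negative integer coefficients.\<close>

lemma ext_induct:
 assumes "\<zero>\<^bsub>Q\<^esub> \<in> U" "!!s t. s \<in> U ==> t \<in> U ==> s \<oplus>\<^bsub>Q\<^esub> t \<in> U" "!!s. s \<in> U ==> \<ominus>\<^bsub>Q\<^esub> s \<in> U"
  and "!!s t. s \<in> carrier S ==> t \<in> carrier T ==> \<iota> t \<otimes>\<^bsub>Q\<^esub> i s \<in> U" and U: "U \<subseteq> carrier Q"
 shows "carrier Q \<subseteq> U"
proof -
 have int: "[(n::int)] \<cdot>\<^bsub>Q\<^esub> x \<in> U" if x: "x \<in> U" for x n
 proof -
  have xc: "x \<in> carrier Q" using x U by auto
  have n: "[n] \<cdot>\<^bsub>Q\<^esub> x \<in> U" for n :: nat by (induction n) (use assms(1,2) x in auto)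
  show ?thesis
  proof (cases n)
   case (neg m)
   then show ?thesis using n[of "Suc m"] assms(3) xc by (simp add: q.S.int_mult_minus q.S.int_mult_of_nat del: of_nat_Suc q.S.add.nat_pow_Suc)
  qed (use n in \<open>simp add: q.S.int_mult_of_nat\<close>)
 qed
 have single: "single int_ring (s, t) n = [n] \<cdot>\<^bsub>Z\<^esub> e s t" if st: "s \<in> carrier S" "t \<in> carrier T" for s t n
 proof -
  have nat: "single int_ring (s, t) (int k) = [k] \<cdot>\<^bsub>Z\<^esub> e s t" for k
  proof (induction k)
   case 0
   show ?case by (auto simp: single_def fun_eq_iff Z.mr_zero)
  next
   case (Suc k)
   then show ?case using Z.single_add[of "int k" 1 "(s, t)"] by (simp add: add.commute)
  qed
  show ?thesis
  proof (cases n)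
   case (neg m)
   have "single int_ring (s, t) (- int (Suc m)) \<oplus>\<^bsub>Z\<^esub> single int_ring (s, t) (int (Suc m)) = \<zero>\<^bsub>Z\<^esub>"
    by (subst Z.single_add) (auto simp: single_def fun_eq_iff Z.mr_zero)
   moreover have "single int_ring (s, t) k \<in> carrier Z" for k using st by (intro Z.single_closed) auto
   ultimately have "single int_ring (s, t) (- int (Suc m)) = \<ominus>\<^bsub>Z\<^esub> single int_ring (s, t) (int (Suc m))"
    using ZR.minus_equality by metis
   then show ?thesis using neg nat[of "Suc m"] st
    by (simp add: ZR.int_mult_minus ZR.int_mult_of_nat del: of_nat_Suc ZR.add.nat_pow_Suc)
  qed (use nat in \<open>simp add: ZR.int_mult_of_nat\<close>)
 qed
 let ?V = "{z \<in> carrier Z. I +>\<^bsub>Z\<^esub> z \<in> U}"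
 have V: "single int_ring m n \<in> ?V" if m: "m \<in> carrier (S \<times>\<times> T)" for m and n :: int
 proof -
  have "m \<in> carrier S \<times> carrier T" using m by simp
  then obtain s t where st: "m = (s, t)" "s \<in> carrier S" "t \<in> carrier T" by blast
  have 1: "I +>\<^bsub>Z\<^esub> ([n] \<cdot>\<^bsub>Z\<^esub> e s t) = [n] \<cdot>\<^bsub>Q\<^esub> (I +>\<^bsub>Z\<^esub> e s t)"
   using e_closed[OF st(2,3)] by (rule q.hom_int_mult)
  have 2: "[n] \<cdot>\<^bsub>Q\<^esub> (I +>\<^bsub>Z\<^esub> e s t) \<in> U"
  proof -
   have "\<iota> t \<otimes>\<^bsub>Q\<^esub> i s \<in> U" using st(2,3) by (rule assms(4))
   then have "I +>\<^bsub>Z\<^esub> e s t \<in> U" by (rule back_subst[OF _ i_iota(1)[OF st(2,3), symmetric]])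
   then show ?thesis by (rule int)
  qed
  show ?thesis
   unfolding st(1) single[OF st(2,3), of n] mem_Collect_eq 1
   using 2 ZR.int_mult_closed[OF e_closed[OF st(2,3)]] by blast
 qed
 have "carrier Z \<subseteq> ?V"
  by (rule Z.mr_induct) (use assms(1,2) V in auto)
 then show ?thesis using I.quot_map_surj unfolding Q_eq by blast
qed

lemma ext_universal:
 assumes "ring_hom_ring S B f" "ring_hom_ring T B g"
  and comm: "!!s t. s \<in> carrier S ==> t \<in> carrier T ==> f s \<otimes>\<^bsub>B\<^esub> g t = g t \<otimes>\<^bsub>B\<^esub> f s"
  and fg: "!!r. r \<in> carrier R ==> f (snd A r) = g (snd K r)"
 shows "\<exists>h. ring_hom_ring Q B h & (\<forall>s\<in>carrier S. h (i s) = f s) & (\<forall>t\<in>carrier T. h (\<iota> t) = g t)"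
proof -
 interpret f: ring_hom_ring S B f by fact
 interpret g: ring_hom_ring T B g by fact
 define \<theta> where "\<theta> n = [(n::int)] \<cdot>\<^bsub>B\<^esub> \<one>\<^bsub>B\<^esub>" for n
 define \<phi> where "\<phi> z = f (fst z) \<otimes>\<^bsub>B\<^esub> g (snd z)" for z
 have "\<theta> \<in> ring_hom int_ring B"
 proof (rule ring_hom_memI)
  fix x y :: int
  have "\<theta> (x * y) = \<theta> x \<otimes>\<^bsub>B\<^esub> \<theta> y"
   by (simp add: \<theta>_def f.S.int_mult_mult f.S.add_pow_ldistr_int)
  then show "\<theta> (x \<otimes>\<^bsub>int_ring\<^esub> y) = \<theta> x \<otimes>\<^bsub>B\<^esub> \<theta> y" by simp
 qed (auto simp: \<theta>_def f.S.int_mult_add)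
 then interpret \<theta>: ring_hom_ring int_ring B \<theta>
  using int_is_cring f.S.ring_axioms by (intro ring_hom_ringI2) (auto simp: cring_def)
 interpret E: monoid_algebra_hom int_ring "S \<times>\<times> T" B \<theta> \<phi>
 proof unfold_locales
  fix z w assume zw: "z \<in> carrier (S \<times>\<times> T)" "w \<in> carrier (S \<times>\<times> T)"
  obtain s t s' t' where st: "z = (s, t)" "w = (s', t')" by (cases z, cases w) auto
  have "g t \<otimes>\<^bsub>B\<^esub> (f s' \<otimes>\<^bsub>B\<^esub> g t') = f s' \<otimes>\<^bsub>B\<^esub> (g t \<otimes>\<^bsub>B\<^esub> g t')"
   using zw st comm[of s' t] by (simp add: f.S.m_assoc[symmetric])
  then show "\<phi> (z \<otimes>\<^bsub>S \<times>\<times> T\<^esub> w) = \<phi> z \<otimes>\<^bsub>B\<^esub> \<phi> w"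
   using zw st by (simp add: \<phi>_def f.S.m_assoc)
 next
  fix r :: int and z assume "r \<in> carrier int_ring" "z \<in> carrier (S \<times>\<times> T)"
  moreover obtain s t where st: "z = (s, t)" by (cases z) auto
  ultimately have "\<phi> z \<in> carrier B" by (simp add: \<phi>_def)
  then show "\<theta> r \<otimes>\<^bsub>B\<^esub> \<phi> z = \<phi> z \<otimes>\<^bsub>B\<^esub> \<theta> r" by (simp add: \<theta>_def f.S.mult_int)
 qed (auto simp: \<phi>_def)
 interpret E: ring_hom_ring Z B E.E by (rule E.eval_hom)
 have ee: "E.E (e s t) = f s \<otimes>\<^bsub>B\<^esub> g t" if "s \<in> carrier S" "t \<in> carrier T" for s t
  using that by (subst E.eval_single) (auto simp: \<theta>_def \<phi>_def)
 have "tensor_relations R A K \<subseteq> a_kernel Z B E.E"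
 proof
  fix z assume z: "z \<in> tensor_relations R A K"
  have "E.E z = \<zero>\<^bsub>B\<^esub>" using z unfolding rel_eq
   by (auto simp: E.hom_diff ee f.S.l_distr f.S.r_distr fg f.S.m_assoc f.S.r_right_minus_eq)
  then show "z \<in> a_kernel Z B E.E" using z rel_closed unfolding a_kernel_def' by blast
 qed
 then have "I \<subseteq> a_kernel Z B E.E" by (rule ZR.genideal_minimal[OF E.kernel_is_ideal])
 then have "E.E r = \<zero>\<^bsub>B\<^esub>" if "r \<in> I" for r using that unfolding a_kernel_def' by blast
 then obtain h where h: "ring_hom_ring Q B h" "!!z. z \<in> carrier Z ==> h (I +>\<^bsub>Z\<^esub> z) = E.E z"
  using quotient_lift[OF I.ideal_axioms E.ring_hom_ring_axioms] unfolding Q_eq by blast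
 then show ?thesis by (intro exI[of _ h]) (auto simp: ee iota_eq)
qed

end

section \<open>Recognising symbol algebras by generators and relations\<close>

lemma (in ring_hom_ring) hom_Units: "x \<in> Units R ==> h x \<in> Units S"
proof -
 assume x: "x \<in> Units R"
 then obtain y where y: "x \<in> carrier R" "y \<in> carrier R" "y \<otimes> x = \<one>" "x \<otimes> y = \<one>" by (auto simp: Units_def)
 then have "h y \<otimes>\<^bsub>S\<^esub> h x = \<one>\<^bsub>S\<^esub>" "h x \<otimes>\<^bsub>S\<^esub> h y = \<one>\<^bsub>S\<^esub>" using hom_mult hom_one by metis+
 then show ?thesis using y unfolding Units_def by (auto intro!: bexI[of _ "h y"])
qed

lemma (in ring_hom_ring) hom_symbol_pair:
 assumes "symbol_pair R p x y" shows "symbol_pair S p (h x) (h y)"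
proof -
 interpret symbol_pair R p x y by fact
 interpret S: char_p_ring S p by (rule hom_char_p) unfold_locales
 show ?thesis
 proof unfold_locales
  show "h y \<otimes>\<^bsub>S\<^esub> h x = (h x \<oplus>\<^bsub>S\<^esub> \<one>\<^bsub>S\<^esub>) \<otimes>\<^bsub>S\<^esub> h y"
   using arg_cong[OF YX, of h] by simp
 qed (use hom_Units Y_unit in auto)
qed

lemma (in ring_hom_ring) hom_mon:
 assumes "symbol_pair R p x y"
 shows "h (symbol_pair.mon R x y z) = symbol_pair.mon S (h x) (h y) z"
proof -
 interpret symbol_pair R p x y by fact
 interpret S: symbol_pair S p "h x" "h y" by (rule hom_symbol_pair[OF assms])
 show ?thesis by (simp add: mon_def S.mon_def hom_falling hom_nat_pow)
qed

lemma (in ring_hom_ring) image_subring: "subring (h ` carrier R) S"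
proof (rule S.subringI)
 show "\<one>\<^bsub>S\<^esub> \<in> h ` carrier R" using hom_one by (metis R.one_closed image_eqI)
 show "\<ominus>\<^bsub>S\<^esub> u \<in> h ` carrier R" if "u \<in> h ` carrier R" for u using that by (metis (no_types, lifting) R.a_inv_closed hom_a_inv image_iff)
 show "u \<otimes>\<^bsub>S\<^esub> w \<in> h ` carrier R" "u \<oplus>\<^bsub>S\<^esub> w \<in> h ` carrier R" if "u \<in> h ` carrier R" "w \<in> h ` carrier R" for u w
  using that by (metis (no_types, lifting) R.m_closed hom_mult image_iff, metis (no_types, lifting) R.a_closed hom_add image_iff)
qed auto

text \<open>A symbol algebra recognised inside an algebra: \<open>x\<close> and \<open>y\<close> satisfy the defining relations and
 generate.  (No freeness is built in; the zero ring qualifies.)\<close>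

definition symbol_system ::
  "nat => 'a ring => ('a, 'b) alg => 'a => 'a => 'b => 'b => bool" where
 "symbol_system p R A a g x y \<longleftrightarrow> ring_hom_ring R (fst A) (snd A) & symbol_pair (fst A) p x y
   & a \<in> carrier R & g \<in> carrier R
   & (\<forall>r \<in> carrier R. symbol_pair.central_elt (fst A) x y (snd A r))
   & x [^]\<^bsub>fst A\<^esub> p \<ominus>\<^bsub>fst A\<^esub> x = snd A a & y [^]\<^bsub>fst A\<^esub> p = snd A g
   & carrier (fst A) = ring.lspan (fst A) (snd A ` carrier R) (symbol_pair.mon (fst A) x y) ({..<p} \<times> {..<p})"

text \<open>\<open>h\<close> maps the monomials in \<open>x\<close>, \<open>y\<close> to those in
  \<open>h x\<close>, \<open>h y\<close>, which are independent over elements commuting with both.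
  Injectivity on all of \<open>A\<close> is thereby reduced to the scalars.\<close>

lemma symbol_system_injective:
 assumes sys: "symbol_system p R A a g x y" and h: "ring_hom_ring (fst A) B h"
  and c: "!!r. r \<in> carrier R ==> symbol_pair.central_elt B (h x) (h y) (h (snd A r))"
  and inj: "!!r. r \<in> carrier R ==> h (snd A r) = \<zero>\<^bsub>B\<^esub> ==> snd A r = \<zero>\<^bsub>fst A\<^esub>"
 shows "inj_on h (carrier (fst A))"
proof -
 interpret x: symbol_pair "fst A" p x y using sys by (simp add: symbol_system_def)
 interpret \<sigma>: ring_hom_ring R "fst A" "snd A" using sys by (simp add: symbol_system_def)
 interpret h: ring_hom_ring "fst A" B h by fact
 interpret B: symbol_pair B p "h x" "h y" by (rule h.hom_symbol_pair) unfold_locales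
 have "z = \<zero>\<^bsub>fst A\<^esub>" if z: "z \<in> carrier (fst A)" "h z = \<zero>\<^bsub>B\<^esub>" for z
 proof -
  obtain d where d: "d \<in> x.I \<rightarrow> snd A ` carrier R" "z = (\<Oplus>\<^bsub>fst A\<^esub>i\<in>x.I. d i \<otimes>\<^bsub>fst A\<^esub> x.mon i)"
   using z(1) sys by (auto simp: symbol_system_def x.lspan_def)
  have dr: "\<exists>r\<in>carrier R. d i = snd A r" if "i \<in> x.I" for i using d(1) that by auto
  have dc: "d i \<in> carrier (fst A)" if "i \<in> x.I" for i using dr[OF that] by auto
  have "h z = (\<Oplus>\<^bsub>B\<^esub>i\<in>x.I. h (d i \<otimes>\<^bsub>fst A\<^esub> x.mon i))"
   unfolding d(2) using dc by (intro h.hom_finsum') auto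
  also have "\<dots> = (\<Oplus>\<^bsub>B\<^esub>i\<in>x.I. h (d i) \<otimes>\<^bsub>B\<^esub> B.mon i)"
   using dc h.hom_mon[OF x.symbol_pair_axioms] by (intro h.S.finsum_cong') auto
  finally have "(\<Oplus>\<^bsub>B\<^esub>i\<in>x.I. h (d i) \<otimes>\<^bsub>B\<^esub> B.mon i) = \<zero>\<^bsub>B\<^esub>" using z by simp
  moreover have "B.central_elt (h (d i))" if "i \<in> x.I" for i using dr[OF that] c by auto
  ultimately have "\<forall>i\<in>x.I. h (d i) = \<zero>\<^bsub>B\<^esub>" by (intro B.mon_indep)
  then have d0: "d i = \<zero>\<^bsub>fst A\<^esub>" if "i \<in> x.I" for i using dr[OF that] inj that by metis
  have "z = (\<Oplus>\<^bsub>fst A\<^esub>i\<in>x.I. \<zero>\<^bsub>fst A\<^esub>)"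
   unfolding d(2) using d0 by (intro x.finsum_cong') auto
  then show ?thesis by simp
 qed
 then have "a_kernel (fst A) B h = {\<zero>\<^bsub>fst A\<^esub>}" unfolding a_kernel_def' by auto
 then show ?thesis by (rule h.trivial_ker_imp_inj)
qed

text \<open>The span of the \<open>p^2\<close> monomials contains the scalars and is stable under
  left multiplication by both generators, so it is everything by \<open>sym_induct\<close>. The
  generator \<open>gy\<close> is a unit because its \<open>p\<close>-th power is.\<close>

lemma symbol_presentation_system:
 assumes "char_p_ring F p" "cring F" "a \<in> carrier F" "b \<in> Units F"
 shows "symbol_system p F (symbol_algebra p F a b) a b (symbol_presentation.gx F p a b) (symbol_presentation.gy F p a b)"
proof -
 interpret F: cring F by fact
 interpret symbol_presentation F p a b using assms by unfold_locales auto
 interpret F: char_p_ring F p by fact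
 interpret i: ring_hom_ring F Sym ins by (rule ins_hom)
 interpret S: char_p_ring Sym p by (rule i.hom_char_p[OF assms(1)])
 interpret P: symbol_pair Sym p gx gy
 proof unfold_locales
  have "gy [^]\<^bsub>Sym\<^esub> p \<in> Units Sym" using i.hom_Units[OF assms(4)] by (simp add: sym_rel)
  then show "gy \<in> Units Sym" by (rule q.S.Units_of_pow[OF g_closed(2) _ S.p_pos])
 qed (auto simp: sym_rel)
 have K: "subring (ins ` carrier F) Sym" by (rule i.image_subring)
 have c: "P.central_elt k" if "k \<in> ins ` carrier F" for k
  using that ins_central by (auto simp: P.central_elt_def)
 have fin: "finite P.I" "P.mon \<in> P.I \<rightarrow> carrier Sym" by auto
 have r: "gx [^]\<^bsub>Sym\<^esub> p \<ominus>\<^bsub>Sym\<^esub> gx \<in> ins ` carrier F" "gy [^]\<^bsub>Sym\<^esub> p \<in> ins ` carrier F"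
  by (auto simp: sym_rel)
 note sp = P.symbol_pair_mon_span[OF K c r]
 note L = q.S.lspan_closed[OF K fin] q.S.lspan_add[OF K fin] q.S.lspan_smult[OF K fin] q.S.lspan_zero[OF K fin]
 let ?L = "q.S.lspan (ins ` carrier F) P.mon P.I"
 have "carrier Sym \<subseteq> ?L"
 proof (rule sym_induct)
  show "ins d \<in> ?L" if "d \<in> carrier F" for d
   using L(3)[OF _ sp(3), of "ins d"] that by simp
 qed (use L sp in auto)
 then have "carrier Sym = ?L" using L(1) by blast
 then show ?thesis unfolding symbol_system_def
  using i.ring_hom_ring_axioms P.symbol_pair_axioms c assms(3) by (auto simp: sym_rel)
qed

text \<open>Expanding \<open>s\<close> in the monomials of \<open>A\<close> and moving the
  coefficients across by \<open>i_structure\<close> puts \<open>i s\<close> into the span over the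
  new scalars; \<open>ext_induct\<close> extends this to the whole tensor product.\<close>

lemma symbol_system_ext:
 assumes sys: "symbol_system p R A a g x y" and K: "cring (fst K)" "ring_hom_ring R (fst K) (snd K)"
 shows "symbol_system p (fst K) (scalar_ext R A K) (snd K a) (snd K g)
  (scalar_extension.i R A K x) (scalar_extension.i R A K y)"
proof -
 interpret x: symbol_pair "fst A" p x y using sys by (simp add: symbol_system_def)
 interpret \<sigma>: ring_hom_ring R "fst A" "snd A" using sys by (simp add: symbol_system_def)
 interpret T: cring "fst K" by fact
 interpret \<kappa>: ring_hom_ring R "fst K" "snd K" by fact
 interpret scalar_extension R A K by unfold_locales
 interpret i: ring_hom_ring S Q i by (rule i_hom)
 interpret io: ring_hom_ring T Q \<iota> by (rule iota_hom)
 interpret P: symbol_pair Q p "i x" "i y" by (rule i.hom_symbol_pair) unfold_locales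
 have ag: "a \<in> carrier R" "g \<in> carrier R" using sys by (auto simp: symbol_system_def)
 have rel: "i x [^]\<^bsub>Q\<^esub> p \<ominus>\<^bsub>Q\<^esub> i x = \<iota> (snd K a)" "i y [^]\<^bsub>Q\<^esub> p = \<iota> (snd K g)"
 proof -
  have "i (x [^]\<^bsub>S\<^esub> p \<ominus>\<^bsub>S\<^esub> x) = i (snd A a)" "i (y [^]\<^bsub>S\<^esub> p) = i (snd A g)"
   using sys by (simp_all add: symbol_system_def)
  then show "i x [^]\<^bsub>Q\<^esub> p \<ominus>\<^bsub>Q\<^esub> i x = \<iota> (snd K a)" "i y [^]\<^bsub>Q\<^esub> p = \<iota> (snd K g)"
   unfolding i_structure[OF ag(1)] i_structure[OF ag(2)]
   using i.hom_diff[of "x [^]\<^bsub>S\<^esub> p" x] i.hom_nat_pow[of x p] i.hom_nat_pow[of y p] by simp_all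
 qed
 have K': "subring (\<iota> ` carrier T) Q" by (rule io.image_subring)
 have c: "P.central_elt k" if "k \<in> \<iota> ` carrier T" for k
 proof -
  obtain t where t: "t \<in> carrier T" "k = \<iota> t" using \<open>k \<in> \<iota> ` carrier T\<close> by blast
  show ?thesis unfolding P.central_elt_def t(2)
   using i_iota_commute[OF x.u t(1)] i_iota_commute[OF x.v t(1)] io.hom_closed[OF t(1)] by blast
 qed
 have fin: "finite P.I" "P.mon \<in> P.I \<rightarrow> carrier Q" by auto
 note L = q.S.lspan_closed[OF K' fin] q.S.lspan_add[OF K' fin] q.S.lspan_smult[OF K' fin] q.S.lspan_zero[OF K' fin] q.S.lspan_minus[OF K' fin]
 let ?L = "q.S.lspan (\<iota> ` carrier T) P.mon P.I"
 have iL: "i s \<in> ?L" if s: "s \<in> carrier S" for s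
 proof -
  obtain d where d: "d \<in> x.I \<rightarrow> snd A ` carrier R" "s = (\<Oplus>\<^bsub>S\<^esub>z\<in>x.I. d z \<otimes>\<^bsub>S\<^esub> x.mon z)"
   using s sys by (auto simp: symbol_system_def x.lspan_def)
  have dr: "\<exists>r\<in>carrier R. d z = snd A r" if "z \<in> x.I" for z using d(1) that by auto
  have dc: "d z \<in> carrier S" if "z \<in> x.I" for z using dr[OF that] by auto
  have di: "i (d z) \<in> \<iota> ` carrier T" if zI: "z \<in> x.I" for z
  proof -
   obtain r where r: "r \<in> carrier R" "d z = snd A r" using dr[OF zI] by blast
   then have "i (d z) = \<iota> (snd K r)" using i_structure by simp
   then show ?thesis using \<kappa>.hom_closed[OF r(1)] by blast
  qed
  have im: "i (d z \<otimes>\<^bsub>S\<^esub> x.mon z) = i (d z) \<otimes>\<^bsub>Q\<^esub> P.mon z" if zI: "z \<in> x.I" for z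
   unfolding i.hom_mon[OF x.symbol_pair_axioms, symmetric]
   by (rule i.hom_mult[OF dc[OF zI] x.mon_closed])
  have "i s = (\<Oplus>\<^bsub>Q\<^esub>z\<in>x.I. i (d z \<otimes>\<^bsub>S\<^esub> x.mon z))"
   unfolding d(2) by (rule i.hom_finsum') (use dc in auto)
  moreover have "\<dots> = (\<Oplus>\<^bsub>Q\<^esub>z\<in>x.I. i (d z) \<otimes>\<^bsub>Q\<^esub> P.mon z)"
   by (rule q.S.finsum_cong'[OF refl _ im]) (auto intro!: q.S.m_closed i.hom_closed dc)
  moreover have "\<dots> \<in> ?L" by (rule q.S.lspanI) (use di in auto)
  ultimately show ?thesis by (simp only:)
 qed
 have "carrier Q \<subseteq> ?L"
 proof (rule ext_induct)
  show "\<iota> t \<otimes>\<^bsub>Q\<^esub> i s \<in> ?L" if "s \<in> carrier S" "t \<in> carrier T" for s t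
   using that iL L(3) by blast
 qed (rule L; assumption)+
 then have "carrier Q = ?L" using L(1) by blast
 then show ?thesis unfolding symbol_system_def
  using io.ring_hom_ring_axioms P.symbol_pair_axioms c rel \<kappa>.hom_closed[OF ag(1)] \<kappa>.hom_closed[OF ag(2)] by blast
qed

text \<open>By construction the universal property belongs to the literally presented algebra. The
  map from it to \<open>A\<close> is injective by independence of the monomials and surjective
  because they span, so \<open>A\<close> inherits the property for every presentation recognised
  inside it.\<close>

lemma symbol_system_universal:
 assumes sys: "symbol_system p F A a g x y" and F: "field F" and one: "\<one>\<^bsub>fst A\<^esub> ~= \<zero>\<^bsub>fst A\<^esub>" and g: "g \<in> Units F"
  and \<tau>: "ring_hom_ring F B \<tau>" and x0: "x0 \<in> carrier B" and y0: "y0 \<in> carrier B"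
  and rel: "x0 [^]\<^bsub>B\<^esub> p \<ominus>\<^bsub>B\<^esub> x0 = \<tau> a" "y0 [^]\<^bsub>B\<^esub> p = \<tau> g" "y0 \<otimes>\<^bsub>B\<^esub> x0 = (x0 \<oplus>\<^bsub>B\<^esub> \<one>\<^bsub>B\<^esub>) \<otimes>\<^bsub>B\<^esub> y0"
  and central: "!!c. c \<in> carrier F ==> \<tau> c \<otimes>\<^bsub>B\<^esub> x0 = x0 \<otimes>\<^bsub>B\<^esub> \<tau> c" "!!c. c \<in> carrier F ==> \<tau> c \<otimes>\<^bsub>B\<^esub> y0 = y0 \<otimes>\<^bsub>B\<^esub> \<tau> c"
 shows "\<exists>h. ring_hom_ring (fst A) B h & h x = x0 & h y = y0 & (\<forall>c\<in>carrier F. h (snd A c) = \<tau> c)"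
proof -
 interpret F: field F by fact
 interpret x: symbol_pair "fst A" p x y using sys by (simp add: symbol_system_def)
 interpret \<sigma>: ring_hom_ring F "fst A" "snd A" using sys by (simp add: symbol_system_def)
 have a: "a \<in> carrier F" "g \<in> carrier F" using sys by (auto simp: symbol_system_def)
 have \<sigma>inj: "r = \<zero>\<^bsub>F\<^esub>" if "r \<in> carrier F" "snd A r = \<zero>\<^bsub>fst A\<^esub>" for r
 proof (rule ccontr)
  assume "r ~= \<zero>\<^bsub>F\<^esub>"
  then have "r \<in> Units F" using that F.field_Units by blast
  then have "\<one>\<^bsub>fst A\<^esub> = snd A (inv\<^bsub>F\<^esub> r) \<otimes>\<^bsub>fst A\<^esub> snd A r" using \<sigma>.hom_mult[of "inv\<^bsub>F\<^esub> r" r] that by simp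
  then show False using that one \<open>r \<in> Units F\<close> by simp
 qed
 have Fp: "char_p_ring F p"
 proof unfold_locales
  show "Factorial_Ring.prime p" by (rule x.prime_p)
  have "snd A ([int p] \<cdot>\<^bsub>F\<^esub> \<one>\<^bsub>F\<^esub>) = \<zero>\<^bsub>fst A\<^esub>" by (subst \<sigma>.hom_int_mult) auto
  then have "[int p] \<cdot>\<^bsub>F\<^esub> \<one>\<^bsub>F\<^esub> = \<zero>\<^bsub>F\<^esub>" by (intro \<sigma>inj) auto
  then show "[p] \<cdot>\<^bsub>F\<^esub> \<one>\<^bsub>F\<^esub> = \<zero>\<^bsub>F\<^esub>" by (simp add: F.int_mult_of_nat)
 qed
 interpret P: symbol_presentation F p a g using a by unfold_locales
 let ?S = "symbol_algebra p F a g"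
 have S: "symbol_system p F ?S a g P.gx P.gy"
  using Fp F.cring_axioms a g by (intro symbol_presentation_system) auto
 have c: "x.central_elt (snd A c)" if "c \<in> carrier F" for c using sys that by (simp add: symbol_system_def)
 obtain f where f: "ring_hom_ring (fst ?S) (fst A) f" "f P.gx = x" "f P.gy = y" "!!c. c \<in> carrier F ==> f (snd ?S c) = snd A c"
  using P.sym_universal[OF \<sigma>.ring_hom_ring_axioms x.u x.v] sys x.YX c
  by (auto simp: symbol_system_def x.central_elt_def)
 interpret f: ring_hom_ring "fst ?S" "fst A" f by fact
 interpret S\<sigma>: ring_hom_ring F "fst ?S" "snd ?S" by (rule P.ins_hom)
 have "inj_on f (carrier (fst ?S))"
 proof (rule symbol_system_injective[OF S f(1)])
  have "x.central_elt (f (snd ?S r)) " if "r \<in> carrier F" for r using that f(4) c by simp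
  then show "symbol_pair.central_elt (fst A) (f P.gx) (f P.gy) (f (snd ?S r))" if "r \<in> carrier F" for r
   unfolding f(2,3) using that .
  show "snd ?S r = \<zero>\<^bsub>fst ?S\<^esub>" if "r \<in> carrier F" "f (snd ?S r) = \<zero>\<^bsub>fst A\<^esub>" for r
   using that f(4) \<sigma>inj S\<sigma>.hom_zero by metis
 qed
 moreover have "f ` carrier (fst ?S) = carrier (fst A)"
 proof
  show "f ` carrier (fst ?S) \<subseteq> carrier (fst A)" by auto
  have U: "subring (f ` carrier (fst ?S)) (fst A)" by (rule f.image_subring)
  have xy: "x \<in> f ` carrier (fst ?S)" "y \<in> f ` carrier (fst ?S)" using f(2,3) P.g_closed by (metis image_eqI)+
  have sc: "snd A c \<in> f ` carrier (fst ?S)" if "c \<in> carrier F" for c using f(4)[OF that] S\<sigma>.hom_closed[OF that] by (metis image_eqI)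
  have int: "[int n] \<cdot>\<^bsub>fst A\<^esub> \<one>\<^bsub>fst A\<^esub> \<in> f ` carrier (fst ?S)" for n
   using sc[of "[int n] \<cdot>\<^bsub>F\<^esub> \<one>\<^bsub>F\<^esub>"] by (simp add: \<sigma>.hom_int_mult)
  have "x.falling x n \<in> f ` carrier (fst ?S)" for n
   by (induction n) (use subringE(3,6)[OF U] x.subring_diff_closed[OF U xy(1) int] in \<open>auto simp: x.falling_Suc\<close>)
  then have "x.mon z \<in> f ` carrier (fst ?S)" for z
   using subringE(6)[OF U] x.subring_pow_closed[OF U xy(2)] by (auto simp: x.mon_def)
  then have "x.lspan (snd A ` carrier F) x.mon x.I \<subseteq> f ` carrier (fst ?S)"
   using subringE(1,2,6,7)[OF U] sc
   by (intro x.lspan_least[OF \<sigma>.image_subring]) auto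
  then show "carrier (fst A) \<subseteq> f ` carrier (fst ?S)" using sys by (simp add: symbol_system_def)
 qed
 ultimately have iso: "f \<in> ring_iso (fst ?S) (fst A)"
  using f.homh by (auto simp: ring_iso_def bij_betw_def)
 let ?f = "inv_into (carrier (fst ?S)) f"
 have inv: "?f \<in> ring_iso (fst A) (fst ?S)" by (rule ring_iso_set_sym[OF P.Sym_ring iso])
 obtain h where h: "ring_hom_ring (fst ?S) B h" "h P.gx = x0" "h P.gy = y0" "!!c. c \<in> carrier F ==> h (snd ?S c) = \<tau> c"
  using P.sym_universal[OF \<tau> x0 y0 rel central] by auto
 interpret h: ring_hom_ring "fst ?S" B h by fact
 have if': "?f (f s) = s" if "s \<in> carrier (fst ?S)" for s
  using that iso by (auto simp: ring_iso_def bij_betw_def)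
 have "h \<circ> ?f \<in> ring_hom (fst A) B"
  using inv h.homh by (intro ring_hom_trans[of _ _ "fst ?S"]) (auto simp: ring_iso_def)
 then have "ring_hom_ring (fst A) B (h \<circ> ?f)" using x.ring_axioms h.S.ring_axioms by (intro ring_hom_ringI2)
 moreover have "(h \<circ> ?f) x = x0" "(h \<circ> ?f) y = y0" using if' P.g_closed f(2,3) h(2,3) by (metis comp_apply)+
 moreover have "(h \<circ> ?f) (snd A c) = \<tau> c" if "c \<in> carrier F" for c
  using if'[of "snd ?S c"] f(4)[OF that] h(4)[OF that] that by simp
 ultimately show ?thesis by blast
qed

text \<open>Matrices satisfying the relations give a map from \<open>A\<close>, which extends over
  \<open>L\<close> and then over \<open>N\<close> by the universal properties. It is injective by
  \<open>symbol_system_injective\<close> and surjective because the pair generates. \<open>N\<close>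
  is a commutative ring rather than a field, as Artin-Schreier algebras may be split.\<close>

lemma symbol_system_splits:
 assumes sys: "symbol_system p F A a g x y" and F: "field F" and one: "\<one>\<^bsub>fst A\<^esub> ~= \<zero>\<^bsub>fst A\<^esub>" and g: "g \<in> Units F"
  and L: "cring (fst L)" "ring_hom_ring F (fst L) (snd L)"
  and N: "cring (fst N)" "ring_hom_ring (fst L) (fst N) (snd N)" "split_matrices (fst N) p"
  and XY: "split_matrices.splitting_pair (fst N) p (snd N (snd L a)) (snd N (snd L g)) x0 y0"
 shows "splits p (fst L) N (scalar_ext F A L)"
proof -
 interpret F: field F by fact
 interpret x: symbol_pair "fst A" p x y using sys by (simp add: symbol_system_def)
 interpret \<sigma>: ring_hom_ring F "fst A" "snd A" using sys by (simp add: symbol_system_def)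
 interpret T: cring "fst L" by fact
 interpret \<kappa>: ring_hom_ring F "fst L" "snd L" by fact
 interpret Nr: cring "fst N" by fact
 interpret \<nu>: ring_hom_ring "fst L" "fst N" "snd N" by fact
 interpret M: split_matrices "fst N" p by fact
 interpret E1: scalar_extension F A L by unfold_locales
 note sys1 = symbol_system_ext[OF sys L]
 interpret \<sigma>1: ring_hom_ring "fst L" "fst (scalar_ext F A L)" "snd (scalar_ext F A L)" by (rule E1.iota_hom)
 interpret E2: scalar_extension "fst L" "scalar_ext F A L" N by unfold_locales
 note sys2 = symbol_system_ext[OF sys1 N(1,2)]
 let ?x = "E2.i (E1.i x)" and ?y = "E2.i (E1.i y)"
 interpret XY: symbol_pair M.Mat p x0 y0 using XY by (simp add: M.splitting_pair_def)
 have scc: "M.sc t \<otimes>\<^bsub>M.Mat\<^esub> z = z \<otimes>\<^bsub>M.Mat\<^esub> M.sc t" if "t \<in> carrier (fst N)" "z \<in> carrier M.Mat" for t z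
  using that by (rule M.sc_central)
 have "M.sc \<circ> snd N \<in> ring_hom (fst L) M.Mat" by (rule ring_hom_trans[OF \<nu>.homh M.sc.homh])
 then have \<tau>1: "ring_hom_ring (fst L) M.Mat (M.sc \<circ> snd N)" by (intro ring_hom_ringI2) unfold_locales
 have "(M.sc \<circ> snd N) \<circ> snd L \<in> ring_hom F M.Mat"
  by (rule ring_hom_trans[OF \<kappa>.homh]) (use \<tau>1 ring_hom_ring.homh in blast)
 then have \<tau>: "ring_hom_ring F M.Mat ((M.sc \<circ> snd N) \<circ> snd L)" by (intro ring_hom_ringI2) unfold_locales
 obtain h0 where h0: "ring_hom_ring (fst A) M.Mat h0" "h0 x = x0" "h0 y = y0"
  "!!c. c \<in> carrier F ==> h0 (snd A c) = M.sc (snd N (snd L c))"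
  using symbol_system_universal[OF sys F one g \<tau> XY.u XY.v _ _ XY.YX] XY scc
  by (auto simp: M.splitting_pair_def)
 interpret h0: ring_hom_ring "fst A" M.Mat h0 by fact
 obtain h1 where h1: "ring_hom_ring E1.Q M.Mat h1" "!!s. s \<in> carrier (fst A) ==> h1 (E1.i s) = h0 s"
  "!!t. t \<in> carrier (fst L) ==> h1 (E1.\<iota> t) = M.sc (snd N t)"
  using E1.ext_universal[OF h0(1) \<tau>1] h0(4) scc[symmetric] by auto
 interpret h1: ring_hom_ring E1.Q M.Mat h1 by fact
 obtain h2 where h2: "ring_hom_ring E2.Q M.Mat h2" "!!s. s \<in> carrier E1.Q ==> h2 (E2.i s) = h1 s"
  "!!t. t \<in> carrier (fst N) ==> h2 (E2.\<iota> t) = M.sc t"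
  using E2.ext_universal[OF h1(1) M.sc.ring_hom_ring_axioms] h1(3) scc[symmetric] by auto
 interpret h2: ring_hom_ring E2.Q M.Mat h2 by fact
 interpret i1: ring_hom_ring "fst A" E1.Q E1.i by (rule E1.i_hom)
 have xy: "h2 ?x = x0" "h2 ?y = y0" using h2(2) h1(2) h0(2,3) by simp_all
 have "inj_on h2 (carrier E2.Q)"
 proof (rule symbol_system_injective[OF sys2 h2(1)])
  show "symbol_pair.central_elt M.Mat (h2 ?x) (h2 ?y) (h2 (snd (scalar_ext (fst L) (scalar_ext F A L) N) r))"
   if "r \<in> carrier (fst N)" for r
   unfolding xy h2(3)[OF that] XY.central_elt_def using scc that by auto
  show "E2.\<iota> r = \<zero>\<^bsub>E2.Q\<^esub>" if r: "r \<in> carrier (fst N)" "h2 (E2.\<iota> r) = \<zero>\<^bsub>M.Mat\<^esub>" for r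
  proof -
   interpret io2: ring_hom_ring "fst N" E2.Q E2.\<iota> by (rule E2.iota_hom)
   have "r = \<zero>\<^bsub>fst N\<^esub>" using r h2(3) M.sc_inj by metis
   then show ?thesis using io2.hom_zero by blast
  qed
 qed
 moreover have "h2 ` carrier E2.Q = carrier M.Mat"
 proof -
  interpret i2: ring_hom_ring E1.Q E2.Q E2.i by (rule E2.i_hom)
  interpret io2: ring_hom_ring "fst N" E2.Q E2.\<iota> by (rule E2.iota_hom)
  have "x0 \<in> h2 ` carrier E2.Q" "y0 \<in> h2 ` carrier E2.Q"
   using xy i2.hom_closed i1.hom_closed x.u x.v by (metis image_eqI)+
  moreover have "M.sc ` carrier (fst N) \<subseteq> h2 ` carrier E2.Q"
   using h2(3) io2.hom_closed by (metis image_eqI image_subsetI)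
  ultimately show ?thesis using XY h2.image_subring unfolding M.splitting_pair_def by blast
 qed
 ultimately have "h2 \<in> ring_iso E2.Q M.Mat" using h2.homh by (auto simp: ring_iso_def bij_betw_def)
 then show ?thesis unfolding splits_def alg_iso_def using h2(3) by blast
qed

section \<open>Dimensions of spans\<close>

context ring begin

context
 fixes K assumes K: "subfield K R"
begin

lemma Span_map_eq_lspan:
 "distinct xs ==> g \<in> set xs \<rightarrow> carrier R ==> Span K (map g xs) = lspan K g (set xs)"
proof (induction xs)
 case Nil
 then show ?case by (auto simp: lspan_def)
next
 case (Cons x xs)
 have Kc: "k \<in> carrier R" if "k \<in> K" for k using subfieldE(3)[OF K] that by auto
 have g: "g x \<in> carrier R" "!!z. z \<in> set xs ==> g z \<in> carrier R" using Cons.prems by auto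
 have IH: "Span K (map g xs) = lspan K g (set xs)" using Cons by auto
 have *: "(\<Oplus>z\<in>set (x # xs). c z \<otimes> g z) = c x \<otimes> g x \<oplus> (\<Oplus>z\<in>set xs. c z \<otimes> g z)"
  if "c \<in> set (x # xs) \<rightarrow> K" for c
  using that Cons.prems(1) g Kc by (simp add: Pi_def)
 show ?case
 proof (intro equalityI subsetI)
  fix v assume "v \<in> Span K (map g (x # xs))"
  then obtain k w where "k \<in> K" "w \<in> lspan K g (set xs)" "v = k \<otimes> g x \<oplus> w"
   using IH by (auto simp: line_extension_mem_iff)
  moreover then obtain c where c: "c \<in> set xs \<rightarrow> K" "w = (\<Oplus>z\<in>set xs. c z \<otimes> g z)" by (auto simp: lspan_def)
  ultimately have "c(x := k) \<in> set (x # xs) \<rightarrow> K" "v = k \<otimes> g x \<oplus> (\<Oplus>z\<in>set xs. (c(x := k)) z \<otimes> g z)"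
  proof -
   show "c(x := k) \<in> set (x # xs) \<rightarrow> K" using c \<open>k \<in> K\<close> by auto
   have "(\<Oplus>z\<in>set xs. (c(x := k)) z \<otimes> g z) = (\<Oplus>z\<in>set xs. c z \<otimes> g z)"
    using Cons.prems(1) c g Kc by (intro finsum_cong') (auto simp: Pi_def)
   then show "v = k \<otimes> g x \<oplus> (\<Oplus>z\<in>set xs. (c(x := k)) z \<otimes> g z)" using c \<open>v = k \<otimes> g x \<oplus> w\<close> by simp
  qed
  then have "v = (\<Oplus>z\<in>set (x # xs). (c(x := k)) z \<otimes> g z)" using *[of "c(x := k)"] by simp
  then show "v \<in> lspan K g (set (x # xs))" using \<open>c(x := k) \<in> set (x # xs) \<rightarrow> K\<close> lspanI by metis
 next
  fix v assume "v \<in> lspan K g (set (x # xs))"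
  then obtain c where c: "c \<in> set (x # xs) \<rightarrow> K" "v = (\<Oplus>z\<in>set (x # xs). c z \<otimes> g z)" unfolding lspan_def by blast
  then have "v = c x \<otimes> g x \<oplus> (\<Oplus>z\<in>set xs. c z \<otimes> g z)" "c x \<in> K" using *[OF c(1)] by auto
  moreover have "(\<Oplus>z\<in>set xs. c z \<otimes> g z) \<in> lspan K g (set xs)" using c(1) by (intro lspanI) auto
  ultimately show "v \<in> Span K (map g (x # xs))" using IH by (auto simp: line_extension_mem_iff)
 qed
qed

lemma independent_map_iff:
 assumes "distinct xs" "g \<in> set xs \<rightarrow> carrier R"
 shows "independent K (map g xs) \<longleftrightarrow>
  (\<forall>c \<in> set xs \<rightarrow> K. (\<Oplus>z\<in>set xs. c z \<otimes> g z) = \<zero> --> (\<forall>z\<in>set xs. c z = \<zero>))"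
 using assms
proof (induction xs)
 case Nil
 then show ?case by auto
next
 case (Cons x xs)
 have Ks: "subring K R" using subfieldE(1)[OF K] .
 have Kc: "k \<in> carrier R" if "k \<in> K" for k using subfieldE(3)[OF K] that by auto
 have g: "g x \<in> carrier R" "!!z. z \<in> set xs ==> g z \<in> carrier R" using Cons.prems by auto
 have x: "x \<notin> set xs" "distinct xs" using Cons.prems by auto
 have split: "(\<Oplus>z\<in>set (x # xs). c z \<otimes> g z) = c x \<otimes> g x \<oplus> (\<Oplus>z\<in>set xs. c z \<otimes> g z)"
  if "c \<in> set (x # xs) \<rightarrow> K" for c
  using that Cons.prems(1) g Kc by (simp add: Pi_def)
 have cl: "(\<Oplus>z\<in>set xs. c z \<otimes> g z) \<in> carrier R" if "c \<in> set xs \<rightarrow> K" for c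
  using that g Kc by (intro finsum_closed) auto
 have Span: "Span K (map g xs) = lspan K g (set xs)" using x g by (intro Span_map_eq_lspan) auto
 show ?case
 proof
  assume ind: "independent K (map g (x # xs))"
  then have 1: "g x \<notin> lspan K g (set xs)" "independent K (map g xs)"
   using independent_backwards[of K "g x" "map g xs"] Span by auto
  show "\<forall>c \<in> set (x # xs) \<rightarrow> K. (\<Oplus>z\<in>set (x # xs). c z \<otimes> g z) = \<zero> --> (\<forall>z\<in>set (x # xs). c z = \<zero>)"
  proof (intro ballI impI)
   fix c z assume c: "c \<in> set (x # xs) \<rightarrow> K" and sum: "(\<Oplus>z\<in>set (x # xs). c z \<otimes> g z) = \<zero>" and z: "z \<in> set (x # xs)"
   let ?s = "\<Oplus>z\<in>set xs. c z \<otimes> g z"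
   have c': "c \<in> set xs \<rightarrow> K" "c x \<in> K" using c by auto
   have s: "?s \<in> carrier R" "?s \<in> lspan K g (set xs)" using cl[OF c'(1)] lspanI[OF c'(1)] by auto
   have eq: "c x \<otimes> g x \<oplus> ?s = \<zero>" using sum split[OF c] by simp
   have cx: "c x = \<zero>"
   proof (rule ccontr)
    assume "c x ~= \<zero>"
    then have i: "inv (c x) \<in> K" "inv (c x) \<otimes> c x = \<one>" using subfield_m_inv[OF K, of "c x"] c'(2) by auto
    have "c x \<otimes> g x = \<ominus> ?s" using minus_equality[OF eq s(1) m_closed[OF Kc[OF c'(2)] g(1)]] by simp
    moreover have "g x = inv (c x) \<otimes> (c x \<otimes> g x)"
     using i(2) g(1) m_assoc[OF Kc[OF i(1)] Kc[OF c'(2)] g(1)] by simp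
    ultimately have gx: "g x = inv (c x) \<otimes> (\<ominus> ?s)" by simp
    have "inv (c x) \<otimes> (\<ominus> ?s) \<in> lspan K g (set xs)"
     using g by (intro lspan_smult[OF Ks _ _ i(1)] lspan_minus[OF Ks _ _ s(2)]) auto
    then show False using 1 unfolding gx[symmetric] Span by simp
   qed
   then have "?s = \<zero>" using eq g s by simp
   then have "\<forall>z\<in>set xs. c z = \<zero>" using 1(2) Cons.IH x g c' by auto
   then show "c z = \<zero>" using z cx by auto
  qed
 next
  assume triv: "\<forall>c \<in> set (x # xs) \<rightarrow> K. (\<Oplus>z\<in>set (x # xs). c z \<otimes> g z) = \<zero> --> (\<forall>z\<in>set (x # xs). c z = \<zero>)"
  have K01: "\<zero> \<in> K" "\<one> \<in> K" "\<ominus> \<one> \<in> K" "\<one> ~= \<zero>" using subringE(2,3,5)[OF Ks] subfieldE(6)[OF K] by auto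
  have cong: "(\<Oplus>z\<in>set xs. (c(x := k)) z \<otimes> g z) = (\<Oplus>z\<in>set xs. c z \<otimes> g z)" if "c \<in> set xs \<rightarrow> K" for c k
   using that x g Kc by (intro finsum_cong') (auto simp: Pi_def)
  have "g x \<notin> Span K (map g xs)"
  proof
   assume "g x \<in> Span K (map g xs)"
   then obtain c where c: "c \<in> set xs \<rightarrow> K" "g x = (\<Oplus>z\<in>set xs. c z \<otimes> g z)" unfolding Span lspan_def by blast
   let ?c = "c(x := \<ominus> \<one>)"
   have c1: "?c \<in> set (x # xs) \<rightarrow> K" using c K01 by auto
   have "(\<Oplus>z\<in>set (x # xs). ?c z \<otimes> g z) = \<ominus> \<one> \<otimes> g x \<oplus> g x"
    unfolding split[OF c1] cong[OF c(1)] using c(2) by simp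
   also have "\<dots> = \<zero>" using g by (simp add: l_minus l_neg)
   finally have "?c x = \<zero>" using triv c1 by (metis list.set_intros(1))
   then show False using K01 by (metis fun_upd_same add.inv_eq_1_iff one_closed)
  qed
  moreover have "independent K (map g xs)"
  proof -
   have "\<forall>z\<in>set xs. c z = \<zero>" if c: "c \<in> set xs \<rightarrow> K" "(\<Oplus>z\<in>set xs. c z \<otimes> g z) = \<zero>" for c
   proof -
    let ?c = "c(x := \<zero>)"
    have c1: "?c \<in> set (x # xs) \<rightarrow> K" using c K01 by auto
    have "(\<Oplus>z\<in>set (x # xs). ?c z \<otimes> g z) = \<zero>"
     unfolding split[OF c1] cong[OF c(1)] using c(2) g by simp
    then have "\<forall>z\<in>set (x # xs). ?c z = \<zero>" using triv c1 by blast
    then show ?thesis using x by (metis fun_upd_apply list.set_intros(2))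
   qed
   then show ?thesis using Cons.IH x g by auto
  qed
  ultimately show "independent K (map g (x # xs))" using g by (simp add: li_Cons)
 qed
qed

text \<open>Each vector in the span of its successors costs one dimension. The clause for equality
  turns a spanning list whose length is the dimension into an independent one.\<close>

lemma Span_dimension_le:
 "set Us \<subseteq> carrier R ==> \<exists>m\<le>length Us. dimension m K (Span K Us) & (m = length Us --> independent K Us)"
proof (induction Us)
 case Nil
 then show ?case by auto
next
 case (Cons u Us)
 then obtain m where m: "m \<le> length Us" "dimension m K (Span K Us)" "m = length Us --> independent K Us" by auto
 have u: "u \<in> carrier R" "set Us \<subseteq> carrier R" using Cons.prems by auto
 show ?case
 proof (cases "u \<in> Span K Us")
  case True
  have "Span K (u # Us) = Span K Us"
  proof
   show "Span K Us \<subseteq> Span K (u # Us)" by (rule mono_Span[OF K u(2) u(1)])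
   show "Span K (u # Us) \<subseteq> Span K Us"
    using True u Span_base_incl[OF K u(2)] by (intro mono_Span_subset[OF K]) auto
  qed
  then show ?thesis using m by (intro exI[of _ m]) (auto simp del: Span.simps)
 next
  case False
  have "dimension (Suc m) K (line_extension K u (Span K Us))" by (rule Suc_dim[OF u(1) False m(2)])
  then show ?thesis using m u False by (intro exI[of _ "Suc m"]) (auto intro: li_Cons)
 qed
qed

lemma spanning_imp_independent:
 assumes "dimension n K E" "length Us = n" "set Us \<subseteq> carrier R" "Span K Us = E"
 shows "independent K Us"
 using Span_dimension_le[OF assms(3)] assms dimension_is_inj[OF K] by blast

lemma finite_lspan_independent:
 assumes "dimension (card A) K E" "finite A" "g \<in> A \<rightarrow> carrier R" "lspan K g A = E"
  and "c \<in> A \<rightarrow> K" "(\<Oplus>z\<in>A. c z \<otimes> g z) = \<zero>"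
 shows "\<forall>z\<in>A. c z = \<zero>"
proof -
 obtain xs where xs: "set xs = A" "distinct xs" using finite_distinct_list[OF assms(2)] by blast
 have "independent K (map g xs)"
  using assms xs by (intro spanning_imp_independent) (auto simp: Span_map_eq_lspan distinct_card simp del: Span.simps)
 then show ?thesis using independent_map_iff[OF xs(2)] xs assms by auto
qed

lemma lspan_dimension:
 assumes "finite A" "g \<in> A \<rightarrow> carrier R"
  and "!!c. c \<in> A \<rightarrow> K ==> (\<Oplus>z\<in>A. c z \<otimes> g z) = \<zero> ==> \<forall>z\<in>A. c z = \<zero>"
 shows "dimension (card A) K (lspan K g A)"
proof -
 obtain xs where xs: "set xs = A" "distinct xs" using finite_distinct_list[OF assms(1)] by blast
 have "independent K (map g xs)" using independent_map_iff[OF xs(2)] xs assms by auto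
 from dimension_independent[OF this] have "dimension (length xs) K (Span K (map g xs))" by simp
 moreover have "length xs = card A" using xs distinct_card by metis
 ultimately show ?thesis using Span_map_eq_lspan[OF xs(2)] xs(1) assms(2) by simp
qed

end

end

section \<open>Adjoining a root of a polynomial\<close>

lemma (in ring_hom_ring) lifted_eval_hom:
 assumes "cring S" "subring K R" "x \<in> carrier S"
 shows "(%q. S.eval (map h q) x) \<in> ring_hom (univ_poly R K) S"
proof -
 interpret S: cring S by fact
 have c: "set q \<subseteq> carrier R" if "q \<in> carrier (univ_poly R K)" for q
  using that R.polynomial_incl[of K q] subringE(1)[OF assms(2)] by (auto simp: univ_poly_carrier[symmetric])
 have ch: "set (map h q) \<subseteq> carrier S" if "set q \<subseteq> carrier R" for q using that by auto
 show ?thesis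
 proof (rule ring_hom_memI)
  fix q r assume q: "q \<in> carrier (univ_poly R K)" and r: "r \<in> carrier (univ_poly R K)"
  show "S.eval (map h q) x \<in> carrier S" using S.eval_in_carrier[OF ch[OF c[OF q]] assms(3)] .
  have "S.eval (map h (R.poly_mult q r)) x = S.eval (map h q) x \<otimes>\<^bsub>S\<^esub> S.eval (map h r) x"
   using S.eval_normalize[OF ch[OF R.poly_mult_in_carrier[OF c[OF q] c[OF r]]] assms(3)]
    S.eval_poly_mult[OF ch[OF c[OF q]] ch[OF c[OF r]] assms(3)] poly_mult_hom'[OF c[OF q] c[OF r]] by simp
  then show "S.eval (map h (q \<otimes>\<^bsub>univ_poly R K\<^esub> r)) x = S.eval (map h q) x \<otimes>\<^bsub>S\<^esub> S.eval (map h r) x"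
   by (simp add: univ_poly_def)
  have "S.eval (map h (R.poly_add q r)) x = S.eval (map h q) x \<oplus>\<^bsub>S\<^esub> S.eval (map h r) x"
   using S.eval_normalize[OF ch[OF R.poly_add_in_carrier[OF c[OF q] c[OF r]]] assms(3)]
    S.eval_poly_add[OF ch[OF c[OF q]] ch[OF c[OF r]] assms(3)] poly_add_hom'[OF c[OF q] c[OF r]]
   by (simp del: R.poly_add.simps S.poly_add.simps)
  then show "S.eval (map h (q \<oplus>\<^bsub>univ_poly R K\<^esub> r)) x = S.eval (map h q) x \<oplus>\<^bsub>S\<^esub> S.eval (map h r) x"
   by (simp add: univ_poly_def)
 qed (use assms in \<open>simp add: univ_poly_def\<close>)
qed

text \<open>\<open>f\<close> may be reducible, because Artin-Schreier polynomials with a root in the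
  base field have to be covered. Polynomials are coefficient lists, so \<open>length f - 1\<close>
  is the degree.\<close>

locale root_adjunction = field R for R :: "'a ring" (structure) +
 fixes f :: "'a list"
 assumes f_poly: "f \<in> carrier (univ_poly R (carrier R))" and f_degree: "length f - 1 > 0"
begin

abbreviation "P \<equiv> univ_poly R (carrier R)"
abbreviation "N \<equiv> fst (adjoin_root R f)"
abbreviation "\<nu> \<equiv> snd (adjoin_root R f)"
abbreviation "quo \<equiv> rupture_surj (carrier R) f"

lemmas K_subfield = carrier_is_subfield
lemmas K_subring = carrier_is_subring

sublocale P: domain P by (rule univ_poly_is_domain[OF K_subring])

lemma N_eq: "N = Rupt (carrier R) f" and nu_eq: "\<nu> a = quo (poly_of_const a)"
 by (simp_all add: adjoin_root_def Let_def)

lemma N_cring: "cring N"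
 unfolding N_eq rupture_def
 using ideal.quotient_is_cring[OF P.cgenideal_ideal[OF f_poly]] P.cring_axioms by blast

sublocale N: cring N by (rule N_cring)

sublocale quo: ring_hom_ring P N quo unfolding N_eq by (rule rupture_surj_hom(2)[OF K_subring f_poly])

lemma const_hom: "ring_hom_ring R P poly_of_const"
 using canonical_embedding_ring_hom[OF K_subring] by simp

lemma nu_hom: "ring_hom_ring R N \<nu>"
proof -
 interpret c: ring_hom_ring R P poly_of_const by (rule const_hom)
 have "quo \<circ> poly_of_const \<in> ring_hom R N" by (rule ring_hom_trans[OF c.homh quo.homh])
 moreover have "quo \<circ> poly_of_const = \<nu>" by (simp add: fun_eq_iff nu_eq)
 ultimately show ?thesis using ring_axioms N.ring_axioms by (intro ring_hom_ringI2) auto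
qed

sublocale nu: ring_hom_ring R N \<nu> by (rule nu_hom)

definition "rt = quo X"

lemma X_closed: "X \<in> carrier P" by (rule var_closed(1)[OF K_subring])

lemma rt_closed [simp]: "rt \<in> carrier N" using X_closed by (simp add: rt_def)

lemma quo_f: "quo f = \<zero>\<^bsub>N\<^esub>"
 using P.cgenideal_self[OF f_poly] P.a_rcos_zero[OF P.cgenideal_ideal[OF f_poly]]
 unfolding N_eq rupture_def FactRing_def by simp

lemma N_one_not_zero: "\<one>\<^bsub>N\<^esub> ~= \<zero>\<^bsub>N\<^esub>"
 unfolding N_eq by (rule rupture_one_not_zero[OF K_subfield f_poly f_degree])

lemma nu_inj: "a \<in> carrier R ==> \<nu> a = \<zero>\<^bsub>N\<^esub> ==> a = \<zero>"
proof (rule ccontr)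
 assume a: "a \<in> carrier R" "\<nu> a = \<zero>\<^bsub>N\<^esub>" "a ~= \<zero>"
 then have "a \<in> Units R" using field_Units by blast
 then have "\<one>\<^bsub>N\<^esub> = \<nu> (inv a) \<otimes>\<^bsub>N\<^esub> \<nu> a" using nu.hom_mult[of "inv a" a] a by simp
 then show False using a N_one_not_zero \<open>a \<in> Units R\<close> by simp
qed

lemma nu_image_subfield: "subfield (\<nu> ` carrier R) N"
proof -
 have "subfield (quo ` poly_of_const ` carrier R) N"
  by (rule quo.img_is_subfield(2)[OF univ_poly_subfield_of_consts[OF K_subfield] N_one_not_zero])
 moreover have "quo ` poly_of_const ` carrier R = \<nu> ` carrier R" by (auto simp: nu_eq)
 ultimately show ?thesis by simp
qed

lemma degree_N: "has_degree R (adjoin_root R f) (length f - 1)"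
proof -
 have "quo ` poly_of_const ` carrier R = \<nu> ` carrier R" by (auto simp: nu_eq)
 then show ?thesis
  unfolding has_degree_def using rupture_dimension[OF K_subfield f_poly f_degree] by (simp add: N_eq)
qed

lemma N_span: "carrier N = N.lspan (\<nu> ` carrier R) (%i. rt [^]\<^bsub>N\<^esub> i) {..<length f - 1}"
proof -
 let ?n = "length f - 1"
 have ne: "f ~= []" using f_degree by auto
 have "carrier N = quo ` P.Span (poly_of_const ` carrier R) (P.exp_base X ?n)"
  unfolding Span_var_pow_base[OF K_subfield] pmod_image_characterization[OF K_subfield f_poly ne, symmetric]
   N_eq by (rule rupture_carrier_as_pmod_image[OF K_subfield f_poly, symmetric])
 also have "\<dots> = N.Span (quo ` poly_of_const ` carrier R) (map quo (P.exp_base X ?n))"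
  using univ_poly_subfield_of_consts[OF K_subfield] P.exp_base_closed[OF X_closed]
  by (intro quo.Span_hom[symmetric]) (auto dest: subfieldE(3))
 also have "quo ` poly_of_const ` carrier R = \<nu> ` carrier R" by (auto simp: nu_eq)
 also have "map quo (P.exp_base X ?n) = map (%i. rt [^]\<^bsub>N\<^esub> i) (rev [0..<?n])"
  using X_closed by (simp add: P.exp_base_def rt_def quo.hom_nat_pow)
 also have "N.Span (\<nu> ` carrier R) \<dots> = N.lspan (\<nu> ` carrier R) (%i. rt [^]\<^bsub>N\<^esub> i) (set (rev [0..<?n]))"
  by (rule N.Span_map_eq_lspan[OF nu_image_subfield]) auto
 also have "set (rev [0..<?n]) = {..<?n}" by auto
 finally show ?thesis .
qed

lemma N_lift:
 assumes "cring S" "ring_hom_ring R S h" "x \<in> carrier S" "ring.eval S (map h f) x = \<zero>\<^bsub>S\<^esub>"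
 shows "\<exists>\<phi>. ring_hom_ring N S \<phi> & \<phi> rt = x & (\<forall>a\<in>carrier R. \<phi> (\<nu> a) = h a)"
proof -
 interpret S: cring S by fact
 interpret h: ring_hom_ring R S h by fact
 define e where "e = (%q. S.eval (map h q) x)"
 have eh: "e \<in> ring_hom P S" unfolding e_def by (rule h.lifted_eval_hom[OF assms(1) K_subring assms(3)])
 interpret e: ring_hom_ring P S e by (rule ring_hom_ringI2[OF P.ring_axioms S.ring_axioms eh])
 have ef: "e f = \<zero>\<^bsub>S\<^esub>" using assms(4) by (simp add: e_def)
 have "f \<in> a_kernel P S e" unfolding a_kernel_def' using f_poly ef by blast
 then have "PIdl\<^bsub>P\<^esub> f \<subseteq> a_kernel P S e" by (rule P.cgenideal_minimal[OF e.kernel_is_ideal])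
 then have z: "e i = \<zero>\<^bsub>S\<^esub>" if "i \<in> PIdl\<^bsub>P\<^esub> f" for i using that unfolding a_kernel_def' by blast
 have N: "P Quot (PIdl\<^bsub>P\<^esub> f) = N" by (simp add: N_eq rupture_def)
 have "\<exists>\<phi>. ring_hom_ring N S \<phi> & (\<forall>z\<in>carrier P. \<phi> (quo z) = e z)"
  using quotient_lift[OF P.cgenideal_ideal[OF f_poly] e.ring_hom_ring_axioms z] unfolding N by blast
 then obtain \<phi> where \<phi>: "ring_hom_ring N S \<phi>" "!!z. z \<in> carrier P ==> \<phi> (quo z) = e z" by blast
 have "e X = x" using assms(3) by (simp add: var_def e_def)
 then have 1: "\<phi> rt = x" using \<phi>(2)[OF X_closed] by (simp add: rt_def)
 have "\<phi> (\<nu> a) = h a" if a: "a \<in> carrier R" for a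
 proof -
  have "e (poly_of_const a) = h a" using a assms(3) by (simp add: poly_of_const_def e_def)
  then show ?thesis using \<phi>(2) ring_hom_closed[OF ring_hom_ring.homh[OF const_hom] a] by (simp add: nu_eq)
 qed
 then show ?thesis using \<phi>(1) 1 by blast
qed

lemma N_hom_eqI:
 assumes "ring_hom_ring N S \<phi>" "ring_hom_ring N S \<psi>" "\<phi> rt = \<psi> rt"
  and "!!a. a \<in> carrier R ==> \<phi> (\<nu> a) = \<psi> (\<nu> a)" and z: "z \<in> carrier N"
 shows "\<phi> z = \<psi> z"
proof -
 interpret \<phi>: ring_hom_ring N S \<phi> by fact
 interpret \<psi>: ring_hom_ring N S \<psi> by fact
 have "N.lspan (\<nu> ` carrier R) (%i. rt [^]\<^bsub>N\<^esub> i) {..<length f - 1} \<subseteq> {z \<in> carrier N. \<phi> z = \<psi> z}"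
  by (rule N.lspan_least[OF subfieldE(1)[OF nu_image_subfield]])
   (use assms(3,4) in \<open>auto simp: \<phi>.hom_nat_pow \<psi>.hom_nat_pow\<close>)
 then show ?thesis using z N_span by auto
qed

end

context domain begin

lemma poly_degree_add_less:
 assumes "a \<in> carrier (univ_poly R (carrier R))" "b \<in> carrier (univ_poly R (carrier R))" "length b - 1 < length a - 1"
 shows "length (a \<oplus>\<^bsub>univ_poly R (carrier R)\<^esub> b) - 1 = length a - 1"
 using assms poly_add_degree_eq[OF carrier_is_subring, of a b] by (simp add: univ_poly_def)

lemma poly_degree_diff_less:
 assumes "a \<in> carrier (univ_poly R (carrier R))" "b \<in> carrier (univ_poly R (carrier R))" "length b - 1 < length a - 1"
 shows "length (a \<ominus>\<^bsub>univ_poly R (carrier R)\<^esub> b) - 1 = length a - 1"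
proof -
 interpret P: domain "univ_poly R (carrier R)" by (rule univ_poly_is_domain[OF carrier_is_subring])
 show ?thesis unfolding P.minus_eq
  using assms poly_degree_add_less[OF assms(1), of "\<ominus>\<^bsub>univ_poly R (carrier R)\<^esub> b"]
  by (simp add: univ_poly_a_inv_length[OF carrier_is_subring])
qed

lemma poly_of_const_degree: "length (poly_of_const a) - 1 = 0"
 by (simp add: poly_of_const_def)

lemma poly_of_const_closed: "a \<in> carrier R ==> poly_of_const a \<in> carrier (univ_poly R (carrier R))"
 using ring_hom_closed[OF canonical_embedding_is_hom[OF carrier_is_subring]] by simp

end

section \<open>Artin-Schreier extensions\<close>

lemma (in cring) falling_shift:
 assumes t: "t \<in> carrier R"
 shows "falling (t \<oplus> \<one>) (Suc i) = (t \<oplus> \<one>) \<otimes> falling t i"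
proof (induction i)
 case 0
 show ?case using t by (simp add: falling_Suc minus_eq)
next
 case (Suc i)
 have "(t \<oplus> \<one>) \<ominus> [int (Suc i)] \<cdot> \<one> = t \<ominus> [int i] \<cdot> \<one>"
  using t by (simp add: int_mult_add minus_eq minus_add a_ac add_minus_cancel r_neg1 r_neg2)
 then have "falling (t \<oplus> \<one>) (Suc (Suc i)) = (t \<ominus> [int i] \<cdot> \<one>) \<otimes> ((t \<oplus> \<one>) \<otimes> falling t i)"
  by (subst falling_Suc) (simp only: Suc)
 also have "\<dots> = (t \<oplus> \<one>) \<otimes> falling t (Suc i)" using t by (simp add: falling_Suc m_lcomm)
 finally show ?case .
qed

lemma (in domain) falling_zero_imp: "t \<in> carrier R ==> falling t n = \<zero> ==> \<exists>i<n. t = [int i] \<cdot> \<one>"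
proof (induction n)
 case (Suc n)
 then have "t \<ominus> [int n] \<cdot> \<one> = \<zero> \<or> falling t n = \<zero>" by (auto simp: falling_Suc integral_iff)
 then show ?case
 proof
  assume "t \<ominus> [int n] \<cdot> \<one> = \<zero>"
  then have "t = [int n] \<cdot> \<one>" using Suc.prems(1) by simp
  then show ?thesis by blast
 next
  assume "falling t n = \<zero>"
  then obtain i where "i < n" "t = [int i] \<cdot> \<one>" using Suc by blast
  then show ?case using less_SucI by blast
 qed
qed simp

lemma shift_mod_image:
 assumes "p > 0"
 shows "inj_on (%i. (i + k) mod p) {..<p}" and "(%i. (i + k) mod p) ` {..<p} = {..<p::nat}"
proof -
 show inj: "inj_on (%i. (i + k) mod p) {..<p}"
 proof (rule inj_onI)
  fix x y assume "x \<in> {..<p}" "y \<in> {..<p}" "(x + k) mod p = (y + k) mod p"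
  then have "[x + k = y + k] (mod p)" by (simp add: cong_def)
  then have "[x = y] (mod p)" by (simp add: cong_add_rcancel_nat)
  then show "x = y" using \<open>x \<in> {..<p}\<close> \<open>y \<in> {..<p}\<close> by (simp add: cong_def)
 qed
 show "(%i. (i + k) mod p) ` {..<p} = {..<p}"
  using inj assms by (intro card_subset_eq) (auto simp: card_image)
qed

text \<open>Translating a proper nonempty subset of \<open>\<int>/p\<close> moves it, since its sum changes.\<close>

lemma shift_mod_moves:
 fixes p :: nat
 assumes p: "Factorial_Ring.prime p" and S: "S \<subseteq> {..<p}" "S ~= {}" "S ~= {..<p}" and k: "0 < k" "k < p"
 shows "(%i. (i + k) mod p) ` S ~= S"
proof
 assume eq: "(%i. (i + k) mod p) ` S = S"
 have p0: "p > 0" using p prime_gt_0_nat by blast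
 have fin: "finite S" using S finite_subset by blast
 have inj: "inj_on (%i. (i + k) mod p) S" using inj_on_subset[OF shift_mod_image(1)[OF p0] S(1)] .
 have "(\<Sum>i\<in>S. i) = (\<Sum>i\<in>S. (i + k) mod p)"
  using sum.reindex[OF inj, of "%i. i"] eq by simp
 then have "[(\<Sum>i\<in>S. i) = (\<Sum>i\<in>S. i + k)] (mod p)" by (simp add: cong_def mod_sum_eq)
 then have "[0 = card S * k] (mod p)" using cong_add_lcancel_0_nat[of "\<Sum>S" "card S * k" p] by (simp add: sum.distrib cong_sym_eq)
 then have "p dvd card S * k" by (metis cong_0_iff cong_sym_eq)
 moreover have "~ p dvd k" using k by (auto dest: dvd_imp_le)
 moreover have "card S < p" using S by (metis card_lessThan finite_lessThan psubsetI psubset_card_mono)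
 then have "~ p dvd card S" using S(2) fin by (auto dest: dvd_imp_le simp: card_gt_0_iff)
 ultimately show False using p by (simp add: prime_dvd_mult_iff)
qed

locale artin_schreier = field R + char_p_ring R p for R :: "'a ring" (structure) and p +
 fixes \<delta> :: 'a
 assumes delta [simp]: "\<delta> \<in> carrier R"
begin

definition "as_poly = (X [^]\<^bsub>univ_poly R (carrier R)\<^esub> p \<ominus>\<^bsub>univ_poly R (carrier R)\<^esub> X)
  \<ominus>\<^bsub>univ_poly R (carrier R)\<^esub> poly_of_const \<delta>"

lemma as_ext: "artin_schreier_ext p R \<delta> = adjoin_root R as_poly"
 by (simp add: artin_schreier_ext_def as_poly_def Let_def)

lemma as_poly_props: "as_poly \<in> carrier (univ_poly R (carrier R))" "length as_poly - 1 = p"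
proof -
 let ?P = "univ_poly R (carrier R)"
 interpret P: domain ?P by (rule univ_poly_is_domain[OF carrier_is_subring])
 have X: "X \<in> carrier ?P" by (rule var_closed(1)[OF carrier_is_subring])
 have c: "poly_of_const \<delta> \<in> carrier ?P" by (rule poly_of_const_closed) simp
 show "as_poly \<in> carrier ?P" using X c by (simp add: as_poly_def)
 have d: "length (X [^]\<^bsub>?P\<^esub> p) - 1 = p" using polynomial_pow_degree[OF X, of p] by (simp add: var_def)
 have "length (X [^]\<^bsub>?P\<^esub> p \<ominus>\<^bsub>?P\<^esub> X) - 1 = p"
  using poly_degree_diff_less[of "X [^]\<^bsub>?P\<^esub> p" X] d X p_gt1 by (simp add: var_def)
 then show "length as_poly - 1 = p"
  unfolding as_poly_def using poly_degree_diff_less[of "X [^]\<^bsub>?P\<^esub> p \<ominus>\<^bsub>?P\<^esub> X" "poly_of_const \<delta>"] X c p_pos poly_of_const_degree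
  by simp
qed

sublocale root_adjunction R as_poly
 using as_poly_props p_pos by unfold_locales auto

abbreviation "E \<equiv> artin_schreier_ext p R \<delta>"

sublocale N: char_p_ring N p by (rule nu.hom_char_p) unfold_locales

lemma lift_root_eq:
 assumes "cring S" "ring_hom_ring R S h" "x \<in> carrier S"
 shows "ring.eval S (map h as_poly) x = (x [^]\<^bsub>S\<^esub> p \<ominus>\<^bsub>S\<^esub> x) \<ominus>\<^bsub>S\<^esub> h \<delta>"
proof -
 interpret S: cring S by fact
 interpret h: ring_hom_ring R S h by fact
 define e where "e = (%q. S.eval (map h q) x)"
 have eh: "e \<in> ring_hom P S" unfolding e_def by (rule h.lifted_eval_hom[OF assms(1) K_subring assms(3)])
 interpret e: ring_hom_ring P S e
  by (rule ring_hom_ringI2[OF P.ring_axioms S.ring_axioms eh])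
 have ex: "e X = x" using assms(3) by (simp add: var_def e_def)
 have ec: "e (poly_of_const \<delta>) = h \<delta>" using assms(3) by (simp add: poly_of_const_def e_def)
 have c: "poly_of_const \<delta> \<in> carrier P" by (rule poly_of_const_closed) simp
 have "e as_poly = (e (X [^]\<^bsub>P\<^esub> p) \<ominus>\<^bsub>S\<^esub> e X) \<ominus>\<^bsub>S\<^esub> e (poly_of_const \<delta>)"
  unfolding as_poly_def using X_closed c e.hom_diff by simp
 then have "e as_poly = (x [^]\<^bsub>S\<^esub> p \<ominus>\<^bsub>S\<^esub> x) \<ominus>\<^bsub>S\<^esub> h \<delta>" unfolding e.hom_nat_pow[OF X_closed] ex ec .
 then show ?thesis by (simp add: e_def)
qed

lemma rt_eq: "rt [^]\<^bsub>N\<^esub> p \<ominus>\<^bsub>N\<^esub> rt = \<nu> \<delta>"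
proof -
 have c: "poly_of_const \<delta> \<in> carrier P" by (rule poly_of_const_closed) simp
 have "quo as_poly = (rt [^]\<^bsub>N\<^esub> p \<ominus>\<^bsub>N\<^esub> rt) \<ominus>\<^bsub>N\<^esub> \<nu> \<delta>"
 proof -
  have "quo ((X [^]\<^bsub>P\<^esub> p \<ominus>\<^bsub>P\<^esub> X) \<ominus>\<^bsub>P\<^esub> poly_of_const \<delta>) = (quo X [^]\<^bsub>N\<^esub> p \<ominus>\<^bsub>N\<^esub> quo X) \<ominus>\<^bsub>N\<^esub> quo (poly_of_const \<delta>)"
   using X_closed c by (simp add: quo.hom_diff quo.hom_nat_pow)
  then show ?thesis unfolding rt_def nu_eq as_poly_def[symmetric] .
 qed
 from sym[OF this] quo_f have "(rt [^]\<^bsub>N\<^esub> p \<ominus>\<^bsub>N\<^esub> rt) \<ominus>\<^bsub>N\<^esub> \<nu> \<delta> = \<zero>\<^bsub>N\<^esub>" by (rule trans)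
 then show ?thesis by simp
qed

lemma ex_sigma: "\<exists>\<phi>. ring_hom_ring N N \<phi> & \<phi> rt = rt \<oplus>\<^bsub>N\<^esub> \<one>\<^bsub>N\<^esub> & (\<forall>a\<in>carrier R. \<phi> (\<nu> a) = \<nu> a)"
proof (rule N_lift[OF N_cring nu_hom])
 have "(rt \<oplus>\<^bsub>N\<^esub> \<one>\<^bsub>N\<^esub>) [^]\<^bsub>N\<^esub> p \<ominus>\<^bsub>N\<^esub> (rt \<oplus>\<^bsub>N\<^esub> \<one>\<^bsub>N\<^esub>) = rt [^]\<^bsub>N\<^esub> p \<ominus>\<^bsub>N\<^esub> rt"
  by (simp add: N.freshman N.minus_eq N.minus_add N.a_ac N.add_minus_cancel N.r_neg1 N.r_neg2)
 then show "ring.eval N (map \<nu> as_poly) (rt \<oplus>\<^bsub>N\<^esub> \<one>\<^bsub>N\<^esub>) = \<zero>\<^bsub>N\<^esub>"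
  by (subst lift_root_eq[OF N_cring nu_hom]) (auto simp: rt_eq)
qed simp

text \<open>The translation of the root by 1. It generates an action of the integers modulo
  \<open>p\<close> whether or not the algebra is a field.\<close>

definition "\<rho> = (SOME \<phi>. ring_hom_ring N N \<phi> & \<phi> rt = rt \<oplus>\<^bsub>N\<^esub> \<one>\<^bsub>N\<^esub> & (\<forall>a\<in>carrier R. \<phi> (\<nu> a) = \<nu> a))"

lemma sigma: "ring_hom_ring N N \<rho>" "\<rho> rt = rt \<oplus>\<^bsub>N\<^esub> \<one>\<^bsub>N\<^esub>" "a \<in> carrier R ==> \<rho> (\<nu> a) = \<nu> a"
 using someI_ex[OF ex_sigma] unfolding \<rho>_def[symmetric] by auto

lemma sigma_pow: "ring_hom_ring N N (\<rho> ^^ k)" "(\<rho> ^^ k) rt = rt \<oplus>\<^bsub>N\<^esub> [int k] \<cdot>\<^bsub>N\<^esub> \<one>\<^bsub>N\<^esub>"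
 "a \<in> carrier R ==> (\<rho> ^^ k) (\<nu> a) = \<nu> a"
proof -
 interpret s: ring_hom_ring N N \<rho> by (rule sigma)
 show "ring_hom_ring N N (\<rho> ^^ k)"
 proof (induction k)
  case 0
  show ?case using N.ring_axioms by (intro ring_hom_ringI2) (auto intro: ring_hom_memI)
 next
  case (Suc k)
  have "\<rho> \<circ> (\<rho> ^^ k) \<in> ring_hom N N" using ring_hom_trans[OF ring_hom_ring.homh[OF Suc] s.homh] .
  then show ?case unfolding funpow.simps by (rule ring_hom_ringI2[OF N.ring_axioms N.ring_axioms])
 qed
 show "(\<rho> ^^ k) rt = rt \<oplus>\<^bsub>N\<^esub> [int k] \<cdot>\<^bsub>N\<^esub> \<one>\<^bsub>N\<^esub>"
  by (induction k) (auto simp: s.hom_int_mult sigma(2) N.int_mult_add N.a_ac)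
 show "(\<rho> ^^ k) (\<nu> a) = \<nu> a" if "a \<in> carrier R"
  using that by (induction k) (auto simp: sigma(3))
qed

lemma sigma_pow_closed [simp]: "z \<in> carrier N ==> (\<rho> ^^ k) z \<in> carrier N"
 using ring_hom_closed[OF ring_hom_ring.homh[OF sigma_pow(1)]] by blast

lemma sigma_pow_mod: "z \<in> carrier N ==> (\<rho> ^^ (k mod p)) z = (\<rho> ^^ k) z"
proof (rule N_hom_eqI[OF sigma_pow(1) sigma_pow(1)])
 have "int k = int p * int (k div p) + int (k mod p)" by (metis div_mult_mod_eq of_nat_add of_nat_mult mult.commute)
 then have "[int k] \<cdot>\<^bsub>N\<^esub> \<one>\<^bsub>N\<^esub> = [int (k mod p)] \<cdot>\<^bsub>N\<^esub> \<one>\<^bsub>N\<^esub>"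
  by (simp add: N.int_mult_add N.int_mult_mult)
 then show "(\<rho> ^^ (k mod p)) rt = (\<rho> ^^ k) rt" by (simp add: sigma_pow)
qed (auto simp: sigma_pow)

abbreviation "ff \<equiv> N.falling rt"
abbreviation "K' \<equiv> \<nu> ` carrier R"

lemma K'_subring: "subring K' N" using subfieldE(1)[OF nu_image_subfield] .

text \<open>On the falling factorials of the root, \<open>\<rho>\<close> minus the identity lowers
  the index by one, which it does not do on powers. Their span is closed under multiplication by the
  root since the \<open>p\<close>-th falling factorial is the constant
  \<open>\<delta>\<close>.\<close>

lemma ff_span: "carrier N = N.lspan K' ff {..<p}"
proof -
 have fin: "finite {..<p}" "ff \<in> {..<p} \<rightarrow> carrier N" by auto
 note L = N.lspan_closed[OF K'_subring fin] N.lspan_add[OF K'_subring fin] N.lspan_smult[OF K'_subring fin]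
  N.lspan_zero[OF K'_subring fin] N.lspan_base[OF K'_subring fin] N.lspan_int_mult[OF K'_subring fin]
 let ?L = "N.lspan K' ff {..<p}"
 have step: "rt \<otimes>\<^bsub>N\<^esub> ff i \<in> ?L" if "i < p" for i
 proof -
  have "ff (Suc i) \<in> ?L"
  proof (cases "Suc i = p")
   case True
   have "ff (Suc i) = \<nu> \<delta> \<otimes>\<^bsub>N\<^esub> ff 0" unfolding True by (simp add: N.falling_p rt_eq)
   then show ?thesis using L(3)[of "\<nu> \<delta>" "ff 0"] L(5)[of 0] p_pos by simp
  next
   case False
   then show ?thesis using that L(5) by auto
  qed
  then show ?thesis unfolding N.falling_mult[OF rt_closed] using that L by auto
 qed
 have mult: "rt \<otimes>\<^bsub>N\<^esub> z \<in> ?L" if "z \<in> ?L" for z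
 proof -
  have "?L \<subseteq> {z \<in> carrier N. rt \<otimes>\<^bsub>N\<^esub> z \<in> ?L}"
  proof (rule N.lspan_least[OF K'_subring fin])
   show "k \<otimes>\<^bsub>N\<^esub> ff i \<in> {z \<in> carrier N. rt \<otimes>\<^bsub>N\<^esub> z \<in> ?L}" if "k \<in> K'" "i \<in> {..<p}" for k i
    using that step[of i] L(3)[OF that(1), of "rt \<otimes>\<^bsub>N\<^esub> ff i"] by (auto simp: N.m_lcomm)
  qed (use L in \<open>auto simp: N.r_distr\<close>)
  then show ?thesis using that by blast
 qed
 have pow: "rt [^]\<^bsub>N\<^esub> (i::nat) \<in> ?L" for i
 proof (induction i)
  case 0
  then show ?case using L(5)[of 0] p_pos by simp
 next
  case (Suc i)
  then show ?case using mult[OF Suc] by (simp add: N.m_comm)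
 qed
 have "N.lspan K' (%i. rt [^]\<^bsub>N\<^esub> i) {..<length as_poly - 1} \<subseteq> ?L"
  by (rule N.lspan_least[OF K'_subring]) (use L pow in auto)
 then show ?thesis using N_span L(1) by blast
qed

text \<open>By counting: these are \<open>p\<close> elements spanning a space of dimension
  \<open>p\<close>.\<close>

lemma ff_indep:
 assumes "c \<in> {..<p} \<rightarrow> K'" "(\<Oplus>\<^bsub>N\<^esub>i\<in>{..<p}. c i \<otimes>\<^bsub>N\<^esub> ff i) = \<zero>\<^bsub>N\<^esub>"
 shows "\<forall>i<p. c i = \<zero>\<^bsub>N\<^esub>"
proof -
 have "N.dimension (card {..<p}) K' (carrier N)"
  using degree_N as_poly_props(2) by (simp add: has_degree_def)
 then show ?thesis
  using N.finite_lspan_independent[OF nu_image_subfield _ _ _ ff_span[symmetric] assms] by auto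
qed

definition "\<Delta> z = \<rho> z \<ominus>\<^bsub>N\<^esub> z"

lemma delta_closed [simp]: "z \<in> carrier N ==> \<Delta> z \<in> carrier N"
 unfolding \<Delta>_def using sigma_pow_closed[of z 1] by simp

lemma delta_ff: "\<Delta> (ff (Suc i)) = [int (Suc i)] \<cdot>\<^bsub>N\<^esub> ff i" "\<Delta> (ff 0) = \<zero>\<^bsub>N\<^esub>"
proof -
 interpret s: ring_hom_ring N N \<rho> by (rule sigma)
 have "\<rho> (ff (Suc i)) = (rt \<oplus>\<^bsub>N\<^esub> \<one>\<^bsub>N\<^esub>) \<otimes>\<^bsub>N\<^esub> ff i"
  by (simp add: s.hom_falling sigma(2) N.falling_shift)
 also have "\<dots> = ff (Suc i) \<oplus>\<^bsub>N\<^esub> [int (Suc i)] \<cdot>\<^bsub>N\<^esub> ff i"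
  by (simp add: N.l_distr N.falling_mult N.int_mult_add N.a_ac)
 finally show "\<Delta> (ff (Suc i)) = [int (Suc i)] \<cdot>\<^bsub>N\<^esub> ff i"
  by (simp add: \<Delta>_def N.minus_eq N.a_ac N.add_minus_cancel N.r_neg1 N.r_neg2)
 show "\<Delta> (ff 0) = \<zero>\<^bsub>N\<^esub>" by (simp add: \<Delta>_def)
qed

lemma delta_sum:
 assumes c: "c \<in> {..<Suc m} \<rightarrow> K'"
 shows "\<Delta> (\<Oplus>\<^bsub>N\<^esub>i\<in>{..<Suc m}. c i \<otimes>\<^bsub>N\<^esub> ff i) = (\<Oplus>\<^bsub>N\<^esub>i\<in>{..<m}. ([int (Suc i)] \<cdot>\<^bsub>N\<^esub> c (Suc i)) \<otimes>\<^bsub>N\<^esub> ff i)"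
proof -
 interpret s: ring_hom_ring N N \<rho> by (rule sigma)
 have cc: "c i \<in> carrier N" "\<rho> (c i) = c i" if "i < Suc m" for i
  using c that sigma(3) by (auto simp: Pi_def image_iff)
 have D: "\<Delta> (c i \<otimes>\<^bsub>N\<^esub> ff i) = c i \<otimes>\<^bsub>N\<^esub> \<Delta> (ff i)" if "i < Suc m" for i
  using cc[OF that] by (simp add: \<Delta>_def N.mult_diff)
 have "\<Delta> (\<Oplus>\<^bsub>N\<^esub>i\<in>{..<Suc m}. c i \<otimes>\<^bsub>N\<^esub> ff i) = (\<Oplus>\<^bsub>N\<^esub>i\<in>{..<Suc m}. \<Delta> (c i \<otimes>\<^bsub>N\<^esub> ff i))"
  by (rule N.additive_finsum) (use cc in \<open>auto simp: \<Delta>_def N.minus_eq N.minus_add N.a_ac\<close>)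
 also have "\<dots> = (\<Oplus>\<^bsub>N\<^esub>i\<in>{..<Suc m}. c i \<otimes>\<^bsub>N\<^esub> \<Delta> (ff i))"
  using D cc by (intro N.finsum_cong') auto
 also have "\<dots> = (\<Oplus>\<^bsub>N\<^esub>i\<in>{..<m}. c (Suc i) \<otimes>\<^bsub>N\<^esub> \<Delta> (ff (Suc i)))"
  using cc by (subst N.finsum_lessThan_Suc_shift) (auto simp: delta_ff(2)[simplified])
 also have "\<dots> = (\<Oplus>\<^bsub>N\<^esub>i\<in>{..<m}. ([int (Suc i)] \<cdot>\<^bsub>N\<^esub> c (Suc i)) \<otimes>\<^bsub>N\<^esub> ff i)"
  using cc by (intro N.finsum_cong') (auto simp: delta_ff N.mult_int)
 finally show ?thesis .
qed

lemma int_K': "k \<in> K' ==> [(n::int)] \<cdot>\<^bsub>N\<^esub> k \<in> K'"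
 by (auto simp: nu.hom_int_mult[symmetric])

text \<open>Where \<open>\<Delta>\<close> vanishes, the coefficients
  \<open>(i + 1) c (i + 1)\<close> vanish, and \<open>i + 1 < p\<close> can be cancelled; only the
  constant term is left. The fixed ring is thus the base field even if the algebra has zero
  divisors.\<close>

lemma sigma_fixed:
 assumes z: "z \<in> carrier N" "\<rho> z = z"
 shows "z \<in> K'"
proof -
 obtain m where m: "Suc m = p" using p_pos gr0_conv_Suc by metis
 have mp: "i < p" "Suc i < p" if "i < m" for i using that m by auto
 have mle: "m \<le> p" using m by simp
 obtain c where c: "c \<in> {..<p} \<rightarrow> K'" "z = (\<Oplus>\<^bsub>N\<^esub>i\<in>{..<p}. c i \<otimes>\<^bsub>N\<^esub> ff i)"
  using z(1) ff_span by (auto simp: N.lspan_def)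
 have cK: "c i \<in> K'" if "i < p" for i using funcset_mem[OF c(1)] that by simp
 have cc: "c i \<in> carrier N" if "i < p" for i using cK[OF that] by auto
 \<comment> \<open>The coefficients of \<open>\<Delta> z\<close>, padded by 0 at index
   \<open>p - 1\<close> so that independence of all \<open>p\<close> falling factorials
   applies.\<close>
 let ?d = "%i. if i < m then [int (Suc i)] \<cdot>\<^bsub>N\<^esub> c (Suc i) else \<zero>\<^bsub>N\<^esub>"
 have d: "?d \<in> {..<p} \<rightarrow> K'" using int_K'[OF cK] mp subringE(2)[OF K'_subring] by (auto simp del: of_nat_Suc)
 have "\<Delta> z = \<zero>\<^bsub>N\<^esub>" using z by (simp add: \<Delta>_def)
 then have "(\<Oplus>\<^bsub>N\<^esub>i\<in>{..<m}. ([int (Suc i)] \<cdot>\<^bsub>N\<^esub> c (Suc i)) \<otimes>\<^bsub>N\<^esub> ff i) = \<zero>\<^bsub>N\<^esub>"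
  using delta_sum[of c m, unfolded m] c by (simp del: of_nat_Suc)
 moreover have "(\<Oplus>\<^bsub>N\<^esub>i\<in>{..<m}. ([int (Suc i)] \<cdot>\<^bsub>N\<^esub> c (Suc i)) \<otimes>\<^bsub>N\<^esub> ff i) = (\<Oplus>\<^bsub>N\<^esub>i\<in>{..<p}. ?d i \<otimes>\<^bsub>N\<^esub> ff i)"
  by (rule N.add.finprod_mono_neutral_cong_left) (use cc mp mle subringE(1)[OF K'_subring] d in \<open>auto simp del: of_nat_Suc intro!: N.int_mult_closed\<close>)
 ultimately have "\<forall>i<p. ?d i = \<zero>\<^bsub>N\<^esub>" using ff_indep[OF d] by simp
 then have "c (Suc i) = \<zero>\<^bsub>N\<^esub>" if "i < m" for i
 proof -
  assume *: "\<forall>i<p. ?d i = \<zero>\<^bsub>N\<^esub>"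
  have "~ int p dvd int (Suc i)" using mp[OF that] by (auto dest!: zdvd_imp_le)
  moreover have "[int (Suc i)] \<cdot>\<^bsub>N\<^esub> c (Suc i) = \<zero>\<^bsub>N\<^esub>" using *[rule_format, of i] that mp[OF that] by (simp del: of_nat_Suc)
  ultimately show ?thesis using N.int_mult_cancel cc mp[OF that] by blast
 qed
 then have "(\<Oplus>\<^bsub>N\<^esub>i\<in>{..<m}. c (Suc i) \<otimes>\<^bsub>N\<^esub> ff (Suc i)) = (\<Oplus>\<^bsub>N\<^esub>i\<in>{..<m}. \<zero>\<^bsub>N\<^esub>)"
  by (intro N.finsum_cong') auto
 moreover have "(\<Oplus>\<^bsub>N\<^esub>i\<in>{..<Suc m}. c i \<otimes>\<^bsub>N\<^esub> ff i) = c 0 \<otimes>\<^bsub>N\<^esub> ff 0 \<oplus>\<^bsub>N\<^esub> (\<Oplus>\<^bsub>N\<^esub>i\<in>{..<m}. c (Suc i) \<otimes>\<^bsub>N\<^esub> ff (Suc i))"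
  by (rule N.finsum_lessThan_Suc_shift) (use cc m in auto)
 ultimately have "z = c 0" using c(2) cc[OF p_pos] unfolding m by simp
 then show ?thesis using c(1) p_pos by auto
qed

text \<open>A nonzero \<open>\<rho>\<close>-stable ideal contains a nonzero constant: apply \<open>\<Delta>\<close> to a nonzero element
 as long as the result does not vanish.\<close>

lemma stable_ideal:
 assumes J: "J \<subseteq> carrier N" "!!x. x \<in> J ==> \<Delta> x \<in> J"
  and z: "z \<in> J" "z ~= \<zero>\<^bsub>N\<^esub>"
 shows "\<exists>c \<in> carrier R. c ~= \<zero> & \<nu> c \<in> J"
proof -
 have "\<exists>c \<in> carrier R. c ~= \<zero> & \<nu> c \<in> J"
  if "k \<le> p" "z \<in> N.lspan K' ff {..<k}" "z \<in> J" "z ~= \<zero>\<^bsub>N\<^esub>" for k z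
  using that
 proof (induction k arbitrary: z)
  case 0
  then show ?case by (auto simp: N.lspan_def)
 next
  case (Suc k)
  obtain c where c: "c \<in> {..<Suc k} \<rightarrow> K'" "z = (\<Oplus>\<^bsub>N\<^esub>i\<in>{..<Suc k}. c i \<otimes>\<^bsub>N\<^esub> ff i)"
   using Suc.prems(2) unfolding N.lspan_def by blast
  have zc: "z \<in> carrier N" using Suc.prems J by blast
  show ?case
  proof (cases "\<Delta> z = \<zero>\<^bsub>N\<^esub>")
   case True
   interpret s: ring_hom_ring N N \<rho> by (rule sigma)
   have "\<rho> z = z" using True zc by (simp add: \<Delta>_def)
   then obtain r where "r \<in> carrier R" "z = \<nu> r" using sigma_fixed zc by blast
   then show ?thesis using Suc.prems by (metis nu.hom_zero)
  next
   case False
   have "\<Delta> z \<in> N.lspan K' ff {..<k}"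
    unfolding c(2) delta_sum[OF c(1)] using int_K'[OF funcset_mem[OF c(1)]] by (intro N.lspanI) (auto simp del: of_nat_Suc)
   then show ?thesis using Suc.IH[of "\<Delta> z"] False Suc.prems J(2) by simp
  qed
 qed
 note * = this[OF order_refl _ z]
 show ?thesis by (rule *) (use z(1) J(1) ff_span in blast)
qed

text \<open>Such a \<open>w\<close> shows that the algebra is split. The ideal generated by its
  conjugates is stable and so contains 1; multiplying the resulting relation by \<open>w\<close>
  leaves \<open>w = a0 w^2\<close>, and \<open>e = a0 w\<close> is an idempotent orthogonal to its
  other conjugates. The sum of the conjugates of \<open>rt e\<close> is invariant, hence a constant,
  and agrees with \<open>rt\<close> after multiplication by \<open>e\<close>; so it satisfies the
  equation of \<open>rt\<close>.\<close>

lemma sigma_orbit_root: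
 assumes w: "w \<in> carrier N" "w ~= \<zero>\<^bsub>N\<^esub>" and orth: "!!k. 0 < k ==> k < p ==> (\<rho> ^^ k) w \<otimes>\<^bsub>N\<^esub> w = \<zero>\<^bsub>N\<^esub>"
 shows "\<exists>c\<in>carrier R. c [^] p \<ominus> c = \<delta>"
proof -
 interpret s: ring_hom_ring N N \<rho> by (rule sigma)
 let ?g = "%k. (\<rho> ^^ k) w"
 have fin: "finite {..<p}" "?g \<in> {..<p} \<rightarrow> carrier N" using w by auto
 have C: "subring (carrier N) N" by (rule N.carrier_is_subring)
 let ?J = "N.lspan (carrier N) ?g {..<p}"
 note L = N.lspan_closed[OF C fin] N.lspan_add[OF C fin] N.lspan_smult[OF C fin]
  N.lspan_zero[OF C fin] N.lspan_base[OF C fin] N.lspan_minus[OF C fin]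
 have sJ: "\<rho> x \<in> ?J" if "x \<in> ?J" for x
 proof -
  have "?J \<subseteq> {x \<in> carrier N. \<rho> x \<in> ?J}"
  proof (rule N.lspan_least[OF C fin])
   fix a k assume ak: "a \<in> carrier N" "k \<in> {..<p}"
   have "\<rho> (?g k) = ?g (Suc k mod p)" using sigma_pow_mod[OF w(1), of "Suc k"] by simp
   moreover have "?g (Suc k mod p) \<in> ?J" using p_pos by (intro L(5)) simp
   ultimately show "a \<otimes>\<^bsub>N\<^esub> ?g k \<in> {x \<in> carrier N. \<rho> x \<in> ?J}"
    using ak w L(3) by simp
  qed (use L in auto)
  then show ?thesis using that by blast
 qed
 have "w \<in> ?J" using L(5)[of 0] p_pos by simp
 then obtain c where c: "c \<in> carrier R" "c ~= \<zero>" "\<nu> c \<in> ?J"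
  using stable_ideal[of ?J w] L sJ w by (auto simp: \<Delta>_def N.minus_eq)
 have "c \<in> Units R" using c field_Units by blast
 then have "\<nu> (inv c) \<otimes>\<^bsub>N\<^esub> \<nu> c = \<one>\<^bsub>N\<^esub>" using nu.hom_mult[of "inv c" c] c by simp
 then have "\<one>\<^bsub>N\<^esub> \<in> ?J" using L(3)[of "\<nu> (inv c)" "\<nu> c"] c \<open>c \<in> Units R\<close> by simp
 then obtain a where a: "a \<in> {..<p} \<rightarrow> carrier N" "\<one>\<^bsub>N\<^esub> = (\<Oplus>\<^bsub>N\<^esub>k\<in>{..<p}. a k \<otimes>\<^bsub>N\<^esub> ?g k)"
  unfolding N.lspan_def by blast
 have ac: "a k \<in> carrier N" if "k < p" for k using a that by auto
 have collapse: "(\<Oplus>\<^bsub>N\<^esub>k\<in>{..<p}. b k \<otimes>\<^bsub>N\<^esub> (\<rho> ^^ k) v) \<otimes>\<^bsub>N\<^esub> v = b 0 \<otimes>\<^bsub>N\<^esub> v \<otimes>\<^bsub>N\<^esub> v"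
  if v: "v \<in> carrier N" "!!k. 0 < k ==> k < p ==> (\<rho> ^^ k) v \<otimes>\<^bsub>N\<^esub> v = \<zero>\<^bsub>N\<^esub>" and b: "!!k. k < p ==> b k \<in> carrier N" for b v
 proof -
  have "(\<Oplus>\<^bsub>N\<^esub>k\<in>{..<p}. b k \<otimes>\<^bsub>N\<^esub> (\<rho> ^^ k) v) \<otimes>\<^bsub>N\<^esub> v = (\<Oplus>\<^bsub>N\<^esub>k\<in>{..<p}. b k \<otimes>\<^bsub>N\<^esub> (\<rho> ^^ k) v \<otimes>\<^bsub>N\<^esub> v)"
   using v b by (intro N.finsum_ldistr) auto
  also have "\<dots> = (\<Oplus>\<^bsub>N\<^esub>k\<in>{..<p}. if 0 = k then b k \<otimes>\<^bsub>N\<^esub> v \<otimes>\<^bsub>N\<^esub> v else \<zero>\<^bsub>N\<^esub>)"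
   using v b by (intro N.finsum_cong') (auto simp: N.m_assoc)
  also have "\<dots> = b 0 \<otimes>\<^bsub>N\<^esub> v \<otimes>\<^bsub>N\<^esub> v"
   using p_pos v b by (intro N.finsum_singleton) auto
  finally show ?thesis .
 qed
 have a0: "a 0 \<in> carrier N" using ac p_pos by blast
 have wa: "w = a 0 \<otimes>\<^bsub>N\<^esub> w \<otimes>\<^bsub>N\<^esub> w"
 proof -
  have "(\<Oplus>\<^bsub>N\<^esub>k\<in>{..<p}. a k \<otimes>\<^bsub>N\<^esub> (\<rho> ^^ k) w) \<otimes>\<^bsub>N\<^esub> w = a 0 \<otimes>\<^bsub>N\<^esub> w \<otimes>\<^bsub>N\<^esub> w"
   by (rule collapse) (use w orth ac in auto)
  then show ?thesis using w(1) unfolding a(2)[symmetric] by simp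
 qed
 define e where "e = a 0 \<otimes>\<^bsub>N\<^esub> w"
 have e: "e \<in> carrier N" using a0 w by (simp add: e_def)
 have ew: "e \<otimes>\<^bsub>N\<^esub> w = w" using wa by (simp add: e_def)
 have "e \<otimes>\<^bsub>N\<^esub> (a 0 \<otimes>\<^bsub>N\<^esub> w) = a 0 \<otimes>\<^bsub>N\<^esub> (e \<otimes>\<^bsub>N\<^esub> w)" by (rule N.m_lcomm[OF e a0 w(1)])
 then have ee: "e \<otimes>\<^bsub>N\<^esub> e = e" unfolding ew e_def[symmetric] .
 have e0: "e ~= \<zero>\<^bsub>N\<^esub>" using ew w N.l_null by metis
 have eorth: "(\<rho> ^^ k) e \<otimes>\<^bsub>N\<^esub> e = \<zero>\<^bsub>N\<^esub>" if "0 < k" "k < p" for k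
 proof -
  interpret sk: ring_hom_ring N N "\<rho> ^^ k" by (rule sigma_pow)
  have "(\<rho> ^^ k) e \<otimes>\<^bsub>N\<^esub> e = (\<rho> ^^ k) (a 0) \<otimes>\<^bsub>N\<^esub> a 0 \<otimes>\<^bsub>N\<^esub> ((\<rho> ^^ k) w \<otimes>\<^bsub>N\<^esub> w)"
   unfolding e_def using a0 w by (simp add: N.m_ac)
  then show ?thesis using orth[OF that] a0 by simp
 qed
 define x where "x = rt \<otimes>\<^bsub>N\<^esub> e"
 have x: "x \<in> carrier N" using e by (simp add: x_def)
 define t where "t = (\<Oplus>\<^bsub>N\<^esub>k\<in>{..<p}. (\<rho> ^^ k) x)"
 have t: "t \<in> carrier N" unfolding t_def using x by (intro N.finsum_closed) auto
 have "\<rho> t = (\<Oplus>\<^bsub>N\<^esub>k\<in>{..<p}. (\<rho> ^^ ((k + 1) mod p)) x)"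
  unfolding t_def using x by (subst s.hom_finsum') (auto simp: sigma_pow_mod intro!: N.finsum_cong')
 also have "\<dots> = (\<Oplus>\<^bsub>N\<^esub>k\<in>(%k. (k + 1) mod p) ` {..<p}. (\<rho> ^^ k) x)"
  by (rule N.finsum_reindex[symmetric]) (use x shift_mod_image(1)[OF p_pos, of 1] in auto)
 finally have "\<rho> t = t" unfolding shift_mod_image(2)[OF p_pos] t_def .
 then obtain c where c: "c \<in> carrier R" "t = \<nu> c" using sigma_fixed t by blast
 have "t \<otimes>\<^bsub>N\<^esub> e = (\<Oplus>\<^bsub>N\<^esub>k\<in>{..<p}. (\<rho> ^^ k) rt \<otimes>\<^bsub>N\<^esub> (\<rho> ^^ k) e) \<otimes>\<^bsub>N\<^esub> e"
 proof -
  have "(\<rho> ^^ k) x = (\<rho> ^^ k) rt \<otimes>\<^bsub>N\<^esub> (\<rho> ^^ k) e" for k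
   unfolding x_def using e ring_hom_mult[OF ring_hom_ring.homh[OF sigma_pow(1)]] by simp
  then show ?thesis by (simp add: t_def)
 qed
 also have "\<dots> = rt \<otimes>\<^bsub>N\<^esub> e"
  using collapse[OF e eorth, of "%k. (\<rho> ^^ k) rt"] e ee by (simp add: N.m_assoc)
 finally have te: "\<nu> c \<otimes>\<^bsub>N\<^esub> e = rt \<otimes>\<^bsub>N\<^esub> e" by (simp add: c)
 have epow: "e [^]\<^bsub>N\<^esub> p = e"
 proof -
  have "e [^]\<^bsub>N\<^esub> Suc n = e" for n by (induction n) (use e ee in auto)
  then show ?thesis using p_pos gr0_conv_Suc by metis
 qed
 have "\<nu> c [^]\<^bsub>N\<^esub> p \<otimes>\<^bsub>N\<^esub> e = rt [^]\<^bsub>N\<^esub> p \<otimes>\<^bsub>N\<^esub> e"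
  using arg_cong[OF te, of "%x. x [^]\<^bsub>N\<^esub> p"] c e epow by (simp add: N.nat_pow_distrib)
 then have "(\<nu> c [^]\<^bsub>N\<^esub> p \<ominus>\<^bsub>N\<^esub> \<nu> c) \<otimes>\<^bsub>N\<^esub> e = (rt [^]\<^bsub>N\<^esub> p \<ominus>\<^bsub>N\<^esub> rt) \<otimes>\<^bsub>N\<^esub> e"
  using te c e by (simp add: N.diff_mult)
 then have "\<nu> ((c [^] p \<ominus> c) \<ominus> \<delta>) \<otimes>\<^bsub>N\<^esub> e = \<zero>\<^bsub>N\<^esub>"
  using c e by (simp add: rt_eq nu.hom_diff nu.hom_nat_pow N.diff_mult)
 have "(c [^] p \<ominus> c) \<ominus> \<delta> = \<zero>"
 proof (rule ccontr)
  let ?d = "(c [^] p \<ominus> c) \<ominus> \<delta>"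
  assume "?d ~= \<zero>"
  then have u: "?d \<in> Units R" using c field_Units by simp
  have i1: "\<nu> (inv ?d) \<otimes>\<^bsub>N\<^esub> \<nu> ?d = \<one>\<^bsub>N\<^esub>"
   unfolding nu.hom_mult[OF Units_inv_closed[OF u] Units_closed[OF u], symmetric] Units_l_inv[OF u] by simp
  have "\<nu> (inv ?d) \<otimes>\<^bsub>N\<^esub> (\<nu> ?d \<otimes>\<^bsub>N\<^esub> e) = \<nu> (inv ?d) \<otimes>\<^bsub>N\<^esub> \<nu> ?d \<otimes>\<^bsub>N\<^esub> e"
   by (rule N.m_assoc[symmetric, OF nu.hom_closed[OF Units_inv_closed[OF u]] nu.hom_closed[OF Units_closed[OF u]] e])
  then have "\<nu> (inv ?d) \<otimes>\<^bsub>N\<^esub> (\<nu> ?d \<otimes>\<^bsub>N\<^esub> e) = e" unfolding i1 N.l_one[OF e] .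
  then have "e = \<zero>\<^bsub>N\<^esub>"
   unfolding \<open>\<nu> ?d \<otimes>\<^bsub>N\<^esub> e = \<zero>\<^bsub>N\<^esub>\<close> N.r_null[OF nu.hom_closed[OF Units_inv_closed[OF u]]] by (rule sym)
  then show False using e0 by contradiction
 qed
 then have "c [^] p \<ominus> c = \<delta>" using c by simp
 then show ?thesis using c by blast
qed

text \<open>The norm of \<open>z\<close> is invariant, hence a constant, and if it is nonzero then
  \<open>z\<close> is a unit. Otherwise there is a largest set of conjugates of \<open>z\<close>
  with nonzero product, and this product is orthogonal to its translates, against
  \<open>sigma_orbit_root\<close>.\<close>

lemma N_field:
 assumes no_root: "~ (\<exists>c\<in>carrier R. c [^] p \<ominus> c = \<delta>)"
 shows "field N"
proof (rule N.cring_fieldI)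
 have unit: "z \<in> Units N" if z: "z \<in> carrier N" "z ~= \<zero>\<^bsub>N\<^esub>" for z
 proof -
  define W where "W S = (\<Otimes>\<^bsub>N\<^esub>i\<in>S. (\<rho> ^^ i) z)" for S
  have Wc [simp]: "W S \<in> carrier N" for S using z by (auto simp: W_def intro!: N.finprod_closed)
  have W_insert: "W (insert j S) = (\<rho> ^^ j) z \<otimes>\<^bsub>N\<^esub> W S" if "finite S" "j \<notin> S" for j S
   unfolding W_def using that z by (intro N.finprod_insert) auto
  have W_shift: "(\<rho> ^^ k) (W S) = W ((%i. (i + k) mod p) ` S)" if S: "S \<subseteq> {..<p}" for k S
  proof -
   interpret sk: ring_hom_ring N N "\<rho> ^^ k" by (rule sigma_pow)
   have fin: "finite S" using S finite_subset by blast
   have hom: "(\<rho> ^^ k) (W A) = (\<Otimes>\<^bsub>N\<^esub>i\<in>A. (\<rho> ^^ k) ((\<rho> ^^ i) z))" if "finite A" for A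
    using that unfolding W_def using z by (induction A rule: finite_induct) (auto simp: Pi_def)
   have "(\<rho> ^^ k) (W S) = (\<Otimes>\<^bsub>N\<^esub>i\<in>S. (\<rho> ^^ ((i + k) mod p)) z)"
    unfolding hom[OF fin] using z by (intro N.finprod_cong') (auto simp: sigma_pow_mod funpow_add add.commute[of _ k])
   also have "\<dots> = W ((%i. (i + k) mod p) ` S)"
    unfolding W_def using z inj_on_subset[OF shift_mod_image(1)[OF p_pos] S]
    by (intro N.finprod_reindex[symmetric]) auto
   finally show ?thesis .
  qed
  have "\<rho> (W {..<p}) = W {..<p}"
   using W_shift[of "{..<p}" 1] shift_mod_image(2)[OF p_pos, of 1] by simp
  then obtain r where r: "r \<in> carrier R" "W {..<p} = \<nu> r" using sigma_fixed[OF Wc] by blast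
  have "r ~= \<zero>"
  proof
   assume "r = \<zero>"
   then have W0: "W {..<p} = \<zero>\<^bsub>N\<^esub>" using r by simp
   let ?Q = "%S. S \<subseteq> {..<p} & W S ~= \<zero>\<^bsub>N\<^esub>"
   have bound: "\<forall>S. ?Q S --> card S < Suc p" by (metis card_lessThan card_mono finite_lessThan le_imp_less_Suc)
   have "?Q {0}" using z p_pos by (auto simp: W_def)
   \<comment> \<open>\<open>S\<close> is proper because the full product vanishes. A nontrivial
     translate of \<open>S\<close> differs from it and brings in an index \<open>j\<close> outside
     \<open>S\<close>; maximality then gives \<open>W (insert j S) = 0\<close>.\<close>
   then obtain S where S: "?Q S" and max: "!!T. ?Q T ==> card T \<le> card S"
    using ex_has_greatest_nat[of ?Q "{0}" card "Suc p"] bound by blast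
   have fin: "finite S" using S finite_subset by blast
   have S0: "S ~= {}" using max[OF \<open>?Q {0}\<close>] by auto
   have Sp: "S ~= {..<p}" using S W0 by auto
   have "(\<rho> ^^ k) (W S) \<otimes>\<^bsub>N\<^esub> W S = \<zero>\<^bsub>N\<^esub>" if k: "0 < k" "k < p" for k
   proof -
    let ?T = "(%i. (i + k) mod p) ` S"
    have T: "?T \<subseteq> {..<p}" "finite ?T" using p_pos fin by auto
    have "card ?T = card S" using inj_on_subset[OF shift_mod_image(1)[OF p_pos]] S by (intro card_image) blast
    moreover have "?T ~= S" using S S0 Sp k by (intro shift_mod_moves[OF prime_p]) auto
    ultimately have "~ ?T \<subseteq> S" using fin card_subset_eq by metis
    then obtain j where j: "j \<in> ?T" "j \<notin> S" by blast
    have "W (insert j S) = \<zero>\<^bsub>N\<^esub>"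
    proof (rule ccontr)
     assume "W (insert j S) ~= \<zero>\<^bsub>N\<^esub>"
     then have "?Q (insert j S)" using S T j by blast
     then show False using max[of "insert j S"] fin j by simp
    qed
    then have jz: "(\<rho> ^^ j) z \<otimes>\<^bsub>N\<^esub> W S = \<zero>\<^bsub>N\<^esub>" using W_insert[OF fin j(2)] by simp
    have "W ?T = (\<rho> ^^ j) z \<otimes>\<^bsub>N\<^esub> W (?T - {j})"
     using W_insert[of "?T - {j}" j] T j by (simp add: insert_absorb)
    then have "W ?T \<otimes>\<^bsub>N\<^esub> W S = W (?T - {j}) \<otimes>\<^bsub>N\<^esub> ((\<rho> ^^ j) z \<otimes>\<^bsub>N\<^esub> W S)"
     using z by (simp add: N.m_ac)
    then show ?thesis using W_shift[of S k] S jz by simp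
   qed
   then show False using sigma_orbit_root[of "W S"] S no_root by auto
  qed
  then have "r \<in> Units R" using r field_Units by blast
  then have "W {..<p} \<in> Units N" using r nu.hom_Units by simp
  moreover have "{..<p} = insert 0 ({..<p} - {0})" using p_pos by auto
  then have "W {..<p} = z \<otimes>\<^bsub>N\<^esub> W ({..<p} - {0})" using W_insert[of "{..<p} - {0}" 0] by simp
  ultimately show ?thesis using z by (metis N.Units_of_comm_prod N.m_comm Wc)
 qed
 show "Units N = carrier N - {\<zero>\<^bsub>N\<^esub>}"
 proof
  show "Units N \<subseteq> carrier N - {\<zero>\<^bsub>N\<^esub>}"
  proof
   fix u assume u: "u \<in> Units N"
   then have "u ~= \<zero>\<^bsub>N\<^esub>" using N_one_not_zero N.r_null N.Units_l_inv N.Units_inv_closed by metis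
   then show "u \<in> carrier N - {\<zero>\<^bsub>N\<^esub>}" using u by (simp add: N.Units_closed)
  qed
  show "carrier N - {\<zero>\<^bsub>N\<^esub>} \<subseteq> Units N" using unit by blast
 qed
qed

text \<open>An automorphism over the base moves the root by some \<open>\<mu>\<close> with
  \<open>\<mu>^p = \<mu>\<close>. In a field the falling factorial of length \<open>p\<close>
  vanishes only at integers, so \<open>\<mu>\<close> is one and the automorphism is a power of
  \<open>\<rho>\<close>.\<close>

lemma cyclic:
 assumes no_root: "~ (\<exists>c\<in>carrier R. c [^] p \<ominus> c = \<delta>)"
 shows "cyclic_ext p R E"
proof -
 interpret Nf: field N by (rule N_field[OF no_root])
 have bij: "\<rho> \<in> ring_iso N N"
 proof -
  have inv1: "(\<rho> ^^ (p - 1)) (\<rho> z) = z" "\<rho> ((\<rho> ^^ (p - 1)) z) = z" if "z \<in> carrier N" for z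
  proof -
   obtain m where m: "p = Suc m" using p_pos gr0_conv_Suc by blast
   have "(\<rho> ^^ p) z = z" using sigma_pow_mod[OF that, of p] by simp
   then show "\<rho> ((\<rho> ^^ (p - 1)) z) = z" "(\<rho> ^^ (p - 1)) (\<rho> z) = z" by (auto simp: m funpow_swap1)
  qed
  have "bij_betw \<rho> (carrier N) (carrier N)"
   by (rule bij_betw_byWitness[where f' = "\<rho> ^^ (p - 1)"])
    (use inv1 ring_hom_closed[OF ring_hom_ring.homh[OF sigma(1)]] in auto)
  then show ?thesis using ring_hom_ring.homh[OF sigma(1)] by (simp add: ring_iso_def)
 qed
 have sg: "\<rho> \<in> galois_auts R E" using bij sigma(3) by (simp add: galois_auts_def as_ext)
 have gen: "\<exists>i::nat. \<forall>x \<in> carrier N. \<tau> x = (\<rho> ^^ i) x" if \<tau>: "\<tau> \<in> galois_auts R E" for \<tau>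
 proof -
  have \<tau>': "\<tau> \<in> ring_iso N N" "!!a. a \<in> carrier R ==> \<tau> (\<nu> a) = \<nu> a"
   using \<tau> by (auto simp: galois_auts_def as_ext)
  then interpret t: ring_hom_ring N N \<tau> using N.ring_axioms by (intro ring_hom_ringI2) (auto simp: ring_iso_def)
  have "\<tau> (rt [^]\<^bsub>N\<^esub> p \<ominus>\<^bsub>N\<^esub> rt) = \<tau> (\<nu> \<delta>)" by (simp only: rt_eq)
  then have tr: "\<tau> rt [^]\<^bsub>N\<^esub> p \<ominus>\<^bsub>N\<^esub> \<tau> rt = \<nu> \<delta>" using \<tau>'(2) by (simp add: t.hom_diff t.hom_nat_pow)
  define \<mu> where "\<mu> = \<tau> rt \<ominus>\<^bsub>N\<^esub> rt"
  have mc: "\<mu> \<in> carrier N" by (simp add: \<mu>_def)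
  have "N.falling \<mu> p = (\<tau> rt [^]\<^bsub>N\<^esub> p \<ominus>\<^bsub>N\<^esub> rt [^]\<^bsub>N\<^esub> p) \<ominus>\<^bsub>N\<^esub> (\<tau> rt \<ominus>\<^bsub>N\<^esub> rt)"
   unfolding N.falling_p[OF mc] unfolding \<mu>_def by (simp add: N.diff_pow_p N.m_comm)
  also have "\<dots> = (\<tau> rt [^]\<^bsub>N\<^esub> p \<ominus>\<^bsub>N\<^esub> \<tau> rt) \<ominus>\<^bsub>N\<^esub> (rt [^]\<^bsub>N\<^esub> p \<ominus>\<^bsub>N\<^esub> rt)"
   by (rule N.diff_exchange) auto
  also have "\<dots> = \<zero>\<^bsub>N\<^esub>" unfolding tr rt_eq by simp
  finally obtain i where i: "\<mu> = [int i] \<cdot>\<^bsub>N\<^esub> \<one>\<^bsub>N\<^esub>" using Nf.falling_zero_imp[OF mc] by blast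
  have "\<tau> rt = rt \<oplus>\<^bsub>N\<^esub> \<mu>" unfolding \<mu>_def by (simp add: N.minus_eq N.add_minus_cancel)
  then have "\<tau> rt = (\<rho> ^^ i) rt" using sigma_pow(2)[of i] i by simp
  then have "\<tau> x = (\<rho> ^^ i) x" if "x \<in> carrier N" for x
   by (rule N_hom_eqI[OF t.ring_hom_ring_axioms sigma_pow(1)]) (use \<open>\<tau> rt = (\<rho> ^^ i) rt\<close> \<tau>'(2) sigma_pow(3) that in simp_all)
  then show ?thesis by blast
 qed
 have fixed: "{x \<in> carrier N. \<forall>\<tau> \<in> galois_auts R E. \<tau> x = x} = \<nu> ` carrier R"
 proof
  show "{x \<in> carrier N. \<forall>\<tau> \<in> galois_auts R E. \<tau> x = x} \<subseteq> \<nu> ` carrier R"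
  proof
   fix x assume "x \<in> {x \<in> carrier N. \<forall>\<tau> \<in> galois_auts R E. \<tau> x = x}"
   then have "x \<in> carrier N" "\<rho> x = x" using sg by auto
   then show "x \<in> \<nu> ` carrier R" by (rule sigma_fixed)
  qed
  show "\<nu> ` carrier R \<subseteq> {x \<in> carrier N. \<forall>\<tau> \<in> galois_auts R E. \<tau> x = x}"
   by (auto simp: galois_auts_def as_ext)
 qed
 have "\<exists>s \<in> galois_auts R E. \<forall>\<tau> \<in> galois_auts R E. \<exists>i::nat. \<forall>x \<in> carrier N. \<tau> x = (s ^^ i) x"
  using sg gen by (intro bexI[of _ \<rho>]) auto
 moreover have "field_ext R E"
  unfolding field_ext_def as_ext using field_axioms Nf.field_axioms nu.homh by simp
 moreover have "has_degree R E p" using degree_N as_poly_props(2) by (simp add: as_ext)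
 ultimately show ?thesis unfolding cyclic_ext_def using fixed by (simp add: as_ext)
qed

end

section \<open>Stable subspaces\<close>

context ring begin

context
 fixes K assumes K: "subfield K R"
begin

text \<open>Independent lists inside \<open>U\<close> have length at most \<open>n\<close>, and a
  longest one spans \<open>U\<close>.\<close>

lemma subspace_dimension:
 assumes "dimension n K E" "U \<subseteq> E" "\<zero> \<in> U" "!!a b. a \<in> U ==> b \<in> U ==> a \<oplus> b \<in> U"
  and "!!k a. k \<in> K ==> a \<in> U ==> k \<otimes> a \<in> U"
 shows "\<exists>k\<le>n. dimension k K U"
proof -
 have UR: "U \<subseteq> carrier R" using assms(2) space_subgroup_props(1)[OF K assms(1)] by blast
 let ?P = "%Us. independent K Us & set Us \<subseteq> U"
 have bound: "length Us \<le> n" if "?P Us" for Us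
  using independent_length_le_dimension[OF K assms(1)] that assms(2) by blast
 have "?P []" by auto
 then obtain Us where Us: "?P Us" and max: "!!Vs. ?P Vs ==> length Vs \<le> length Us"
  using ex_has_greatest_nat[of ?P "[]" length "Suc n"] bound by (metis less_Suc_eq_le)
 have span: "Span K Us \<subseteq> U"
 proof -
  have "set Vs \<subseteq> U ==> Span K Vs \<subseteq> U" for Vs
  proof (induction Vs)
   case Nil
   then show ?case using assms(3) by simp
  next
   case (Cons v Vs)
   have IH: "Span K Vs \<subseteq> U" and v: "v \<in> U" using Cons by auto
   show ?case
   proof
    fix z assume "z \<in> Span K (v # Vs)"
    then obtain k w where kw: "k \<in> K" "w \<in> Span K Vs" "z = k \<otimes> v \<oplus> w" by (auto simp: line_extension_mem_iff)
    then have "w \<in> U" using IH by blast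
    then show "z \<in> U" unfolding kw(3) by (rule assms(4)[OF assms(5)[OF kw(1) v]])
   qed
  qed
  then show ?thesis using Us by blast
 qed
 have "U \<subseteq> Span K Us"
 proof
  fix u assume u: "u \<in> U"
  show "u \<in> Span K Us"
  proof (rule ccontr)
   assume "u \<notin> Span K Us"
   then have "?P (u # Us)" using Us u UR by (auto intro: li_Cons)
   then show False using max[of "u # Us"] by simp
  qed
 qed
 then have "Span K Us = U" using span by blast
 then show ?thesis using dimension_independent[of K Us] Us bound by auto
qed

lemma subspace_dimension_le:
 assumes "dimension n K E" "dimension k K U" "U \<subseteq> E"
 shows "k \<le> n" "k = n ==> U = E"
proof -
 obtain Us where Us: "set Us \<subseteq> carrier R" "independent K Us" "length Us = k" "Span K Us = U"
  using exists_base[OF K assms(2)] by blast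
 have s: "set Us \<subseteq> E" using Span_base_incl[OF K Us(1)] Us(4) assms(3) by blast
 show "k \<le> n" using independent_length_le_dimension[OF K assms(1) Us(2) s] Us(3) by simp
 show "U = E" if "k = n" using independent_length_eq_dimension[OF K assms(1) Us(2) s] Us(3,4) that by simp
qed

text \<open>Multiplication by a unit commuting with \<open>K\<close> is injective and linear over
  \<open>K\<close>, so it carries one tower of line extensions to another.\<close>

lemma dimension_unit_image:
 assumes "dimension n K E" "g \<in> Units R" "!!k. k \<in> K ==> g \<otimes> k = k \<otimes> g"
 shows "dimension n K ((%a. g \<otimes> a) ` E)"
 using assms(1)
proof (induction n arbitrary: E)
 case 0
 have "(%a. g \<otimes> a) ` {\<zero>} = {\<zero>}" using assms(2) by auto
 then show ?case using dimension_zero[OF K 0] by simp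
next
 case (Suc n E0)
 obtain v E where Suc_dim: "v \<in> carrier R" "v \<notin> E" "dimension n K E" and E0: "E0 = line_extension K v E"
  using dimension_backwards[OF K Suc.prems] by blast
 have g: "g \<in> carrier R" using assms(2) by auto
 have ER: "E \<subseteq> carrier R" using space_subgroup_props(1)[OF K Suc_dim(3)] .
 have KR: "K \<subseteq> carrier R" using subfieldE(3)[OF K] .
 have v: "g \<otimes> v \<notin> (%a. g \<otimes> a) ` E"
 proof
  assume "g \<otimes> v \<in> (%a. g \<otimes> a) ` E"
  then obtain a where "a \<in> E" "g \<otimes> v = g \<otimes> a" by blast
  then have "v = a" using Units_l_cancel[OF assms(2) Suc_dim(1), of a] ER by blast
  then show False using \<open>a \<in> E\<close> Suc_dim(2) by simp
 qed
 have line: "g \<otimes> (k \<otimes> v \<oplus> a) = k \<otimes> (g \<otimes> v) \<oplus> g \<otimes> a" if "k \<in> K" "a \<in> E" for k a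
 proof -
  have c: "k \<in> carrier R" "a \<in> carrier R" using that KR ER by auto
  have "g \<otimes> (k \<otimes> v) = (k \<otimes> g) \<otimes> v" using m_assoc[OF g c(1) Suc_dim(1)] assms(3)[OF that(1)] by simp
  then show ?thesis using c g Suc_dim(1) by (simp add: r_distr m_assoc)
 qed
 have "(%a. g \<otimes> a) ` line_extension K v E = line_extension K (g \<otimes> v) ((%a. g \<otimes> a) ` E)"
 proof (intro equalityI subsetI)
  fix z assume "z \<in> (%a. g \<otimes> a) ` line_extension K v E"
  then obtain k a where "k \<in> K" "a \<in> E" "z = g \<otimes> (k \<otimes> v \<oplus> a)" by (auto simp: line_extension_mem_iff)
  then show "z \<in> line_extension K (g \<otimes> v) ((%a. g \<otimes> a) ` E)"
   using line by (auto simp: line_extension_mem_iff)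
 next
  fix z assume "z \<in> line_extension K (g \<otimes> v) ((%a. g \<otimes> a) ` E)"
  then obtain k a where ka: "k \<in> K" "a \<in> E" "z = k \<otimes> (g \<otimes> v) \<oplus> g \<otimes> a" by (auto simp: line_extension_mem_iff)
  then have "z = g \<otimes> (k \<otimes> v \<oplus> a)" using line by simp
  moreover have "k \<otimes> v \<oplus> a \<in> line_extension K v E" using ka unfolding line_extension_mem_iff by blast
  ultimately show "z \<in> (%a. g \<otimes> a) ` line_extension K v E" by blast
 qed
 then show ?case using dimension.Suc_dim[OF m_closed[OF g Suc_dim(1)] v Suc.IH[OF Suc_dim(3)]] unfolding E0 by simp
qed

text \<open>If \<open>V\<close> is irreducible under \<open>S\<close> and the unit \<open>y\<close>, and \<open>W\<close> is a nonzero \<open>S\<close>-stable subspace of the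
 least possible dimension, then \<open>V\<close> is a direct sum of some of the translates \<open>y\<^sup>i W\<close>.\<close>

lemma minimal_stable_subspace:
 assumes V: "dimension n K V" "n > 0" and S: "S \<subseteq> carrier R" and y: "y \<in> Units R"
  and yK: "!!k. k \<in> K ==> y \<otimes> k = k \<otimes> y" and yS: "!!s. s \<in> S ==> y \<otimes> s = s \<otimes> y"
  and SV: "!!s v. s \<in> S ==> v \<in> V ==> s \<otimes> v \<in> V" and yV: "!!v. v \<in> V ==> y \<otimes> v \<in> V"
  and q: "(q::nat) > 0" "y [^] q \<in> K"
  and irr: "!!U m. dimension m K U ==> U \<subseteq> V ==> U ~= {\<zero>} ==> (!!s u. s \<in> S ==> u \<in> U ==> s \<otimes> u \<in> U)
    ==> (!!u. u \<in> U ==> y \<otimes> u \<in> U) ==> U = V"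
 shows "\<exists>W d. W \<subseteq> V & dimension d K W & d > 0 & d dvd n & (\<forall>s\<in>S. \<forall>w\<in>W. s \<otimes> w \<in> W) &
  (\<forall>U k. dimension k K U --> U \<subseteq> W --> U ~= {\<zero>} --> (\<forall>s\<in>S. \<forall>u\<in>U. s \<otimes> u \<in> U) --> U = W)"
proof -
 define Q where "Q d \<longleftrightarrow> (\<exists>W. W \<subseteq> V & dimension d K W & d > 0 & (\<forall>s\<in>S. \<forall>w\<in>W. s \<otimes> w \<in> W))" for d
 define d where "d = (LEAST d. Q d)"
 have "Q n" unfolding Q_def using V SV by (intro exI[of _ V]) auto
 then have "Q d" unfolding d_def by (rule LeastI)
 then obtain W where W: "W \<subseteq> V" "dimension d K W" "d > 0" "!!s w. s \<in> S ==> w \<in> W ==> s \<otimes> w \<in> W"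
  unfolding Q_def by blast
 have pos: "k > 0" if "dimension k K U" "U ~= {\<zero>}" for k U
 proof (rule ccontr)
  assume "~ k > 0"
  then have "dimension 0 K U" using that(1) by simp
  from dimension_zero[OF K this] show False using that(2) by contradiction
 qed
 \<comment> \<open>Minimality is stated for every subspace of \<open>V\<close> of dimension
   \<open>d\<close>, because it is applied to the translates as well as to \<open>W\<close>.\<close>
 have least: "U = E" if U: "dimension k K U" "U \<subseteq> E" "U ~= {\<zero>}" "\<forall>s\<in>S. \<forall>u\<in>U. s \<otimes> u \<in> U"
  and E: "dimension d K E" "E \<subseteq> V" for U k E
 proof -
  have "Q k" unfolding Q_def using U E pos[OF U(1,3)] by blast
  then have "d \<le> k" unfolding d_def by (rule Least_le)
  moreover have "k \<le> d" using subspace_dimension_le(1)[OF E(1) U(1,2)] .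
  ultimately show ?thesis using subspace_dimension_le(2)[OF E(1) U(1,2)] by simp
 qed
 have yc: "y \<in> carrier R" using y by auto
 have VR: "V \<subseteq> carrier R" using space_subgroup_props(1)[OF K V(1)] .
 have yp: "y [^] i \<in> Units R" "y [^] i \<in> carrier R" for i :: nat using y by (auto intro: Units_pow_closed)
 have ypK: "y [^] i \<otimes> k = k \<otimes> y [^] i" if "k \<in> K" for i :: nat and k
  using group_commutes_pow[OF yK[OF that] yc subsetD[OF subfieldE(3)[OF K] that]] .
 have ypS: "y [^] i \<otimes> k = k \<otimes> y [^] i" if "k \<in> S" for i :: nat and k
  using group_commutes_pow[OF yS[OF that] yc subsetD[OF S that]] .
 define T where "T i = (%w. y [^] i \<otimes> w) ` W" for i :: nat
 have TV: "T i \<subseteq> V" for i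
 proof (induction i)
  case 0
  then show ?case using W(1) VR by (auto simp: T_def subset_iff)
 next
  case (Suc i)
  have "y [^] Suc i \<otimes> w \<in> V" if "w \<in> W" for w
  proof -
   have "w \<in> carrier R" using that W(1) VR by blast
   then have "y [^] Suc i \<otimes> w = y \<otimes> (y [^] i \<otimes> w)" unfolding nat_pow_Suc2[OF yc] using yc by (simp add: m_assoc)
   moreover have "y [^] i \<otimes> w \<in> V" using Suc that by (auto simp: T_def)
   ultimately show ?thesis using yV by simp
  qed
  then show ?case by (auto simp: T_def)
 qed
 have Td: "dimension d K (T i)" for i
  unfolding T_def by (rule dimension_unit_image[OF W(2) yp(1) ypK])
 have TS: "s \<otimes> t \<in> T i" if s: "s \<in> S" and t: "t \<in> T i" for s t i
 proof -
  obtain w where w: "w \<in> W" "t = y [^] i \<otimes> w" using t by (auto simp: T_def)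
  have c: "s \<in> carrier R" "w \<in> carrier R" using s S w W(1) VR by auto
  have "s \<otimes> t = y [^] i \<otimes> (s \<otimes> w)"
   unfolding w(2) using m_assoc[OF c(1) yp(2) c(2)] m_assoc[OF yp(2) c] ypS[OF s] by simp
  then show ?thesis using W(4)[OF s w(1)] by (auto simp: T_def)
 qed
 \<comment> \<open>\<open>C i\<close> is the sum of the first \<open>i\<close> translates. By
   minimality the next translate meets it in 0 or lies inside it, so every dimension occurring is a
   multiple of \<open>d\<close>.\<close>
 define C where "C = rec_nat {\<zero>} (%i A. A <+>\<^bsub>R\<^esub> T i)"
 have C0: "C 0 = {\<zero>}" and CS: "C (Suc i) = C i <+>\<^bsub>R\<^esub> T i" for i by (simp_all add: C_def)
 have Cmem: "z \<in> C (Suc i) \<longleftrightarrow> (\<exists>a\<in>C i. \<exists>t\<in>T i. z = a \<oplus> t)" for z i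
  unfolding CS set_add_def' by blast
 have TR: "t \<in> carrier R" if "t \<in> T i" for t i using subsetD[OF VR subsetD[OF TV that]] .
 note Vp = space_subgroup_props[OF K V(1)]
 note Tp = space_subgroup_props[OF K Td]
 have C: "C i \<subseteq> V & (\<forall>s\<in>S. \<forall>a\<in>C i. s \<otimes> a \<in> C i) & (\<exists>m. dimension (m * d) K (C i))" for i
 proof (induction i)
  case 0
  have "dimension (0 * d) K {\<zero>}" by simp
  then show ?case unfolding C0 using Vp(2) S by (auto intro!: exI[of _ 0])
 next
  case (Suc i)
  then obtain m where IH: "C i \<subseteq> V" "\<forall>s\<in>S. \<forall>a\<in>C i. s \<otimes> a \<in> C i" "dimension (m * d) K (C i)" by blast
  have sub: "C (Suc i) \<subseteq> V"
  proof
   fix z assume "z \<in> C (Suc i)"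
   then obtain a t where at: "a \<in> C i" "t \<in> T i" "z = a \<oplus> t" unfolding Cmem by blast
   show "z \<in> V" unfolding at(3) by (rule Vp(3)[OF subsetD[OF IH(1) at(1)] subsetD[OF TV at(2)]])
  qed
  have st: "\<forall>s\<in>S. \<forall>a\<in>C (Suc i). s \<otimes> a \<in> C (Suc i)"
  proof (intro ballI)
   fix s z assume s: "s \<in> S" and "z \<in> C (Suc i)"
   then obtain a t where at: "a \<in> C i" "t \<in> T i" "z = a \<oplus> t" unfolding Cmem by blast
   have "s \<otimes> z = s \<otimes> a \<oplus> s \<otimes> t" unfolding at(3)
    by (rule r_distr[OF subsetD[OF VR subsetD[OF IH(1) at(1)]] TR[OF at(2)] subsetD[OF S s]])
   moreover have "s \<otimes> a \<in> C i" using IH(2) s at(1) by blast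
   ultimately show "s \<otimes> z \<in> C (Suc i)" using TS[OF s at(2)] unfolding Cmem by blast
  qed
  note Cp = space_subgroup_props[OF K IH(3)]
  let ?U = "C i \<inter> T i"
  have "\<exists>k\<le>d. dimension k K ?U"
  proof (rule subspace_dimension[OF Td[of i]])
   show "\<zero> \<in> ?U" using Cp(2) Tp(2) by blast
   show "a \<oplus> b \<in> ?U" if "a \<in> ?U" "b \<in> ?U" for a b using that Cp(3) Tp(3) by blast
   show "k \<otimes> a \<in> ?U" if "k \<in> K" "a \<in> ?U" for k a using that Cp(5) Tp(5) by blast
  qed blast
  then obtain k where k: "dimension k K ?U" by blast
  show ?case
  proof (cases "?U = {\<zero>}")
   case True
   have "dimension (m * d + d) K (C (Suc i))"
    unfolding CS by (rule dimension_direct_sum_space[OF K IH(3) Td True])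
   then have "dimension (Suc m * d) K (C (Suc i))" by (simp add: add.commute)
   then show ?thesis using sub st by blast
  next
   case False
   have "?U = T i" by (rule least[OF k _ False _ Td TV]) (use IH(2) TS in blast)+
   then have TC: "T i \<subseteq> C i" by blast
   have "C (Suc i) = C i"
   proof (intro equalityI subsetI)
    fix z assume "z \<in> C (Suc i)"
    then obtain a t where at: "a \<in> C i" "t \<in> T i" "z = a \<oplus> t" unfolding Cmem by blast
    show "z \<in> C i" unfolding at(3) by (rule Cp(3)[OF at(1) subsetD[OF TC at(2)]])
   next
    fix z assume z: "z \<in> C i"
    then have "z = z \<oplus> \<zero>" using subsetD[OF VR subsetD[OF IH(1)]] by simp
    then show "z \<in> C (Suc i)" using z Tp(2)[of i] unfolding Cmem by blast
   qed
   then show ?thesis using IH by metis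
  qed
 qed
 have C_mono: "C i \<subseteq> C (Suc i)" for i
 proof
  fix z assume z: "z \<in> C i"
  then have "z = z \<oplus> \<zero>" using C[of i] VR by (metis r_zero subsetD)
  then show "z \<in> C (Suc i)" using z Tp(2)[of i] unfolding Cmem by blast
 qed
 have C_le: "i \<le> j ==> C i \<subseteq> C j" for i j
  by (induction j rule: dec_induct) (use C_mono in auto)
 obtain m where m: "dimension (m * d) K (C q)" using C by blast
 note Cq = space_subgroup_props[OF K m]
 have TC: "T i \<subseteq> C q" if "i < q" for i
 proof -
  have "T i \<subseteq> C (Suc i)"
  proof
   fix t assume t: "t \<in> T i"
   obtain m where "dimension (m * d) K (C i)" using C by blast
   then have "\<zero> \<in> C i" by (rule space_subgroup_props(2)[OF K])
   moreover have "t = \<zero> \<oplus> t" using subsetD[OF subset_trans[OF TV VR] t] by simp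
   ultimately show "t \<in> C (Suc i)" using t unfolding Cmem by blast
  qed
  then show ?thesis using C_le[of "Suc i" q] that by auto
 qed
 have T0: "T 0 = W" using W(1) VR by (auto simp: T_def image_iff subset_iff)
 have yT: "y \<otimes> t \<in> C q" if i: "i < q" and t: "t \<in> T i" for i t
 proof -
  obtain w where w: "w \<in> W" "t = y [^] i \<otimes> w" using t by (auto simp: T_def)
  have wc: "w \<in> carrier R" using w W(1) VR by blast
  have yt: "y \<otimes> t = y [^] Suc i \<otimes> w" unfolding w(2) nat_pow_Suc2[OF yc] using yc wc by (simp add: m_assoc)
  show ?thesis
  proof (cases "Suc i < q")
   case True
   have "y \<otimes> t \<in> T (Suc i)" unfolding yt T_def using w(1) by blast
   then show ?thesis using TC[OF True] by blast
  next
   case False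
   \<comment> \<open>The last translate returns to \<open>W\<close>, since \<open>y^q\<close> acts
     on \<open>W\<close> as a scalar from \<open>K\<close>.\<close>
   then have "Suc i = q" using i by simp
   then have "y \<otimes> t \<in> W" unfolding yt using q(2) space_subgroup_props(5)[OF K W(2)] w(1) by simp
   then show ?thesis using TC[of 0] q(1) T0 by blast
  qed
 qed
 have yC: "i \<le> q ==> a \<in> C i ==> y \<otimes> a \<in> C q" for i a
 proof (induction i arbitrary: a)
  case 0
  then show ?case using Cq(2) yc by (simp add: C0)
 next
  case (Suc i)
  then obtain b t where bt: "b \<in> C i" "t \<in> T i" "a = b \<oplus> t" unfolding Cmem by blast
  have "y \<otimes> a = y \<otimes> b \<oplus> y \<otimes> t" unfolding bt(3)
   using bt C[of i] TR[OF bt(2)] VR yc by (intro r_distr) blast+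
  moreover have "y \<otimes> b \<in> C q" using Suc.IH[OF _ bt(1)] Suc.prems(1) by simp
  moreover have "y \<otimes> t \<in> C q" using yT[OF _ bt(2)] Suc.prems(1) by simp
  ultimately show ?case using Cq(3) by simp
 qed
 have "C q ~= {\<zero>}"
 proof
  assume "C q = {\<zero>}"
  then have "W \<subseteq> {\<zero>}" using TC[of 0] q(1) T0 by blast
  moreover have "\<zero> \<in> W" using space_subgroup_props(2)[OF K W(2)] .
  ultimately have "W = {\<zero>}" by blast
  then have "dimension 0 K W" by simp
  then show False using dimension_is_inj[OF K W(2)] W(3) by blast
 qed
 then have "C q = V" using irr[OF m] C[of q] yC[of q] by blast
 then have "n = m * d" using dimension_is_inj[OF K V(1)] m by blast
 then have "d dvd n" by simp
 moreover have "\<forall>U k. dimension k K U --> U \<subseteq> W --> U ~= {\<zero>} --> (\<forall>s\<in>S. \<forall>u\<in>U. s \<otimes> u \<in> U) --> U = W"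
  using least[OF _ _ _ _ W(2,1)] by blast
 ultimately show ?thesis using W by blast
qed

end

end

section \<open>Changing the presentation of a symbol algebra\<close>

lemma (in monoid) mult_pow_intertwine:
 assumes "c \<in> carrier G" "u \<in> carrier G" "w \<in> carrier G" "c \<otimes> u = w \<otimes> c"
 shows "c \<otimes> u [^] (k::nat) = w [^] k \<otimes> c"
proof (induction k)
 case (Suc k)
 have "c \<otimes> u [^] Suc k = (c \<otimes> u [^] k) \<otimes> u" using assms by (simp add: m_assoc)
 also have "\<dots> = w [^] k \<otimes> (c \<otimes> u)" unfolding Suc using assms by (simp add: m_assoc)
 also have "\<dots> = w [^] Suc k \<otimes> c" unfolding assms(4) using assms by (simp add: m_assoc)
 finally show ?case .
qed (use assms in simp)

text \<open>A symbol system provides spanning monomials, and \<open>mon_indep\<close> makes them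
  independent over the scalars; once \<open>A\<close> is nonzero this fixes the dimension.
  Commutation with the scalars spreads from \<open>x\<close> and \<open>y\<close> along the
  span.\<close>

lemma symbol_system_carrier:
 assumes sys: "symbol_system p F A a g x y" and F: "field F" and one: "\<one>\<^bsub>fst A\<^esub> ~= \<zero>\<^bsub>fst A\<^esub>"
 shows "subfield (snd A ` carrier F) (fst A)"
  and "r \<in> carrier F ==> z \<in> carrier (fst A) ==> snd A r \<otimes>\<^bsub>fst A\<^esub> z = z \<otimes>\<^bsub>fst A\<^esub> snd A r"
  and "ring.dimension (fst A) (p * p) (snd A ` carrier F) (carrier (fst A))"
proof -
 interpret F: field F by fact
 interpret x: symbol_pair "fst A" p x y using sys by (simp add: symbol_system_def)
 interpret \<sigma>: ring_hom_ring F "fst A" "snd A" using sys by (simp add: symbol_system_def)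
 let ?K = "snd A ` carrier F"
 show K: "subfield ?K (fst A)"
  by (rule \<sigma>.img_is_subfield(2)[OF F.carrier_is_subfield one])
 have cent: "x.central_elt (snd A r)" if "r \<in> carrier F" for r using sys that by (simp add: symbol_system_def)
 have span: "carrier (fst A) = x.lspan ?K x.mon x.I" using sys by (simp add: symbol_system_def)
 have fin: "finite x.I" "x.mon \<in> x.I \<rightarrow> carrier (fst A)" by auto
 have "x.dimension (card x.I) ?K (x.lspan ?K x.mon x.I)"
 proof (rule x.lspan_dimension[OF K fin])
  fix c assume c: "c \<in> x.I \<rightarrow> ?K" "(\<Oplus>\<^bsub>fst A\<^esub>z\<in>x.I. c z \<otimes>\<^bsub>fst A\<^esub> x.mon z) = \<zero>\<^bsub>fst A\<^esub>"
  have "x.central_elt (c z)" if "z \<in> x.I" for z using funcset_mem[OF c(1) that] cent by auto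
  then show "\<forall>z\<in>x.I. c z = \<zero>\<^bsub>fst A\<^esub>" using x.mon_indep c(2) by blast
 qed
 then show "x.dimension (p * p) ?K (carrier (fst A))" using span by simp
 assume r: "r \<in> carrier F" and z: "z \<in> carrier (fst A)"
 let ?C = "{z \<in> carrier (fst A). snd A r \<otimes>\<^bsub>fst A\<^esub> z = z \<otimes>\<^bsub>fst A\<^esub> snd A r}"
 have rc: "snd A r \<in> carrier (fst A)" using r by simp
 have mul: "v \<otimes>\<^bsub>fst A\<^esub> w \<in> ?C" if v: "v \<in> ?C" and w: "w \<in> ?C" for v w
 proof -
  have c: "v \<in> carrier (fst A)" "w \<in> carrier (fst A)"
   "snd A r \<otimes>\<^bsub>fst A\<^esub> v = v \<otimes>\<^bsub>fst A\<^esub> snd A r" "snd A r \<otimes>\<^bsub>fst A\<^esub> w = w \<otimes>\<^bsub>fst A\<^esub> snd A r" using v w by auto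
  have "snd A r \<otimes>\<^bsub>fst A\<^esub> (v \<otimes>\<^bsub>fst A\<^esub> w) = v \<otimes>\<^bsub>fst A\<^esub> (snd A r \<otimes>\<^bsub>fst A\<^esub> w)"
   unfolding x.m_assoc[OF rc c(1,2), symmetric] c(3) by (rule x.m_assoc[OF c(1) rc c(2)])
  also have "\<dots> = v \<otimes>\<^bsub>fst A\<^esub> w \<otimes>\<^bsub>fst A\<^esub> snd A r"
   unfolding c(4) by (rule x.m_assoc[OF c(1,2) rc, symmetric])
  finally show ?thesis using c by simp
 qed
 have xy: "x \<in> ?C" "y \<in> ?C" using cent[OF r] by (auto simp: x.central_elt_def)
 have pw: "v [^]\<^bsub>fst A\<^esub> (i::nat) \<in> ?C" if "v \<in> ?C" for v i
 proof (induction i)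
  case 0
  then show ?case using rc by simp
 next
  case (Suc i)
  show ?case unfolding nat_pow_Suc using mul[OF Suc that] .
 qed
 have fal: "x.falling x i \<in> ?C" for i
 proof (induction i)
  case 0
  then show ?case using rc by simp
 next
  case (Suc i)
  have "x \<ominus>\<^bsub>fst A\<^esub> [int i] \<cdot>\<^bsub>fst A\<^esub> \<one>\<^bsub>fst A\<^esub> \<in> ?C"
   using xy(1) rc by (auto simp: x.diff_mult x.mult_diff x.mult_int)
  then show ?case unfolding x.falling_Suc using mul Suc by blast
 qed
 have kz: "snd A s \<in> ?C" if "s \<in> carrier F" for s
  using that r \<sigma>.hom_mult[OF r that] \<sigma>.hom_mult[OF that r] F.m_comm[OF r that] by simp
 have "x.lspan ?K x.mon x.I \<subseteq> ?C"
 proof (rule x.lspan_least[OF subfieldE(1)[OF K] fin])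
  show "\<zero>\<^bsub>fst A\<^esub> \<in> ?C" using rc by simp
  show "v \<oplus>\<^bsub>fst A\<^esub> w \<in> ?C" if "v \<in> ?C" "w \<in> ?C" for v w using that rc by (simp add: x.r_distr x.l_distr)
  show "k \<otimes>\<^bsub>fst A\<^esub> x.mon z \<in> ?C" if "k \<in> ?K" "z \<in> x.I" for k z
  proof -
   have "x.mon z \<in> ?C" unfolding x.mon_def using mul[OF fal pw[OF xy(2)]] by (cases z) simp
   then show ?thesis using mul kz that(1) by blast
  qed
 qed blast
 then show "snd A r \<otimes>\<^bsub>fst A\<^esub> z = z \<otimes>\<^bsub>fst A\<^esub> snd A r" using z span by blast
qed

text \<open>The \<open>p^2\<close> monomials of the new pair are independent and \<open>A\<close>
  has dimension \<open>p^2\<close>. So any pair in \<open>A\<close> with the commutation rule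
  already spans.\<close>

lemma symbol_system_pair_span:
 assumes sys: "symbol_system p F A a g x y" and F: "field F" and one: "\<one>\<^bsub>fst A\<^esub> ~= \<zero>\<^bsub>fst A\<^esub>"
  and pair: "symbol_pair (fst A) p u v"
 shows "r \<in> carrier F ==> symbol_pair.central_elt (fst A) u v (snd A r)"
  and "carrier (fst A) = ring.lspan (fst A) (snd A ` carrier F) (symbol_pair.mon (fst A) u v) ({..<p} \<times> {..<p})"
proof -
 interpret u: symbol_pair "fst A" p u v by fact
 interpret F: field F by fact
 interpret \<sigma>: ring_hom_ring F "fst A" "snd A" using sys by (simp add: symbol_system_def)
 note A = symbol_system_carrier[OF sys F one]
 let ?K = "snd A ` carrier F"
 have cent: "u.central_elt (snd A r)" if "r \<in> carrier F" for r
  using that A(2)[OF that u.u] A(2)[OF that u.v] by (simp add: u.central_elt_def)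
 then show "r \<in> carrier F ==> u.central_elt (snd A r)" .
 have fin: "finite u.I" "u.mon \<in> u.I \<rightarrow> carrier (fst A)" by auto
 have "u.dimension (card u.I) ?K (u.lspan ?K u.mon u.I)"
 proof (rule u.lspan_dimension[OF A(1) fin])
  fix c assume c: "c \<in> u.I \<rightarrow> ?K" "(\<Oplus>\<^bsub>fst A\<^esub>z\<in>u.I. c z \<otimes>\<^bsub>fst A\<^esub> u.mon z) = \<zero>\<^bsub>fst A\<^esub>"
  have "u.central_elt (c z)" if "z \<in> u.I" for z using funcset_mem[OF c(1) that] cent by auto
  then show "\<forall>z\<in>u.I. c z = \<zero>\<^bsub>fst A\<^esub>" using u.mon_indep c(2) by blast
 qed
 then have d: "u.dimension (p * p) ?K (u.lspan ?K u.mon u.I)" by simp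
 show "carrier (fst A) = u.lspan ?K u.mon u.I"
  using u.subspace_dimension_le(2)[OF A(1,3) d u.lspan_closed[OF subfieldE(1)[OF A(1)] fin]] by simp
qed

lemma symbol_system_change:
 assumes sys: "symbol_system p F A a g x y" and F: "field F" and one: "\<one>\<^bsub>fst A\<^esub> ~= \<zero>\<^bsub>fst A\<^esub>"
  and pair: "symbol_pair (fst A) p u v" and b: "b \<in> carrier F" and h: "h \<in> carrier F"
  and rel: "u [^]\<^bsub>fst A\<^esub> p \<ominus>\<^bsub>fst A\<^esub> u = snd A b" "v [^]\<^bsub>fst A\<^esub> p = snd A h"
 shows "symbol_system p F A b h u v"
 using symbol_system_pair_span[OF sys F one pair] pair sys b h rel by (simp add: symbol_system_def)

text \<open>Expansion in the monomials of the pair and \<open>mon_centralizer\<close> leave only the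
  constant coefficient. It is used to show that some expression in new generators is a
  scalar.\<close>

lemma symbol_system_center:
 assumes sys: "symbol_system p F A a g x y" and F: "field F" and one: "\<one>\<^bsub>fst A\<^esub> ~= \<zero>\<^bsub>fst A\<^esub>"
  and pair: "symbol_pair (fst A) p u v" and z: "symbol_pair.central_elt (fst A) u v z"
 shows "z \<in> snd A ` carrier F"
proof -
 interpret u: symbol_pair "fst A" p u v by fact
 let ?K = "snd A ` carrier F"
 have "z \<in> u.lspan ?K u.mon u.I"
  using u.central_elt_closed[OF z] by (simp only: symbol_system_pair_span(2)[OF sys F one pair, symmetric])
 then obtain c where c: "c \<in> u.I \<rightarrow> ?K" "z = (\<Oplus>\<^bsub>fst A\<^esub>z\<in>u.I. c z \<otimes>\<^bsub>fst A\<^esub> u.mon z)"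
  unfolding u.lspan_def by blast
 have "u.central_elt (c z)" if "z \<in> u.I" for z
  using funcset_mem[OF c(1) that] symbol_system_pair_span(1)[OF sys F one pair] by auto
 then have "z = c (0, 0)" using u.mon_centralizer[of c] z c(2) by simp
 then show ?thesis using funcset_mem[OF c(1), of "(0, 0)"] u.p_pos by simp
qed

text \<open>Replacing \<open>x\<close> by \<open>x + t\<close> adds \<open>t^p - t\<close> to the
  first slot. This is the freedom by which two first slots can be made different.\<close>

lemma symbol_system_shift:
 assumes sys: "symbol_system p F A a g x y" and F: "field F" and one: "\<one>\<^bsub>fst A\<^esub> ~= \<zero>\<^bsub>fst A\<^esub>" and t: "t \<in> carrier F"
 shows "symbol_system p F A (a \<oplus>\<^bsub>F\<^esub> (t [^]\<^bsub>F\<^esub> p \<ominus>\<^bsub>F\<^esub> t)) g (x \<oplus>\<^bsub>fst A\<^esub> snd A t) y"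
proof -
 interpret F: field F by fact
 interpret x: symbol_pair "fst A" p x y using sys by (simp add: symbol_system_def)
 interpret \<sigma>: ring_hom_ring F "fst A" "snd A" using sys by (simp add: symbol_system_def)
 have ag: "a \<in> carrier F" "g \<in> carrier F" and rel: "x [^]\<^bsub>fst A\<^esub> p \<ominus>\<^bsub>fst A\<^esub> x = snd A a" "y [^]\<^bsub>fst A\<^esub> p = snd A g"
  using sys by (auto simp: symbol_system_def)
 note cent = symbol_system_carrier(2)[OF sys F one t]
 let ?t = "snd A t"
 have tc: "?t \<in> carrier (fst A)" using t by simp
 have pair: "symbol_pair (fst A) p (x \<oplus>\<^bsub>fst A\<^esub> ?t) y"
 proof unfold_locales
  show "y \<otimes>\<^bsub>fst A\<^esub> (x \<oplus>\<^bsub>fst A\<^esub> ?t) = (x \<oplus>\<^bsub>fst A\<^esub> ?t \<oplus>\<^bsub>fst A\<^esub> \<one>\<^bsub>fst A\<^esub>) \<otimes>\<^bsub>fst A\<^esub> y"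
   using tc cent[OF x.v] by (simp add: x.r_distr x.l_distr x.YX x.a_ac)
 qed (use tc x.Y_unit in auto)
 have "(x \<oplus>\<^bsub>fst A\<^esub> ?t) [^]\<^bsub>fst A\<^esub> p = x [^]\<^bsub>fst A\<^esub> p \<oplus>\<^bsub>fst A\<^esub> ?t [^]\<^bsub>fst A\<^esub> p"
  using tc cent[OF x.u] by (intro x.freshman) auto
 then have "(x \<oplus>\<^bsub>fst A\<^esub> ?t) [^]\<^bsub>fst A\<^esub> p \<ominus>\<^bsub>fst A\<^esub> (x \<oplus>\<^bsub>fst A\<^esub> ?t)
   = (x [^]\<^bsub>fst A\<^esub> p \<ominus>\<^bsub>fst A\<^esub> x) \<oplus>\<^bsub>fst A\<^esub> (?t [^]\<^bsub>fst A\<^esub> p \<ominus>\<^bsub>fst A\<^esub> ?t)"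
  using tc by (simp add: x.minus_eq x.minus_add x.a_ac)
 also have "\<dots> = snd A (a \<oplus>\<^bsub>F\<^esub> (t [^]\<^bsub>F\<^esub> p \<ominus>\<^bsub>F\<^esub> t))"
  using t ag unfolding rel by (simp add: \<sigma>.hom_diff \<sigma>.hom_nat_pow)
 finally show ?thesis
  using t ag rel by (intro symbol_system_change[OF sys F one pair]) auto
qed

text \<open>A matrix representation of degree \<open>p\<close> over the base field is an isomorphism, and the matrix
 algebra is \<open>[0, g)\<close> for every unit \<open>g\<close>.\<close>

lemma symbol_system_of_matrix_rep:
 assumes sys: "symbol_system p F A a b x y" and F: "field F" and Fp: "char_p_ring F p" and one: "\<one>\<^bsub>fst A\<^esub> ~= \<zero>\<^bsub>fst A\<^esub>"
  and h: "ring_hom_ring (fst A) (fst (matrix_algebra p F)) h"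
  and hs: "!!r. r \<in> carrier F ==> h (snd A r) = snd (matrix_algebra p F) r"
  and g: "g \<in> Units F"
 shows "\<exists>u v. symbol_system p F A \<zero>\<^bsub>F\<^esub> g u v"
proof -
 interpret F: field F by fact
 interpret F: char_p_ring F p by fact
 interpret split_matrices F p using F.p_pos by unfold_locales
 interpret x: symbol_pair "fst A" p x y using sys by (simp add: symbol_system_def)
 interpret \<sigma>: ring_hom_ring F "fst A" "snd A" using sys by (simp add: symbol_system_def)
 interpret h: ring_hom_ring "fst A" Mat h by fact
 interpret hx: symbol_pair Mat p "h x" "h y" by (rule h.hom_symbol_pair) unfold_locales
 have rel: "x [^]\<^bsub>fst A\<^esub> p \<ominus>\<^bsub>fst A\<^esub> x = snd A a" "y [^]\<^bsub>fst A\<^esub> p = snd A b" "a \<in> carrier F" "b \<in> carrier F"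
  using sys by (auto simp: symbol_system_def)
 have gF: "g \<in> carrier F" using g by auto
 have z: "\<zero>\<^bsub>F\<^esub> [^]\<^bsub>F\<^esub> p \<ominus>\<^bsub>F\<^esub> \<zero>\<^bsub>F\<^esub> = \<zero>\<^bsub>F\<^esub>" using F.p_pos by (simp add: F.nat_pow_zero F.minus_eq)
 \<comment> \<open>This is \<open>splitting_pair_diag\<close> at \<open>l = 0\<close>, whose first
   slot is \<open>0^p - 0\<close>.\<close>
 have SP: "splitting_pair \<zero>\<^bsub>F\<^esub> g (diag \<zero>\<^bsub>F\<^esub>) (shift g)" using splitting_pair_diag[OF F.zero_closed g] unfolding z .
 interpret d: symbol_pair Mat p "diag \<zero>\<^bsub>F\<^esub>" "shift g" using SP by (simp add: splitting_pair_def)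
 have dc: "d.central_elt (sc r)" if "r \<in> carrier F" for r
  using that gF sc_central[OF that] by (simp add: d.central_elt_def)
 have M: "symbol_system p F (matrix_algebra p F) \<zero>\<^bsub>F\<^esub> g (diag \<zero>\<^bsub>F\<^esub>) (shift g)"
 proof -
  let ?L = "M.lspan (sc ` carrier F) d.mon d.I"
  have K: "subring (sc ` carrier F) Mat" by (rule sc.img_is_subring[OF F.carrier_is_subring])
  have Kc: "d.central_elt k" if "k \<in> sc ` carrier F" for k using that dc by auto
  have r: "diag \<zero>\<^bsub>F\<^esub> [^]\<^bsub>Mat\<^esub> p \<ominus>\<^bsub>Mat\<^esub> diag \<zero>\<^bsub>F\<^esub> = sc \<zero>\<^bsub>F\<^esub>" "shift g [^]\<^bsub>Mat\<^esub> p = sc g"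
   using SP by (auto simp: splitting_pair_def)
  have rK: "diag \<zero>\<^bsub>F\<^esub> [^]\<^bsub>Mat\<^esub> p \<ominus>\<^bsub>Mat\<^esub> diag \<zero>\<^bsub>F\<^esub> \<in> sc ` carrier F" "shift g [^]\<^bsub>Mat\<^esub> p \<in> sc ` carrier F"
   unfolding r by (rule imageI[OF F.zero_closed], rule imageI[OF gF])
  have fin: "finite d.I" "d.mon \<in> d.I \<rightarrow> carrier Mat" by auto
  have "subring ?L Mat"
   by (rule M.subringI) (use M.lspan_closed[OF K fin] d.lspan_one[OF K Kc rK] M.lspan_minus[OF K fin]
     d.lspan_mult[OF K Kc rK] M.lspan_add[OF K fin] in auto)
  moreover have "sc ` carrier F \<subseteq> ?L"
  proof
   fix k assume k: "k \<in> sc ` carrier F"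
   then have "k \<otimes>\<^bsub>Mat\<^esub> \<one>\<^bsub>Mat\<^esub> \<in> ?L" using M.lspan_smult[OF K fin k d.lspan_one[OF K Kc rK]] by simp
   then show "k \<in> ?L" using k by auto
  qed
  moreover have "diag \<zero>\<^bsub>F\<^esub> \<in> ?L" "shift g \<in> ?L" using d.u_lspan[OF K Kc rK d.lspan_one[OF K Kc rK]] d.v_lspan[OF K Kc rK d.lspan_one[OF K Kc rK]] by auto
  ultimately have "?L = carrier Mat" using SP by (simp add: splitting_pair_def)
  then show ?thesis
   using d.symbol_pair_axioms sc.ring_hom_ring_axioms dc r gF by (simp add: symbol_system_def)
 qed
 have one': "\<one>\<^bsub>Mat\<^esub> ~= \<zero>\<^bsub>Mat\<^esub>" using sc_inj[of "\<one>\<^bsub>F\<^esub>"] sc.hom_one by auto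
 have inj: "inj_on h (carrier (fst A))"
 proof (rule symbol_system_injective[OF sys h])
  show "hx.central_elt (h (snd A r))" if "r \<in> carrier F" for r
   using that sc_central[OF that hx.u] sc_central[OF that hx.v] by (simp add: hx.central_elt_def hs)
  show "snd A r = \<zero>\<^bsub>fst A\<^esub>" if "r \<in> carrier F" "h (snd A r) = \<zero>\<^bsub>Mat\<^esub>" for r
   using sc_inj[OF that(1)] that hs[OF that(1)] by auto
 qed
 \<comment> \<open>The image contains the monomials in \<open>h x\<close>, \<open>h y\<close> with
   their scalar multiples, and any symbol pair in the matrix algebra has spanning monomials by
   \<open>symbol_system_pair_span\<close>.\<close>
 have surj: "m \<in> h ` carrier (fst A)" if m: "m \<in> carrier Mat" for m
 proof -
  have fin: "finite hx.I" "hx.mon \<in> hx.I \<rightarrow> carrier Mat" by auto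
  have Ksub: "subring (sc ` carrier F) Mat" by (rule sc.img_is_subring[OF F.carrier_is_subring])
  have "M.lspan (sc ` carrier F) hx.mon hx.I \<subseteq> h ` carrier (fst A)"
  proof (rule M.lspan_least[OF Ksub fin])
   show "\<zero>\<^bsub>Mat\<^esub> \<in> h ` carrier (fst A)" using h.hom_zero x.zero_closed by (metis image_eqI)
   show "v \<oplus>\<^bsub>Mat\<^esub> w \<in> h ` carrier (fst A)" if "v \<in> h ` carrier (fst A)" "w \<in> h ` carrier (fst A)" for v w
    using that by (auto simp flip: h.hom_add)
   show "k \<otimes>\<^bsub>Mat\<^esub> hx.mon z \<in> h ` carrier (fst A)" if "k \<in> sc ` carrier F" "z \<in> hx.I" for k z
   proof -
    obtain r where r: "r \<in> carrier F" "k = h (snd A r)" using \<open>k \<in> sc ` carrier F\<close> hs by auto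
    have eq: "k \<otimes>\<^bsub>Mat\<^esub> hx.mon z = h (snd A r \<otimes>\<^bsub>fst A\<^esub> x.mon z)"
     unfolding r(2) using r(1) by (simp add: h.hom_mon[OF x.symbol_pair_axioms])
    show ?thesis unfolding eq by (rule imageI) (use r(1) in simp)
   qed
  qed auto
  moreover have "m \<in> M.lspan (sc ` carrier F) hx.mon hx.I"
   using m by (simp only: symbol_system_pair_span(2)[OF M F one' hx.symbol_pair_axioms, symmetric])
  ultimately show ?thesis by blast
 qed
 obtain u where u: "u \<in> carrier (fst A)" "h u = diag \<zero>\<^bsub>F\<^esub>" using surj[OF d.u] by auto
 obtain v where v: "v \<in> carrier (fst A)" "h v = shift g" using surj[OF d.v] by auto
 have r: "diag \<zero>\<^bsub>F\<^esub> [^]\<^bsub>Mat\<^esub> p \<ominus>\<^bsub>Mat\<^esub> diag \<zero>\<^bsub>F\<^esub> = sc \<zero>\<^bsub>F\<^esub>" "shift g [^]\<^bsub>Mat\<^esub> p = sc g"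
  using SP by (auto simp: splitting_pair_def)
 have r1: "u [^]\<^bsub>fst A\<^esub> p \<ominus>\<^bsub>fst A\<^esub> u = snd A \<zero>\<^bsub>F\<^esub>"
  by (rule inj_onD[OF inj]) (use u r in \<open>simp_all add: h.hom_diff h.hom_nat_pow\<close>)
 have r2: "v [^]\<^bsub>fst A\<^esub> p = snd A g"
  by (rule inj_onD[OF inj]) (use v r gF hs in \<open>simp_all add: h.hom_nat_pow\<close>)
 have r3: "v \<otimes>\<^bsub>fst A\<^esub> u = (u \<oplus>\<^bsub>fst A\<^esub> \<one>\<^bsub>fst A\<^esub>) \<otimes>\<^bsub>fst A\<^esub> v"
  by (rule inj_onD[OF inj]) (use u v d.YX in simp_all)
 have "v \<in> Units (fst A)"
  using x.Units_of_pow[of v p] v r2 \<sigma>.hom_Units[OF g] F.p_pos by simp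
 then have "symbol_pair (fst A) p u v" using u r3 by unfold_locales auto
 then show ?thesis
  using symbol_system_change[OF sys F one _ F.zero_closed gF r1 r2] by blast
qed

text \<open>If \<open>c\<^sup>p\<close> is central, the inner derivation \<open>z \<mapsto> c z - z c\<close> is nilpotent; an element \<open>z\<close> of the kernel of
 its square but not of the derivation itself yields \<open>x' = z w\<^sup>-\<^sup>1 c\<close> with \<open>c x' = (x' + 1) c\<close>, where \<open>w = c z - z c\<close>.\<close>

lemma symbol_system_of_radical:
 assumes sys: "symbol_system p F A a b x y" and F: "field F" and one: "\<one>\<^bsub>fst A\<^esub> ~= \<zero>\<^bsub>fst A\<^esub>"
  and div: "!!z. z \<in> carrier (fst A) ==> z ~= \<zero>\<^bsub>fst A\<^esub> ==> z \<in> Units (fst A)"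
  and g: "g \<in> Units F" and c: "c \<in> carrier (fst A)" "c [^]\<^bsub>fst A\<^esub> p = snd A g" "c \<notin> snd A ` carrier F"
 shows "\<exists>a' x'. symbol_system p F A a' g x' c"
proof -
 interpret F: field F by fact
 interpret x: symbol_pair "fst A" p x y using sys by (simp add: symbol_system_def)
 interpret \<sigma>: ring_hom_ring F "fst A" "snd A" using sys by (simp add: symbol_system_def)
 have gF: "g \<in> carrier F" using g by auto
 define D where "D z = c \<otimes>\<^bsub>fst A\<^esub> z \<ominus>\<^bsub>fst A\<^esub> z \<otimes>\<^bsub>fst A\<^esub> c" for z
 have Dc: "D z \<in> carrier (fst A)" if "z \<in> carrier (fst A)" for z using that c by (simp add: D_def)
 have D0: "D z = \<zero>\<^bsub>fst A\<^esub> \<longleftrightarrow> c \<otimes>\<^bsub>fst A\<^esub> z = z \<otimes>\<^bsub>fst A\<^esub> c" if "z \<in> carrier (fst A)" for z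
  using that c by (simp add: D_def)
 have Dpc: "(D ^^ k) z \<in> carrier (fst A)" if "z \<in> carrier (fst A)" for k z
  using that by (induction k) (auto intro: Dc)
 have Dp: "(D ^^ p) z = \<zero>\<^bsub>fst A\<^esub>" if z: "z \<in> carrier (fst A)" for z
 proof -
  \<comment> \<open>Left multiplication by \<open>c\<close> and the negative of right multiplication
    by \<open>c\<close> commute, so the \<open>p\<close>-th iterate of their sum is
    \<open>z -> c^p z - z c^p\<close>, which vanishes as \<open>c^p\<close> is a scalar.\<close>
  have D': "D = (%z. c \<otimes>\<^bsub>fst A\<^esub> z \<oplus>\<^bsub>fst A\<^esub> \<ominus>\<^bsub>fst A\<^esub> (z \<otimes>\<^bsub>fst A\<^esub> c))" by (simp add: D_def x.minus_eq fun_eq_iff)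
  have f: "((%z. c \<otimes>\<^bsub>fst A\<^esub> z) ^^ k) z = c [^]\<^bsub>fst A\<^esub> k \<otimes>\<^bsub>fst A\<^esub> z" for k
  proof (induction k)
   case (Suc k)
   then show ?case using c(1) z x.nat_pow_Suc2[OF c(1), of k] by (simp add: x.m_assoc del: nat_pow_Suc)
  qed (use z in simp)
  have g: "((%z. \<ominus>\<^bsub>fst A\<^esub> (z \<otimes>\<^bsub>fst A\<^esub> c)) ^^ k) z = z \<otimes>\<^bsub>fst A\<^esub> (\<ominus>\<^bsub>fst A\<^esub> c) [^]\<^bsub>fst A\<^esub> k" for k
  proof (induction k)
   case (Suc k)
   then show ?case using c(1) z by (simp add: x.m_assoc x.r_minus)
  qed (use z in simp)
  have "(D ^^ p) z = c [^]\<^bsub>fst A\<^esub> p \<otimes>\<^bsub>fst A\<^esub> z \<oplus>\<^bsub>fst A\<^esub> z \<otimes>\<^bsub>fst A\<^esub> (\<ominus>\<^bsub>fst A\<^esub> c) [^]\<^bsub>fst A\<^esub> p"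
   unfolding D' by (subst x.operator_frobenius) (use c(1) z in \<open>auto simp: f g x.r_distr x.l_distr x.minus_add x.r_minus x.l_minus x.m_assoc x.a_comm\<close>)
  also have "\<dots> = c [^]\<^bsub>fst A\<^esub> p \<otimes>\<^bsub>fst A\<^esub> z \<ominus>\<^bsub>fst A\<^esub> z \<otimes>\<^bsub>fst A\<^esub> c [^]\<^bsub>fst A\<^esub> p"
   using c(1) z by (simp add: x.uminus_pow_p x.r_minus x.minus_eq)
  finally have "(D ^^ p) z = c [^]\<^bsub>fst A\<^esub> p \<otimes>\<^bsub>fst A\<^esub> z \<ominus>\<^bsub>fst A\<^esub> z \<otimes>\<^bsub>fst A\<^esub> c [^]\<^bsub>fst A\<^esub> p" .
  then show ?thesis using symbol_system_carrier(2)[OF sys F one gF z] z gF by (simp add: c(2))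
 qed
 obtain z0 where z0: "z0 \<in> carrier (fst A)" "D z0 ~= \<zero>\<^bsub>fst A\<^esub>"
 proof -
  have "~ x.central_elt c"
   using symbol_system_center[OF sys F one x.symbol_pair_axioms] c(3) by blast
  then have "D x ~= \<zero>\<^bsub>fst A\<^esub> \<or> D y ~= \<zero>\<^bsub>fst A\<^esub>" using c(1) D0[OF x.u] D0[OF x.v] by (auto simp: x.central_elt_def)
  then show thesis using that x.u x.v by blast
 qed
 let ?P = "%k. (D ^^ k) z0 = \<zero>\<^bsub>fst A\<^esub>"
 \<comment> \<open>Neither \<open>z0\<close> nor \<open>D z0\<close> vanishes, so \<open>n\<close>
   is at least 2 and the iterate of order \<open>n - 2\<close> exists; it is killed by the square of
   \<open>D\<close> but not by \<open>D\<close>.\<close>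
 define n where "n = (LEAST k. ?P k)"
 have Pn: "?P n" unfolding n_def by (rule LeastI[of ?P p]) (rule Dp[OF z0(1)])
 have z00: "z0 ~= \<zero>\<^bsub>fst A\<^esub>" using z0(2) D0[OF x.zero_closed] c(1) by auto
 have "n ~= 0"
 proof
  assume "n = 0"
  then show False using Pn z00 by simp
 qed
 moreover have "n ~= 1"
 proof
  assume "n = 1"
  then show False using Pn z0(2) by simp
 qed
 ultimately obtain k where k: "n = Suc (Suc k)" by (metis One_nat_def old.nat.exhaust)
 define z where "z = (D ^^ k) z0"
 define w where "w = D z"
 have z: "z \<in> carrier (fst A)" using Dpc z0(1) by (simp add: z_def)
 have w: "w \<in> carrier (fst A)" using Dc z by (simp add: w_def)
 have w0: "w ~= \<zero>\<^bsub>fst A\<^esub>"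
 proof
  assume "w = \<zero>\<^bsub>fst A\<^esub>"
  then have "?P (Suc k)" by (simp add: w_def z_def)
  then have "n \<le> Suc k" unfolding n_def by (rule Least_le)
  then show False using k by simp
 qed
 have "D w = \<zero>\<^bsub>fst A\<^esub>" using Pn by (simp add: w_def z_def k)
 then have cw: "c \<otimes>\<^bsub>fst A\<^esub> w = w \<otimes>\<^bsub>fst A\<^esub> c" using D0[OF w] by simp
 have wU: "w \<in> Units (fst A)" using div w w0 by blast
 define v where "v = inv\<^bsub>fst A\<^esub> w"
 have v: "v \<in> carrier (fst A)" "w \<otimes>\<^bsub>fst A\<^esub> v = \<one>\<^bsub>fst A\<^esub>" "v \<otimes>\<^bsub>fst A\<^esub> w = \<one>\<^bsub>fst A\<^esub>" using wU by (auto simp: v_def)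
 have cv: "c \<otimes>\<^bsub>fst A\<^esub> v = v \<otimes>\<^bsub>fst A\<^esub> c"
 proof -
  have "v \<otimes>\<^bsub>fst A\<^esub> (c \<otimes>\<^bsub>fst A\<^esub> w) \<otimes>\<^bsub>fst A\<^esub> v = v \<otimes>\<^bsub>fst A\<^esub> c \<otimes>\<^bsub>fst A\<^esub> (w \<otimes>\<^bsub>fst A\<^esub> v)"
   using c(1) w v(1) by (simp add: x.m_assoc)
  moreover have "v \<otimes>\<^bsub>fst A\<^esub> (w \<otimes>\<^bsub>fst A\<^esub> c) \<otimes>\<^bsub>fst A\<^esub> v = v \<otimes>\<^bsub>fst A\<^esub> w \<otimes>\<^bsub>fst A\<^esub> (c \<otimes>\<^bsub>fst A\<^esub> v)"
   using c(1) w v(1) by (simp add: x.m_assoc)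
  ultimately show ?thesis using c(1) v by (simp add: cw)
 qed
 define u where "u = z \<otimes>\<^bsub>fst A\<^esub> (v \<otimes>\<^bsub>fst A\<^esub> c)"
 have u: "u \<in> carrier (fst A)" using z v c by (simp add: u_def)
 have cz: "c \<otimes>\<^bsub>fst A\<^esub> z = z \<otimes>\<^bsub>fst A\<^esub> c \<oplus>\<^bsub>fst A\<^esub> w"
  unfolding w_def D_def using c z by (simp add: x.minus_eq x.add_minus_cancel)
 have cu: "c \<otimes>\<^bsub>fst A\<^esub> u = (u \<oplus>\<^bsub>fst A\<^esub> \<one>\<^bsub>fst A\<^esub>) \<otimes>\<^bsub>fst A\<^esub> c"
 proof -
  have vc: "v \<otimes>\<^bsub>fst A\<^esub> c \<in> carrier (fst A)" using v c by simp
  have "c \<otimes>\<^bsub>fst A\<^esub> u = (c \<otimes>\<^bsub>fst A\<^esub> z) \<otimes>\<^bsub>fst A\<^esub> (v \<otimes>\<^bsub>fst A\<^esub> c)"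
   unfolding u_def using c z vc by (simp add: x.m_assoc)
  also have "\<dots> = z \<otimes>\<^bsub>fst A\<^esub> c \<otimes>\<^bsub>fst A\<^esub> (v \<otimes>\<^bsub>fst A\<^esub> c) \<oplus>\<^bsub>fst A\<^esub> w \<otimes>\<^bsub>fst A\<^esub> (v \<otimes>\<^bsub>fst A\<^esub> c)"
   unfolding cz using c z w vc by (intro x.l_distr) auto
  also have "w \<otimes>\<^bsub>fst A\<^esub> (v \<otimes>\<^bsub>fst A\<^esub> c) = c" using w v c by (simp add: x.m_assoc[symmetric])
  also have "z \<otimes>\<^bsub>fst A\<^esub> c \<otimes>\<^bsub>fst A\<^esub> (v \<otimes>\<^bsub>fst A\<^esub> c) = z \<otimes>\<^bsub>fst A\<^esub> ((c \<otimes>\<^bsub>fst A\<^esub> v) \<otimes>\<^bsub>fst A\<^esub> c)"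
   using c z v by (simp add: x.m_assoc)
  also have "\<dots> = u \<otimes>\<^bsub>fst A\<^esub> c" unfolding cv u_def using c z v by (simp add: x.m_assoc)
  finally show ?thesis using u c by (simp add: x.l_distr)
 qed
 have cU: "c \<in> Units (fst A)"
  using x.Units_of_pow[of c p] c(1,2) \<sigma>.hom_Units[OF g] x.p_pos by simp
 interpret u: symbol_pair "fst A" p u c using u cU cu by unfold_locales auto
 \<comment> \<open>From \<open>c u^p = (u + 1)^p c = (u^p + 1) c\<close> and
   \<open>c u = (u + 1) c\<close> it follows that \<open>u^p - u\<close> commutes with
   \<open>c\<close>. It is therefore a scalar and becomes the new first slot.\<close>
 have "u.central_elt (u [^]\<^bsub>fst A\<^esub> p \<ominus>\<^bsub>fst A\<^esub> u)"
 proof -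
  have "c \<otimes>\<^bsub>fst A\<^esub> u [^]\<^bsub>fst A\<^esub> p = (u \<oplus>\<^bsub>fst A\<^esub> \<one>\<^bsub>fst A\<^esub>) [^]\<^bsub>fst A\<^esub> p \<otimes>\<^bsub>fst A\<^esub> c"
   by (rule x.mult_pow_intertwine) (use u c cu in auto)
  also have "(u \<oplus>\<^bsub>fst A\<^esub> \<one>\<^bsub>fst A\<^esub>) [^]\<^bsub>fst A\<^esub> p = u [^]\<^bsub>fst A\<^esub> p \<oplus>\<^bsub>fst A\<^esub> \<one>\<^bsub>fst A\<^esub>"
   using x.freshman[of u "\<one>\<^bsub>fst A\<^esub>"] u by simp
  finally have e1: "c \<otimes>\<^bsub>fst A\<^esub> u [^]\<^bsub>fst A\<^esub> p = u [^]\<^bsub>fst A\<^esub> p \<otimes>\<^bsub>fst A\<^esub> c \<oplus>\<^bsub>fst A\<^esub> c" using u c by (simp add: x.l_distr)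
  have e2: "c \<otimes>\<^bsub>fst A\<^esub> u = u \<otimes>\<^bsub>fst A\<^esub> c \<oplus>\<^bsub>fst A\<^esub> c" unfolding cu using u c by (simp add: x.l_distr)
  have "c \<otimes>\<^bsub>fst A\<^esub> (u [^]\<^bsub>fst A\<^esub> p \<ominus>\<^bsub>fst A\<^esub> u) = c \<otimes>\<^bsub>fst A\<^esub> u [^]\<^bsub>fst A\<^esub> p \<ominus>\<^bsub>fst A\<^esub> c \<otimes>\<^bsub>fst A\<^esub> u"
   by (rule x.mult_diff) (use u c in auto)
  also have "\<dots> = u [^]\<^bsub>fst A\<^esub> p \<otimes>\<^bsub>fst A\<^esub> c \<ominus>\<^bsub>fst A\<^esub> u \<otimes>\<^bsub>fst A\<^esub> c"
   unfolding e1 e2 using x.diff_diff_cancel[of "u [^]\<^bsub>fst A\<^esub> p \<otimes>\<^bsub>fst A\<^esub> c" "u \<otimes>\<^bsub>fst A\<^esub> c" "\<ominus>\<^bsub>fst A\<^esub> c"] u c(1)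
   by (simp add: x.minus_eq)
  also have "\<dots> = (u [^]\<^bsub>fst A\<^esub> p \<ominus>\<^bsub>fst A\<^esub> u) \<otimes>\<^bsub>fst A\<^esub> c"
   by (rule x.diff_mult[symmetric]) (use u c in auto)
  finally have "c \<otimes>\<^bsub>fst A\<^esub> (u [^]\<^bsub>fst A\<^esub> p \<ominus>\<^bsub>fst A\<^esub> u) = (u [^]\<^bsub>fst A\<^esub> p \<ominus>\<^bsub>fst A\<^esub> u) \<otimes>\<^bsub>fst A\<^esub> c" .
  moreover have "u \<otimes>\<^bsub>fst A\<^esub> u [^]\<^bsub>fst A\<^esub> p = u [^]\<^bsub>fst A\<^esub> p \<otimes>\<^bsub>fst A\<^esub> u"
   using x.nat_pow_Suc2[OF u, of p] by simp
  ultimately show ?thesis using u c by (simp add: u.central_elt_def x.mult_diff x.diff_mult)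
 qed
 then obtain t where t: "t \<in> carrier F" "u [^]\<^bsub>fst A\<^esub> p \<ominus>\<^bsub>fst A\<^esub> u = snd A t"
  using symbol_system_center[OF sys F one u.symbol_pair_axioms] by auto
 show ?thesis
  using symbol_system_change[OF sys F one u.symbol_pair_axioms t(1) gF t(2) c(2)] by blast
qed

section \<open>Matrix representations from a basis\<close>

lemma (in matrix_ring) mat_finsum:
 assumes "finite A" "g \<in> A \<rightarrow> carrier Mat" "i < n" "k < n"
 shows "(finsum Mat g A) (i, k) = (\<Oplus>z\<in>A. g z (i, k))"
 using assms(1,2)
proof (induction A rule: finite_induct)
 case empty
 interpret M: ring Mat by (rule mat_ring)
 show ?case by (simp add: mat_zero)
next
 case (insert x A)
 interpret M: ring Mat by (rule mat_ring)
 have "g x (i, k) \<in> carrier R" "(%z. g z (i, k)) \<in> A \<rightarrow> carrier R" using insert by (auto simp: Pi_def)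
 then show ?case using insert assms(3,4) by (simp add: mat_add Pi_def)
qed

text \<open>The module is the span of the \<open>w i\<close> inside the ring \<open>B\<close>, on
  which \<open>A\<close> acts through \<open>j\<close>. Coordinates over \<open>F\<close> are
  unique, and \<open>s r\<close> commutes with the action, so taking coordinate matrices is a
  homomorphism.\<close>

lemma matrix_rep_of_basis:
 assumes F: "cring F" and p: "p > 0" and A: "ring A" and s: "ring_hom_ring F B s" and j: "ring_hom_ring A B j"
  and \<sigma>: "\<sigma> \<in> carrier F \<rightarrow> carrier A" "!!r. r \<in> carrier F ==> j (\<sigma> r) = s r"
  and comm: "!!r a. r \<in> carrier F ==> a \<in> carrier A ==> s r \<otimes>\<^bsub>B\<^esub> j a = j a \<otimes>\<^bsub>B\<^esub> s r"
  and w: "!!i. i < p ==> w i \<in> carrier B"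
  and indep: "!!f. f \<in> {..<p} \<rightarrow> carrier F ==> (\<Oplus>\<^bsub>B\<^esub>i\<in>{..<p}. s (f i) \<otimes>\<^bsub>B\<^esub> w i) = \<zero>\<^bsub>B\<^esub> ==> \<forall>i<p. f i = \<zero>\<^bsub>F\<^esub>"
  and ex: "!!a k. a \<in> carrier A ==> k < p ==> \<exists>f \<in> {..<p} \<rightarrow> carrier F. j a \<otimes>\<^bsub>B\<^esub> w k = (\<Oplus>\<^bsub>B\<^esub>i\<in>{..<p}. s (f i) \<otimes>\<^bsub>B\<^esub> w i)"
 shows "\<exists>h. ring_hom_ring A (fst (matrix_algebra p F)) h & (\<forall>r\<in>carrier F. h (\<sigma> r) = snd (matrix_algebra p F) r)"
proof -
 interpret F: cring F by fact
 interpret A: ring A by fact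
 interpret s: ring_hom_ring F B s by fact
 interpret j: ring_hom_ring A B j by fact
 interpret matrix_ring F p using p by unfold_locales
 interpret M: ring Mat by (rule mat_ring)
 define L where "L f = (\<Oplus>\<^bsub>B\<^esub>i\<in>{..<p}. s (f i) \<otimes>\<^bsub>B\<^esub> w i)" for f
 have Lc: "L f \<in> carrier B" if "!!i. i < p ==> f i \<in> carrier F" for f
  unfolding L_def using that w by (intro s.S.finsum_closed) auto
 have uniq: "f i = g i" if f: "!!i. i < p ==> f i \<in> carrier F" and g: "!!i. i < p ==> g i \<in> carrier F" and eq: "L f = L g" and i: "i < p" for f g i
 proof -
  have "L (%i. f i \<ominus>\<^bsub>F\<^esub> g i) = (\<Oplus>\<^bsub>B\<^esub>i\<in>{..<p}. s (f i) \<otimes>\<^bsub>B\<^esub> w i \<oplus>\<^bsub>B\<^esub> \<ominus>\<^bsub>B\<^esub> (s (g i) \<otimes>\<^bsub>B\<^esub> w i))"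
   unfolding L_def using f g w
   by (intro s.S.finsum_cong') (auto simp: s.hom_diff s.S.minus_eq s.S.l_distr s.S.l_minus)
  also have "\<dots> = L f \<oplus>\<^bsub>B\<^esub> (\<Oplus>\<^bsub>B\<^esub>i\<in>{..<p}. \<ominus>\<^bsub>B\<^esub> (s (g i) \<otimes>\<^bsub>B\<^esub> w i))"
   unfolding L_def using f g w by (intro s.S.finsum_addf) auto
  also have "(\<Oplus>\<^bsub>B\<^esub>i\<in>{..<p}. \<ominus>\<^bsub>B\<^esub> (s (g i) \<otimes>\<^bsub>B\<^esub> w i)) = \<ominus>\<^bsub>B\<^esub> L g"
   unfolding L_def by (rule s.S.additive_finsum[symmetric]) (use g w in \<open>auto simp: s.S.minus_add\<close>)
  finally have "L (%i. f i \<ominus>\<^bsub>F\<^esub> g i) = \<zero>\<^bsub>B\<^esub>" using eq Lc[OF g] by (simp add: s.S.r_neg)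
  moreover have fg: "(%i. f i \<ominus>\<^bsub>F\<^esub> g i) \<in> {..<p} \<rightarrow> carrier F" using f g by (intro Pi_I) simp
  ultimately have "f i \<ominus>\<^bsub>F\<^esub> g i = \<zero>\<^bsub>F\<^esub>" using indep[OF fg] i unfolding L_def by blast
  then show ?thesis using F.r_right_minus_eq[OF f[OF i] g[OF i]] by blast
 qed
 define c where "c a k = (SOME f. f \<in> {..<p} \<rightarrow> carrier F & j a \<otimes>\<^bsub>B\<^esub> w k = L f)" for a k
 have c: "c a k \<in> {..<p} \<rightarrow> carrier F" "j a \<otimes>\<^bsub>B\<^esub> w k = L (c a k)" if "a \<in> carrier A" "k < p" for a k
 proof -
  have "\<exists>f. f \<in> {..<p} \<rightarrow> carrier F & j a \<otimes>\<^bsub>B\<^esub> w k = L f" using ex[OF that] unfolding L_def by blast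
  from someI_ex[OF this] show "c a k \<in> {..<p} \<rightarrow> carrier F" "j a \<otimes>\<^bsub>B\<^esub> w k = L (c a k)" unfolding c_def by auto
 qed
 have cF: "c a k i \<in> carrier F" if "a \<in> carrier A" "k < p" "i < p" for a k i
  using funcset_mem[OF c(1)[OF that(1,2)]] that(3) by simp
 define h where "h a = (%(i, k). if i < p & k < p then c a k i else \<zero>\<^bsub>F\<^esub>)" for a
 have he: "h a (i, k) = c a k i" if "i < p" "k < p" for a i k using that by (simp add: h_def)
 have hc: "h a \<in> carrier Mat" if "a \<in> carrier A" for a
  by (rule matI) (use cF[OF that] in \<open>auto simp: h_def\<close>)
 \<comment> \<open>A matrix is recognised as \<open>h a\<close> by its columns, which reduces each
   homomorphism law to an identity of coordinates.\<close>
 have coefI: "h a = m" if a: "a \<in> carrier A" and m: "m \<in> carrier Mat" and eq: "!!k. k < p ==> j a \<otimes>\<^bsub>B\<^esub> w k = L (%i. m (i, k))" for a m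
 proof (rule mat_eqI[OF hc[OF a] m])
  fix i k assume ik: "i < p" "k < p"
  show "h a (i, k) = m (i, k)"
   unfolding he[OF ik] by (rule uniq[OF cF[OF a ik(2)] _ _ ik(1)]) (use c(2)[OF a ik(2)] eq[OF ik(2)] m in auto)
 qed
 have delta: "L (%i. if i = k then r else \<zero>\<^bsub>F\<^esub>) = s r \<otimes>\<^bsub>B\<^esub> w k" if "k < p" "r \<in> carrier F" for k r
 proof -
  have "L (%i. if i = k then r else \<zero>\<^bsub>F\<^esub>) = (\<Oplus>\<^bsub>B\<^esub>i\<in>{..<p}. if k = i then s r \<otimes>\<^bsub>B\<^esub> w i else \<zero>\<^bsub>B\<^esub>)"
   unfolding L_def using that w by (intro s.S.finsum_cong') auto
  also have "\<dots> = s r \<otimes>\<^bsub>B\<^esub> w k" using that w by (intro s.S.finsum_singleton) auto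
  finally show ?thesis .
 qed
 have hs: "h (\<sigma> r) = sc r" if r: "r \<in> carrier F" for r
 proof (rule coefI)
  show "\<sigma> r \<in> carrier A" using funcset_mem[OF \<sigma>(1) r] .
  show "sc r \<in> carrier Mat" using r by simp
  fix k assume k: "k < p"
  have "L (%i. sc r (i, k)) = L (%i. if i = k then r else \<zero>\<^bsub>F\<^esub>)"
   unfolding L_def using k r w by (intro s.S.finsum_cong') (auto simp: mat_sc)
  then show "j (\<sigma> r) \<otimes>\<^bsub>B\<^esub> w k = L (%i. sc r (i, k))" using delta[OF k r] \<sigma>(2)[OF r] by simp
 qed
 have hom: "h \<in> ring_hom A Mat"
 proof (rule ring_hom_memI)
  show "h a \<in> carrier Mat" if "a \<in> carrier A" for a using hc[OF that] .
  show "h \<one>\<^bsub>A\<^esub> = \<one>\<^bsub>Mat\<^esub>"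
  proof (rule coefI)
   fix k assume k: "k < p"
   have "L (%i. \<one>\<^bsub>Mat\<^esub> (i, k)) = L (%i. if i = k then \<one>\<^bsub>F\<^esub> else \<zero>\<^bsub>F\<^esub>)"
    unfolding L_def using k w by (intro s.S.finsum_cong') (auto simp: mat_one)
   then show "j \<one>\<^bsub>A\<^esub> \<otimes>\<^bsub>B\<^esub> w k = L (%i. \<one>\<^bsub>Mat\<^esub> (i, k))" using delta[OF k F.one_closed] w[OF k] by simp
  qed auto
  fix a a' assume a: "a \<in> carrier A" "a' \<in> carrier A"
  show "h (a \<oplus>\<^bsub>A\<^esub> a') = h a \<oplus>\<^bsub>Mat\<^esub> h a'"
  proof (rule coefI)
   fix k assume k: "k < p"
   have "L (%i. (h a \<oplus>\<^bsub>Mat\<^esub> h a') (i, k)) = (\<Oplus>\<^bsub>B\<^esub>i\<in>{..<p}. s (c a k i) \<otimes>\<^bsub>B\<^esub> w i \<oplus>\<^bsub>B\<^esub> s (c a' k i) \<otimes>\<^bsub>B\<^esub> w i)"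
    unfolding L_def using k w cF[OF a(1) k] cF[OF a(2) k] by (intro s.S.finsum_cong') (auto simp: mat_add he s.S.l_distr)
   also have "\<dots> = L (c a k) \<oplus>\<^bsub>B\<^esub> L (c a' k)"
    unfolding L_def using w cF[OF a(1) k] cF[OF a(2) k] by (intro s.S.finsum_addf) auto
   also have "\<dots> = j (a \<oplus>\<^bsub>A\<^esub> a') \<otimes>\<^bsub>B\<^esub> w k"
    using a w[OF k] by (simp add: c(2)[OF a(1) k, symmetric] c(2)[OF a(2) k, symmetric] s.S.l_distr)
   finally show "j (a \<oplus>\<^bsub>A\<^esub> a') \<otimes>\<^bsub>B\<^esub> w k = L (%i. (h a \<oplus>\<^bsub>Mat\<^esub> h a') (i, k))" by simp
  qed (use a hc in auto)
  show "h (a \<otimes>\<^bsub>A\<^esub> a') = h a \<otimes>\<^bsub>Mat\<^esub> h a'"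
  proof (rule coefI)
   fix k assume k: "k < p"
   have ja: "j a \<in> carrier B" "j a' \<in> carrier B" using a by auto
   have sc: "s (c a' k l) \<in> carrier B" if "l < p" for l using cF[OF a(2) k that] by simp
   have sc2: "s (c a l i) \<in> carrier B" if "l < p" "i < p" for l i using cF[OF a(1) that] by simp
   have "j (a \<otimes>\<^bsub>A\<^esub> a') \<otimes>\<^bsub>B\<^esub> w k = j a \<otimes>\<^bsub>B\<^esub> L (c a' k)"
    using a w[OF k] by (simp add: c(2)[OF a(2) k, symmetric] s.S.m_assoc)
   also have "\<dots> = (\<Oplus>\<^bsub>B\<^esub>l\<in>{..<p}. j a \<otimes>\<^bsub>B\<^esub> (s (c a' k l) \<otimes>\<^bsub>B\<^esub> w l))"
    unfolding L_def using ja sc w by (intro s.S.finsum_rdistr) auto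
   also have "\<dots> = (\<Oplus>\<^bsub>B\<^esub>l\<in>{..<p}. \<Oplus>\<^bsub>B\<^esub>i\<in>{..<p}. s (c a l i \<otimes>\<^bsub>F\<^esub> c a' k l) \<otimes>\<^bsub>B\<^esub> w i)"
   proof (rule s.S.finsum_cong')
    fix l assume "l \<in> {..<p}"
    then have l: "l < p" by simp
    have "j a \<otimes>\<^bsub>B\<^esub> (s (c a' k l) \<otimes>\<^bsub>B\<^esub> w l) = s (c a' k l) \<otimes>\<^bsub>B\<^esub> (j a \<otimes>\<^bsub>B\<^esub> w l)"
     using comm[OF cF[OF a(2) k l] a(1)] s.S.m_assoc[OF ja(1) sc[OF l] w[OF l]] s.S.m_assoc[OF sc[OF l] ja(1) w[OF l]] by simp
    also have "\<dots> = (\<Oplus>\<^bsub>B\<^esub>i\<in>{..<p}. s (c a' k l) \<otimes>\<^bsub>B\<^esub> (s (c a l i) \<otimes>\<^bsub>B\<^esub> w i))"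
     unfolding c(2)[OF a(1) l] L_def using sc[OF l] sc2[OF l] w by (intro s.S.finsum_rdistr) auto
    also have "\<dots> = (\<Oplus>\<^bsub>B\<^esub>i\<in>{..<p}. s (c a l i \<otimes>\<^bsub>F\<^esub> c a' k l) \<otimes>\<^bsub>B\<^esub> w i)"
     using sc[OF l] sc2[OF l] w cF[OF a(1) l] cF[OF a(2) k l]
     by (intro s.S.finsum_cong') (auto simp: s.S.m_assoc[symmetric] F.m_comm simp flip: s.hom_mult)
    finally show "j a \<otimes>\<^bsub>B\<^esub> (s (c a' k l) \<otimes>\<^bsub>B\<^esub> w l) = (\<Oplus>\<^bsub>B\<^esub>i\<in>{..<p}. s (c a l i \<otimes>\<^bsub>F\<^esub> c a' k l) \<otimes>\<^bsub>B\<^esub> w i)" .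
   qed (use w cF[OF a(1)] cF[OF a(2) k] in \<open>auto intro!: s.S.finsum_closed\<close>)
   also have "\<dots> = (\<Oplus>\<^bsub>B\<^esub>i\<in>{..<p}. \<Oplus>\<^bsub>B\<^esub>l\<in>{..<p}. s (c a l i \<otimes>\<^bsub>F\<^esub> c a' k l) \<otimes>\<^bsub>B\<^esub> w i)"
    by (rule s.S.finsum_swap) (use w cF[OF a(1)] cF[OF a(2) k] in auto)
   also have "\<dots> = L (%i. (h a \<otimes>\<^bsub>Mat\<^esub> h a') (i, k))"
    unfolding L_def
   proof (rule s.S.finsum_cong')
    fix i assume "i \<in> {..<p}"
    then have i: "i < p" by simp
    have t: "c a l i \<otimes>\<^bsub>F\<^esub> c a' k l \<in> carrier F" if "l < p" for l using cF[OF a(1) that i] cF[OF a(2) k that] by simp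
    have "(h a \<otimes>\<^bsub>Mat\<^esub> h a') (i, k) = (\<Oplus>\<^bsub>F\<^esub>l\<in>{..<p}. c a l i \<otimes>\<^bsub>F\<^esub> c a' k l)"
     unfolding mat_mult[OF i k] using i k t by (intro F.finsum_cong') (auto simp: he)
    then have "s ((h a \<otimes>\<^bsub>Mat\<^esub> h a') (i, k)) = (\<Oplus>\<^bsub>B\<^esub>l\<in>{..<p}. s (c a l i \<otimes>\<^bsub>F\<^esub> c a' k l))"
     using s.hom_finsum'[of "{..<p}" "%l. c a l i \<otimes>\<^bsub>F\<^esub> c a' k l"] t by auto
    then have "s ((h a \<otimes>\<^bsub>Mat\<^esub> h a') (i, k)) \<otimes>\<^bsub>B\<^esub> w i = (\<Oplus>\<^bsub>B\<^esub>l\<in>{..<p}. s (c a l i \<otimes>\<^bsub>F\<^esub> c a' k l)) \<otimes>\<^bsub>B\<^esub> w i" by (rule arg_cong)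
    also have "\<dots> = (\<Oplus>\<^bsub>B\<^esub>l\<in>{..<p}. s (c a l i \<otimes>\<^bsub>F\<^esub> c a' k l) \<otimes>\<^bsub>B\<^esub> w i)"
     by (rule s.S.finsum_ldistr) (use w[OF i] t s.hom_closed in blast)+
    finally show "(\<Oplus>\<^bsub>B\<^esub>l\<in>{..<p}. s (c a l i \<otimes>\<^bsub>F\<^esub> c a' k l) \<otimes>\<^bsub>B\<^esub> w i) = s ((h a \<otimes>\<^bsub>Mat\<^esub> h a') (i, k)) \<otimes>\<^bsub>B\<^esub> w i" by simp
   qed (use w hc[OF a(1)] hc[OF a(2)] in auto)
   finally show "j (a \<otimes>\<^bsub>A\<^esub> a') \<otimes>\<^bsub>B\<^esub> w k = L (%i. (h a \<otimes>\<^bsub>Mat\<^esub> h a') (i, k))" .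
  qed (use a hc in auto)
 qed
 then have "ring_hom_ring A Mat h" by (intro ring_hom_ringI2[OF A.ring_axioms M.ring_axioms])
 then show ?thesis using hs by blast
qed

text \<open>If \<open>r\<close> lies in \<open>K\<close> then so do its powers, and they span
  nothing beyond \<open>K\<close>. Read backwards: a generator of an extension of degree above 1
  lies outside the base.\<close>

lemma (in field) subfield_span_imp_carrier:
 assumes K: "subfield K R" and r: "r \<in> K" and span: "carrier R = lspan K (%i. r [^] i) {..<n::nat}"
  and dim: "dimension m K (carrier R)"
 shows "m = 1"
proof -
 have Ks: "subring K R" using subfieldE(1)[OF K] .
 have rc: "r \<in> carrier R" using r subfieldE(3)[OF K] by blast
 have pow: "r [^] (i::nat) \<in> K" for i
  by (induction i) (use r subringE(3,6)[OF Ks] in auto)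
 have "lspan K (%i. r [^] i) {..<n} \<subseteq> K"
  by (rule lspan_least[OF Ks]) (use rc pow subringE(1,2,6,7)[OF Ks] in auto)
 then have "carrier R = K" using span subfieldE(3)[OF K] by blast
 then have "dimension m K K" using dim by simp
 then show ?thesis using dimension_is_inj[OF K _ dimension_one[OF K]] by blast
qed

lemma (in symbol_pair) lspan_mon_subset:
 assumes K: "subring K R" and S: "S \<subseteq> carrier R" "K \<subseteq> S" "u \<in> S" "v \<in> S"
  and add: "!!a b. a \<in> S ==> b \<in> S ==> a \<oplus> b \<in> S" and mult: "!!a b. a \<in> S ==> b \<in> S ==> a \<otimes> b \<in> S"
 shows "lspan K mon I \<subseteq> S"
proof -
 have one: "\<zero> \<in> S" "\<one> \<in> S" "\<ominus> \<one> \<in> S" using subringE(2,3,5)[OF K] S(2) by auto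
 \<comment> \<open>\<open>S\<close> is closed under sums and products only, so negative integers are
   obtained from \<open>- 1\<close>, which lies in \<open>K\<close>.\<close>
 have neg: "[(- int i)] \<cdot> \<one> \<in> S" for i
 proof (induction i)
  case 0
  then show ?case using one(1) by simp
 next
  case (Suc i)
  have "[(- int (Suc i))] \<cdot> \<one> = [(- int i)] \<cdot> \<one> \<oplus> [(-1::int)] \<cdot> \<one>"
   using int_mult_add[of \<one> "- int i" "-1"] by (simp add: add.commute)
  moreover have "[(-1::int)] \<cdot> \<one> = \<ominus> \<one>" using add.int_pow_neg[of \<one> 1] by simp
  ultimately show ?case using add[OF Suc one(3)] by simp
 qed
 have fal: "falling u i \<in> S" for i
 proof (induction i)
  case 0
  then show ?case using one(2) by simp
 next
  case (Suc i)
  have "u \<ominus> [int i] \<cdot> \<one> = u \<oplus> [(- int i)] \<cdot> \<one>" using add.int_pow_neg[of \<one> "int i"] by (simp add: minus_eq)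
  then have "u \<ominus> [int i] \<cdot> \<one> \<in> S" using add[OF S(3) neg] by simp
  then show ?case unfolding falling_Suc using mult Suc by blast
 qed
 have pow: "v [^] (i::nat) \<in> S" for i by (induction i) (use one(2) mult S(4) in auto)
 have "k \<otimes> mon z \<in> S" if "k \<in> K" for k z
  unfolding mon_def using mult[OF subsetD[OF S(2) that] mult[OF fal pow]] .
 then show ?thesis
  by (intro lspan_least[OF K _ _ one(1) add]) (use S(1) in auto)
qed

section \<open>Descent from a purely inseparable splitting field\<close>

text \<open>\<open>N\<close> is generated over \<open>F\<close> by a \<open>p\<close>-th root
  \<open>r0\<close> of \<open>\<gamma>\<close>, and \<open>j\<close> maps \<open>A\<close> to the
  matrices over \<open>N\<close>. Of the splitting isomorphism, \<open>j_span\<close> retains that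
  the image of \<open>A\<close> spans all matrices over \<open>N\<close>.\<close>

locale split_descent = F: field F + F: char_p_ring F p + N: field N + nu: ring_hom_ring F N \<nu> + x: symbol_pair "fst A" p x y
 for F :: "'a ring" and p :: nat and N :: "'k ring" and \<nu> :: "'a => 'k" and A :: "('a, 'b) alg" and x y :: 'b +
 fixes j :: "'b => nat \<times> nat => 'k" and \<alpha> \<beta> \<gamma> :: 'a and r0 :: 'k
 assumes sys: "symbol_system p F A \<alpha> \<beta> x y"
  and r0: "r0 \<in> carrier N" "r0 [^]\<^bsub>N\<^esub> p = \<nu> \<gamma>" "\<gamma> \<in> carrier F"
  and N_span: "carrier N = N.lspan (\<nu> ` carrier F) (%i. r0 [^]\<^bsub>N\<^esub> i) {..<p}"
  and N_dim: "N.dimension p (\<nu> ` carrier F) (carrier N)"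
  and j_hom: "ring_hom_ring (fst A) (fst (matrix_algebra p N)) j"
  and j_struct: "!!r. r \<in> carrier F ==> j (snd A r) = snd (matrix_algebra p N) (\<nu> r)"
  and j_span: "carrier (fst (matrix_algebra p N)) = ring.lspan (fst (matrix_algebra p N)) (snd (matrix_algebra p N) ` carrier N)
   (symbol_pair.mon (fst (matrix_algebra p N)) (j x) (j y)) ({..<p} \<times> {..<p})"
begin

sublocale B: split_matrices N p
 using nu.hom_char_p[OF F.char_p_ring_axioms] F.p_pos
 by (auto intro!: split_matrices.intro matrix_ring.intro matrix_ring_axioms.intro N.is_cring)

abbreviation "Mat \<equiv> fst (matrix_algebra p N)"
abbreviation "sc \<equiv> snd (matrix_algebra p N)"

sublocale j: ring_hom_ring "fst A" Mat j by (rule j_hom)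
sublocale \<sigma>: ring_hom_ring F "fst A" "snd A" using sys by (simp add: symbol_system_def)
sublocale jx: symbol_pair Mat p "j x" "j y" by (rule j.hom_symbol_pair) (rule x.symbol_pair_axioms)

definition "s r = sc (\<nu> r)"

lemma s_hom: "ring_hom_ring F Mat s"
proof (rule ring_hom_ringI2[OF F.ring_axioms B.M.ring_axioms])
 have "sc \<circ> \<nu> \<in> ring_hom F Mat" by (rule ring_hom_trans[OF nu.homh B.sc.homh])
 moreover have "sc \<circ> \<nu> = s" by (simp add: s_def fun_eq_iff)
 ultimately show "s \<in> ring_hom F Mat" by simp
qed

sublocale s: ring_hom_ring F Mat s by (rule s_hom)

lemma nu_inj: "r \<in> carrier F ==> \<nu> r = \<zero>\<^bsub>N\<^esub> ==> r = \<zero>\<^bsub>F\<^esub>"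
proof (rule ccontr)
 assume r: "r \<in> carrier F" "\<nu> r = \<zero>\<^bsub>N\<^esub>" "r ~= \<zero>\<^bsub>F\<^esub>"
 then have u: "r \<in> Units F" using F.field_Units by blast
 have "\<nu> (inv\<^bsub>F\<^esub> r) \<otimes>\<^bsub>N\<^esub> \<nu> r = \<one>\<^bsub>N\<^esub>"
  unfolding nu.hom_mult[OF F.Units_inv_closed[OF u] r(1), symmetric] F.Units_l_inv[OF u] by simp
 then have "\<one>\<^bsub>N\<^esub> = \<zero>\<^bsub>N\<^esub>" unfolding r(2) using N.r_null[OF nu.hom_closed[OF F.Units_inv_closed[OF u]]] by simp
 then show False using N.one_not_zero by contradiction
qed

lemma s_inj: "r \<in> carrier F ==> s r = \<zero>\<^bsub>Mat\<^esub> ==> r = \<zero>\<^bsub>F\<^esub>"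
 unfolding s_def using B.sc_inj[OF nu.hom_closed] nu_inj by blast

lemma Mat_one: "\<one>\<^bsub>Mat\<^esub> ~= \<zero>\<^bsub>Mat\<^esub>"
 using s_inj[OF F.one_closed] s.hom_one F.one_not_zero by metis

lemma A_one: "\<one>\<^bsub>fst A\<^esub> ~= \<zero>\<^bsub>fst A\<^esub>"
 using Mat_one j.hom_one j.hom_zero by metis

abbreviation "F0 \<equiv> \<nu> ` carrier F"
abbreviation "F1 \<equiv> s ` carrier F"
abbreviation "N1 \<equiv> sc ` carrier N"

lemma F0: "subfield F0 N" by (rule nu.img_is_subfield(2)[OF F.carrier_is_subfield N.one_not_zero])
lemma F1: "subfield F1 Mat" by (rule s.img_is_subfield(2)[OF F.carrier_is_subfield Mat_one])
lemma N1: "subfield N1 Mat" by (rule B.sc.img_is_subfield(2)[OF N.carrier_is_subfield Mat_one])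

lemma r0_not_in: "r0 \<notin> F0"
 using N.subfield_span_imp_carrier[OF F0 _ N_span N_dim] F.p_gt1 by auto

lemma r0_unit: "r0 \<in> Units N"
proof -
 have "\<zero>\<^bsub>N\<^esub> \<in> F0" using subringE(2)[OF subfieldE(1)[OF F0]] .
 then have "r0 ~= \<zero>\<^bsub>N\<^esub>" using r0_not_in by metis
 then show ?thesis using r0(1) N.field_Units by blast
qed

lemma gamma_unit: "\<gamma> \<in> Units F"
proof -
 have "\<gamma> ~= \<zero>\<^bsub>F\<^esub>"
 proof
  assume "\<gamma> = \<zero>\<^bsub>F\<^esub>"
  then have "r0 [^]\<^bsub>N\<^esub> p = \<zero>\<^bsub>N\<^esub>" using r0(2) nu.hom_zero by simp
  moreover have "r0 [^]\<^bsub>N\<^esub> p \<in> Units N" using N.Units_pow_closed[OF r0_unit] .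
  ultimately show False using N.field_Units by simp
 qed
 then show ?thesis using r0(3) F.field_Units by blast
qed

text \<open>The column space of dimension \<open>p\<close> over \<open>N\<close>, realised as a left
  ideal of the matrix ring, so that \<open>A\<close>, \<open>F\<close> and \<open>N\<close> all act
  by multiplication within one ring and dimensions over \<open>F\<close> and \<open>N\<close> can be
  compared there.\<close>

definition "V = {m \<in> carrier Mat. \<forall>i k. k ~= 0 --> m (i, k) = \<zero>\<^bsub>N\<^esub>}"

lemma V_carrier: "v \<in> V ==> v \<in> carrier Mat" by (simp add: V_def)

lemma V_zero: "v \<in> V ==> k ~= 0 ==> v (i, k) = \<zero>\<^bsub>N\<^esub>" by (simp add: V_def)

lemma V_mult: "m \<in> carrier Mat ==> v \<in> V ==> m \<otimes>\<^bsub>Mat\<^esub> v \<in> V"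
proof -
 assume m: "m \<in> carrier Mat" and v: "v \<in> V"
 have "(m \<otimes>\<^bsub>Mat\<^esub> v) (i, k) = \<zero>\<^bsub>N\<^esub>" if k: "k ~= 0" for i k
 proof (cases "i < p & k < p")
  case True
  have "(\<Oplus>\<^bsub>N\<^esub>l\<in>{..<p}. m (i, l) \<otimes>\<^bsub>N\<^esub> v (l, k)) = (\<Oplus>\<^bsub>N\<^esub>l\<in>{..<p}. \<zero>\<^bsub>N\<^esub>)"
   using V_zero[OF v k] m by (intro N.finsum_cong') auto
  then show ?thesis using True by (simp add: B.mat_mult)
 next
  case False
  then show ?thesis by (rule B.mat_outs(1))
 qed
 then show ?thesis using m V_carrier[OF v] by (simp add: V_def)
qed

lemma col_sum:
 assumes t: "!!k. k < p ==> t k \<in> carrier N" and il: "i < p" "l < p"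
 shows "(\<Oplus>\<^bsub>Mat\<^esub>k\<in>{..<p}. sc (t k) \<otimes>\<^bsub>Mat\<^esub> B.col k) (i, l) = (if l = 0 then t i else \<zero>\<^bsub>N\<^esub>)"
proof -
 have "(\<Oplus>\<^bsub>Mat\<^esub>k\<in>{..<p}. sc (t k) \<otimes>\<^bsub>Mat\<^esub> B.col k) (i, l) = (\<Oplus>\<^bsub>N\<^esub>k\<in>{..<p}. (sc (t k) \<otimes>\<^bsub>Mat\<^esub> B.col k) (i, l))"
  by (rule B.mat_finsum) (use t il in auto)
 also have "\<dots> = (\<Oplus>\<^bsub>N\<^esub>k\<in>{..<p}. if i = k then (if l = 0 then t k else \<zero>\<^bsub>N\<^esub>) else \<zero>\<^bsub>N\<^esub>)"
 proof (rule N.finsum_cong')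
  fix k assume "k \<in> {..<p}"
  then have k: "k < p" by simp
  show "(sc (t k) \<otimes>\<^bsub>Mat\<^esub> B.col k) (i, l) = (if i = k then (if l = 0 then t k else \<zero>\<^bsub>N\<^esub>) else \<zero>\<^bsub>N\<^esub>)"
   unfolding B.sc_mult[OF t[OF k] B.col_closed[OF k] il] using t[OF k] by (auto simp: B.col_def mat_unit_def)
 qed (use t in auto)
 also have "\<dots> = (if l = 0 then t i else \<zero>\<^bsub>N\<^esub>)" by (rule N.finsum_singleton) (use t il in auto)
 finally show ?thesis .
qed

lemma V_dim_N: "B.M.dimension p N1 V"
proof -
 have fin: "finite {..<p}" "B.col \<in> {..<p} \<rightarrow> carrier Mat" by auto
 have coeff: "\<exists>t. (\<forall>k<p. t k \<in> carrier N) & (\<forall>k<p. c k = sc (t k))" if c: "c \<in> {..<p} \<rightarrow> N1" for c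
 proof -
  have "\<forall>k. \<exists>u. k < p --> u \<in> carrier N & c k = sc u" using funcset_mem[OF c] by blast
  from choice[OF this] show ?thesis by blast
 qed
 have sum_cong: "(\<Oplus>\<^bsub>Mat\<^esub>k\<in>{..<p}. c k \<otimes>\<^bsub>Mat\<^esub> B.col k) = (\<Oplus>\<^bsub>Mat\<^esub>k\<in>{..<p}. sc (t k) \<otimes>\<^bsub>Mat\<^esub> B.col k)"
  if "\<forall>k<p. t k \<in> carrier N" "\<forall>k<p. c k = sc (t k)" for c t
  using that by (intro B.M.finsum_cong') auto
 have "B.M.lspan N1 B.col {..<p} = V"
 proof (intro equalityI subsetI)
  fix v assume "v \<in> B.M.lspan N1 B.col {..<p}"
  then obtain c where c: "c \<in> {..<p} \<rightarrow> N1" "v = (\<Oplus>\<^bsub>Mat\<^esub>k\<in>{..<p}. c k \<otimes>\<^bsub>Mat\<^esub> B.col k)" unfolding B.M.lspan_def by blast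
  obtain t where t: "\<forall>k<p. t k \<in> carrier N" "\<forall>k<p. c k = sc (t k)" using coeff[OF c(1)] by blast
  have v: "v = (\<Oplus>\<^bsub>Mat\<^esub>k\<in>{..<p}. sc (t k) \<otimes>\<^bsub>Mat\<^esub> B.col k)" unfolding c(2) by (rule sum_cong[OF t])
  have vM: "v \<in> carrier Mat" unfolding v using t by (intro B.M.finsum_closed) auto
  have "v (i, k) = \<zero>\<^bsub>N\<^esub>" if "k ~= 0" for i k
  proof (cases "i < p & k < p")
   case True
   then show ?thesis using col_sum[of t i k] t(1) that unfolding v by simp
  next
   case False
   then show ?thesis by (rule B.mat_outside[OF vM])
  qed
  then show "v \<in> V" using vM by (simp add: V_def)
 next
  fix v assume v: "v \<in> V"
  have vc: "v (k, 0) \<in> carrier N" for k using V_carrier[OF v] by simp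
  have eq: "v = (\<Oplus>\<^bsub>Mat\<^esub>k\<in>{..<p}. sc (v (k, 0)) \<otimes>\<^bsub>Mat\<^esub> B.col k)"
  proof (rule B.mat_eqI[OF V_carrier[OF v]])
   show "(\<Oplus>\<^bsub>Mat\<^esub>k\<in>{..<p}. sc (v (k, 0)) \<otimes>\<^bsub>Mat\<^esub> B.col k) \<in> carrier Mat"
    using vc by (intro B.M.finsum_closed) auto
   show "v (i, l) = (\<Oplus>\<^bsub>Mat\<^esub>k\<in>{..<p}. sc (v (k, 0)) \<otimes>\<^bsub>Mat\<^esub> B.col k) (i, l)" if "i < p" "l < p" for i l
    using col_sum[of "%k. v (k, 0)" i l] vc that V_zero[OF v] by auto
  qed
  have "(\<Oplus>\<^bsub>Mat\<^esub>k\<in>{..<p}. sc (v (k, 0)) \<otimes>\<^bsub>Mat\<^esub> B.col k) \<in> B.M.lspan N1 B.col {..<p}"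
   by (rule B.M.lspanI) (use vc in auto)
  then show "v \<in> B.M.lspan N1 B.col {..<p}" by (simp only: eq[symmetric])
 qed
 moreover have "B.M.dimension (card {..<p}) N1 (B.M.lspan N1 B.col {..<p})"
 proof (rule B.M.lspan_dimension[OF N1 fin])
  fix c assume c: "c \<in> {..<p} \<rightarrow> N1" "(\<Oplus>\<^bsub>Mat\<^esub>k\<in>{..<p}. c k \<otimes>\<^bsub>Mat\<^esub> B.col k) = \<zero>\<^bsub>Mat\<^esub>"
  obtain t where t: "\<forall>k<p. t k \<in> carrier N" "\<forall>k<p. c k = sc (t k)" using coeff[OF c(1)] by blast
  have z: "(\<Oplus>\<^bsub>Mat\<^esub>k\<in>{..<p}. sc (t k) \<otimes>\<^bsub>Mat\<^esub> B.col k) = \<zero>\<^bsub>Mat\<^esub>"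
   by (rule trans[OF sym[OF sum_cong[OF t]] c(2)])
  have "t i = \<zero>\<^bsub>N\<^esub>" if "i < p" for i
   using col_sum[of t i 0] t(1) that F.p_pos unfolding z B.mat_zero by simp
  then show "\<forall>k\<in>{..<p}. c k = \<zero>\<^bsub>Mat\<^esub>" using t(2) by simp
 qed
 ultimately show ?thesis by simp
qed

text \<open>The tower of \<open>F\<close>, \<open>N\<close> and \<open>V\<close>, with a factor
  \<open>p\<close> at each stage.\<close>

lemma V_dim: "B.M.dimension (p * p) F1 V"
proof -
 have "F1 = sc ` F0" by (auto simp: s_def)
 moreover have "inj_on sc (carrier N)"
 proof (rule inj_onI)
  fix u v assume uv: "u \<in> carrier N" "v \<in> carrier N" "sc u = sc v"
  then have "sc (u \<ominus>\<^bsub>N\<^esub> v) = \<zero>\<^bsub>Mat\<^esub>" by (simp add: B.sc.hom_diff)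
  then show "u = v" using B.sc_inj[of "u \<ominus>\<^bsub>N\<^esub> v"] uv by simp
 qed
 ultimately have "B.M.dimension p F1 N1"
  using B.sc.inj_hom_dimension[OF F0 Mat_one _ N_dim] by simp
 then show ?thesis by (rule B.M.telescopic_base[OF F1 N1 _ V_dim_N])
qed

text \<open>A subspace stable under \<open>j x\<close>, \<open>j y\<close>, \<open>F\<close> and
  \<open>r0\<close> is stable under \<open>N\<close>, whose elements are polynomials in
  \<open>r0\<close>, and hence under all matrices, which are spanned over \<open>N\<close> by the
  monomials in \<open>j x\<close> and \<open>j y\<close>.\<close>

lemma V_irreducible:
 assumes U: "B.M.dimension m F1 U" "U \<subseteq> V" "U ~= {\<zero>\<^bsub>Mat\<^esub>}"
  and st: "!!u. u \<in> U ==> j x \<otimes>\<^bsub>Mat\<^esub> u \<in> U" "!!u. u \<in> U ==> j y \<otimes>\<^bsub>Mat\<^esub> u \<in> U" "!!u. u \<in> U ==> sc r0 \<otimes>\<^bsub>Mat\<^esub> u \<in> U"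
 shows "U = V"
proof -
 note Up = B.M.space_subgroup_props[OF F1 U(1)]
 have UM: "u \<in> carrier Mat" if "u \<in> U" for u using that Up(1) by blast
 define S where "S = {m \<in> carrier Mat. \<forall>u\<in>U. m \<otimes>\<^bsub>Mat\<^esub> u \<in> U}"
 have Sc: "m \<in> S ==> m \<in> carrier Mat" for m by (simp add: S_def)
 have S_add: "a \<oplus>\<^bsub>Mat\<^esub> b \<in> S" if "a \<in> S" "b \<in> S" for a b
  using that UM Up(3) by (auto simp: S_def B.M.l_distr)
 have S_mult: "a \<otimes>\<^bsub>Mat\<^esub> b \<in> S" if "a \<in> S" "b \<in> S" for a b
  using that UM by (auto simp: S_def B.M.m_assoc)
 have S_zero: "\<zero>\<^bsub>Mat\<^esub> \<in> S" using UM Up(2) by (auto simp: S_def)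
 have S_one: "\<one>\<^bsub>Mat\<^esub> \<in> S" using UM by (auto simp: S_def)
 have S_F: "s r \<in> S" if "r \<in> carrier F" for r using that Up(5)[of "s r"] by (auto simp: S_def)
 have S_pow: "a [^]\<^bsub>Mat\<^esub> (k::nat) \<in> S" if "a \<in> S" for a k
  by (induction k) (use S_one S_mult that in auto)
 have gens: "j x \<in> S" "j y \<in> S" "sc r0 \<in> S" using st r0(1) by (auto simp: S_def)
 have S_N: "sc t \<in> S" if "t \<in> carrier N" for t
 proof -
  have "N.lspan F0 (%i. r0 [^]\<^bsub>N\<^esub> i) {..<p} \<subseteq> {t \<in> carrier N. sc t \<in> S}"
  proof (rule N.lspan_least[OF subfieldE(1)[OF F0]])
   show "k \<otimes>\<^bsub>N\<^esub> r0 [^]\<^bsub>N\<^esub> i \<in> {t \<in> carrier N. sc t \<in> S}" if "k \<in> F0" for k and i :: nat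
   proof -
    obtain r where r: "r \<in> carrier F" "k = \<nu> r" using \<open>k \<in> F0\<close> by blast
    have "sc (k \<otimes>\<^bsub>N\<^esub> r0 [^]\<^bsub>N\<^esub> i) = s r \<otimes>\<^bsub>Mat\<^esub> sc r0 [^]\<^bsub>Mat\<^esub> i"
     using r r0(1) by (simp add: s_def B.sc.hom_nat_pow)
    then show ?thesis using S_mult[OF S_F[OF r(1)] S_pow[OF gens(3)]] r r0(1) by simp
   qed
  qed (use S_zero S_add r0(1) in auto)
  then show ?thesis using that N_span by blast
 qed
 have "B.M.lspan N1 jx.mon jx.I \<subseteq> S"
  by (rule jx.lspan_mon_subset[OF subfieldE(1)[OF N1] _ _ gens(1,2) S_add S_mult]) (use Sc S_N in auto)
 then have SM: "carrier Mat \<subseteq> S" using j_span by blast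
 obtain u where u: "u \<in> U" "u ~= \<zero>\<^bsub>Mat\<^esub>" using U(3) Up(2) by blast
 have uV: "u \<in> V" using u U(2) by blast
 obtain i where i: "i < p" "u (i, 0) ~= \<zero>\<^bsub>N\<^esub>"
 proof -
  have "\<exists>i<p. u (i, 0) ~= \<zero>\<^bsub>N\<^esub>"
  proof (rule ccontr)
   assume no: "~ (\<exists>i<p. u (i, 0) ~= \<zero>\<^bsub>N\<^esub>)"
   have "u = \<zero>\<^bsub>Mat\<^esub>"
   proof (rule B.mat_eqI[OF UM[OF u(1)] B.mat_zero_closed])
    fix a c assume "a < p" "c < p"
    then show "u (a, c) = \<zero>\<^bsub>Mat\<^esub> (a, c)" using no V_zero[OF uV, of c a] by (cases "c = 0") (auto simp: B.mat_zero)
   qed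
   then show False using u(2) by contradiction
  qed
  then show thesis using that by blast
 qed
 define t where "t = inv\<^bsub>N\<^esub> (u (i, 0))"
 have uc: "u (a, c) \<in> carrier N" for a c using UM[OF u(1)] by simp
 have uU: "u (i, 0) \<in> Units N" using uc i(2) N.field_Units by blast
 then have t: "t \<in> carrier N" "t \<otimes>\<^bsub>N\<^esub> u (i, 0) = \<one>\<^bsub>N\<^esub>" by (auto simp: t_def)
 have "v \<in> U" if v: "v \<in> V" for v
 proof -
  have vc: "v (a, c) \<in> carrier N" for a c using V_carrier[OF v] by simp
  \<comment> \<open>Multiplication by \<open>m\<close> sends \<open>u\<close> to \<open>v\<close>:
    it reads coordinate \<open>i\<close> of \<open>u\<close>, scales it to 1 and distributes it
    along the coordinates of \<open>v\<close>.\<close>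
  define m where "m = (%(a, b). if a < p & b = i then v (a, 0) \<otimes>\<^bsub>N\<^esub> t else \<zero>\<^bsub>N\<^esub>)"
  have mM: "m \<in> carrier Mat" by (rule B.matI) (use vc t i in \<open>auto simp: m_def\<close>)
  have "m \<otimes>\<^bsub>Mat\<^esub> u = v"
  proof (rule B.mat_eqI[OF _ V_carrier[OF v]])
   show "m \<otimes>\<^bsub>Mat\<^esub> u \<in> carrier Mat" using mM UM[OF u(1)] by simp
   fix a c assume ac: "a < p" "c < p"
   have "(m \<otimes>\<^bsub>Mat\<^esub> u) (a, c) = (\<Oplus>\<^bsub>N\<^esub>b\<in>{..<p}. if i = b then v (a, 0) \<otimes>\<^bsub>N\<^esub> t \<otimes>\<^bsub>N\<^esub> u (b, c) else \<zero>\<^bsub>N\<^esub>)"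
    unfolding B.mat_mult[OF ac] using ac vc t uc by (intro N.finsum_cong') (auto simp: m_def)
   also have "\<dots> = v (a, 0) \<otimes>\<^bsub>N\<^esub> t \<otimes>\<^bsub>N\<^esub> u (i, c)"
    by (rule N.finsum_singleton) (use i vc t uc in auto)
   also have "\<dots> = v (a, c)"
    using t vc uc V_zero[OF v, of c a] V_zero[OF uV, of c i] by (cases "c = 0") (auto simp: N.m_assoc)
   finally show "(m \<otimes>\<^bsub>Mat\<^esub> u) (a, c) = v (a, c)" .
  qed
  moreover have "m \<otimes>\<^bsub>Mat\<^esub> u \<in> U" using SM mM u(1) by (auto simp: S_def)
  ultimately show "v \<in> U" by simp
 qed
 then show ?thesis using U(2) by blast
qed

lemma s_central: "r \<in> carrier F ==> m \<in> carrier Mat ==> s r \<otimes>\<^bsub>Mat\<^esub> m = m \<otimes>\<^bsub>Mat\<^esub> s r"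
 unfolding s_def by (rule B.sc_central) auto

text \<open>The unit in \<open>minimal_stable_subspace\<close> is the scalar \<open>r0\<close>:
  \<open>V\<close> is irreducible under \<open>A\<close> and \<open>r0\<close> together, and
  \<open>r0^p\<close> lies in \<open>F\<close>. The dimension so obtained divides
  \<open>p^2\<close>, and it is not 1: on a line \<open>x\<close> and \<open>y\<close> would act by
  commuting scalars, and \<open>y x = (x + 1) y\<close> would force the unit \<open>y\<close> to act
  as 0.\<close>

lemma minimal_module:
 "\<exists>W d. W \<subseteq> V & B.M.dimension d F1 W & d \<in> {p, p * p} & j x \<in> {a. \<forall>w\<in>W. a \<otimes>\<^bsub>Mat\<^esub> w \<in> W} & j y \<in> {a. \<forall>w\<in>W. a \<otimes>\<^bsub>Mat\<^esub> w \<in> W}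
  & (\<forall>U k. B.M.dimension k F1 U --> U \<subseteq> W --> U ~= {\<zero>\<^bsub>Mat\<^esub>} --> (\<forall>a\<in>{j x, j y}. \<forall>u\<in>U. a \<otimes>\<^bsub>Mat\<^esub> u \<in> U) --> U = W)"
proof -
 have Y: "sc r0 \<in> Units Mat" by (rule B.sc_Units[OF r0_unit])
 have Yp: "sc r0 [^]\<^bsub>Mat\<^esub> p \<in> F1"
 proof -
  have "sc r0 [^]\<^bsub>Mat\<^esub> p = s \<gamma>"
   unfolding s_def r0(2)[symmetric] by (rule B.sc.hom_nat_pow[OF r0(1), symmetric])
  then show ?thesis using r0(3) by blast
 qed
 have "\<exists>W d. W \<subseteq> V & B.M.dimension d F1 W & d > 0 & d dvd p * p & (\<forall>a\<in>{j x, j y}. \<forall>w\<in>W. a \<otimes>\<^bsub>Mat\<^esub> w \<in> W) &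
  (\<forall>U k. B.M.dimension k F1 U --> U \<subseteq> W --> U ~= {\<zero>\<^bsub>Mat\<^esub>} --> (\<forall>a\<in>{j x, j y}. \<forall>u\<in>U. a \<otimes>\<^bsub>Mat\<^esub> u \<in> U) --> U = W)"
 proof (rule B.M.minimal_stable_subspace[OF F1 V_dim _ _ Y _ _ _ _ F.p_pos Yp])
  show "0 < p * p" using F.p_pos by simp
  show "{j x, j y} \<subseteq> carrier Mat" by auto
  show "sc r0 \<otimes>\<^bsub>Mat\<^esub> k = k \<otimes>\<^bsub>Mat\<^esub> sc r0" if "k \<in> F1" for k
   by (rule B.sc_central[OF r0(1)]) (use that in auto)
  show "sc r0 \<otimes>\<^bsub>Mat\<^esub> a = a \<otimes>\<^bsub>Mat\<^esub> sc r0" if "a \<in> {j x, j y}" for a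
   by (rule B.sc_central[OF r0(1)]) (use that in auto)
  show "a \<otimes>\<^bsub>Mat\<^esub> v \<in> V" if "a \<in> {j x, j y}" "v \<in> V" for a v
   by (rule V_mult) (use that in auto)
  show "sc r0 \<otimes>\<^bsub>Mat\<^esub> v \<in> V" if "v \<in> V" for v by (rule V_mult) (use that r0(1) in auto)
  show "U = V" if "B.M.dimension m F1 U" "U \<subseteq> V" "U ~= {\<zero>\<^bsub>Mat\<^esub>}" "!!a u. a \<in> {j x, j y} ==> u \<in> U ==> a \<otimes>\<^bsub>Mat\<^esub> u \<in> U"
   "!!u. u \<in> U ==> sc r0 \<otimes>\<^bsub>Mat\<^esub> u \<in> U" for U m
   by (rule V_irreducible[OF that(1-3)]) (use that(4,5) in blast)+
 qed
 then obtain W d where W: "W \<subseteq> V" "B.M.dimension d F1 W" "d > 0" "d dvd p * p" "\<forall>a\<in>{j x, j y}. \<forall>w\<in>W. a \<otimes>\<^bsub>Mat\<^esub> w \<in> W"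
  "\<forall>U k. B.M.dimension k F1 U --> U \<subseteq> W --> U ~= {\<zero>\<^bsub>Mat\<^esub>} --> (\<forall>a\<in>{j x, j y}. \<forall>u\<in>U. a \<otimes>\<^bsub>Mat\<^esub> u \<in> U) --> U = W"
  by (elim exE conjE) (rule that, assumption+)
 have "d ~= 1"
 proof
  assume "d = 1"
  obtain Ws where Ws: "set Ws \<subseteq> carrier Mat" "B.M.independent F1 Ws" "length Ws = d" "B.M.Span F1 Ws = W"
   using B.M.exists_base[OF F1 W(2)] by blast
  then obtain w where w: "Ws = [w]" using \<open>d = 1\<close> by (auto simp: length_Suc_conv)
  have wM: "w \<in> carrier Mat" using Ws(1) w by simp
  have "w \<notin> B.M.Span F1 []" using B.M.independent_backwards(1)[of F1 w "[]"] Ws(2) unfolding w by blast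
  then have w0: "w ~= \<zero>\<^bsub>Mat\<^esub>" by simp
  have wW: "w \<in> W" using B.M.Span_base_incl[OF F1 Ws(1)] Ws(4) w by auto
  have line: "\<exists>r\<in>carrier F. z = s r \<otimes>\<^bsub>Mat\<^esub> w" if z: "z \<in> W" for z
  proof -
   have "z \<in> B.M.line_extension F1 w {\<zero>\<^bsub>Mat\<^esub>}" using z Ws(4) unfolding w by simp
   then obtain k where "k \<in> F1" "z = k \<otimes>\<^bsub>Mat\<^esub> w \<oplus>\<^bsub>Mat\<^esub> \<zero>\<^bsub>Mat\<^esub>"
    unfolding B.M.line_extension_mem_iff by blast
   then show ?thesis using wM by auto
  qed
  obtain k where k: "k \<in> carrier F" "j x \<otimes>\<^bsub>Mat\<^esub> w = s k \<otimes>\<^bsub>Mat\<^esub> w" using line[of "j x \<otimes>\<^bsub>Mat\<^esub> w"] W(5) wW by blast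
  obtain l where l: "l \<in> carrier F" "j y \<otimes>\<^bsub>Mat\<^esub> w = s l \<otimes>\<^bsub>Mat\<^esub> w" using line[of "j y \<otimes>\<^bsub>Mat\<^esub> w"] W(5) wW by blast
  have sM: "s k \<in> carrier Mat" "s l \<in> carrier Mat" using k l by auto
  have comm: "s k \<otimes>\<^bsub>Mat\<^esub> s l = s l \<otimes>\<^bsub>Mat\<^esub> s k" by (rule s_central[OF k(1) sM(2)])
  have "j y \<otimes>\<^bsub>Mat\<^esub> (j x \<otimes>\<^bsub>Mat\<^esub> w) = s k \<otimes>\<^bsub>Mat\<^esub> (j y \<otimes>\<^bsub>Mat\<^esub> w)"
   unfolding k(2) using B.M.m_assoc[OF jx.v sM(1) wM] B.M.m_assoc[OF sM(1) jx.v wM] s_central[OF k(1) jx.v] by simp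
  then have 1: "j y \<otimes>\<^bsub>Mat\<^esub> j x \<otimes>\<^bsub>Mat\<^esub> w = s k \<otimes>\<^bsub>Mat\<^esub> s l \<otimes>\<^bsub>Mat\<^esub> w"
   unfolding l(2) B.M.m_assoc[OF jx.v jx.u wM] B.M.m_assoc[OF sM wM] .
  have "(j x \<oplus>\<^bsub>Mat\<^esub> \<one>\<^bsub>Mat\<^esub>) \<otimes>\<^bsub>Mat\<^esub> j y \<otimes>\<^bsub>Mat\<^esub> w = (j x \<oplus>\<^bsub>Mat\<^esub> \<one>\<^bsub>Mat\<^esub>) \<otimes>\<^bsub>Mat\<^esub> (s l \<otimes>\<^bsub>Mat\<^esub> w)"
   unfolding l(2)[symmetric] by (rule B.M.m_assoc) (use wM in auto)
  also have "\<dots> = s l \<otimes>\<^bsub>Mat\<^esub> ((j x \<oplus>\<^bsub>Mat\<^esub> \<one>\<^bsub>Mat\<^esub>) \<otimes>\<^bsub>Mat\<^esub> w)"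
   using s_central[OF l(1), of "j x \<oplus>\<^bsub>Mat\<^esub> \<one>\<^bsub>Mat\<^esub>"] wM sM by (simp add: B.M.m_assoc[symmetric])
  also have "\<dots> = s l \<otimes>\<^bsub>Mat\<^esub> (s k \<otimes>\<^bsub>Mat\<^esub> w) \<oplus>\<^bsub>Mat\<^esub> s l \<otimes>\<^bsub>Mat\<^esub> w"
   using wM sM by (simp add: B.M.l_distr B.M.r_distr k(2))
  finally have 2: "(j x \<oplus>\<^bsub>Mat\<^esub> \<one>\<^bsub>Mat\<^esub>) \<otimes>\<^bsub>Mat\<^esub> j y \<otimes>\<^bsub>Mat\<^esub> w = s k \<otimes>\<^bsub>Mat\<^esub> s l \<otimes>\<^bsub>Mat\<^esub> w \<oplus>\<^bsub>Mat\<^esub> s l \<otimes>\<^bsub>Mat\<^esub> w"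
   unfolding comm B.M.m_assoc[OF sM(2,1) wM] .
  have eq: "s k \<otimes>\<^bsub>Mat\<^esub> s l \<otimes>\<^bsub>Mat\<^esub> w \<oplus>\<^bsub>Mat\<^esub> s l \<otimes>\<^bsub>Mat\<^esub> w = s k \<otimes>\<^bsub>Mat\<^esub> s l \<otimes>\<^bsub>Mat\<^esub> w"
   by (rule trans[OF sym[OF 2] 1[unfolded jx.YX]])
  have c: "s k \<otimes>\<^bsub>Mat\<^esub> s l \<otimes>\<^bsub>Mat\<^esub> w \<in> carrier Mat" "s l \<otimes>\<^bsub>Mat\<^esub> w \<in> carrier Mat" using sM wM by simp_all
  have "s l \<otimes>\<^bsub>Mat\<^esub> w = \<zero>\<^bsub>Mat\<^esub>"
   using B.M.r_neg1[OF c] unfolding eq B.M.l_neg[OF c(1)] by (rule sym)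
  then have "j y \<otimes>\<^bsub>Mat\<^esub> w = \<zero>\<^bsub>Mat\<^esub>" unfolding l(2) .
  then have "inv\<^bsub>Mat\<^esub> (j y) \<otimes>\<^bsub>Mat\<^esub> (j y \<otimes>\<^bsub>Mat\<^esub> w) = \<zero>\<^bsub>Mat\<^esub>" using jx.Y_unit by simp
  then have "w = \<zero>\<^bsub>Mat\<^esub>" using jx.Y_unit wM by (simp add: B.M.m_assoc[symmetric])
  then show False using w0 by contradiction
 qed
 moreover have "\<exists>i\<le>2. d = p ^ i"
  using W(4) divides_primepow_nat[OF F.prime_p, of d 2] by (simp add: power2_eq_square)
 ultimately have d: "d \<in> {p, p * p}" by (auto simp: le_Suc_eq numeral_2_eq_2)
 show ?thesis
  by (rule exI[of _ W], rule exI[of _ d], intro conjI)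
   (rule W(1), rule W(2), rule d, use W(5) in simp, use W(5) in simp, rule W(6))
qed

end

context split_descent begin

text \<open>If \<open>V\<close> is irreducible over \<open>A\<close>, acting on a nonzero vector
  maps \<open>A\<close> onto \<open>V\<close>, and bijectively because both have dimension
  \<open>p^2\<close> over \<open>F\<close>. Hence every nonzero element of \<open>A\<close> is
  invertible, and \<open>r0 v0 = j c v0\<close> for some \<open>c\<close> in \<open>A\<close>, which
  inherits \<open>c^p = \<gamma>\<close>.\<close>

lemma cyclic_vector_descent:
 assumes min: "!!U k. B.M.dimension k F1 U ==> U \<subseteq> V ==> U ~= {\<zero>\<^bsub>Mat\<^esub>} ==> (\<forall>a\<in>{j x, j y}. \<forall>u\<in>U. a \<otimes>\<^bsub>Mat\<^esub> u \<in> U) ==> U = V"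
 shows "\<exists>a u v. symbol_system p F A a \<gamma> u v"
proof -
 let ?K = "snd A ` carrier F"
 note A = symbol_system_carrier[OF sys F.field_axioms A_one]
 have spanA: "carrier (fst A) = x.lspan ?K x.mon x.I" using sys by (simp add: symbol_system_def)
 have relA: "x [^]\<^bsub>fst A\<^esub> p \<ominus>\<^bsub>fst A\<^esub> x = snd A \<alpha>" "y [^]\<^bsub>fst A\<^esub> p = snd A \<beta>" "\<alpha> \<in> carrier F" "\<beta> \<in> carrier F"
  using sys by (auto simp: symbol_system_def)
 have F1s: "subring F1 Mat" using subfieldE(1)[OF F1] .
 have F1c: "jx.central_elt k" if "k \<in> F1" for k
  using that s_central[OF _ jx.u] s_central[OF _ jx.v] by (auto simp: jx.central_elt_def)
 have "j x [^]\<^bsub>Mat\<^esub> p \<ominus>\<^bsub>Mat\<^esub> j x = j (snd A \<alpha>)" unfolding relA(1)[symmetric] by (simp add: j.hom_diff j.hom_nat_pow)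
 then have rx: "j x [^]\<^bsub>Mat\<^esub> p \<ominus>\<^bsub>Mat\<^esub> j x \<in> F1" using j_struct[OF relA(3)] relA(3) by (auto simp: s_def)
 have "j y [^]\<^bsub>Mat\<^esub> p = j (snd A \<beta>)" unfolding relA(2)[symmetric] by (simp add: j.hom_nat_pow)
 then have ry: "j y [^]\<^bsub>Mat\<^esub> p \<in> F1" using j_struct[OF relA(4)] relA(4) by (auto simp: s_def)
 note lsp = F1s F1c rx ry
 let ?LA = "B.M.lspan F1 jx.mon jx.I"
 have fin: "finite jx.I" "jx.mon \<in> jx.I \<rightarrow> carrier Mat" by auto
 note L = B.M.lspan_closed[OF F1s fin] B.M.lspan_add[OF F1s fin] B.M.lspan_smult[OF F1s fin] B.M.lspan_zero[OF F1s fin]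
 have j_mon: "j (x.mon z) = jx.mon z" for z by (rule j.hom_mon[OF x.symbol_pair_axioms])
 have LA_img: "?LA \<subseteq> j ` carrier (fst A)"
 proof (rule B.M.lspan_least[OF F1s fin])
  show "\<zero>\<^bsub>Mat\<^esub> \<in> j ` carrier (fst A)" using j.hom_zero x.zero_closed by (metis image_eqI)
  show "v \<oplus>\<^bsub>Mat\<^esub> w \<in> j ` carrier (fst A)" if "v \<in> j ` carrier (fst A)" "w \<in> j ` carrier (fst A)" for v w
   using that by (auto simp flip: j.hom_add)
  show "k \<otimes>\<^bsub>Mat\<^esub> jx.mon z \<in> j ` carrier (fst A)" if k: "k \<in> F1" for k z
  proof -
   obtain r where r: "r \<in> carrier F" "k = j (snd A r)" using k j_struct by (auto simp: s_def)
   have eq: "k \<otimes>\<^bsub>Mat\<^esub> jx.mon z = j (snd A r \<otimes>\<^bsub>fst A\<^esub> x.mon z)"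
    unfolding r(2) j_mon[symmetric] using r(1) by simp
   show ?thesis unfolding eq by (rule imageI) (use r(1) in simp)
  qed
 qed auto
 have trans: "\<exists>a\<in>carrier (fst A). w = j a \<otimes>\<^bsub>Mat\<^esub> v" "\<exists>m\<in>?LA. w = m \<otimes>\<^bsub>Mat\<^esub> v" if v: "v \<in> V" "v ~= \<zero>\<^bsub>Mat\<^esub>" and w: "w \<in> V" for v w
 proof -
  let ?U = "(%m. m \<otimes>\<^bsub>Mat\<^esub> v) ` ?LA"
  have vM: "v \<in> carrier Mat" using V_carrier[OF v(1)] .
  have LM: "m \<in> carrier Mat" if "m \<in> ?LA" for m using that L(1) by blast
  have UV: "?U \<subseteq> V" using V_mult[OF LM v(1)] by blast
  have U0: "\<zero>\<^bsub>Mat\<^esub> \<in> ?U" using imageI[OF L(4), of "%m. m \<otimes>\<^bsub>Mat\<^esub> v"] unfolding B.M.l_null[OF vM] .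
  have "\<exists>k\<le>p * p. B.M.dimension k F1 ?U"
  proof (rule B.M.subspace_dimension[OF F1 V_dim UV U0])
   show "a \<oplus>\<^bsub>Mat\<^esub> b \<in> ?U" if "a \<in> ?U" "b \<in> ?U" for a b
   proof -
    obtain m n where mn: "m \<in> ?LA" "n \<in> ?LA" "a = m \<otimes>\<^bsub>Mat\<^esub> v" "b = n \<otimes>\<^bsub>Mat\<^esub> v"
     using \<open>a \<in> ?U\<close> \<open>b \<in> ?U\<close> by blast
    have "a \<oplus>\<^bsub>Mat\<^esub> b = (m \<oplus>\<^bsub>Mat\<^esub> n) \<otimes>\<^bsub>Mat\<^esub> v" unfolding mn(3,4) using LM[OF mn(1)] LM[OF mn(2)] vM by (simp add: B.M.l_distr)
    then show ?thesis using L(2)[OF mn(1,2)] by blast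
   qed
   show "k \<otimes>\<^bsub>Mat\<^esub> a \<in> ?U" if "k \<in> F1" "a \<in> ?U" for k a
   proof -
    obtain m where m: "m \<in> ?LA" "a = m \<otimes>\<^bsub>Mat\<^esub> v" using \<open>a \<in> ?U\<close> by blast
    have kM: "k \<in> carrier Mat" using \<open>k \<in> F1\<close> by auto
    have "k \<otimes>\<^bsub>Mat\<^esub> a = (k \<otimes>\<^bsub>Mat\<^esub> m) \<otimes>\<^bsub>Mat\<^esub> v" unfolding m(2) using LM[OF m(1)] vM kM by (simp add: B.M.m_assoc)
    then show ?thesis using L(3)[OF \<open>k \<in> F1\<close> m(1)] by blast
   qed
  qed
  then obtain k where k: "B.M.dimension k F1 ?U" by blast
  have one: "\<one>\<^bsub>Mat\<^esub> \<in> ?LA" by (rule jx.lspan_one[OF lsp])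
  have vU: "v \<in> ?U" using imageI[OF one, of "%m. m \<otimes>\<^bsub>Mat\<^esub> v"] unfolding B.M.l_one[OF vM] .
  then have ne: "?U ~= {\<zero>\<^bsub>Mat\<^esub>}" using v(2) by blast
  have st: "\<forall>a\<in>{j x, j y}. \<forall>u\<in>?U. a \<otimes>\<^bsub>Mat\<^esub> u \<in> ?U"
  proof (intro ballI)
   fix a u assume a: "a \<in> {j x, j y}" and "u \<in> ?U"
   then obtain m where m: "m \<in> ?LA" "u = m \<otimes>\<^bsub>Mat\<^esub> v" by blast
   have aM: "a \<in> carrier Mat" using a by auto
   have "a \<otimes>\<^bsub>Mat\<^esub> m \<in> ?LA" using a jx.u_lspan[OF lsp m(1)] jx.v_lspan[OF lsp m(1)] by blast
   moreover have "a \<otimes>\<^bsub>Mat\<^esub> u = (a \<otimes>\<^bsub>Mat\<^esub> m) \<otimes>\<^bsub>Mat\<^esub> v" unfolding m(2) using aM LM[OF m(1)] vM by (simp add: B.M.m_assoc)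
   ultimately show "a \<otimes>\<^bsub>Mat\<^esub> u \<in> ?U" by blast
  qed
  have "?U = V" by (rule min[OF k UV ne st])
  then show 1: "\<exists>m\<in>?LA. w = m \<otimes>\<^bsub>Mat\<^esub> v" using w by blast
  show "\<exists>a\<in>carrier (fst A). w = j a \<otimes>\<^bsub>Mat\<^esub> v" using 1 LA_img by blast
 qed
 have expand: "(\<Oplus>\<^bsub>Mat\<^esub>z\<in>jx.I. c z \<otimes>\<^bsub>Mat\<^esub> jx.mon z) \<otimes>\<^bsub>Mat\<^esub> v = (\<Oplus>\<^bsub>Mat\<^esub>z\<in>jx.I. c z \<otimes>\<^bsub>Mat\<^esub> (jx.mon z \<otimes>\<^bsub>Mat\<^esub> v))"
  if c: "!!z. z \<in> jx.I ==> c z \<in> F1" and v: "v \<in> V" for c v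
 proof -
  have cM: "c z \<in> carrier Mat" if "z \<in> jx.I" for z using c[OF that] by auto
  have vM: "v \<in> carrier Mat" using V_carrier[OF v] .
  have "(\<Oplus>\<^bsub>Mat\<^esub>z\<in>jx.I. c z \<otimes>\<^bsub>Mat\<^esub> jx.mon z) \<otimes>\<^bsub>Mat\<^esub> v = (\<Oplus>\<^bsub>Mat\<^esub>z\<in>jx.I. c z \<otimes>\<^bsub>Mat\<^esub> jx.mon z \<otimes>\<^bsub>Mat\<^esub> v)"
   by (rule B.M.finsum_ldistr[OF fin(1) vM]) (use cM in auto)
  also have "\<dots> = (\<Oplus>\<^bsub>Mat\<^esub>z\<in>jx.I. c z \<otimes>\<^bsub>Mat\<^esub> (jx.mon z \<otimes>\<^bsub>Mat\<^esub> v))"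
   using cM vM by (intro B.M.finsum_cong') (auto simp: B.M.m_assoc)
  finally show ?thesis .
 qed
 \<comment> \<open>The \<open>p^2\<close> vectors obtained by applying the monomials to
   \<open>v\<close> span \<open>V\<close>, which has dimension \<open>p^2\<close>, so they are
   independent and all coefficients of \<open>a\<close> vanish.\<close>
 have faithful: "a = \<zero>\<^bsub>fst A\<^esub>" if v: "v \<in> V" "v ~= \<zero>\<^bsub>Mat\<^esub>" and a: "a \<in> carrier (fst A)" "j a \<otimes>\<^bsub>Mat\<^esub> v = \<zero>\<^bsub>Mat\<^esub>" for v a
 proof -
  have vM: "v \<in> carrier Mat" using V_carrier[OF v(1)] .
  let ?f = "%z. jx.mon z \<otimes>\<^bsub>Mat\<^esub> v"
  have f: "?f \<in> jx.I \<rightarrow> carrier Mat" using vM by auto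
  have "B.M.lspan F1 ?f jx.I = V"
  proof (intro equalityI subsetI)
   fix w assume "w \<in> B.M.lspan F1 ?f jx.I"
   then obtain c where c: "c \<in> jx.I \<rightarrow> F1" "w = (\<Oplus>\<^bsub>Mat\<^esub>z\<in>jx.I. c z \<otimes>\<^bsub>Mat\<^esub> ?f z)" unfolding B.M.lspan_def by blast
   have "w = (\<Oplus>\<^bsub>Mat\<^esub>z\<in>jx.I. c z \<otimes>\<^bsub>Mat\<^esub> jx.mon z) \<otimes>\<^bsub>Mat\<^esub> v"
    unfolding c(2) by (rule expand[symmetric, OF funcset_mem[OF c(1)] v(1)])
   moreover have "(\<Oplus>\<^bsub>Mat\<^esub>z\<in>jx.I. c z \<otimes>\<^bsub>Mat\<^esub> jx.mon z) \<in> carrier Mat" using B.M.lspanI[OF c(1)] L(1) by blast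
   ultimately show "w \<in> V" using V_mult v(1) by simp
  next
   fix w assume "w \<in> V"
   then obtain m where m: "m \<in> ?LA" "w = m \<otimes>\<^bsub>Mat\<^esub> v" using trans(2)[OF v] by blast
   then obtain c where c: "c \<in> jx.I \<rightarrow> F1" "m = (\<Oplus>\<^bsub>Mat\<^esub>z\<in>jx.I. c z \<otimes>\<^bsub>Mat\<^esub> jx.mon z)" unfolding B.M.lspan_def by blast
   have "w = (\<Oplus>\<^bsub>Mat\<^esub>z\<in>jx.I. c z \<otimes>\<^bsub>Mat\<^esub> ?f z)"
    unfolding m(2) c(2) by (rule expand[OF funcset_mem[OF c(1)] v(1)])
   then show "w \<in> B.M.lspan F1 ?f jx.I" using B.M.lspanI[OF c(1)] by simp
  qed
  note sp = this
  have dim: "B.M.dimension (card jx.I) F1 V" using V_dim by simp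
  have "a \<in> x.lspan ?K x.mon x.I" using a(1) by (simp only: spanA[symmetric])
  then obtain c where c: "c \<in> x.I \<rightarrow> ?K" "a = (\<Oplus>\<^bsub>fst A\<^esub>z\<in>x.I. c z \<otimes>\<^bsub>fst A\<^esub> x.mon z)" unfolding x.lspan_def by blast
  have cA: "c z \<in> carrier (fst A)" and jc: "j (c z) \<in> F1" and j0: "j (c z) = \<zero>\<^bsub>Mat\<^esub> ==> c z = \<zero>\<^bsub>fst A\<^esub>" if z: "z \<in> x.I" for z
  proof -
   obtain r where r: "r \<in> carrier F" "c z = snd A r" using funcset_mem[OF c(1) z] by blast
   show "c z \<in> carrier (fst A)" using r by simp
   show "j (c z) \<in> F1" unfolding r(2) j_struct[OF r(1)] s_def[symmetric] using r(1) by blast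
   assume "j (c z) = \<zero>\<^bsub>Mat\<^esub>"
   then have "r = \<zero>\<^bsub>F\<^esub>" using s_inj[OF r(1)] unfolding r(2) j_struct[OF r(1)] s_def by blast
   then show "c z = \<zero>\<^bsub>fst A\<^esub>" unfolding r(2) by simp
  qed
  have "j a = (\<Oplus>\<^bsub>Mat\<^esub>z\<in>x.I. j (c z \<otimes>\<^bsub>fst A\<^esub> x.mon z))"
   unfolding c(2) by (rule j.hom_finsum') (use cA in auto)
  also have "\<dots> = (\<Oplus>\<^bsub>Mat\<^esub>z\<in>jx.I. j (c z) \<otimes>\<^bsub>Mat\<^esub> jx.mon z)"
   using cA by (intro B.M.finsum_cong') (auto simp: j_mon)
  finally have "(\<Oplus>\<^bsub>Mat\<^esub>z\<in>jx.I. j (c z) \<otimes>\<^bsub>Mat\<^esub> ?f z) = \<zero>\<^bsub>Mat\<^esub>" using a(2) expand[OF jc v(1)] by simp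
  then have z0: "\<forall>z\<in>jx.I. j (c z) = \<zero>\<^bsub>Mat\<^esub>"
   by (intro B.M.finite_lspan_independent[OF F1 dim fin(1) f sp]) (use jc in auto)
  have "a = (\<Oplus>\<^bsub>fst A\<^esub>z\<in>x.I. \<zero>\<^bsub>fst A\<^esub>)"
   unfolding c(2) using j0 z0 by (intro x.finsum_cong') auto
  then show ?thesis by simp
 qed
 have inj: "a = b" if v: "v \<in> V" "v ~= \<zero>\<^bsub>Mat\<^esub>" and a: "a \<in> carrier (fst A)" "b \<in> carrier (fst A)" and eq: "j a \<otimes>\<^bsub>Mat\<^esub> v = j b \<otimes>\<^bsub>Mat\<^esub> v" for v a b
 proof -
  have "j (a \<ominus>\<^bsub>fst A\<^esub> b) \<otimes>\<^bsub>Mat\<^esub> v = \<zero>\<^bsub>Mat\<^esub>" using a V_carrier[OF v(1)] eq by (simp add: j.hom_diff B.M.diff_mult)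
  then have "a \<ominus>\<^bsub>fst A\<^esub> b = \<zero>\<^bsub>fst A\<^esub>" using faithful[OF v] a by simp
  then show ?thesis using a by simp
 qed
 define v0 where "v0 = B.col 0"
 have v00: "v0 (0, 0) = \<one>\<^bsub>N\<^esub>" by (simp add: v0_def B.col_def mat_unit_def)
 have v0: "v0 \<in> V" using B.col_closed[OF F.p_pos] by (auto simp: V_def v0_def B.col_def mat_unit_def)
 have v0z: "v0 ~= \<zero>\<^bsub>Mat\<^esub>" using v00 N.one_not_zero by (auto simp: B.mat_zero)
 have v0M: "v0 \<in> carrier Mat" using V_carrier[OF v0] .
 have rM: "sc r0 \<in> carrier Mat" using r0(1) by simp
 obtain c where c: "c \<in> carrier (fst A)" "sc r0 \<otimes>\<^bsub>Mat\<^esub> v0 = j c \<otimes>\<^bsub>Mat\<^esub> v0"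
  using trans(1)[OF v0 v0z V_mult[OF rM v0]] by blast
 have jcM: "j c \<in> carrier Mat" using c(1) by simp
 \<comment> \<open>\<open>j c\<close> and \<open>sc r0\<close> agree only on \<open>v0\<close>;
   since \<open>sc r0\<close> is central it can be moved past the powers of \<open>j c\<close>, so
   their powers agree on \<open>v0\<close> as well.\<close>
 have cpow: "j c [^]\<^bsub>Mat\<^esub> (k::nat) \<otimes>\<^bsub>Mat\<^esub> v0 = sc r0 [^]\<^bsub>Mat\<^esub> k \<otimes>\<^bsub>Mat\<^esub> v0" for k
 proof (induction k)
  case (Suc k)
  have "j c [^]\<^bsub>Mat\<^esub> Suc k \<otimes>\<^bsub>Mat\<^esub> v0 = j c [^]\<^bsub>Mat\<^esub> k \<otimes>\<^bsub>Mat\<^esub> (sc r0 \<otimes>\<^bsub>Mat\<^esub> v0)"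
   unfolding c(2) using jcM v0M by (simp add: B.M.m_assoc)
  also have "\<dots> = sc r0 \<otimes>\<^bsub>Mat\<^esub> (j c [^]\<^bsub>Mat\<^esub> k \<otimes>\<^bsub>Mat\<^esub> v0)"
   by (rule B.sc_left_commute[OF r0(1)]) (use jcM v0M in auto)
  also have "\<dots> = sc r0 [^]\<^bsub>Mat\<^esub> Suc k \<otimes>\<^bsub>Mat\<^esub> v0"
   unfolding Suc B.M.nat_pow_Suc2[OF rM] using rM v0M by (simp add: B.M.m_assoc)
  finally show ?case .
 qed simp
 have sg: "sc r0 [^]\<^bsub>Mat\<^esub> p = j (snd A \<gamma>)"
  unfolding B.sc.hom_nat_pow[OF r0(1), symmetric] r0(2) j_struct[OF r0(3)] ..
 have cp: "c [^]\<^bsub>fst A\<^esub> p = snd A \<gamma>"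
 proof (rule inj[OF v0 v0z])
  show "j (c [^]\<^bsub>fst A\<^esub> p) \<otimes>\<^bsub>Mat\<^esub> v0 = j (snd A \<gamma>) \<otimes>\<^bsub>Mat\<^esub> v0"
   unfolding j.hom_nat_pow[OF c(1)] cpow sg ..
 qed (use c(1) r0(3) in auto)
 \<comment> \<open>A scalar \<open>c\<close> would put \<open>r0\<close> into the image of
   \<open>F\<close>, by comparison of the entries at \<open>(0, 0)\<close>.\<close>
 have cn: "c \<notin> ?K"
 proof
  assume "c \<in> ?K"
  then obtain r where r: "r \<in> carrier F" "c = snd A r" by blast
  have "sc r0 \<otimes>\<^bsub>Mat\<^esub> v0 = sc (\<nu> r) \<otimes>\<^bsub>Mat\<^esub> v0" using c(2) unfolding r(2) j_struct[OF r(1)] .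
  then have "(sc r0 \<otimes>\<^bsub>Mat\<^esub> v0) (0, 0) = (sc (\<nu> r) \<otimes>\<^bsub>Mat\<^esub> v0) (0, 0)" by simp
  then have "r0 = \<nu> r"
   unfolding B.sc_mult[OF r0(1) v0M F.p_pos F.p_pos] B.sc_mult[OF nu.hom_closed[OF r(1)] v0M F.p_pos F.p_pos] v00
   using r0(1) r(1) by simp
  then show False using r0_not_in r(1) by blast
 qed
 have linv: "\<exists>b\<in>carrier (fst A). b \<otimes>\<^bsub>fst A\<^esub> z = \<one>\<^bsub>fst A\<^esub>" if z: "z \<in> carrier (fst A)" "z ~= \<zero>\<^bsub>fst A\<^esub>" for z
 proof -
  have jz: "j z \<in> carrier Mat" using z by simp
  have "j z \<otimes>\<^bsub>Mat\<^esub> v0 ~= \<zero>\<^bsub>Mat\<^esub>" using faithful[OF v0 v0z z(1)] z(2) by blast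
  then obtain b where b: "b \<in> carrier (fst A)" "v0 = j b \<otimes>\<^bsub>Mat\<^esub> (j z \<otimes>\<^bsub>Mat\<^esub> v0)"
   using trans(1)[OF V_mult[OF jz v0] _ v0] by blast
  have "b \<otimes>\<^bsub>fst A\<^esub> z = \<one>\<^bsub>fst A\<^esub>"
  proof (rule inj[OF v0 v0z])
   have "j (b \<otimes>\<^bsub>fst A\<^esub> z) \<otimes>\<^bsub>Mat\<^esub> v0 = j b \<otimes>\<^bsub>Mat\<^esub> (j z \<otimes>\<^bsub>Mat\<^esub> v0)"
    unfolding j.hom_mult[OF b(1) z(1)] by (rule B.M.m_assoc) (use b z v0M in auto)
   then show "j (b \<otimes>\<^bsub>fst A\<^esub> z) \<otimes>\<^bsub>Mat\<^esub> v0 = j \<one>\<^bsub>fst A\<^esub> \<otimes>\<^bsub>Mat\<^esub> v0" using b(2) v0M by simp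
  qed (use b z in auto)
  then show ?thesis using b(1) by blast
 qed
 \<comment> \<open>A left inverse is itself nonzero, so it has a left inverse too, which makes it
   two-sided.\<close>
 have div: "z \<in> Units (fst A)" if z: "z \<in> carrier (fst A)" "z ~= \<zero>\<^bsub>fst A\<^esub>" for z
 proof -
  obtain b where b: "b \<in> carrier (fst A)" "b \<otimes>\<^bsub>fst A\<^esub> z = \<one>\<^bsub>fst A\<^esub>" using linv[OF z] by blast
  have "b ~= \<zero>\<^bsub>fst A\<^esub>"
  proof
   assume "b = \<zero>\<^bsub>fst A\<^esub>"
   then have "\<zero>\<^bsub>fst A\<^esub> \<otimes>\<^bsub>fst A\<^esub> z = \<one>\<^bsub>fst A\<^esub>" using b(2) by simp
   then show False using A_one unfolding x.l_null[OF z(1)] by simp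
  qed
  then obtain d where d: "d \<in> carrier (fst A)" "d \<otimes>\<^bsub>fst A\<^esub> b = \<one>\<^bsub>fst A\<^esub>" using linv[OF b(1)] by blast
  have "d = d \<otimes>\<^bsub>fst A\<^esub> (b \<otimes>\<^bsub>fst A\<^esub> z)" unfolding b(2) using d(1) by simp
  also have "\<dots> = z" unfolding x.m_assoc[OF d(1) b(1) z(1), symmetric] d(2) using z(1) by simp
  finally have "z \<otimes>\<^bsub>fst A\<^esub> b = \<one>\<^bsub>fst A\<^esub>" using d(2) by simp
  then show ?thesis using b z(1) by (auto simp: Units_def)
 qed
 show ?thesis
  using symbol_system_of_radical[OF sys F.field_axioms A_one div gamma_unit c(1) cp cn] by blast
qed

text \<open>Otherwise \<open>(r0 - \<gamma>)^p = \<gamma> - \<gamma>^p = 0\<close>, and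
  \<open>r0\<close> would lie in \<open>F\<close>. So \<open>\<gamma>^p - \<gamma>\<close> is a
  nonzero amount by which a first slot can be changed.\<close>

lemma gamma_pow: "\<gamma> [^]\<^bsub>F\<^esub> p ~= \<gamma>"
proof
 assume eq: "\<gamma> [^]\<^bsub>F\<^esub> p = \<gamma>"
 have nc: "\<nu> \<gamma> \<in> carrier N" using r0(3) by simp
 have "\<nu> \<gamma> [^]\<^bsub>N\<^esub> p = \<nu> \<gamma>" unfolding nu.hom_nat_pow[OF r0(3), symmetric] eq ..
 then have "(r0 \<ominus>\<^bsub>N\<^esub> \<nu> \<gamma>) [^]\<^bsub>N\<^esub> p = \<zero>\<^bsub>N\<^esub>"
  using B.diff_pow_p[OF r0(1) nc N.m_comm[OF r0(1) nc]] nc by (simp add: r0(2))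
 moreover have "r0 \<ominus>\<^bsub>N\<^esub> \<nu> \<gamma> ~= \<zero>\<^bsub>N\<^esub>"
 proof
  assume "r0 \<ominus>\<^bsub>N\<^esub> \<nu> \<gamma> = \<zero>\<^bsub>N\<^esub>"
  then have "r0 = \<nu> \<gamma>" using N.r_right_minus_eq[OF r0(1) nc] by blast
  then show False using r0_not_in r0(3) by blast
 qed
 then have "(r0 \<ominus>\<^bsub>N\<^esub> \<nu> \<gamma>) [^]\<^bsub>N\<^esub> p \<in> Units N"
  using r0(1) nc N.field_Units by (intro N.Units_pow_closed) simp
 ultimately show False using N.field_Units by simp
qed

lemma descent: "\<exists>a u v. symbol_system p F A a \<gamma> u v"
proof -
 obtain W d where W: "W \<subseteq> V" "B.M.dimension d F1 W" "d \<in> {p, p * p}" "j x \<in> {a. \<forall>w\<in>W. a \<otimes>\<^bsub>Mat\<^esub> w \<in> W}" "j y \<in> {a. \<forall>w\<in>W. a \<otimes>\<^bsub>Mat\<^esub> w \<in> W}"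
  "\<forall>U k. B.M.dimension k F1 U --> U \<subseteq> W --> U ~= {\<zero>\<^bsub>Mat\<^esub>} --> (\<forall>a\<in>{j x, j y}. \<forall>u\<in>U. a \<otimes>\<^bsub>Mat\<^esub> u \<in> U) --> U = W"
  using minimal_module by (elim exE conjE) (rule that, assumption+)
 note Wp = B.M.space_subgroup_props[OF F1 W(2)]
 show ?thesis
 proof (cases "d = p")
  case False
  then have "d = p * p" using W(3) by simp
  then have "W = V" using B.M.subspace_dimension_le(2)[OF F1 V_dim W(2,1)] by simp
  then show ?thesis by (intro cyclic_vector_descent) (use W(6) in blast)
 next
  case True
  let ?K = "snd A ` carrier F"
  have WM: "w \<in> carrier Mat" if "w \<in> W" for w using that Wp(1) by blast
  have Ks: "subring ?K (fst A)" by (rule \<sigma>.img_is_subring[OF F.carrier_is_subring])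
  define S where "S = {a \<in> carrier (fst A). \<forall>w\<in>W. j a \<otimes>\<^bsub>Mat\<^esub> w \<in> W}"
  have "x.lspan ?K x.mon x.I \<subseteq> S"
  proof (rule x.lspan_mon_subset[OF Ks])
   show "S \<subseteq> carrier (fst A)" by (auto simp: S_def)
   show "?K \<subseteq> S"
   proof
    fix k assume "k \<in> ?K"
    then obtain r where r: "r \<in> carrier F" "k = snd A r" by blast
    have "s r \<otimes>\<^bsub>Mat\<^esub> w \<in> W" if "w \<in> W" for w using Wp(5)[OF imageI[OF r(1)] that] .
    then show "k \<in> S" unfolding S_def r(2) using r(1) j_struct[OF r(1)] by (simp add: s_def)
   qed
   show "x \<in> S" "y \<in> S" using W(4,5) by (auto simp: S_def)
   show "a \<oplus>\<^bsub>fst A\<^esub> b \<in> S" if "a \<in> S" "b \<in> S" for a b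
    using that Wp(3) WM by (auto simp: S_def B.M.l_distr)
   show "a \<otimes>\<^bsub>fst A\<^esub> b \<in> S" if "a \<in> S" "b \<in> S" for a b
    using that WM by (auto simp: S_def B.M.m_assoc)
  qed
  then have jW: "j a \<otimes>\<^bsub>Mat\<^esub> w \<in> W" if "a \<in> carrier (fst A)" "w \<in> W" for a w
   using that sys by (auto simp: symbol_system_def S_def)
  obtain Ws where Ws: "set Ws \<subseteq> carrier Mat" "B.M.independent F1 Ws" "length Ws = p" "B.M.Span F1 Ws = W"
   using B.M.exists_base[OF F1 W(2)] True by blast
  define w where "w i = Ws ! i" for i
  have mw: "map w [0..<p] = Ws" using Ws(3) by (intro nth_equalityI) (auto simp: w_def)
  have wM: "w i \<in> carrier Mat" if "i < p" for i using Ws(1,3) that by (auto simp: w_def)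
  have wW: "w i \<in> W" if "i < p" for i
   using B.M.Span_base_incl[OF F1 Ws(1)] Ws(3,4) that by (auto simp: w_def)
  have wP: "w \<in> set [0..<p] \<rightarrow> carrier Mat" using wM by auto
  have W_lspan: "W = B.M.lspan F1 w {..<p}"
   using B.M.Span_map_eq_lspan[OF F1 _ wP] Ws(4) mw by (simp add: lessThan_atLeast0)
  have st: "set [0..<p] = {..<p}" by auto
  have "B.M.independent F1 (map w [0..<p])" unfolding mw by (rule Ws(2))
  note ind0 = iffD1[OF B.M.independent_map_iff[OF F1 distinct_upt wP] this]
  have ind: "\<forall>c \<in> {..<p} \<rightarrow> F1. (\<Oplus>\<^bsub>Mat\<^esub>z\<in>{..<p}. c z \<otimes>\<^bsub>Mat\<^esub> w z) = \<zero>\<^bsub>Mat\<^esub> --> (\<forall>z\<in>{..<p}. c z = \<zero>\<^bsub>Mat\<^esub>)"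
   using ind0 unfolding st .
  have "\<exists>h. ring_hom_ring (fst A) (fst (matrix_algebra p F)) h & (\<forall>r\<in>carrier F. h (snd A r) = snd (matrix_algebra p F) r)"
  proof (rule matrix_rep_of_basis[OF F.is_cring F.p_pos x.ring_axioms s_hom j_hom])
   show "snd A \<in> carrier F \<rightarrow> carrier (fst A)" by auto
   show "j (snd A r) = s r" if "r \<in> carrier F" for r using j_struct[OF that] by (simp add: s_def)
   show "s r \<otimes>\<^bsub>Mat\<^esub> j a = j a \<otimes>\<^bsub>Mat\<^esub> s r" if "r \<in> carrier F" "a \<in> carrier (fst A)" for r a
    by (rule s_central[OF that(1)]) (use that in auto)
   show "w i \<in> carrier Mat" if "i < p" for i using wM[OF that] .
   show "\<forall>i<p. f i = \<zero>\<^bsub>F\<^esub>" if f: "f \<in> {..<p} \<rightarrow> carrier F" and sum: "(\<Oplus>\<^bsub>Mat\<^esub>i\<in>{..<p}. s (f i) \<otimes>\<^bsub>Mat\<^esub> w i) = \<zero>\<^bsub>Mat\<^esub>" for f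
   proof (intro allI impI)
    fix i assume i: "i < p"
    have "(%i. s (f i)) \<in> {..<p} \<rightarrow> F1" using f by auto
    from bspec[OF ind this] sum have sf: "s (f i) = \<zero>\<^bsub>Mat\<^esub>" using i by blast
    have fi: "f i \<in> carrier F" using funcset_mem[OF f] i by simp
    show "f i = \<zero>\<^bsub>F\<^esub>" by (rule s_inj[OF fi sf])
   qed
   show "\<exists>f \<in> {..<p} \<rightarrow> carrier F. j a \<otimes>\<^bsub>Mat\<^esub> w k = (\<Oplus>\<^bsub>Mat\<^esub>i\<in>{..<p}. s (f i) \<otimes>\<^bsub>Mat\<^esub> w i)" if "a \<in> carrier (fst A)" "k < p" for a k
   proof -
    have "j a \<otimes>\<^bsub>Mat\<^esub> w k \<in> B.M.lspan F1 w {..<p}" using jW[OF that(1) wW[OF that(2)]] unfolding W_lspan .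
    then obtain c where c: "c \<in> {..<p} \<rightarrow> F1" "j a \<otimes>\<^bsub>Mat\<^esub> w k = (\<Oplus>\<^bsub>Mat\<^esub>i\<in>{..<p}. c i \<otimes>\<^bsub>Mat\<^esub> w i)"
     unfolding B.M.lspan_def by blast
    have "\<forall>i. \<exists>r. i < p --> r \<in> carrier F & c i = s r" using funcset_mem[OF c(1)] by blast
    from choice[OF this] obtain f where f: "!!i. i < p ==> f i \<in> carrier F" "!!i. i < p ==> c i = s (f i)" by blast
    have "j a \<otimes>\<^bsub>Mat\<^esub> w k = (\<Oplus>\<^bsub>Mat\<^esub>i\<in>{..<p}. s (f i) \<otimes>\<^bsub>Mat\<^esub> w i)"
     unfolding c(2) using f wM by (intro B.M.finsum_cong') auto
    moreover have "f \<in> {..<p} \<rightarrow> carrier F" using f(1) by auto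
    ultimately show ?thesis by blast
   qed
  qed
  then obtain h where h: "ring_hom_ring (fst A) (fst (matrix_algebra p F)) h" "!!r. r \<in> carrier F ==> h (snd A r) = snd (matrix_algebra p F) r"
   by blast
  show ?thesis
   using symbol_system_of_matrix_rep[OF sys F.field_axioms F.char_p_ring_axioms A_one h gamma_unit] by blast
 qed
qed

end

lemma radical_split_descent:
 assumes F: "field F" and Fp: "char_p_ring F p" and g: "g \<in> carrier F"
  and K: "field_ext F (radical_ext p F g)" "has_degree F (radical_ext p F g) p"
  and a: "a \<in> carrier F" and b: "b \<in> Units F" and A: "A = symbol_algebra p F a b"
  and spl: "splits p F (radical_ext p F g) A"
 shows "g \<in> Units F & g [^]\<^bsub>F\<^esub> p ~= g & \<one>\<^bsub>fst A\<^esub> ~= \<zero>\<^bsub>fst A\<^esub> & (\<exists>a' u v. symbol_system p F A a' g u v)"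
proof -
 interpret F: field F by fact
 interpret F: char_p_ring F p by fact
 let ?P = "univ_poly F (carrier F)"
 define f where "f = var F [^]\<^bsub>?P\<^esub> p \<ominus>\<^bsub>?P\<^esub> F.poly_of_const g"
 have Kf: "radical_ext p F g = adjoin_root F f" by (simp add: radical_ext_def f_def Let_def)
 interpret P: domain ?P by (rule F.univ_poly_is_domain[OF F.carrier_is_subring])
 have X: "var F \<in> carrier ?P" by (rule F.var_closed(1)[OF F.carrier_is_subring])
 have c: "F.poly_of_const g \<in> carrier ?P" by (rule F.poly_of_const_closed[OF g])
 have f: "f \<in> carrier ?P" using X c by (simp add: f_def)
 have "length (var F [^]\<^bsub>?P\<^esub> p) - 1 = p" using F.polynomial_pow_degree[OF X, of p] by (simp add: var_def)
 then have deg: "length f - 1 = p"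
  unfolding f_def using F.poly_degree_diff_less[of "var F [^]\<^bsub>?P\<^esub> p" "F.poly_of_const g"] X c F.p_pos F.poly_of_const_degree by simp
 interpret r: root_adjunction F f using f deg F.p_pos by unfold_locales auto
 interpret N: field "fst (adjoin_root F f)" using K(1) by (simp add: field_ext_def Kf)
 have rp: "r.rt [^]\<^bsub>r.N\<^esub> p = r.\<nu> g"
 proof -
  have "r.quo f = r.rt [^]\<^bsub>r.N\<^esub> p \<ominus>\<^bsub>r.N\<^esub> r.\<nu> g"
   unfolding r.rt_def r.nu_eq using X c r.quo.hom_diff[of "var F [^]\<^bsub>?P\<^esub> p" "F.poly_of_const g"] r.quo.hom_nat_pow[OF X, of p]
   by (simp add: f_def)
  from sym[OF this] r.quo_f have "r.rt [^]\<^bsub>r.N\<^esub> p \<ominus>\<^bsub>r.N\<^esub> r.\<nu> g = \<zero>\<^bsub>r.N\<^esub>" by (rule trans)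
  then show ?thesis using g by simp
 qed
 let ?x = "symbol_presentation.gx F p a b" and ?y = "symbol_presentation.gy F p a b"
 have sys: "symbol_system p F A a b ?x ?y" unfolding A by (rule symbol_presentation_system[OF Fp F.is_cring a b])
 interpret x: symbol_pair "fst A" p ?x ?y using sys by (simp add: symbol_system_def)
 interpret \<sigma>: ring_hom_ring F "fst A" "snd A" using sys by (simp add: symbol_system_def)
 interpret E: scalar_extension F A "adjoin_root F f" by unfold_locales
 have Kc: "cring r.N" by (rule r.N.is_cring)
 note sysE = symbol_system_ext[OF sys Kc r.nu_hom]
 interpret i: ring_hom_ring "fst A" E.Q E.i by (rule E.i_hom)
 interpret io: ring_hom_ring r.N E.Q E.\<iota> by (rule E.iota_hom)
 obtain \<phi> where \<phi>: "\<phi> \<in> ring_iso E.Q (fst (matrix_algebra p r.N))" "!!k. k \<in> carrier r.N ==> \<phi> (E.\<iota> k) = snd (matrix_algebra p r.N) k"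
  using spl by (auto simp: splits_def alg_iso_def Kf)
 interpret Np: char_p_ring r.N p by (rule r.nu.hom_char_p[OF Fp])
 interpret B: split_matrices r.N p using F.p_pos by unfold_locales
 interpret \<phi>: ring_hom_ring E.Q B.Mat \<phi>
  by (rule ring_hom_ringI2[OF E.Q_ring B.M.ring_axioms]) (use \<phi>(1) in \<open>simp add: ring_iso_def\<close>)
 define j where "j = \<phi> \<circ> E.i"
 have jh: "ring_hom_ring (fst A) B.Mat j"
  unfolding j_def by (rule ring_hom_ringI2[OF x.ring_axioms B.M.ring_axioms ring_hom_trans[OF i.homh \<phi>.homh]])
 interpret j: ring_hom_ring "fst A" B.Mat j by (rule jh)
 interpret ix: symbol_pair E.Q p "E.i ?x" "E.i ?y" by (rule i.hom_symbol_pair) (rule x.symbol_pair_axioms)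
 interpret jx: symbol_pair B.Mat p "j ?x" "j ?y" by (rule j.hom_symbol_pair) (rule x.symbol_pair_axioms)
 have fin: "finite jx.I" "jx.mon \<in> jx.I \<rightarrow> carrier B.Mat" by auto
 have Ns: "subring (B.sc ` carrier r.N) B.Mat" by (rule B.sc.img_is_subring[OF r.N.carrier_is_subring])
 \<comment> \<open>By \<open>symbol_system_ext\<close> the monomials span the scalar extension over
   \<open>N\<close>; the splitting isomorphism carries this span to the matrices.\<close>
 have span: "carrier B.Mat = B.M.lspan (B.sc ` carrier r.N) jx.mon jx.I"
 proof (intro equalityI subsetI)
  fix m assume "m \<in> carrier B.Mat"
  then obtain q where q: "q \<in> carrier E.Q" "m = \<phi> q" using \<phi>(1) by (auto simp: ring_iso_def bij_betw_def)
  have "carrier E.Q = E.q.S.lspan (E.\<iota> ` carrier r.N) ix.mon ix.I" using sysE by (simp add: symbol_system_def)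
  then have "q \<in> E.q.S.lspan (E.\<iota> ` carrier r.N) ix.mon ix.I" using q(1) by blast
  then obtain c where c: "c \<in> ix.I \<rightarrow> E.\<iota> ` carrier r.N" "q = (\<Oplus>\<^bsub>E.Q\<^esub>z\<in>ix.I. c z \<otimes>\<^bsub>E.Q\<^esub> ix.mon z)"
   unfolding E.q.S.lspan_def by blast
  have cQ: "c z \<in> carrier E.Q" and cs: "\<phi> (c z) \<in> B.sc ` carrier r.N" if z: "z \<in> ix.I" for z
  proof -
   obtain k where k: "k \<in> carrier r.N" "c z = E.\<iota> k" using funcset_mem[OF c(1) z] by blast
   show "c z \<in> carrier E.Q" using k by simp
   show "\<phi> (c z) \<in> B.sc ` carrier r.N" unfolding k(2) \<phi>(2)[OF k(1)] using k(1) by blast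
  qed
  have "m = (\<Oplus>\<^bsub>B.Mat\<^esub>z\<in>ix.I. \<phi> (c z \<otimes>\<^bsub>E.Q\<^esub> ix.mon z))"
   unfolding q(2) c(2) by (rule \<phi>.hom_finsum') (use cQ in auto)
  also have "\<dots> = (\<Oplus>\<^bsub>B.Mat\<^esub>z\<in>jx.I. \<phi> (c z) \<otimes>\<^bsub>B.Mat\<^esub> jx.mon z)"
  proof (rule B.M.finsum_cong')
   fix z assume z: "z \<in> jx.I"
   have "\<phi> (ix.mon z) = jx.mon z" using \<phi>.hom_mon[OF ix.symbol_pair_axioms, of z] by (simp add: j_def)
   then show "\<phi> (c z \<otimes>\<^bsub>E.Q\<^esub> ix.mon z) = \<phi> (c z) \<otimes>\<^bsub>B.Mat\<^esub> jx.mon z" using cQ[OF z] by simp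
  qed (use cQ in auto)
  finally show "m \<in> B.M.lspan (B.sc ` carrier r.N) jx.mon jx.I"
   using B.M.lspanI[of "%z. \<phi> (c z)" jx.I] cs by auto
 next
  fix m assume "m \<in> B.M.lspan (B.sc ` carrier r.N) jx.mon jx.I"
  then show "m \<in> carrier B.Mat" using B.M.lspan_closed[OF Ns fin] by blast
 qed
 have struct: "j (snd A t) = B.sc (r.\<nu> t)" if "t \<in> carrier F" for t
  unfolding j_def comp_def E.i_structure[OF that] by (rule \<phi>(2)) (use that in simp)
 have Nspan: "carrier r.N = r.N.lspan (r.\<nu> ` carrier F) (%i. r.rt [^]\<^bsub>r.N\<^esub> i) {..<p}"
  using r.N_span unfolding deg .
 have dim: "r.N.dimension p (r.\<nu> ` carrier F) (carrier r.N)" using K(2) by (simp add: has_degree_def Kf)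
 interpret D: split_descent F p r.N r.\<nu> A ?x ?y j a b g r.rt
  using sys rp g Nspan dim jh struct span by unfold_locales auto
 show ?thesis using D.gamma_unit D.gamma_pow D.A_one D.descent by blast
qed

section \<open>The linkage polynomial\<close>

text \<open>Degrees add in a factorisation, so if \<open>p\<close> does not divide the degree of the
  product then it does not divide the degree of one of the factors.\<close>

lemma (in field) pirreducible_factor_coprime_degree:
 "q \<in> carrier (univ_poly R (carrier R)) ==> ~ p dvd length q - 1 ==>
  \<exists>g \<in> carrier (univ_poly R (carrier R)). \<exists>h \<in> carrier (univ_poly R (carrier R)).
   pirreducible (carrier R) g & ~ p dvd length g - 1 & length g - 1 \<le> length q - 1 & q = g \<otimes>\<^bsub>univ_poly R (carrier R)\<^esub> h"
proof (induction "length q - 1" arbitrary: q rule: less_induct)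
 case less
 let ?P = "univ_poly R (carrier R)"
 interpret P: domain ?P by (rule univ_poly_is_domain[OF carrier_is_subring])
 have deg: "length q - 1 ~= 0" using less.prems(2) by auto
 then have q0: "q ~= []" by auto
 have qU: "q \<notin> Units ?P" using deg univ_poly_units'[OF carrier_is_subfield] by auto
 have multdeg: "length (a \<otimes>\<^bsub>?P\<^esub> b) - 1 = (if a = [] \<or> b = [] then 0 else (length a - 1) + (length b - 1))"
  if "a \<in> carrier ?P" "b \<in> carrier ?P" for a b
  using poly_mult_degree_eq[OF carrier_is_subring, of a b] that by (simp add: univ_poly_def)
 show ?case
 proof (cases "pirreducible (carrier R) q")
  case True
  then show ?thesis using less.prems by (intro bexI[of _ q] bexI[of _ "\<one>\<^bsub>?P\<^esub>"]) auto
 next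
  case False
  have "\<exists>a b. a \<in> carrier ?P & b \<in> carrier ?P & q = a \<otimes>\<^bsub>?P\<^esub> b & a \<notin> Units ?P & b \<notin> Units ?P"
  proof (rule ccontr)
   assume no: "~ ?thesis"
   have "pirreducible (carrier R) q"
    by (rule pirreducibleI[OF carrier_is_subring less.prems(1) q0 qU]) (use no in blast)
   then show False using False by contradiction
  qed
  then obtain a b where ab: "a \<in> carrier ?P" "b \<in> carrier ?P" "q = a \<otimes>\<^bsub>?P\<^esub> b" "a \<notin> Units ?P" "b \<notin> Units ?P" by blast
  have "a ~= [] & b ~= []" using multdeg[OF ab(1,2)] deg unfolding ab(3)[symmetric] by (auto split: if_splits)
  then have d: "length q - 1 = (length a - 1) + (length b - 1)" using multdeg[OF ab(1,2)] unfolding ab(3)[symmetric] by simp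
  have pos: "length a - 1 > 0" "length b - 1 > 0"
   using ab univ_poly_units'[OF carrier_is_subfield] \<open>a ~= [] & b ~= []\<close> by auto
  have la: "length a - 1 < length q - 1" and lb: "length b - 1 < length q - 1" using d pos by auto
  have "~ p dvd length a - 1 \<or> ~ p dvd length b - 1" using less.prems(2) d by auto
  then show ?thesis
  proof
   assume "~ p dvd length a - 1"
   then obtain g h where gh: "g \<in> carrier ?P" "h \<in> carrier ?P" "pirreducible (carrier R) g" "~ p dvd length g - 1"
    "length g - 1 \<le> length a - 1" "a = g \<otimes>\<^bsub>?P\<^esub> h" using less.hyps[OF la ab(1)] by blast
   have "q = g \<otimes>\<^bsub>?P\<^esub> (h \<otimes>\<^bsub>?P\<^esub> b)" unfolding ab(3) gh(6) by (rule P.m_assoc[OF gh(1,2) ab(2)])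
   moreover have "length g - 1 \<le> length q - 1" using gh(5) d by simp
   ultimately show ?thesis using gh(1-4) P.m_closed[OF gh(2) ab(2)] by blast
  next
   assume "~ p dvd length b - 1"
   then obtain g h where gh: "g \<in> carrier ?P" "h \<in> carrier ?P" "pirreducible (carrier R) g" "~ p dvd length g - 1"
    "length g - 1 \<le> length b - 1" "b = g \<otimes>\<^bsub>?P\<^esub> h" using less.hyps[OF lb ab(2)] by blast
   have "q = g \<otimes>\<^bsub>?P\<^esub> (a \<otimes>\<^bsub>?P\<^esub> h)" unfolding ab(3) gh(6) by (rule P.m_lcomm[OF ab(1) gh(1,2)])
   moreover have "length g - 1 \<le> length q - 1" using gh(5) d by simp
   ultimately show ?thesis using gh(1-4) P.m_closed[OF ab(1) gh(2)] by blast
  qed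
 qed
qed

text \<open>Two linear equations for one unknown \<open>v\<close>, compatible by \<open>eq\<close>.
  In the application \<open>U\<close> and \<open>Q\<close> are the powers \<open>p - 1\<close> of
  \<open>u\<close> and \<open>u + 1\<close>: if \<open>U\<close> vanishes then \<open>u = 0\<close>
  and \<open>Q\<close> is 1.\<close>

lemma (in field) solve_proportional:
 assumes c: "U \<in> carrier R" "Q \<in> carrier R" "B \<in> carrier R" "C \<in> carrier R" and G: "G \<in> Units R"
  and eq: "B \<otimes> Q = C \<otimes> U" and ne: "U ~= \<zero> \<or> Q = \<one>"
 shows "\<exists>v\<in>carrier R. G \<otimes> (v \<otimes> U) = B & G \<otimes> (v \<otimes> Q) = C"
proof (cases "U = \<zero>")
 case True
 then have "Q = \<one>" using ne by simp
 then have B0: "B = \<zero>" using eq c True by simp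
 have Gc: "G \<in> carrier R" "inv G \<in> carrier R" "G \<otimes> inv G = \<one>" using G by auto
 have "G \<otimes> (inv G \<otimes> C \<otimes> Q) = C"
  unfolding \<open>Q = \<one>\<close> using m_assoc[OF Gc(1,2) c(4)] Gc c by simp
 moreover have "G \<otimes> (inv G \<otimes> C \<otimes> U) = B" unfolding True B0 using Gc c by simp
 ultimately show ?thesis using Gc c by (intro bexI[of _ "inv G \<otimes> C"]) auto
next
 case False
 then have U: "U \<in> Units R" using c field_Units by blast
 have Gc: "G \<in> carrier R" "inv G \<in> carrier R" "G \<otimes> inv G = \<one>" using G by auto
 have Uc: "inv U \<in> carrier R" "inv U \<otimes> U = \<one>" using U by auto
 define v where "v = inv G \<otimes> (B \<otimes> inv U)"
 have v: "v \<in> carrier R" using Gc Uc c by (simp add: v_def)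
 have Gv: "G \<otimes> v = B \<otimes> inv U" unfolding v_def using m_assoc[OF Gc(1,2), of "B \<otimes> inv U"] Gc c Uc by simp
 have "G \<otimes> (v \<otimes> U) = B \<otimes> inv U \<otimes> U" using m_assoc[OF Gc(1) v c(1)] Gv by simp
 also have "\<dots> = B" using m_assoc[OF c(3) Uc(1) c(1)] Uc(2) c by simp
 finally have 1: "G \<otimes> (v \<otimes> U) = B" .
 have "G \<otimes> (v \<otimes> Q) = B \<otimes> inv U \<otimes> Q" using m_assoc[OF Gc(1) v c(2)] Gv by simp
 also have "\<dots> = (B \<otimes> Q) \<otimes> inv U" using c Uc by (simp add: m_ac)
 also have "\<dots> = C \<otimes> (inv U \<otimes> U)" unfolding eq using c Uc(1) by (simp add: m_ac)
 also have "\<dots> = C" unfolding Uc(2) using c by simp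
 finally show ?thesis using 1 v by blast
qed

text \<open>The left side of the last assumption is, up to sign, the determinant of the two
  equations for \<open>v\<close>. Here \<open>U\<close> and \<open>Q\<close> stand for the powers
  \<open>p - 1\<close> of \<open>u\<close> and \<open>u + 1\<close>, so that \<open>u U\<close> and
  \<open>(u + 1) Q\<close> are their \<open>p\<close>-th powers.\<close>

lemma (in cring) linkage_identity:
 assumes "g \<in> carrier R" "a \<in> carrier R" "b \<in> carrier R" "c \<in> carrier R" "u \<in> carrier R" "U \<in> carrier R" "Q \<in> carrier R"
  and "g \<otimes> (U \<otimes> (Q \<otimes> ((c \<ominus> b) \<otimes> u \<oplus> c))) \<oplus> (a \<ominus> b) \<otimes> Q \<ominus> (a \<ominus> c) \<otimes> U = \<zero>"
 shows "(g \<otimes> (u \<otimes> U \<otimes> b) \<oplus> (b \<ominus> a)) \<otimes> Q = (g \<otimes> ((u \<oplus> \<one>) \<otimes> Q \<otimes> c) \<oplus> (c \<ominus> a)) \<otimes> U"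
proof -
 have "(g \<otimes> (u \<otimes> U \<otimes> b) \<oplus> (b \<ominus> a)) \<otimes> Q \<oplus>
   (g \<otimes> (U \<otimes> (Q \<otimes> ((c \<ominus> b) \<otimes> u \<oplus> c))) \<oplus> (a \<ominus> b) \<otimes> Q \<ominus> (a \<ominus> c) \<otimes> U)
  = (g \<otimes> ((u \<oplus> \<one>) \<otimes> Q \<otimes> c) \<oplus> (c \<ominus> a)) \<otimes> U"
  using assms(1-7) by algebra
 then show ?thesis using assms(1-7) unfolding assms(8) by simp
qed

text \<open>Equality of two shifted first slots is linear in \<open>v\<close>: \<open>V\<close>
  stands for \<open>v^p\<close> and cancels, \<open>T\<close> for \<open>u^p b\<close> and
  \<open>W\<close> for \<open>u^(p-1)\<close>.\<close>

lemma (in cring) linkage_rearrange: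
 assumes "a \<in> carrier R" "b \<in> carrier R" "g \<in> carrier R" "v \<in> carrier R" "V \<in> carrier R" "T \<in> carrier R" "W \<in> carrier R"
  and "g \<otimes> (v \<otimes> W) = g \<otimes> T \<oplus> (b \<ominus> a)"
 shows "a \<oplus> g \<otimes> V = b \<oplus> g \<otimes> ((T \<oplus> V) \<ominus> v \<otimes> W)"
proof -
 have "b \<oplus> g \<otimes> ((T \<oplus> V) \<ominus> v \<otimes> W) = (b \<oplus> g \<otimes> T \<oplus> g \<otimes> V) \<ominus> g \<otimes> (v \<otimes> W)" using assms(1-7) by algebra
 also have "\<dots> = (b \<oplus> g \<otimes> T \<oplus> g \<otimes> V) \<ominus> (g \<otimes> T \<oplus> (b \<ominus> a))" unfolding assms(8) ..
 also have "\<dots> = a \<oplus> g \<otimes> V" using assms(1-7) by algebra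
 finally show ?thesis by simp
qed

text \<open>Let \<open>s\<close> be \<open>g (u\<^sup>p a + v\<^sup>p - v u\<^sup>p\<^sup>-\<^sup>1)\<close>, that is \<open>g\<close> times a norm from the Artin--Schreier extension attached to \<open>a\<close>
 (up to \<open>p\<close>-th powers of \<open>u\<close>). If \<open>s\<close> is a unit then \<open>[a, g) = [a + s, g)\<close>; if \<open>s = 0\<close> there is nothing to do.\<close>

lemma symbol_system_splits_shifted:
 assumes sys: "symbol_system p F A a g x y" and F: "field F" and one: "\<one>\<^bsub>fst A\<^esub> ~= \<zero>\<^bsub>fst A\<^esub>" and g: "g \<in> Units F"
  and L: "field (fst L)" "ring_hom_ring F (fst L) (snd L)" "char_p_ring (fst L) p"
  and N: "cring (fst N)" "ring_hom_ring (fst L) (fst N) (snd N)"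
  and l: "l \<in> carrier (fst N)" and u: "u \<in> carrier (fst L)" and v: "v \<in> carrier (fst L)"
  and eq: "l [^]\<^bsub>fst N\<^esub> p \<ominus>\<^bsub>fst N\<^esub> l = snd N (snd L a \<oplus>\<^bsub>fst L\<^esub> snd L g \<otimes>\<^bsub>fst L\<^esub>
   ((u [^]\<^bsub>fst L\<^esub> p \<otimes>\<^bsub>fst L\<^esub> snd L a \<oplus>\<^bsub>fst L\<^esub> v [^]\<^bsub>fst L\<^esub> p) \<ominus>\<^bsub>fst L\<^esub> v \<otimes>\<^bsub>fst L\<^esub> u [^]\<^bsub>fst L\<^esub> (p - 1)))"
 shows "splits p (fst L) N (scalar_ext F A L)"
proof -
 interpret L: field "fst L" by fact
 interpret L: char_p_ring "fst L" p by fact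
 interpret k: ring_hom_ring F "fst L" "snd L" by fact
 interpret N: cring "fst N" by fact
 interpret n: ring_hom_ring "fst L" "fst N" "snd N" by fact
 interpret N: char_p_ring "fst N" p by (rule n.hom_char_p) (rule L.char_p_ring_axioms)
 interpret M: split_matrices "fst N" p using L.p_pos by unfold_locales
 have aF: "a \<in> carrier F" using sys by (simp add: symbol_system_def)
 define A' where "A' = snd L a"
 define G where "G = snd L g"
 have Ac: "A' \<in> carrier (fst L)" using aF by (simp add: A'_def)
 have GU: "G \<in> Units (fst L)" unfolding G_def by (rule k.hom_Units[OF g])
 then have Gc: "G \<in> carrier (fst L)" by auto
 let ?z = "(u [^]\<^bsub>fst L\<^esub> p \<otimes>\<^bsub>fst L\<^esub> A' \<oplus>\<^bsub>fst L\<^esub> v [^]\<^bsub>fst L\<^esub> p) \<ominus>\<^bsub>fst L\<^esub> v \<otimes>\<^bsub>fst L\<^esub> u [^]\<^bsub>fst L\<^esub> (p - 1)"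
 define s where "s = G \<otimes>\<^bsub>fst L\<^esub> ?z"
 have sc: "s \<in> carrier (fst L)" using Gc u v Ac by (simp add: s_def)
 have nA: "snd N A' \<in> carrier (fst N)" and ns: "snd N s \<in> carrier (fst N)" using Ac sc by auto
 have nG: "snd N G \<in> Units (fst N)" by (rule n.hom_Units[OF GU])
 have lp: "l [^]\<^bsub>fst N\<^esub> p \<ominus>\<^bsub>fst N\<^esub> l = snd N A' \<oplus>\<^bsub>fst N\<^esub> snd N s"
  using eq Ac sc unfolding A'_def[symmetric] G_def[symmetric] s_def[symmetric] by simp
 \<comment> \<open>The matrices are built from a root for the first slot \<open>a + s\<close>;
   subtracting \<open>s\<close> recovers the slot of the given algebra.\<close>
 have ae: "snd N A' = (l [^]\<^bsub>fst N\<^esub> p \<ominus>\<^bsub>fst N\<^esub> l) \<ominus>\<^bsub>fst N\<^esub> snd N s"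
  unfolding lp using nA ns by (simp add: N.minus_eq N.a_assoc N.r_neg)
 have "\<exists>x0 y0. M.splitting_pair (snd N A') (snd N G) x0 y0"
 proof (cases "s = \<zero>\<^bsub>fst L\<^esub>")
  case True
  have "snd N A' = l [^]\<^bsub>fst N\<^esub> p \<ominus>\<^bsub>fst N\<^esub> l" unfolding ae True using l by (simp add: N.minus_eq)
  then show ?thesis using M.splitting_pair_diag[OF l nG] by metis
 next
  case False
  then have sU: "s \<in> Units (fst L)" using sc L.field_Units by blast
  have nsU: "snd N s \<in> Units (fst N)" by (rule n.hom_Units[OF sU])
  \<comment> \<open>For \<open>u = 0\<close> the norm is that of the constant \<open>v\<close>.
    Otherwise \<open>u^p\<close> is pulled out, which leaves \<open>a + w^p - w\<close> with
    \<open>w = v / u\<close>.\<close>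
  show ?thesis
  proof (cases "u = \<zero>\<^bsub>fst L\<^esub>")
   case True
   have z: "?z = v [^]\<^bsub>fst L\<^esub> p"
    unfolding True using L.p_pos L.p_gt1 Ac v by (simp add: L.nat_pow_zero L.minus_eq)
   have sv: "s = G \<otimes>\<^bsub>fst L\<^esub> v [^]\<^bsub>fst L\<^esub> p" unfolding s_def z ..
   have "v ~= \<zero>\<^bsub>fst L\<^esub>"
   proof
    assume "v = \<zero>\<^bsub>fst L\<^esub>"
    then have "s = \<zero>\<^bsub>fst L\<^esub>" unfolding sv using L.p_pos Gc by (simp add: L.nat_pow_zero)
    then show False using False by contradiction
   qed
   then have vU: "v \<in> Units (fst L)" using v L.field_Units by blast
   have e: "snd N s = snd N G \<otimes>\<^bsub>fst N\<^esub> snd N v [^]\<^bsub>fst N\<^esub> p" unfolding sv using Gc v by (simp add: n.hom_nat_pow)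
   show ?thesis
    by (rule M.splitting_pair_scalar[OF l nA N.Units_closed[OF nG] n.hom_Units[OF vU]]) (use nsU ae e in simp_all)
  next
   case ne: False
   then have uU: "u \<in> Units (fst L)" using u L.field_Units by blast
   define w where "w = v \<otimes>\<^bsub>fst L\<^esub> inv\<^bsub>fst L\<^esub> u"
   have i: "inv\<^bsub>fst L\<^esub> u \<in> carrier (fst L)" "inv\<^bsub>fst L\<^esub> u \<otimes>\<^bsub>fst L\<^esub> u = \<one>\<^bsub>fst L\<^esub>" using uU by auto
   have w: "w \<in> carrier (fst L)" using v i by (simp add: w_def)
   have uw: "v = w \<otimes>\<^bsub>fst L\<^esub> u" unfolding w_def using v i u by (simp add: L.m_assoc)
   obtain m where m: "p = Suc m" using L.p_pos gr0_conv_Suc by blast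
   have up: "u [^]\<^bsub>fst L\<^esub> p = u [^]\<^bsub>fst L\<^esub> (p - 1) \<otimes>\<^bsub>fst L\<^esub> u" by (simp add: m)
   have vp: "v [^]\<^bsub>fst L\<^esub> p = w [^]\<^bsub>fst L\<^esub> p \<otimes>\<^bsub>fst L\<^esub> u [^]\<^bsub>fst L\<^esub> p"
    unfolding uw using w u by (rule L.nat_pow_distrib)
   have vu: "v \<otimes>\<^bsub>fst L\<^esub> u [^]\<^bsub>fst L\<^esub> (p - 1) = u [^]\<^bsub>fst L\<^esub> p \<otimes>\<^bsub>fst L\<^esub> w"
    unfolding up uw using w u by (simp add: L.m_ac)
   have cl: "u [^]\<^bsub>fst L\<^esub> p \<in> carrier (fst L)" "w [^]\<^bsub>fst L\<^esub> p \<in> carrier (fst L)" using u w by auto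
   have "?z = u [^]\<^bsub>fst L\<^esub> p \<otimes>\<^bsub>fst L\<^esub> (A' \<oplus>\<^bsub>fst L\<^esub> (w [^]\<^bsub>fst L\<^esub> p \<ominus>\<^bsub>fst L\<^esub> w))"
    unfolding vp vu using cl w Ac
    by (simp add: L.minus_eq L.r_distr L.r_minus L.a_ac L.m_comm[of "w [^]\<^bsub>fst L\<^esub> p"])
   then have sv: "s = G \<otimes>\<^bsub>fst L\<^esub> u [^]\<^bsub>fst L\<^esub> p \<otimes>\<^bsub>fst L\<^esub> (A' \<oplus>\<^bsub>fst L\<^esub> (w [^]\<^bsub>fst L\<^esub> p \<ominus>\<^bsub>fst L\<^esub> w))"
    unfolding s_def using Gc cl w Ac by (simp add: L.m_assoc)
   have e: "snd N s = snd N G \<otimes>\<^bsub>fst N\<^esub> snd N u [^]\<^bsub>fst N\<^esub> p \<otimes>\<^bsub>fst N\<^esub>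
     (snd N A' \<oplus>\<^bsub>fst N\<^esub> (snd N w [^]\<^bsub>fst N\<^esub> p \<ominus>\<^bsub>fst N\<^esub> snd N w))"
    unfolding sv using Gc u w Ac by (simp add: n.hom_nat_pow n.hom_diff)
   show ?thesis
    by (rule M.splitting_pair_norm[OF l nA N.Units_closed[OF nG] n.hom_Units[OF uU] n.hom_closed[OF w] nsU e ae])
  qed
 qed
 then obtain x0 y0 where "M.splitting_pair (snd N (snd L a)) (snd N (snd L g)) x0 y0" unfolding A'_def G_def by blast
 then show ?thesis
  using symbol_system_splits[OF sys F one g L.is_cring L(2) N M.split_matrices_axioms] by blast
qed

text \<open>The product term has degree \<open>(p - 1) + (p - 1) + 1\<close> and leading coefficient
  \<open>g (c - b)\<close>, nonzero by assumption; both other terms have degree at most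
  \<open>p - 1\<close>.\<close>

lemma (in field) linkage_polynomial:
 assumes p: "p > 1" and c: "g \<in> carrier R" "g ~= \<zero>" "a \<in> carrier R" "b \<in> carrier R" "c \<in> carrier R" "c ~= b"
 defines "P \<equiv> univ_poly R (carrier R)"
 defines "f \<equiv> (poly_of_const g \<otimes>\<^bsub>P\<^esub> (X [^]\<^bsub>P\<^esub> (p - 1) \<otimes>\<^bsub>P\<^esub> ((X \<oplus>\<^bsub>P\<^esub> \<one>\<^bsub>P\<^esub>) [^]\<^bsub>P\<^esub> (p - 1) \<otimes>\<^bsub>P\<^esub>
   (poly_of_const (c \<ominus> b) \<otimes>\<^bsub>P\<^esub> X \<oplus>\<^bsub>P\<^esub> poly_of_const c)))
  \<oplus>\<^bsub>P\<^esub> poly_of_const (a \<ominus> b) \<otimes>\<^bsub>P\<^esub> (X \<oplus>\<^bsub>P\<^esub> \<one>\<^bsub>P\<^esub>) [^]\<^bsub>P\<^esub> (p - 1))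
  \<ominus>\<^bsub>P\<^esub> poly_of_const (a \<ominus> c) \<otimes>\<^bsub>P\<^esub> X [^]\<^bsub>P\<^esub> (p - 1)"
 shows "f \<in> carrier P" "length f - 1 = 2 * p - 1"
proof -
 interpret P: domain P unfolding P_def by (rule univ_poly_is_domain[OF carrier_is_subring])
 have Xc: "X \<in> carrier P" unfolding P_def by (rule var_closed(1)[OF carrier_is_subring])
 have cc: "poly_of_const k \<in> carrier P" if "k \<in> carrier R" for k unfolding P_def by (rule poly_of_const_closed[OF that])
 have multdeg: "length (q \<otimes>\<^bsub>P\<^esub> r) - 1 = (if q = [] \<or> r = [] then 0 else (length q - 1) + (length r - 1))"
  if "q \<in> carrier P" "r \<in> carrier P" for q r
  using poly_mult_degree_eq[OF carrier_is_subring, of q r] that by (simp add: univ_poly_def P_def)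
 have zero: "\<zero>\<^bsub>P\<^esub> = []" by (simp add: univ_poly_def P_def)
 have dX: "length X - 1 = 1" by (simp add: var_def)
 have dc: "length (poly_of_const k) - 1 = 0" for k by (rule poly_of_const_degree)
 have d1: "length \<one>\<^bsub>P\<^esub> - 1 = 0" by (simp add: univ_poly_def P_def)
 have dX1: "length (X \<oplus>\<^bsub>P\<^esub> \<one>\<^bsub>P\<^esub>) - 1 = 1"
  using poly_degree_add_less[of X "\<one>\<^bsub>P\<^esub>"] Xc d1 dX unfolding P_def[symmetric] by simp
 have pw: "length (q [^]\<^bsub>P\<^esub> n) - 1 = n * (length q - 1)" if "q \<in> carrier P" for q n
  using polynomial_pow_degree[of q n] that unfolding P_def by simp
 have ne: "q ~= []" if "length q - 1 ~= 0" for q :: "'a list" using that by auto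
 define XX where "XX = X [^]\<^bsub>P\<^esub> (p - 1)"
 define QQ where "QQ = (X \<oplus>\<^bsub>P\<^esub> \<one>\<^bsub>P\<^esub>) [^]\<^bsub>P\<^esub> (p - 1)"
 define l where "l = poly_of_const (c \<ominus> b) \<otimes>\<^bsub>P\<^esub> X \<oplus>\<^bsub>P\<^esub> poly_of_const c"
 have XXc: "XX \<in> carrier P" "length XX - 1 = p - 1" using Xc pw[OF Xc, of "p - 1"] dX by (auto simp: XX_def)
 have QQc: "QQ \<in> carrier P" "length QQ - 1 = p - 1" using Xc pw[of "X \<oplus>\<^bsub>P\<^esub> \<one>\<^bsub>P\<^esub>" "p - 1"] dX1 by (auto simp: QQ_def)
 have cb: "c \<ominus> b \<in> carrier R" "c \<ominus> b ~= \<zero>" using c by auto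
 have const_ne: "poly_of_const k ~= []" if "k ~= \<zero>" for k using that by (simp add: poly_of_const_def)
 have "length (poly_of_const (c \<ominus> b) \<otimes>\<^bsub>P\<^esub> X) - 1 = 1"
  using multdeg[OF cc[OF cb(1)] Xc] const_ne[OF cb(2)] ne[of X] dX dc by simp
 then have l: "l \<in> carrier P" "length l - 1 = 1"
  using poly_degree_add_less[of "poly_of_const (c \<ominus> b) \<otimes>\<^bsub>P\<^esub> X" "poly_of_const c"] cc[OF cb(1)] cc[OF c(5)] Xc dc
  unfolding P_def[symmetric] l_def by simp_all
 have "length (QQ \<otimes>\<^bsub>P\<^esub> l) - 1 = p" using multdeg[OF QQc(1) l(1)] QQc(2) l(2) ne[of QQ] ne[of l] p by simp
 then have "length (XX \<otimes>\<^bsub>P\<^esub> (QQ \<otimes>\<^bsub>P\<^esub> l)) - 1 = 2 * p - 1"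
  using multdeg[OF XXc(1) P.m_closed[OF QQc(1) l(1)]] XXc(2) ne[of XX] ne[of "QQ \<otimes>\<^bsub>P\<^esub> l"] p by simp
 then have T: "length (poly_of_const g \<otimes>\<^bsub>P\<^esub> (XX \<otimes>\<^bsub>P\<^esub> (QQ \<otimes>\<^bsub>P\<^esub> l))) - 1 = 2 * p - 1"
  using multdeg[OF cc[OF c(1)] P.m_closed[OF XXc(1) P.m_closed[OF QQc(1) l(1)]]] const_ne[OF c(2)]
   ne[of "XX \<otimes>\<^bsub>P\<^esub> (QQ \<otimes>\<^bsub>P\<^esub> l)"] dc p by simp
 have Tc: "poly_of_const g \<otimes>\<^bsub>P\<^esub> (XX \<otimes>\<^bsub>P\<^esub> (QQ \<otimes>\<^bsub>P\<^esub> l)) \<in> carrier P" using cc[OF c(1)] XXc QQc l by simp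
 have small: "length (poly_of_const k \<otimes>\<^bsub>P\<^esub> q) - 1 < 2 * p - 1" if "k \<in> carrier R" "q \<in> carrier P" "length q - 1 = p - 1" for k q
  using multdeg[OF cc[OF that(1)] that(2)] that(3) dc[of k] p by (auto split: if_splits)
 have ab: "a \<ominus> b \<in> carrier R" "a \<ominus> c \<in> carrier R" using c by auto
 define T2 where "T2 = poly_of_const g \<otimes>\<^bsub>P\<^esub> (XX \<otimes>\<^bsub>P\<^esub> (QQ \<otimes>\<^bsub>P\<^esub> l)) \<oplus>\<^bsub>P\<^esub> poly_of_const (a \<ominus> b) \<otimes>\<^bsub>P\<^esub> QQ"
 have T2c: "T2 \<in> carrier P" using Tc cc[OF ab(1)] QQc by (simp add: T2_def)
 have T2: "length T2 - 1 = 2 * p - 1"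
  unfolding T2_def using poly_degree_add_less[of _ "poly_of_const (a \<ominus> b) \<otimes>\<^bsub>P\<^esub> QQ"] Tc T small[OF ab(1) QQc] cc[OF ab(1)] QQc(1)
  unfolding P_def[symmetric] by simp
 have f: "f = T2 \<ominus>\<^bsub>P\<^esub> poly_of_const (a \<ominus> c) \<otimes>\<^bsub>P\<^esub> XX" unfolding f_def T2_def XX_def QQ_def l_def ..
 show "f \<in> carrier P" unfolding f using T2c cc[OF ab(2)] XXc by simp
 show "length f - 1 = 2 * p - 1"
  unfolding f using poly_degree_diff_less[of T2 "poly_of_const (a \<ominus> c) \<otimes>\<^bsub>P\<^esub> XX"] T2c T2 small[OF ab(2) XXc] cc[OF ab(2)] XXc(1)
  unfolding P_def[symmetric] by simp
qed

lemma (in artin_schreier) splits_shifted: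
 assumes sys: "symbol_system p F A a g x y" and F: "field F" and one: "\<one>\<^bsub>fst A\<^esub> ~= \<zero>\<^bsub>fst A\<^esub>" and g: "g \<in> Units F"
  and L: "fst L = R" "ring_hom_ring F R (snd L)"
  and l: "l \<in> carrier N" "l [^]\<^bsub>N\<^esub> p \<ominus>\<^bsub>N\<^esub> l = \<nu> d" and u: "u \<in> carrier R" and v: "v \<in> carrier R"
  and d: "d = snd L a \<oplus> snd L g \<otimes> ((u [^] p \<otimes> snd L a \<oplus> v [^] p) \<ominus> v \<otimes> u [^] (p - 1))"
 shows "splits p R E (scalar_ext F A L)"
proof -
 have "splits p (fst L) (adjoin_root R as_poly) (scalar_ext F A L)"
  by (rule symbol_system_splits_shifted[OF sys F one g _ _ _ _ _ l(1), where u = u and v = v])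
   (use L l(2) u v d field_axioms char_p_ring_axioms N_cring nu_hom in simp_all)
 then show ?thesis by (simp add: L(1) as_ext)
qed

text \<open>If the first slot equals \<open>b\<close>, it is shifted with \<open>t = g\<close>, for
  which \<open>t^p - t\<close> is nonzero by assumption.\<close>

lemma exists_unequal_shift:
 assumes sys: "symbol_system p F A a g x y" and F: "field F" and one: "\<one>\<^bsub>fst A\<^esub> ~= \<zero>\<^bsub>fst A\<^esub>"
  and g: "g \<in> carrier F" "g [^]\<^bsub>F\<^esub> p ~= g"
 shows "\<exists>a' x'. symbol_system p F A a' g x' y & a' ~= b"
proof (cases "a = b")
 case False
 then show ?thesis using sys by blast
next
 case True
 interpret F: field F by fact
 have a: "a \<in> carrier F" using sys by (simp add: symbol_system_def)
 have d: "g [^]\<^bsub>F\<^esub> p \<ominus>\<^bsub>F\<^esub> g \<in> carrier F" "g [^]\<^bsub>F\<^esub> p \<ominus>\<^bsub>F\<^esub> g ~= \<zero>\<^bsub>F\<^esub>" using g by auto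
 have "a \<oplus>\<^bsub>F\<^esub> (g [^]\<^bsub>F\<^esub> p \<ominus>\<^bsub>F\<^esub> g) ~= b"
 proof
  assume "a \<oplus>\<^bsub>F\<^esub> (g [^]\<^bsub>F\<^esub> p \<ominus>\<^bsub>F\<^esub> g) = b"
  then have eq: "a \<oplus>\<^bsub>F\<^esub> (g [^]\<^bsub>F\<^esub> p \<ominus>\<^bsub>F\<^esub> g) = a" using True by simp
  have "g [^]\<^bsub>F\<^esub> p \<ominus>\<^bsub>F\<^esub> g = \<zero>\<^bsub>F\<^esub>" using F.r_neg1[OF a d(1)] unfolding eq F.l_neg[OF a] by (rule sym)
  then show False using d(2) by contradiction
 qed
 then show ?thesis using symbol_system_shift[OF sys F one g(1)] by blast
qed

section \<open>The common Artin-Schreier splitting field\<close>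

theorem theorem3p1:
  fixes F :: "'a ring" and p :: nat and \<alpha>1 \<beta>1 \<alpha>2 \<beta>2 \<alpha>3 \<beta>3 :: 'a
    and A1 A2 A3 :: "('a, (gen list \<Rightarrow> 'a) set) alg"
  assumes "Factorial_Ring.prime p" and "field F" and "add_pow F p \<one>\<^bsub>F\<^esub> = \<zero>\<^bsub>F\<^esub>"
    and "\<alpha>1 \<in> carrier F" "\<alpha>2 \<in> carrier F" "\<alpha>3 \<in> carrier F"
    and "\<beta>1 \<in> carrier F - {\<zero>\<^bsub>F\<^esub>}" "\<beta>2 \<in> carrier F - {\<zero>\<^bsub>F\<^esub>}" "\<beta>3 \<in> carrier F - {\<zero>\<^bsub>F\<^esub>}"
    and "A1 = symbol_algebra p F \<alpha>1 \<beta>1"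
    and "A2 = symbol_algebra p F \<alpha>2 \<beta>2"
    and "A3 = symbol_algebra p F \<alpha>3 \<beta>3"
    and "inseparably_linked p F {A1, A2, A3}"
  shows "\<exists>(L :: ('a, 'a list set) alg) d.
           field_ext F L \<and> has_degree F L d \<and> coprime d p \<and> d \<le> 2 * p - 1 \<and>
           cyclically_linked p (fst L) {scalar_ext F A1 L, scalar_ext F A2 L, scalar_ext F A3 L}"
proof -
 interpret F: field F by fact
 interpret F: char_p_ring F p using assms(1,3) by unfold_locales
 have F: "field F" and Fp: "char_p_ring F p" by unfold_locales
 have \<beta>: "\<beta>1 \<in> Units F" "\<beta>2 \<in> Units F" "\<beta>3 \<in> Units F" using assms(7-9) F.field_Units by auto
 obtain g where g: "g \<in> carrier F" "purely_inseparable_ext p F (radical_ext p F g)" "has_degree F (radical_ext p F g) p"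
  and spl: "splits p F (radical_ext p F g) A1" "splits p F (radical_ext p F g) A2" "splits p F (radical_ext p F g) A3"
  using assms(13) by (auto simp: inseparably_linked_def Let_def)
 have Kext: "field_ext F (radical_ext p F g)" using g(2) by (simp add: purely_inseparable_ext_def)
 note desc = radical_split_descent[OF F Fp g(1) Kext g(3)]
 note d1 = desc[OF assms(4) \<beta>(1) assms(10) spl(1)]
 note d2 = desc[OF assms(5) \<beta>(2) assms(11) spl(2)]
 note d3 = desc[OF assms(6) \<beta>(3) assms(12) spl(3)]
 have gU: "g \<in> Units F" and one: "\<one>\<^bsub>fst A1\<^esub> ~= \<zero>\<^bsub>fst A1\<^esub>" "\<one>\<^bsub>fst A2\<^esub> ~= \<zero>\<^bsub>fst A2\<^esub>" "\<one>\<^bsub>fst A3\<^esub> ~= \<zero>\<^bsub>fst A3\<^esub>"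
  using d1 d2 d3 by auto
 have g0: "g ~= \<zero>\<^bsub>F\<^esub>" using gU F.field_Units by auto
 have gp: "g [^]\<^bsub>F\<^esub> p ~= g" using d1 by blast
 obtain a1 x1 y1 where s1: "symbol_system p F A1 a1 g x1 y1" using d1 by blast
 obtain a2 x2 y2 where s2: "symbol_system p F A2 a2 g x2 y2" using d2 by blast
 obtain a3' x3' y3 where "symbol_system p F A3 a3' g x3' y3" using d3 by blast
 then obtain a3 x3 where s3: "symbol_system p F A3 a3 g x3 y3" and ne: "a3 ~= a2"
  using exists_unequal_shift[OF _ F one(3) g(1) gp] by blast
 have a: "a1 \<in> carrier F" "a2 \<in> carrier F" "a3 \<in> carrier F" using s1 s2 s3 by (auto simp: symbol_system_def)
 let ?P = "univ_poly F (carrier F)"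
 interpret P: domain ?P by (rule F.univ_poly_is_domain[OF F.carrier_is_subring])
 define C where "C = F.poly_of_const"
 have Xc: "var F \<in> carrier ?P" by (rule F.var_closed(1)[OF F.carrier_is_subring])
 have Cc: "C k \<in> carrier ?P" if "k \<in> carrier F" for k unfolding C_def by (rule F.poly_of_const_closed[OF that])
 define f where "f = (C g \<otimes>\<^bsub>?P\<^esub> (var F [^]\<^bsub>?P\<^esub> (p - 1) \<otimes>\<^bsub>?P\<^esub> ((var F \<oplus>\<^bsub>?P\<^esub> \<one>\<^bsub>?P\<^esub>) [^]\<^bsub>?P\<^esub> (p - 1) \<otimes>\<^bsub>?P\<^esub>
   (C (a3 \<ominus>\<^bsub>F\<^esub> a2) \<otimes>\<^bsub>?P\<^esub> var F \<oplus>\<^bsub>?P\<^esub> C a3)))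
  \<oplus>\<^bsub>?P\<^esub> C (a1 \<ominus>\<^bsub>F\<^esub> a2) \<otimes>\<^bsub>?P\<^esub> (var F \<oplus>\<^bsub>?P\<^esub> \<one>\<^bsub>?P\<^esub>) [^]\<^bsub>?P\<^esub> (p - 1))
  \<ominus>\<^bsub>?P\<^esub> C (a1 \<ominus>\<^bsub>F\<^esub> a3) \<otimes>\<^bsub>?P\<^esub> var F [^]\<^bsub>?P\<^esub> (p - 1)"
 have f: "f \<in> carrier ?P" "length f - 1 = 2 * p - 1"
  using F.linkage_polynomial[OF F.p_gt1 g(1) g0 a ne] unfolding f_def C_def by blast+
 have "~ p dvd 2 * p - 1"
 proof
  assume d: "p dvd 2 * p - 1"
  have "p dvd 2 * p - (2 * p - 1)" by (rule dvd_diff_nat[OF dvd_triv_right d])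
  moreover have "2 * p - (2 * p - 1) = 1" using F.p_gt1 by simp
  ultimately show False using F.p_gt1 by simp
 qed
 then obtain q h where q: "q \<in> carrier ?P" "h \<in> carrier ?P" "pirreducible\<^bsub>F\<^esub> (carrier F) q" "~ p dvd length q - 1"
  "length q - 1 \<le> 2 * p - 1" "f = q \<otimes>\<^bsub>?P\<^esub> h"
  using F.pirreducible_factor_coprime_degree[OF f(1), of p] unfolding f(2) by blast
 have qd: "length q - 1 > 0" using q(4) by (metis dvd_0_right gr0I)
 interpret r: root_adjunction F q using q(1) qd by unfold_locales auto
 define L where "L = adjoin_root F q"
 have Lfield: "field r.N" using q(3) F.rupture_is_field_iff_pirreducible[OF F.carrier_is_subfield q(1)] unfolding r.N_eq by blast
 interpret N: field r.N by (rule Lfield)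
 interpret Np: char_p_ring r.N p by (rule r.nu.hom_char_p[OF Fp])
 have field_ext: "field_ext F L" using F Lfield r.nu.homh by (simp add: field_ext_def L_def)
 have degree: "has_degree F L (length q - 1)" unfolding L_def by (rule r.degree_N)
 have coprime: "coprime (length q - 1) p"
  using prime_imp_coprime[OF assms(1) q(4)] by (simp add: coprime_commute)
 \<comment> \<open>The adjoined root of the factor \<open>q\<close> is also a root of the linkage
   polynomial \<open>f\<close>.\<close>
 define u where "u = r.rt"
 define U where "U = u [^]\<^bsub>r.N\<^esub> (p - 1)"
 define Q where "Q = (u \<oplus>\<^bsub>r.N\<^esub> \<one>\<^bsub>r.N\<^esub>) [^]\<^bsub>r.N\<^esub> (p - 1)"
 have uc: "u \<in> carrier r.N" "U \<in> carrier r.N" "Q \<in> carrier r.N" by (auto simp: u_def U_def Q_def)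
 let ?n = "r.\<nu>"
 have nc: "?n g \<in> carrier r.N" "?n a1 \<in> carrier r.N" "?n a2 \<in> carrier r.N" "?n a3 \<in> carrier r.N" using g(1) a by auto
 have qC: "r.quo (C k) = ?n k" for k unfolding C_def r.nu_eq ..
 have qX: "r.quo (var F) = u" unfolding u_def r.rt_def ..
 have "r.quo f = \<zero>\<^bsub>r.N\<^esub>"
  unfolding q(6) r.quo.hom_mult[OF q(1,2)] r.quo_f by (rule r.N.l_null[OF r.quo.hom_closed[OF q(2)]])
 moreover have "r.quo f = ?n g \<otimes>\<^bsub>r.N\<^esub> (U \<otimes>\<^bsub>r.N\<^esub> (Q \<otimes>\<^bsub>r.N\<^esub> ((?n a3 \<ominus>\<^bsub>r.N\<^esub> ?n a2) \<otimes>\<^bsub>r.N\<^esub> u \<oplus>\<^bsub>r.N\<^esub> ?n a3)))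
   \<oplus>\<^bsub>r.N\<^esub> (?n a1 \<ominus>\<^bsub>r.N\<^esub> ?n a2) \<otimes>\<^bsub>r.N\<^esub> Q \<ominus>\<^bsub>r.N\<^esub> (?n a1 \<ominus>\<^bsub>r.N\<^esub> ?n a3) \<otimes>\<^bsub>r.N\<^esub> U"
  using Xc Cc g(1) a unfolding f_def U_def Q_def
  by (simp add: r.quo.hom_diff r.quo.hom_nat_pow r.nu.hom_diff qC qX)
 ultimately have poly: "?n g \<otimes>\<^bsub>r.N\<^esub> (U \<otimes>\<^bsub>r.N\<^esub> (Q \<otimes>\<^bsub>r.N\<^esub> ((?n a3 \<ominus>\<^bsub>r.N\<^esub> ?n a2) \<otimes>\<^bsub>r.N\<^esub> u \<oplus>\<^bsub>r.N\<^esub> ?n a3)))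
   \<oplus>\<^bsub>r.N\<^esub> (?n a1 \<ominus>\<^bsub>r.N\<^esub> ?n a2) \<otimes>\<^bsub>r.N\<^esub> Q \<ominus>\<^bsub>r.N\<^esub> (?n a1 \<ominus>\<^bsub>r.N\<^esub> ?n a3) \<otimes>\<^bsub>r.N\<^esub> U = \<zero>\<^bsub>r.N\<^esub>" by simp
 define u' where "u' = u \<oplus>\<^bsub>r.N\<^esub> \<one>\<^bsub>r.N\<^esub>"
 have u'c: "u' \<in> carrier r.N" using uc by (simp add: u'_def)
 obtain m where m: "p = Suc m" using F.p_pos gr0_conv_Suc by blast
 have up: "u [^]\<^bsub>r.N\<^esub> p = u \<otimes>\<^bsub>r.N\<^esub> U" "u' [^]\<^bsub>r.N\<^esub> p = u' \<otimes>\<^bsub>r.N\<^esub> Q"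
  using r.N.nat_pow_Suc2[OF uc(1), of m] r.N.nat_pow_Suc2[OF u'c, of m] by (simp_all add: U_def Q_def u'_def m)
 \<comment> \<open>\<open>B\<close> and \<open>D\<close> are the values that \<open>g v U\<close>
   and \<open>g v Q\<close> must take for the second and third shifted slots to agree with
   \<open>a1 + g v^p\<close>.\<close>
 define B where "B = ?n g \<otimes>\<^bsub>r.N\<^esub> (u [^]\<^bsub>r.N\<^esub> p \<otimes>\<^bsub>r.N\<^esub> ?n a2) \<oplus>\<^bsub>r.N\<^esub> (?n a2 \<ominus>\<^bsub>r.N\<^esub> ?n a1)"
 define D where "D = ?n g \<otimes>\<^bsub>r.N\<^esub> (u' [^]\<^bsub>r.N\<^esub> p \<otimes>\<^bsub>r.N\<^esub> ?n a3) \<oplus>\<^bsub>r.N\<^esub> (?n a3 \<ominus>\<^bsub>r.N\<^esub> ?n a1)"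
 have BD: "B \<in> carrier r.N" "D \<in> carrier r.N" using nc uc u'c by (auto simp: B_def D_def)
 have prop_eq: "B \<otimes>\<^bsub>r.N\<^esub> Q = D \<otimes>\<^bsub>r.N\<^esub> U"
  unfolding B_def D_def up unfolding u'_def by (rule r.N.linkage_identity[OF nc uc poly])
 have UQ: "U ~= \<zero>\<^bsub>r.N\<^esub> \<or> Q = \<one>\<^bsub>r.N\<^esub>"
 proof (cases "u = \<zero>\<^bsub>r.N\<^esub>")
  case True
  then show ?thesis by (simp add: Q_def)
 next
  case False
  then have "U \<in> Units r.N" unfolding U_def using N.field_Units uc(1) by (intro r.N.Units_pow_closed) blast
  then show ?thesis using N.field_Units by blast
 qed
 obtain v where v: "v \<in> carrier r.N" "?n g \<otimes>\<^bsub>r.N\<^esub> (v \<otimes>\<^bsub>r.N\<^esub> U) = B" "?n g \<otimes>\<^bsub>r.N\<^esub> (v \<otimes>\<^bsub>r.N\<^esub> Q) = D"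
  using N.solve_proportional[OF uc(2,3) BD r.nu.hom_Units[OF gU] prop_eq UQ] by blast
 define V where "V = v [^]\<^bsub>r.N\<^esub> p"
 have Vc: "V \<in> carrier r.N" using v(1) by (simp add: V_def)
 define \<delta> where "\<delta> = ?n a1 \<oplus>\<^bsub>r.N\<^esub> ?n g \<otimes>\<^bsub>r.N\<^esub> V"
 have dc: "\<delta> \<in> carrier r.N" using nc Vc by (simp add: \<delta>_def)
 \<comment> \<open>The parameter for the first algebra is 0: both \<open>0^p\<close> and
   \<open>0^(p-1)\<close> vanish, the latter because \<open>p > 1\<close>.\<close>
 have e1: "\<delta> = ?n a1 \<oplus>\<^bsub>r.N\<^esub> ?n g \<otimes>\<^bsub>r.N\<^esub> ((\<zero>\<^bsub>r.N\<^esub> [^]\<^bsub>r.N\<^esub> p \<otimes>\<^bsub>r.N\<^esub> ?n a1 \<oplus>\<^bsub>r.N\<^esub> v [^]\<^bsub>r.N\<^esub> p) \<ominus>\<^bsub>r.N\<^esub> v \<otimes>\<^bsub>r.N\<^esub> \<zero>\<^bsub>r.N\<^esub> [^]\<^bsub>r.N\<^esub> (p - 1))"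
  unfolding \<delta>_def V_def using F.p_pos F.p_gt1 nc v(1) by (simp add: r.N.nat_pow_zero r.N.minus_eq)
 have T: "u [^]\<^bsub>r.N\<^esub> p \<otimes>\<^bsub>r.N\<^esub> ?n a2 \<in> carrier r.N" "u' [^]\<^bsub>r.N\<^esub> p \<otimes>\<^bsub>r.N\<^esub> ?n a3 \<in> carrier r.N" using uc u'c nc by auto
 have e2: "\<delta> = ?n a2 \<oplus>\<^bsub>r.N\<^esub> ?n g \<otimes>\<^bsub>r.N\<^esub> ((u [^]\<^bsub>r.N\<^esub> p \<otimes>\<^bsub>r.N\<^esub> ?n a2 \<oplus>\<^bsub>r.N\<^esub> v [^]\<^bsub>r.N\<^esub> p) \<ominus>\<^bsub>r.N\<^esub> v \<otimes>\<^bsub>r.N\<^esub> u [^]\<^bsub>r.N\<^esub> (p - 1))"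
  unfolding \<delta>_def V_def[symmetric] U_def[symmetric]
  by (rule r.N.linkage_rearrange[OF nc(2,3,1) v(1) Vc T(1) uc(2)]) (simp only: v(2) B_def)
 have e3: "\<delta> = ?n a3 \<oplus>\<^bsub>r.N\<^esub> ?n g \<otimes>\<^bsub>r.N\<^esub> ((u' [^]\<^bsub>r.N\<^esub> p \<otimes>\<^bsub>r.N\<^esub> ?n a3 \<oplus>\<^bsub>r.N\<^esub> v [^]\<^bsub>r.N\<^esub> p) \<ominus>\<^bsub>r.N\<^esub> v \<otimes>\<^bsub>r.N\<^esub> u' [^]\<^bsub>r.N\<^esub> (p - 1))"
  unfolding \<delta>_def V_def[symmetric] Q_def[folded u'_def, symmetric]
  by (rule r.N.linkage_rearrange[OF nc(2,4,1) v(1) Vc T(2) uc(3)]) (simp only: v(3) D_def)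
 \<comment> \<open>Stated for every \<open>\<epsilon>\<close> whose Artin-Schreier algebra contains
   a solution of \<open>l^p - l = \<delta>\<close>, so that it also covers the replacement of
   \<open>\<delta>\<close> by another constant.\<close>
 have split_all: "\<forall>A \<in> {scalar_ext F A1 L, scalar_ext F A2 L, scalar_ext F A3 L}. splits p r.N (artin_schreier_ext p r.N \<epsilon>) A"
  if e: "\<epsilon> \<in> carrier r.N" and l: "l \<in> carrier (fst (artin_schreier_ext p r.N \<epsilon>))"
   "l [^]\<^bsub>fst (artin_schreier_ext p r.N \<epsilon>)\<^esub> p \<ominus>\<^bsub>fst (artin_schreier_ext p r.N \<epsilon>)\<^esub> l = snd (artin_schreier_ext p r.N \<epsilon>) \<delta>" for \<epsilon> l
 proof -
  interpret S: artin_schreier r.N p \<epsilon> using e by unfold_locales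
  have L: "fst L = r.N" "ring_hom_ring F r.N (snd L)" using r.nu_hom by (simp_all add: L_def)
  have l': "l \<in> carrier S.N" "l [^]\<^bsub>S.N\<^esub> p \<ominus>\<^bsub>S.N\<^esub> l = S.\<nu> \<delta>" using l unfolding S.as_ext by blast+
  have "splits p r.N S.E (scalar_ext F A1 L)"
   by (rule S.splits_shifted[OF s1 F one(1) gU L l' r.N.zero_closed v(1)]) (simp only: L_def e1[symmetric])
  moreover have "splits p r.N S.E (scalar_ext F A2 L)"
   by (rule S.splits_shifted[OF s2 F one(2) gU L l' uc(1) v(1)]) (simp only: L_def e2[symmetric])
  moreover have "splits p r.N S.E (scalar_ext F A3 L)"
   by (rule S.splits_shifted[OF s3 F one(3) gU L l' u'c v(1)]) (simp only: L_def e3[symmetric])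
  ultimately show ?thesis by blast
 qed
 interpret S: artin_schreier r.N p \<delta> using dc by unfold_locales
 have Srt: "S.rt \<in> carrier (fst (artin_schreier_ext p r.N \<delta>))"
  "S.rt [^]\<^bsub>fst (artin_schreier_ext p r.N \<delta>)\<^esub> p \<ominus>\<^bsub>fst (artin_schreier_ext p r.N \<delta>)\<^esub> S.rt = snd (artin_schreier_ext p r.N \<delta>) \<delta>"
  unfolding S.as_ext by (rule S.rt_closed, rule S.rt_eq)
 \<comment> \<open>If \<open>\<delta> = c^p - c\<close> over the new base field, every
   Artin-Schreier algebra over it contains a solution, namely the image of \<open>c\<close>. A
   cyclic one is taken if there is any; otherwise the clause for base fields without cyclic
   Artin-Schreier extensions applies, with \<open>\<delta>\<close> itself.\<close>
 have "cyclically_linked p r.N {scalar_ext F A1 L, scalar_ext F A2 L, scalar_ext F A3 L}"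
 proof (cases "\<exists>c\<in>carrier r.N. c [^]\<^bsub>r.N\<^esub> p \<ominus>\<^bsub>r.N\<^esub> c = \<delta>")
  case False
  have "cyclic_ext p r.N (artin_schreier_ext p r.N \<delta>)" by (rule S.cyclic[OF False])
  then show ?thesis
   unfolding cyclically_linked_def Let_def using split_all[OF dc Srt] dc by blast
 next
  case True
  then obtain c where c: "c \<in> carrier r.N" "c [^]\<^bsub>r.N\<^esub> p \<ominus>\<^bsub>r.N\<^esub> c = \<delta>" by blast
  show ?thesis
  proof (cases "\<exists>\<epsilon>\<in>carrier r.N. cyclic_ext p r.N (artin_schreier_ext p r.N \<epsilon>)")
   case True
   then obtain \<epsilon> where e: "\<epsilon> \<in> carrier r.N" "cyclic_ext p r.N (artin_schreier_ext p r.N \<epsilon>)" by blast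
   interpret S': artin_schreier r.N p \<epsilon> using e(1) by unfold_locales
   have "S'.\<nu> c [^]\<^bsub>S'.N\<^esub> p \<ominus>\<^bsub>S'.N\<^esub> S'.\<nu> c = S'.\<nu> \<delta>"
    unfolding c(2)[symmetric] using c(1) by (simp add: S'.nu.hom_diff S'.nu.hom_nat_pow)
   then have "\<forall>A \<in> {scalar_ext F A1 L, scalar_ext F A2 L, scalar_ext F A3 L}. splits p r.N (artin_schreier_ext p r.N \<epsilon>) A"
    using c(1) by (intro split_all[OF e(1), of "S'.\<nu> c"]) (auto simp: S'.as_ext)
   then show ?thesis unfolding cyclically_linked_def Let_def using e by blast
  next
   case False
   then show ?thesis
    unfolding cyclically_linked_def Let_def using split_all[OF dc Srt] dc by blast
  qed
 qed
 then have "cyclically_linked p (fst L) {scalar_ext F A1 L, scalar_ext F A2 L, scalar_ext F A3 L}"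
  by (simp add: L_def)
 then show ?thesis using field_ext degree coprime q(5) by blast
qed

end
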